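(* Let $\Omega_n$ ($n\in\mathbb N$), $\Omega$ be bounded open sets in $\mathbb R^N$ contained in a ball $D$. Let $u_n$ and $u$ be the variational solutions of the Neumann parabolic problems on $\Omega_n$ (with data $f_n,u_{0,n}$) and on $\Omega$ (with data $f,u_0$), respectively. Suppose $\tilde f_n\to\tilde f$ in $L^2((0,T),L^2(D))$ and $\tilde u_{0,n}\to\tilde u_0$ in $L^2(D)$. If $H^1(\Omega_n)$ converges to $H^1(\Omega)$ in the sense of Mosco, then $\tilde u_n$ converges strongly to $\tilde u$ in $C([0,T],L^2(D))$.
   Context: Fix $0<T<\infty$. Let $a_{ij},a_i,b_i,c_0\in L^\infty(D\times(0,T))$ ($i,j=1,\dots,N$), with a constant $\alpha>0$ such that $a_{ij}(x,t)\xi_i\xi_j\ge\alpha|\xi|^2$ for all $\xi\in\mathbb R^N$ and a.e. $(x,t)\in D\times(0,T)$ (summation convention over $i,j=1,\dots,N$). Neumann problem: put $V_n=H^1(\Omega_n)$, $H_n=L^2(\Omega_n)$, $V=H^1(\Omega)$, $H=L^2(\Omega)$, with evolution triples $V_n\hookrightarrow H_n\hookrightarrow V_n'$ and $V\hookrightarrow H\hookrightarrow V'$. For $t\in(0,T)$ define on $V_n$ the bilinear form $$a_n(t;u,v)=\int_{\Omega_n}[a_{ij}(x,t)\partial_ju+a_i(x,t)u]\partial_iv+b_i(x,t)\partial_iu\,v+c_0(x,t)uv\,dx,$$ and let $A_n(t)\in\mathscr L(V_n,V_n')$ be given by $\langle A_n(t)u,v\rangle=a_n(t;u,v)$; define $a(t;\cdot,\cdot)$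 and $A(t)$ in the same way on $V$, with $\Omega$ in place of $\Omega_n$. Data are $u_{0,n},u_0\in L^2(D)$ and $f_n,f\in L^2(D\times(0,T))$, restricted to $\Omega_n$, respectively $\Omega$. The variational solution $u_n$ is the unique $u_n\in W((0,T),V_n,V_n')$ with $u_n'(t)+A_n(t)u_n=f_n(t)$ in $V_n'$ for a.e. $t\in(0,T)$ and $u_n(0)=u_{0,n}$; $u$ is the unique $u\in W((0,T),V,V')$ with $u'(t)+A(t)u=f(t)$ for a.e. $t$ and $u(0)=u_0$. Here $W((0,T),V,V')=\{u\in L^2((0,T),V):u'\in L^2((0,T),V')\}$ (distributional derivative), which embeds continuously in $C([0,T],H)$; solutions are identified with their continuous representatives. Tilde: for a function $v$ on $\Omega_n$ (resp. $\Omega$), $\tilde v$ denotes its extension by zero to $D$, and $\tilde\nabla v$ denotes the extension by zero to $D$ of $\nabla v$ (not the distributional gradient of $\tilde v$); for time-dependent functions these are applied for each $t$. $\tilde f_n,\tilde u_{0,n}$ (resp. $\tilde f,\tilde u_0$) are the zero extensions of the data on $\Omega_n$ (resp. $\Omega$). Mosco convergence: let $X=L^2(D)\times L^2(D,\mathbb R^N)$, $K_n=\{(\tilde v,\tilde\nabla v):v\in H^1(\Omega_n)\}$ and $K=\{(\tilde v,\tilde\nabla v):v\in H^1(\Omega)\}$, closed subspaces of $X$. "$H^1(\Omega_n)$ converges to $H^1(\Omega)$ in the sense of Mosco" means: (M1) for every $w\in K$ there is a sequence $w_n\in K_n$ with $w_n\to w$ strongly in $X$; (M2) if $(n_k)$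 is a sequence of indices converging to $\infty$, $w_k\in K_{n_k}$ for every $k$ and $w_k\rightharpoonup w$ weakly in $X$, then $w\in K$. *)

theory Defs
  imports "HOL-Analysis.Analysis"
begin

section \<open>Lebesgue spaces\<close>

text \<open>Elements of function spaces are represented by functions; they are only used
  up to equality almost everywhere on the underlying set.\<close>

definition L2 :: "'a::euclidean_space set \<Rightarrow> ('a \<Rightarrow> 'b::euclidean_space) set" where
  "L2 S = {f \<in> borel_measurable (lebesgue_on S).
             integrable (lebesgue_on S) (\<lambda>x. (norm (f x))\<^sup>2)}"

definition L2_norm :: "'a::euclidean_space set \<Rightarrow> ('a \<Rightarrow> 'b::euclidean_space) \<Rightarrow> real" where
  "L2_norm S f = sqrt (LINT x|lebesgue_on S. (norm (f x))\<^sup>2)"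

definition L_infty :: "'a::euclidean_space set \<Rightarrow> ('a \<Rightarrow> real) set" where
  "L_infty S = {f \<in> borel_measurable (lebesgue_on S).
                  \<exists>C. AE x in lebesgue_on S. \<bar>f x\<bar> \<le> C}"

definition extend0 :: "'a set \<Rightarrow> ('a \<Rightarrow> 'b::zero) \<Rightarrow> 'a \<Rightarrow> 'b" where
  "extend0 S f = (\<lambda>x. if x \<in> S then f x else 0)"


section \<open>Test functions, weak gradients and the space $H^1$\<close>

definition dir_deriv :: "'a::euclidean_space \<Rightarrow> ('a \<Rightarrow> real) \<Rightarrow> 'a \<Rightarrow> real" where
  "dir_deriv v f = (\<lambda>x. frechet_derivative f (at x) v)"

text \<open>Every iterated directional derivative exists and is itself differentiable.\<close>

definition smooth :: "('a::euclidean_space \<Rightarrow> real) \<Rightarrow> bool" where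
  "smooth f \<longleftrightarrow> (\<forall>vs. foldr dir_deriv vs f differentiable_on UNIV)"

definition test_functions :: "'a::euclidean_space set \<Rightarrow> ('a \<Rightarrow> real) set" where
  "test_functions S = {\<phi>. smooth \<phi> \<and> compact (closure {x. \<phi> x \<noteq> 0}) \<and> closure {x. \<phi> x \<noteq> 0} \<subseteq> S}"

definition has_weak_gradient ::
    "(real^'n) set \<Rightarrow> (real^'n \<Rightarrow> real) \<Rightarrow> (real^'n \<Rightarrow> real^'n) \<Rightarrow> bool" where
  "has_weak_gradient \<Omega> v g \<longleftrightarrow>
     (\<forall>\<phi> \<in> test_functions \<Omega>. \<forall>i.
        (LINT x|lebesgue_on \<Omega>. v x * dir_deriv (axis i 1) \<phi> x)
          = - (LINT x|lebesgue_on \<Omega>. g x $ i * \<phi> x))"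

definition H1 :: "(real^'n) set \<Rightarrow> (real^'n \<Rightarrow> real) set" where
  "H1 \<Omega> = {v \<in> L2 \<Omega>. \<exists>g \<in> L2 \<Omega>. has_weak_gradient \<Omega> v g}"

text \<open>The weak gradient is unique up to null sets; a representative is chosen.\<close>

definition weak_grad :: "(real^'n) set \<Rightarrow> (real^'n \<Rightarrow> real) \<Rightarrow> real^'n \<Rightarrow> real^'n" where
  "weak_grad \<Omega> v = (SOME g. g \<in> L2 \<Omega> \<and> has_weak_gradient \<Omega> v g)"

definition H1_norm :: "(real^'n) set \<Rightarrow> (real^'n \<Rightarrow> real) \<Rightarrow> real" where
  "H1_norm \<Omega> v = sqrt ((L2_norm \<Omega> v)\<^sup>2 + (L2_norm \<Omega> (weak_grad \<Omega> v))\<^sup>2)"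


section \<open>The dual of $H^1$\<close>

text \<open>A functional on $H^1(\Omega)$ is represented by a map on all functions, of which
  only the values on \<^term>\<open>H1 \<Omega>\<close> matter.\<close>

definition H1_dual :: "(real^'n) set \<Rightarrow> ((real^'n \<Rightarrow> real) \<Rightarrow> real) set" where
  "H1_dual \<Omega> = {l. (\<forall>v \<in> H1 \<Omega>. \<forall>w \<in> H1 \<Omega>. \<forall>c d. l (\<lambda>x. c * v x + d * w x) = c * l v + d * l w)
                  \<and> (\<exists>C. \<forall>v \<in> H1 \<Omega>. \<bar>l v\<bar> \<le> C * H1_norm \<Omega> v)}"

definition H1_dual_norm :: "(real^'n) set \<Rightarrow> ((real^'n \<Rightarrow> real) \<Rightarrow> real) \<Rightarrow> real" where
  "H1_dual_norm \<Omega> l = (SUP v \<in> {v \<in> H1 \<Omega>. H1_norm \<Omega> v \<le> 1}. \<bar>l v\<bar>)"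

text \<open>The embedding of $H = L^2(\Omega)$ into $V' = H^1(\Omega)'$ given by the inner product of $H$.\<close>

definition H_to_dual :: "(real^'n) set \<Rightarrow> (real^'n \<Rightarrow> real) \<Rightarrow> (real^'n \<Rightarrow> real) \<Rightarrow> real" where
  "H_to_dual \<Omega> h = (\<lambda>v. LINT x|lebesgue_on \<Omega>. h x * v x)"


section \<open>Bochner spaces\<close>

text \<open>The spaces $V$ and $V'$ depend on $\Omega$ and hence are not types. The Bochner theory is
  therefore spelled out for a space given by a carrier \<open>E\<close> of real functions, with pointwise
  linear structure, and a (semi-)norm \<open>nrm\<close> on it; it is used for
  \<open>E = H1 \<Omega>\<close> and \<open>E = H1_dual \<Omega>\<close>.\<close>

definition simple_fun_on :: "real set \<Rightarrow> ('z \<Rightarrow> real) set \<Rightarrow> (real \<Rightarrow> 'z \<Rightarrow> real) \<Rightarrow> bool" where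
  "simple_fun_on I E s \<longleftrightarrow>
     finite (s ` I) \<and> s ` I \<subseteq> E \<and> (\<forall>y. {t \<in> I. s t = y} \<in> sets lebesgue)"

definition simple_integral_on :: "real set \<Rightarrow> (real \<Rightarrow> 'z \<Rightarrow> real) \<Rightarrow> 'z \<Rightarrow> real" where
  "simple_integral_on I s = (\<lambda>z. \<Sum>y \<in> s ` I. measure lebesgue {t \<in> I. s t = y} * y z)"

definition strongly_measurable_on ::
    "real set \<Rightarrow> ('z \<Rightarrow> real) set \<Rightarrow> (('z \<Rightarrow> real) \<Rightarrow> real) \<Rightarrow> (real \<Rightarrow> 'z \<Rightarrow> real) \<Rightarrow> bool" where
  "strongly_measurable_on I E nrm u \<longleftrightarrow>
     (AE t in lebesgue_on I. u t \<in> E) \<and>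
     (\<exists>s. (\<forall>k::nat. simple_fun_on I E (s k)) \<and>
          (AE t in lebesgue_on I. (\<lambda>k. nrm (\<lambda>z. s k t z - u t z)) \<longlonglongrightarrow> 0))"

definition bochner_L2 ::
    "real set \<Rightarrow> ('z \<Rightarrow> real) set \<Rightarrow> (('z \<Rightarrow> real) \<Rightarrow> real) \<Rightarrow> (real \<Rightarrow> 'z \<Rightarrow> real) set" where
  "bochner_L2 I E nrm = {u. strongly_measurable_on I E nrm u
                            \<and> integrable (lebesgue_on I) (\<lambda>t. (nrm (u t))\<^sup>2)}"

text \<open>\<open>J\<close> is the Bochner integral of \<open>g\<close> over the (bounded) set \<open>I\<close>.\<close>

definition has_bochner_integral_on ::
    "real set \<Rightarrow> ('z \<Rightarrow> real) set \<Rightarrow> (('z \<Rightarrow> real) \<Rightarrow> real) \<Rightarrow> (real \<Rightarrow> 'z \<Rightarrow> real) \<Rightarrow> ('z \<Rightarrow> real) \<Rightarrow> bool"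
  where
  "has_bochner_integral_on I E nrm g J \<longleftrightarrow>
     (AE t in lebesgue_on I. g t \<in> E) \<and> J \<in> E \<and>
     (\<exists>s. (\<forall>k::nat. simple_fun_on I E (s k)) \<and>
          (AE t in lebesgue_on I. (\<lambda>k. nrm (\<lambda>z. s k t z - g t z)) \<longlonglongrightarrow> 0) \<and>
          (\<lambda>k. \<integral>\<^sup>+t. ennreal (nrm (\<lambda>z. s k t z - g t z)) \<partial>lebesgue_on I) \<longlonglongrightarrow> 0 \<and>
          (\<lambda>k. nrm (\<lambda>z. simple_integral_on I (s k) z - J z)) \<longlonglongrightarrow> 0)"

text \<open>\<open>u'\<close> is the distributional derivative of \<open>u\<close> on $(0,T)$:
  $\int_0^T u\,\phi'\,dt = -\int_0^T u'\,\phi\,dt$ in $V'$ for all $\phi \in C_c^\infty(0,T)$,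
  with \<open>u t\<close> viewed in $V'$ via $V \hookrightarrow H \hookrightarrow V'$.\<close>

definition has_distr_deriv ::
    "real \<Rightarrow> (real^'n) set \<Rightarrow> (real \<Rightarrow> real^'n \<Rightarrow> real) \<Rightarrow> (real \<Rightarrow> (real^'n \<Rightarrow> real) \<Rightarrow> real) \<Rightarrow> bool"
  where
  "has_distr_deriv T \<Omega> u u' \<longleftrightarrow>
     (\<forall>\<phi> \<in> test_functions {0<..<T}. \<exists>J.
        has_bochner_integral_on {0<..<T} (H1_dual \<Omega>) (H1_dual_norm \<Omega>)
          (\<lambda>t v. dir_deriv 1 \<phi> t * H_to_dual \<Omega> (u t) v) J \<and>
        has_bochner_integral_on {0<..<T} (H1_dual \<Omega>) (H1_dual_norm \<Omega>)
          (\<lambda>t v. \<phi> t * u' t v) (\<lambda>v. - J v))"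

text \<open>\<open>u\<close> belongs to $W((0,T),V,V')$ with derivative \<open>u'\<close>.\<close>

definition W_space ::
    "real \<Rightarrow> (real^'n) set \<Rightarrow> (real \<Rightarrow> real^'n \<Rightarrow> real) \<Rightarrow> (real \<Rightarrow> (real^'n \<Rightarrow> real) \<Rightarrow> real) \<Rightarrow> bool"
  where
  "W_space T \<Omega> u u' \<longleftrightarrow>
     u \<in> bochner_L2 {0<..<T} (H1 \<Omega>) (H1_norm \<Omega>) \<and>
     u' \<in> bochner_L2 {0<..<T} (H1_dual \<Omega>) (H1_dual_norm \<Omega>) \<and>
     has_distr_deriv T \<Omega> u u'"

text \<open>The space $C([0,T],L^2(S))$ and convergence in it.\<close>

definition C_L2 :: "real \<Rightarrow> 'a::euclidean_space set \<Rightarrow> (real \<Rightarrow> 'a \<Rightarrow> real) set" where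
  "C_L2 T S = {u. (\<forall>t \<in> {0..T}. u t \<in> L2 S) \<and>
                  (\<forall>t \<in> {0..T}. ((\<lambda>s. L2_norm S (\<lambda>x. u s x - u t x)) \<longlongrightarrow> 0) (at t within {0..T}))}"

definition converges_in_C_L2 ::
    "real \<Rightarrow> 'a::euclidean_space set \<Rightarrow> (nat \<Rightarrow> real \<Rightarrow> 'a \<Rightarrow> real) \<Rightarrow> (real \<Rightarrow> 'a \<Rightarrow> real) \<Rightarrow> bool" where
  "converges_in_C_L2 T S U u \<longleftrightarrow>
     (\<forall>n. U n \<in> C_L2 T S) \<and> u \<in> C_L2 T S \<and>
     uniform_limit {0..T} (\<lambda>n t. L2_norm S (\<lambda>x. U n t x - u t x)) (\<lambda>_. 0) sequentially"


section \<open>The Neumann parabolic problem\<close>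

definition neumann_form ::
    "('n \<Rightarrow> 'n \<Rightarrow> (real^'n) \<times> real \<Rightarrow> real) \<Rightarrow> ('n \<Rightarrow> (real^'n) \<times> real \<Rightarrow> real) \<Rightarrow>
     ('n \<Rightarrow> (real^'n) \<times> real \<Rightarrow> real) \<Rightarrow> ((real^'n) \<times> real \<Rightarrow> real) \<Rightarrow>
     (real^'n) set \<Rightarrow> real \<Rightarrow> (real^'n \<Rightarrow> real) \<Rightarrow> (real^'n \<Rightarrow> real) \<Rightarrow> real" where
  "neumann_form A a b c \<Omega> t u v =
     (LINT x|lebesgue_on \<Omega>.
        (\<Sum>i\<in>UNIV. ((\<Sum>j\<in>UNIV. A i j (x, t) * weak_grad \<Omega> u x $ j) + a i (x, t) * u x)
                     * weak_grad \<Omega> v x $ i)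
        + (\<Sum>i\<in>UNIV. b i (x, t) * weak_grad \<Omega> u x $ i) * v x
        + c (x, t) * u x * v x)"

text \<open>The solution \<open>u\<close> is the representative in $C([0,T],L^2(\Omega))$. The equation
  $u'(t) + A(t)u(t) = f(t)$ in $V'$ is the equality of functionals on $V$, where
  $\langle A(t)u, v\rangle = a(t;u,v)$.\<close>

definition variational_solution ::
    "('n \<Rightarrow> 'n \<Rightarrow> (real^'n) \<times> real \<Rightarrow> real) \<Rightarrow> ('n \<Rightarrow> (real^'n) \<times> real \<Rightarrow> real) \<Rightarrow>
     ('n \<Rightarrow> (real^'n) \<times> real \<Rightarrow> real) \<Rightarrow> ((real^'n) \<times> real \<Rightarrow> real) \<Rightarrow>
     real \<Rightarrow> (real^'n) set \<Rightarrow> ((real^'n) \<times> real \<Rightarrow> real) \<Rightarrow> (real^'n \<Rightarrow> real) \<Rightarrow>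
     (real \<Rightarrow> real^'n \<Rightarrow> real) \<Rightarrow> bool" where
  "variational_solution A a b c T \<Omega> f u0 u \<longleftrightarrow>
     (\<exists>u'. W_space T \<Omega> u u' \<and>
           (AE t in lebesgue_on {0<..<T}. \<forall>v \<in> H1 \<Omega>.
              u' t v + neumann_form A a b c \<Omega> t (u t) v = H_to_dual \<Omega> (\<lambda>x. f (x, t)) v)) \<and>
     u \<in> C_L2 T \<Omega> \<and>
     (AE x in lebesgue_on \<Omega>. u 0 x = u0 x)"


section \<open>Mosco convergence\<close>

text \<open>Elements of $X = L^2(D) \times L^2(D,\mathbb{R}^N)$ are pairs of functions, and
  \<open>K_space D \<Omega>\<close> is the set of all representatives of elements of $K$.\<close>

definition X_space :: "(real^'n) set \<Rightarrow> ((real^'n \<Rightarrow> real) \<times> (real^'n \<Rightarrow> real^'n)) set" where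
  "X_space D = L2 D \<times> L2 D"

definition K_space :: "(real^'n) set \<Rightarrow> (real^'n) set \<Rightarrow> ((real^'n \<Rightarrow> real) \<times> (real^'n \<Rightarrow> real^'n)) set" where
  "K_space D \<Omega> =
     {w \<in> X_space D. \<exists>v \<in> H1 \<Omega>.
        (AE x in lebesgue_on D. fst w x = extend0 \<Omega> v x) \<and>
        (AE x in lebesgue_on D. snd w x = extend0 \<Omega> (weak_grad \<Omega> v) x)}"

definition X_strong_conv ::
    "(real^'n) set \<Rightarrow> (nat \<Rightarrow> (real^'n \<Rightarrow> real) \<times> (real^'n \<Rightarrow> real^'n)) \<Rightarrow>
     (real^'n \<Rightarrow> real) \<times> (real^'n \<Rightarrow> real^'n) \<Rightarrow> bool" where
  "X_strong_conv D W w \<longleftrightarrow>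
     (\<lambda>n. sqrt ((L2_norm D (\<lambda>x. fst (W n) x - fst w x))\<^sup>2
              + (L2_norm D (\<lambda>x. snd (W n) x - snd w x))\<^sup>2)) \<longlonglongrightarrow> 0"

definition X_inner ::
    "(real^'n) set \<Rightarrow> (real^'n \<Rightarrow> real) \<times> (real^'n \<Rightarrow> real^'n) \<Rightarrow>
     (real^'n \<Rightarrow> real) \<times> (real^'n \<Rightarrow> real^'n) \<Rightarrow> real" where
  "X_inner D w z =
     (LINT x|lebesgue_on D. fst w x * fst z x) + (LINT x|lebesgue_on D. snd w x \<bullet> snd z x)"

text \<open>Weak convergence in the Hilbert space $X$: the functionals are the inner products.\<close>

definition X_weak_conv ::
    "(real^'n) set \<Rightarrow> (nat \<Rightarrow> (real^'n \<Rightarrow> real) \<times> (real^'n \<Rightarrow> real^'n)) \<Rightarrow>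
     (real^'n \<Rightarrow> real) \<times> (real^'n \<Rightarrow> real^'n) \<Rightarrow> bool" where
  "X_weak_conv D W w \<longleftrightarrow> (\<forall>z \<in> X_space D. (\<lambda>k. X_inner D (W k) z) \<longlonglongrightarrow> X_inner D w z)"

definition H1_Mosco_convergence ::
    "(real^'n) set \<Rightarrow> (nat \<Rightarrow> (real^'n) set) \<Rightarrow> (real^'n) set \<Rightarrow> bool" where
  "H1_Mosco_convergence D \<Omega>n \<Omega> \<longleftrightarrow>
     (\<forall>w \<in> K_space D \<Omega>. \<exists>W. (\<forall>n. W n \<in> K_space D (\<Omega>n n)) \<and> X_strong_conv D W w) \<and>
     (\<forall>m W w. filterlim m at_top sequentially \<longrightarrow> (\<forall>k. W k \<in> K_space D (\<Omega>n (m k))) \<longrightarrow>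
        w \<in> X_space D \<longrightarrow> X_weak_conv D W w \<longrightarrow> w \<in> K_space D \<Omega>)"

end

theory Submission
  imports Defs "HOL-Library.Diagonal_Subsequence"
begin

text \<open>By extension by zero, \<open>H\<^sup>1(\<Omega>)\<close> becomes the closed subspace \<open>K\<close> of
  \<open>X = L\<^sup>2(\<real>\<^sup>N) \<times> L\<^sup>2(\<real>\<^sup>N, \<real>\<^sup>N)\<close>, and the
  bilinear forms for all domains are restrictions of one family of bounded operators on \<open>X\<close> that
  is coercive up to a shift. Mosco convergence says that the orthogonal projections onto \<open>K\<^sub>n\<close>
  converge strongly to the projection onto \<open>K\<close>. Approximate \<open>u\<close>, by averaging in time, by a
  function \<open>w\<close> with a time derivative in \<open>K\<close>, and compare \<open>u\<^sub>n\<close>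
  with the projection of \<open>w\<close> onto \<open>K\<^sub>n\<close> by the energy estimate. Since only test functions
  in \<open>K\<^sub>n\<close> are used, the residual enters through its projection onto \<open>K\<^sub>n\<close>,
  which converges strongly to its projection onto \<open>K\<close>; the latter is small because \<open>u\<close>
  solves the limit problem. No weak limits of the solutions \<open>u\<^sub>n\<close> are needed.\<close>

section \<open>Hilbert spaces\<close>

text \<open>The obstacle is that the problems share no dual space: \<open>u'\<close> is a functional
  on H1(\<Omega>) and says nothing about test functions on the approximating domains, so no equation
  for the difference of the two solutions is available, nor one for the projection of
  \<open>u\<close>. Functionals are therefore represented by elements of \<open>X\<close>, which can
  be tested against every subspace, and \<open>u\<close> is replaced by a \<open>w\<close> whose
  time derivative is itself a function with values in \<open>K\<close>. Projection then commutes
  with the time derivative, and both \<open>w\<close> and its derivative are projected with strong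
  convergence; integrating the derivative makes the convergence of the projections of
  \<open>w\<close> uniform in time. A forward average needs values beyond \<open>T\<close>. They
  come from the even reflection at \<open>T\<close>, which turns an evolution on the interval into
  one on the doubled interval. The energy identity is obtained from the integrated equation by
  difference quotients, so the only fact about functions with values in the dual space is that a
  Bochner integral may be evaluated at a fixed test function.\<close>

text \<open>The representative minimises \<open>J v = v \<bullet> v - 2 * l v\<close> over
  \<open>K\<close>: the parallelogram law makes a minimising sequence Cauchy, and the first
  variation at the minimiser is the identity sought.\<close>

lemma riesz_on_subspace:
  fixes l :: "'a::{real_inner,complete_space} \<Rightarrow> real"
  assumes K: "subspace K" "closed K" and l: "bounded_linear l"
  obtains p where "p \<in> K" "\<And>v. v \<in> K \<Longrightarrow> l v = p \<bullet> v"
proof -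
  interpret l: bounded_linear l by (rule l)
  obtain B where B: "\<And>x. norm (l x) \<le> norm x * B" and "B > 0"
    using l.pos_bounded by blast
  define J where "J v = v \<bullet> v - 2 * l v" for v
  have J_lower: "- (B\<^sup>2) \<le> J v" for v
  proof -
    have "l v \<le> norm v * B" using B[of v] by auto
    moreover have "0 \<le> (norm v - B)\<^sup>2" by simp
    ultimately show ?thesis
      unfolding J_def power2_norm_eq_inner[symmetric] by (simp add: power2_eq_square algebra_simps)
  qed
  define m where "m = Inf (J ` K)"
  have bdd: "bdd_below (J ` K)" using J_lower by (auto intro!: bdd_belowI2)
  have ne: "J ` K \<noteq> {}" using K(1) subspace_0 by blast
  have m_le: "m \<le> J v" if "v \<in> K" for v
    unfolding m_def using bdd that by (auto intro: cInf_lower)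
  have "\<exists>v\<in>K. J v < m + inverse (real (Suc k))" for k
  proof -
    have "Inf (J ` K) < m + inverse (real (Suc k))" by (simp add: m_def)
    from cInf_lessD[OF ne this] show ?thesis by auto
  qed
  then have "\<exists>v. \<forall>k. v k \<in> K \<and> J (v k) < m + inverse (real (Suc k))" by (intro choice) blast
  then obtain v where vK: "\<And>k. v k \<in> K" and v: "\<And>k. J (v k) < m + inverse (real (Suc k))"
    by blast
  \<comment> \<open>The midpoint of \<open>x\<close> and \<open>y\<close> lies in \<open>K\<close>,
    so \<open>J\<close> is at least \<open>m\<close> there; the parallelogram identity converts this
    into a bound on the distance.\<close>
  have par: "(dist x y)\<^sup>2 \<le> 2 * (J x - m) + 2 * (J y - m)" if "x \<in> K" "y \<in> K" for x y
  proof -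
    have "(1/2) *\<^sub>R (x + y) \<in> K" using that K(1) by (simp add: subspace_add subspace_scale)
    from m_le[OF this] have "m \<le> (1/4) * ((x + y) \<bullet> (x + y)) - l (x + y)"
      by (simp add: J_def l.scaleR)
    moreover have "(dist x y)\<^sup>2 + (x + y) \<bullet> (x + y) = 2 * (x \<bullet> x) + 2 * (y \<bullet> y)"
      by (simp add: dist_norm power2_norm_eq_inner inner_simps)
    ultimately show ?thesis by (simp add: J_def l.add)
  qed
  have "Cauchy v"
  proof (rule metric_CauchyI)
    fix e :: real assume "e > 0"
    then obtain N where N: "inverse (real (Suc N)) < e\<^sup>2 / 4"
      using reals_Archimedean[of "e\<^sup>2/4"] by auto
    have "dist (v i) (v j) < e" if "i \<ge> N" "j \<ge> N" for i j
    proof -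
      have *: "J (v k) - m < e\<^sup>2 / 4" if "k \<ge> N" for k
      proof -
        have "inverse (real (Suc k)) \<le> inverse (real (Suc N))" using that by simp
        then show ?thesis using v[of k] N by linarith
      qed
      have "(dist (v i) (v j))\<^sup>2 < e\<^sup>2"
      proof -
        have "2 * (J (v i) - m) + 2 * (J (v j) - m) < 2 * (e\<^sup>2 / 4) + 2 * (e\<^sup>2 / 4)"
          using *[OF that(1)] *[OF that(2)] by (intro add_strict_mono mult_strict_left_mono) auto
        then show ?thesis using par[OF vK vK, of i j] by (simp add: field_simps)
      qed
      then show ?thesis using \<open>e > 0\<close> by (simp add: power2_less_imp_less)
    qed
    then show "\<exists>M. \<forall>m\<ge>M. \<forall>n\<ge>M. dist (v m) (v n) < e" by blast
  qed
  then obtain p where p: "v \<longlonglongrightarrow> p" using Cauchy_convergent convergent_def by blast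
  have pK: "p \<in> K" using K(2) vK p closed_sequentially by blast
  have "(\<lambda>k. J (v k)) \<longlonglongrightarrow> J p"
    unfolding J_def by (intro tendsto_intros p l.tendsto)
  moreover have "(\<lambda>k. m + inverse (real (Suc k))) \<longlonglongrightarrow> m + 0"
    by (intro tendsto_intros LIMSEQ_inverse_real_of_nat)
  ultimately have "J p \<le> m + 0"
    by (rule LIMSEQ_le) (use v less_imp_le in blast)
  then have min: "J p \<le> J w" if "w \<in> K" for w using m_le[OF that] by simp
  have "l w = p \<bullet> w" if w: "w \<in> K" for w
  proof -
    define d where "d = p \<bullet> w - l w"
    have q: "0 \<le> 2 * s * d + s\<^sup>2 * (w \<bullet> w)" for s
    proof -
      have "p + s *\<^sub>R w \<in> K" using pK w K(1) by (simp add: subspace_add subspace_scale)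
      from min[OF this] show ?thesis
        by (simp add: J_def d_def l.add l.scaleR inner_simps inner_commute power2_eq_square algebra_simps)
    qed
    \<comment> \<open>The summand 1 keeps the denominator positive even for \<open>w = 0\<close>;
      the choice \<open>s = - d / W\<close> makes the nonnegative quadratic of \<open>q\<close> at
      most \<open>- (d * d / W)\<close>, which forces \<open>d = 0\<close>.\<close>
    define W where "W = w \<bullet> w + 1"
    have W: "W > 0" "w \<bullet> w \<le> W" by (auto simp: W_def add_nonneg_pos)
    have "0 \<le> 2 * (- d / W) * d + (- d / W)\<^sup>2 * (w \<bullet> w)" by (rule q)
    also have "\<dots> \<le> 2 * (- d / W) * d + (- d / W)\<^sup>2 * W"
      using W by (intro add_left_mono mult_left_mono) auto
    also have "\<dots> = - (d\<^sup>2 / W)" using W by (simp add: power2_eq_square field_simps)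
    finally have "d\<^sup>2 / W \<le> 0" by simp
    then have "d = 0" using W by (simp add: divide_le_0_iff)
    then show ?thesis by (simp add: d_def)
  qed
  then show thesis using that pK by blast
qed

text \<open>The defining property is orthogonality of the error to \<open>K\<close>, not minimal
  distance. The choice is total, but meaningful for closed subspaces, where the Riesz representative
  supplies a value.\<close>

definition proj :: "'a::real_inner set \<Rightarrow> 'a \<Rightarrow> 'a" where
  "proj K x = (SOME p. p \<in> K \<and> (\<forall>v\<in>K. p \<bullet> v = x \<bullet> v))"

context
  fixes K :: "'a::{real_inner,complete_space} set"
  assumes K: "subspace K" "closed K"
begin

lemma proj_props: "proj K x \<in> K \<and> (\<forall>v\<in>K. proj K x \<bullet> v = x \<bullet> v)"
proof -
  obtain p where "p \<in> K" "\<And>v. v \<in> K \<Longrightarrow> x \<bullet> v = p \<bullet> v"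
    using riesz_on_subspace[OF K bounded_linear_inner_right[of x]] by blast
  then have "\<exists>p. p \<in> K \<and> (\<forall>v\<in>K. p \<bullet> v = x \<bullet> v)" by auto
  then show ?thesis unfolding proj_def by (rule someI_ex)
qed

lemma proj_in: "proj K x \<in> K" and proj_inner: "v \<in> K \<Longrightarrow> proj K x \<bullet> v = x \<bullet> v"
  using proj_props by auto

lemma proj_unique: "p \<in> K \<Longrightarrow> (\<And>v. v \<in> K \<Longrightarrow> p \<bullet> v = x \<bullet> v) \<Longrightarrow> proj K x = p"
proof -
  assume p: "p \<in> K" "\<And>v. v \<in> K \<Longrightarrow> p \<bullet> v = x \<bullet> v"
  have "proj K x - p \<in> K" using p proj_in K(1) by (simp add: subspace_diff)
  then have "(proj K x - p) \<bullet> (proj K x - p) = 0"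
    using p(2)[of "proj K x - p"] proj_inner[of "proj K x - p" x] by (simp add: inner_diff_left)
  then show ?thesis by simp
qed

lemma proj_id: "x \<in> K \<Longrightarrow> proj K x = x"
  by (rule proj_unique) auto

lemma proj_norm_le: "norm (proj K x) \<le> norm x"
proof (cases "proj K x = 0")
  case False
  have "(norm (proj K x))\<^sup>2 = x \<bullet> proj K x"
    using proj_inner[OF proj_in, of x x] by (simp add: power2_norm_eq_inner)
  also have "\<dots> \<le> norm x * norm (proj K x)" by (rule norm_cauchy_schwarz)
  finally show ?thesis using False by (simp add: power2_eq_square)
qed simp

lemma bounded_linear_proj: "bounded_linear (proj K)"
proof (rule bounded_linear_intro[where K=1])
  fix x y :: 'a and r :: real
  show "proj K (x + y) = proj K x + proj K y"
    by (rule proj_unique) (auto simp: K(1) proj_in subspace_add inner_add_left proj_inner)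
  show "proj K (r *\<^sub>R x) = r *\<^sub>R proj K x"
    by (rule proj_unique) (auto simp: K(1) proj_in subspace_scale proj_inner)
  show "norm (proj K x) \<le> norm x * 1" using proj_norm_le by simp
qed

end

lemma closed_subspace_eq_UNIV:
  fixes K :: "'a::{real_inner,complete_space} set"
  assumes K: "subspace K" "closed K" and orth: "\<And>x. (\<And>v. v \<in> K \<Longrightarrow> x \<bullet> v = 0) \<Longrightarrow> x = 0"
  shows "K = UNIV"
proof -
  have "x \<in> K" for x
  proof -
    have "x - proj K x = 0"
      by (rule orth) (simp add: inner_diff_left proj_inner[OF K])
    then show ?thesis using proj_in[OF K, of x] by simp
  qed
  then show ?thesis by auto
qed

section \<open>Separability of Hilbert spaces\<close>

text \<open>The conclusion has the form of the axiom of \<open>second_countable_topology\<close>,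
  the class that Bochner integration demands of its value space. Balls with centres in
  \<open>D\<close> and rational radii are a countable basis.\<close>

lemma second_countable_of_dense:
  fixes D :: "'a::metric_space set"
  assumes "countable D" and dense: "\<And>x e. e > 0 \<Longrightarrow> \<exists>d\<in>D. dist x d < e"
  shows "\<exists>B::'a set set. countable B \<and> open = generate_topology B"
proof -
  define B where "B = (\<lambda>(d,q). ball d (of_rat q)) ` (D \<times> (UNIV :: rat set))"
  have "countable B" unfolding B_def using assms(1) by blast
  moreover have "topological_basis B"
  proof (rule topological_basisI)
    show "open b" if "b \<in> B" for b using that by (auto simp: B_def)
    fix U and x :: 'a assume "open U" "x \<in> U"
    then obtain e where e: "e > 0" "ball x e \<subseteq> U" using openE by blast
    \<comment> \<open>The radius exceeds e/4, which bounds the distance to the centre, so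
      \<open>x\<close> is inside; it is below e/2, so the ball does not leave
      \<open>ball x e\<close>.\<close>
    obtain q where q: "e/4 < real_of_rat q" "real_of_rat q < e/2"
      using of_rat_dense[of "e/4" "e/2"] e by auto
    obtain d where d: "d \<in> D" "dist x d < e/4" using dense[of "e/4" x] e by auto
    have "ball d (of_rat q) \<in> B" using d by (auto simp: B_def)
    moreover have "x \<in> ball d (of_rat q)" using d q by (simp add: dist_commute)
    moreover have "ball d (of_rat q) \<subseteq> U"
    proof -
      have "dist x y < e" if "dist d y < of_rat q" for y
        using that d q dist_triangle[of x y d] by linarith
      then have "ball d (of_rat q) \<subseteq> ball x e" by auto
      then show ?thesis using e by blast
    qed
    ultimately show "\<exists>b\<in>B. x \<in> b \<and> b \<subseteq> U" by blast
  qed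
  ultimately show ?thesis by (blast intro: topological_basis_imp_subbasis)
qed

text \<open>The finite rational combinations of \<open>S\<close> are countable. Their closure is a
  closed subspace with trivial orthogonal complement, hence the whole space.\<close>

lemma second_countable_of_total:
  fixes S :: "'a::{real_inner,complete_space} set"
  assumes S: "countable S" and orth: "\<And>x. (\<And>s. s \<in> S \<Longrightarrow> x \<bullet> s = 0) \<Longrightarrow> x = 0"
  shows "\<exists>B::'a set set. countable B \<and> open = generate_topology B"
proof -
  \<comment> \<open>Combinations are coded as lists of pairs, so that countability is that of
    \<open>lists\<close>. Only rational multiples stay inside \<open>D\<close>; real multiples are
    reached in the closure.\<close>
  define F where "F xs = sum_list (map (\<lambda>(q,s). real_of_rat q *\<^sub>R s) xs)" for xs :: "(rat \<times> 'a) list"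
  define D where "D = F ` lists ((UNIV::rat set) \<times> S)"
  have cD: "countable D" unfolding D_def using S by blast
  have D0: "0 \<in> D" unfolding D_def by (rule image_eqI[of _ _ "[]"]) (auto simp: F_def)
  have Dadd: "x + y \<in> D" if "x \<in> D" "y \<in> D" for x y
  proof -
    obtain xs where "x = F xs" "xs \<in> lists (UNIV \<times> S)" using \<open>x \<in> D\<close> unfolding D_def by (rule imageE)
    moreover obtain ys where "y = F ys" "ys \<in> lists (UNIV \<times> S)" using \<open>y \<in> D\<close> unfolding D_def by (rule imageE)
    ultimately show ?thesis unfolding D_def by (intro image_eqI[of _ _ "xs @ ys"]) (auto simp: F_def)
  qed
  have Dscale: "of_rat q *\<^sub>R x \<in> D" if "x \<in> D" for x q
  proof -
    obtain xs where xs: "x = F xs" "xs \<in> lists (UNIV \<times> S)"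
      using \<open>x \<in> D\<close> unfolding D_def by (rule imageE)
    have "of_rat q *\<^sub>R F xs = F (map (\<lambda>(p,s). (q*p,s)) xs)"
      by (induction xs) (auto simp: F_def scaleR_add_right of_rat_mult)
    then show ?thesis unfolding D_def
      by (intro image_eqI[of _ _ "map (\<lambda>(p,s). (q*p,s)) xs"]) (use xs in auto)
  qed
  have sub: "subspace (closure D)"
  proof (rule subspaceI)
    show "0 \<in> closure D" using D0 closure_subset by blast
    fix x y assume "x \<in> closure D" "y \<in> closure D"
    then obtain X Y where X: "\<And>n::nat. X n \<in> D" "X \<longlonglongrightarrow> x" and Y: "\<And>n::nat. Y n \<in> D" "Y \<longlonglongrightarrow> y"
      unfolding closure_sequential by metis
    show "x + y \<in> closure D" unfolding closure_sequential
      by (rule exI[of _ "\<lambda>n. X n + Y n"]) (auto intro!: tendsto_intros X Y Dadd)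
  next
    fix r :: real and x assume "x \<in> closure D"
    then obtain X where X: "\<And>n::nat. X n \<in> D" "X \<longlonglongrightarrow> x"
      unfolding closure_sequential by metis
    have "\<exists>q. \<bar>real_of_rat q - r\<bar> < inverse (real (Suc n))" for n
    proof -
      obtain q where "r < real_of_rat q" "real_of_rat q < r + inverse (real (Suc n))"
        using of_rat_dense[of "r" "r + inverse (real (Suc n))"] by auto
      then show ?thesis by (intro exI[of _ q]) linarith
    qed
    then obtain q where q: "\<And>n. \<bar>real_of_rat (q n) - r\<bar> < inverse (real (Suc n))" by metis
    have "(\<lambda>n. real_of_rat (q n) - r) \<longlonglongrightarrow> 0"
      by (rule Lim_null_comparison[OF _ LIMSEQ_inverse_real_of_nat])
         (use q less_imp_le in \<open>auto intro!: always_eventually\<close>)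
    then have "(\<lambda>n. real_of_rat (q n)) \<longlonglongrightarrow> r" by (simp add: LIM_zero_iff)
    then show "r *\<^sub>R x \<in> closure D" unfolding closure_sequential
      by (intro exI[of _ "\<lambda>n. of_rat (q n) *\<^sub>R X n"]) (auto intro!: tendsto_intros X Dscale)
  qed
  have "closure D = UNIV"
  proof (rule closed_subspace_eq_UNIV[OF sub closed_closure])
    fix x :: 'a assume "\<And>v. v \<in> closure D \<Longrightarrow> x \<bullet> v = 0"
    moreover have "s \<in> closure D" if "s \<in> S" for s
    proof -
      have "s = F [(1,s)]" by (simp add: F_def)
      then have "s \<in> D" unfolding D_def by (rule image_eqI) (use that in auto)
      then show ?thesis using closure_subset by blast
    qed
    ultimately show "x = 0" using orth by blast
  qed
  then have "\<exists>d\<in>D. dist x d < e" if "e > 0" for x e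
    using that closure_approachable[of x D] by (auto simp: dist_commute)
  then show ?thesis using second_countable_of_dense[OF cD] by blast
qed

section \<open>Weak compactness and Mosco convergence\<close>

text \<open>The diagonal selection tests the sequence only against its own members. The set
  \<open>Z\<close> of all \<open>z\<close> with convergent inner products is then a closed subspace
  containing the whole sequence; vectors orthogonal to \<open>Z\<close> have inner products zero and
  so belong to \<open>Z\<close> as well. Riesz turns the limit functional into a vector.\<close>

lemma bounded_seq_weakly_convergent_subseq:
  fixes x :: "nat \<Rightarrow> 'a::{real_inner,complete_space}"
  assumes bound: "\<And>n. norm (x n) \<le> B"
  obtains r y where "strict_mono r" "\<And>z. (\<lambda>k. x (r k) \<bullet> z) \<longlonglongrightarrow> y \<bullet> z"
proof -
  define P where "P j s \<longleftrightarrow> convergent (\<lambda>k. x (s k) \<bullet> x j)" for j and s :: "nat \<Rightarrow> nat"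
  have inner_bd: "\<bar>x n \<bullet> z\<bar> \<le> B * norm z" for n z
    using Cauchy_Schwarz_ineq2[of "x n" z] mult_right_mono[OF bound[of n], of "norm z"] by simp
  have B0: "0 \<le> B" using order_trans[OF norm_ge_zero bound] .
  interpret subseqs P
  proof
    fix n and s :: "nat \<Rightarrow> nat" assume "strict_mono s"
    have "bounded (range (\<lambda>k. x (s k) \<bullet> x n))"
      unfolding bounded_iff using inner_bd by (auto intro!: exI[of _ "B * norm (x n)"])
    then obtain l r where "strict_mono r" "((\<lambda>k. x (s k) \<bullet> x n) \<circ> r) \<longlonglongrightarrow> l"
      using bounded_imp_convergent_subsequence by blast
    then show "\<exists>r'. strict_mono r' \<and> P n (s \<circ> r')"
      by (auto simp: P_def convergent_def o_def)
  qed
  have "P k (diagseq \<circ> ((+) (Suc k)))" for k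
  proof (rule diagseq_holds)
    fix n and r s :: "nat \<Rightarrow> nat" assume "strict_mono r" "P n s"
    then show "P n (s \<circ> r)"
      unfolding P_def using convergent_subseq_convergent[of "\<lambda>k. x (s k) \<bullet> x n" r]
      by (auto simp: o_def)
  qed
  then have "convergent (\<lambda>k. x (diagseq (k + Suc j)) \<bullet> x j)" for j
    unfolding P_def o_def by (metis (no_types, lifting) add.commute ext)
  \<comment> \<open>The diagonal sequence is a subsequence of the \<open>j\<close>-th selection only
    from index \<open>Suc j\<close> on; the skipped initial segment does not affect
    convergence.\<close>
  then have conv: "convergent (\<lambda>k. x (diagseq k) \<bullet> x j)" for j
    using convergent_ignore_initial_segment[of "\<lambda>k. x (diagseq k) \<bullet> x j" "Suc j"] by blast
  define Z where "Z = {z. convergent (\<lambda>k. x (diagseq k) \<bullet> z)}"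
  have subZ: "subspace Z"
    by (rule subspaceI) (auto simp: Z_def inner_add_right intro: convergent_add convergent_mult convergent_const)
  have clZ: "closed Z"
    unfolding closed_sequential_limits
  proof (intro allI impI, elim conjE)
    fix zs :: "nat \<Rightarrow> 'a" and z assume zs: "\<forall>n. zs n \<in> Z" "zs \<longlonglongrightarrow> z"
    have "Cauchy (\<lambda>k. x (diagseq k) \<bullet> z)"
    proof (rule metric_CauchyI)
      fix e :: real assume e: "e > 0"
      have "e / (3 * (B + 1)) > 0" using e B0 by simp
      then obtain n where "dist (zs n) z < e / (3 * (B + 1))"
        using zs(2) by (meson lim_sequentially order_refl)
      then have n: "norm (z - zs n) < e / (3 * (B + 1))" by (simp add: dist_norm norm_minus_commute)
      have d: "\<bar>x k \<bullet> z - x k \<bullet> zs n\<bar> < e/3" for k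
      proof -
        have "\<bar>x k \<bullet> z - x k \<bullet> zs n\<bar> \<le> B * norm (z - zs n)"
          using inner_bd[of k "z - zs n"] by (simp add: inner_diff_right)
        also have "\<dots> \<le> (B + 1) * norm (z - zs n)" by (simp add: distrib_right)
        also have "\<dots> < (B + 1) * (e / (3 * (B + 1)))" using n B0 by (intro mult_strict_left_mono) auto
        also have "\<dots> = e/3" using B0 by (simp add: field_simps)
        finally show ?thesis .
      qed
      have "Cauchy (\<lambda>k. x (diagseq k) \<bullet> zs n)"
        using zs(1) by (auto simp: Z_def intro: convergent_Cauchy)
      then obtain M where M: "\<And>i j. i \<ge> M \<Longrightarrow> j \<ge> M \<Longrightarrow> dist (x (diagseq i) \<bullet> zs n) (x (diagseq j) \<bullet> zs n) < e/3"
        using e unfolding Cauchy_def by (meson zero_less_divide_iff zero_less_numeral)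
      have "dist (x (diagseq i) \<bullet> z) (x (diagseq j) \<bullet> z) < e" if "i \<ge> M" "j \<ge> M" for i j
        using M[OF that] d[of "diagseq i"] d[of "diagseq j"] unfolding dist_real_def by linarith
      then show "\<exists>M. \<forall>m\<ge>M. \<forall>n\<ge>M. dist (x (diagseq m) \<bullet> z) (x (diagseq n) \<bullet> z) < e" by blast
    qed
    then show "z \<in> Z" by (simp add: Z_def Cauchy_convergent)
  qed
  have "z \<in> Z" for z
  proof -
    have "x (diagseq k) \<bullet> (z - proj Z z) = 0" for k
    proof -
      have "x (diagseq k) \<in> Z" using conv by (simp add: Z_def)
      then show ?thesis
        using proj_inner[OF subZ clZ, of "x (diagseq k)" z]
        by (simp add: inner_diff_right inner_commute)
    qed
    then have "z - proj Z z \<in> Z" by (simp add: Z_def convergent_const)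
    then have "(z - proj Z z) + proj Z z \<in> Z" by (rule subspace_add[OF subZ _ proj_in[OF subZ clZ]])
    then show ?thesis by simp
  qed
  then have lims: "(\<lambda>k. x (diagseq k) \<bullet> z) \<longlonglongrightarrow> lim (\<lambda>k. x (diagseq k) \<bullet> z)" for z
    by (auto simp: Z_def convergent_LIMSEQ_iff)
  define l where "l z = lim (\<lambda>k. x (diagseq k) \<bullet> z)" for z
  have "bounded_linear l"
  proof (rule bounded_linear_intro[where K=B])
    fix u v and c :: real
    show "l (u + v) = l u + l v"
      using tendsto_add[OF lims[of u] lims[of v]] lims[of "u+v"]
      by (auto simp: l_def inner_add_right intro: LIMSEQ_unique)
    show "l (c *\<^sub>R u) = c *\<^sub>R l u"
      using tendsto_mult[OF tendsto_const[of c] lims[of u]] lims[of "c *\<^sub>R u"]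
      by (auto simp: l_def intro: LIMSEQ_unique)
    show "norm (l u) \<le> norm u * B"
      using LIMSEQ_le_const2[OF tendsto_norm[OF lims[of u]], of "B * norm u"] inner_bd
      by (auto simp: l_def mult.commute)
  qed
  then obtain y where "\<And>z. l z = y \<bullet> z"
    using riesz_on_subspace[OF subspace_UNIV closed_UNIV] by (metis UNIV_I)
  then have "(\<lambda>k. x (diagseq k) \<bullet> z) \<longlonglongrightarrow> y \<bullet> z" for z using lims[of z] by (simp add: l_def)
  then show thesis using that subseq_diagseq by blast
qed

text \<open>The vector is split along \<open>K\<close>. On \<open>K\<close>, the approximants of M1
  are fixed by the projections, which gives strong convergence. For \<open>y\<close> orthogonal to
  \<open>K\<close>, a weak limit \<open>w\<close> of projections of \<open>y\<close> lies in
  \<open>K\<close> by M2, and the squared norm of a projection equals its inner product with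
  \<open>y\<close>, which tends to \<open>w \<bullet> y = 0\<close>.\<close>

lemma mosco_imp_proj_tendsto:
  fixes K :: "'a::{real_inner,complete_space} set" and Kn :: "nat \<Rightarrow> 'a set"
  assumes K: "subspace K" "closed K" and Kn: "\<And>n. subspace (Kn n)" "\<And>n. closed (Kn n)"
    and M1: "\<And>w. w \<in> K \<Longrightarrow> \<exists>W. (\<forall>n. W n \<in> Kn n) \<and> W \<longlonglongrightarrow> w"
    and M2: "\<And>m W w. filterlim m at_top sequentially \<Longrightarrow> (\<And>k. W k \<in> Kn (m k)) \<Longrightarrow>
      (\<And>z. (\<lambda>k. W k \<bullet> z) \<longlonglongrightarrow> w \<bullet> z) \<Longrightarrow> w \<in> K"
  shows "(\<lambda>n. proj (Kn n) x) \<longlonglongrightarrow> proj K x"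
proof -
  have orth: "(\<lambda>n. proj (Kn n) y) \<longlonglongrightarrow> 0" if y: "\<And>v. v \<in> K \<Longrightarrow> y \<bullet> v = 0" for y
  proof (rule ccontr)
    assume "\<not> (\<lambda>n. proj (Kn n) y) \<longlonglongrightarrow> 0"
    then obtain e where e: "e > 0" "\<forall>N. \<exists>n\<ge>N. norm (proj (Kn n) y) \<ge> e"
      unfolding LIMSEQ_iff by (auto simp: not_less)
    then have "infinite {n. norm (proj (Kn n) y) \<ge> e}" by (auto simp: infinite_nat_iff_unbounded_le)
    from infinite_enumerate[OF this]
    obtain f :: "nat \<Rightarrow> nat" where f: "strict_mono f" "\<And>k. norm (proj (Kn (f k)) y) \<ge> e"
      by auto
    obtain r w where r: "strict_mono r" and w: "\<And>z. (\<lambda>k. proj (Kn (f (r k))) y \<bullet> z) \<longlonglongrightarrow> w \<bullet> z"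
      using bounded_seq_weakly_convergent_subseq[of "\<lambda>k. proj (Kn (f k)) y" "norm y"]
        proj_norm_le[OF Kn] by metis
    have "strict_mono (f \<circ> r)" using f(1) r by (rule strict_mono_o)
    then have "filterlim (\<lambda>k. f (r k)) at_top sequentially"
      using filterlim_subseq[of "f \<circ> r"] by (simp add: o_def)
    then have "w \<in> K" using M2[of "\<lambda>k. f (r k)" "\<lambda>k. proj (Kn (f (r k))) y" w] w proj_in[OF Kn] by blast
    then have "(\<lambda>k. proj (Kn (f (r k))) y \<bullet> y) \<longlonglongrightarrow> 0" using w[of y] y[of w] by (simp add: inner_commute)
    moreover have "e\<^sup>2 \<le> proj (Kn (f (r k))) y \<bullet> y" for k
    proof -
      have "e\<^sup>2 \<le> (norm (proj (Kn (f (r k))) y))\<^sup>2" using f(2)[of "r k"] e(1) by (simp add: power_mono)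
      also have "\<dots> = proj (Kn (f (r k))) y \<bullet> y"
        using proj_inner[OF Kn proj_in[OF Kn], of "f (r k)" y y] by (simp add: power2_norm_eq_inner inner_commute)
      finally show ?thesis .
    qed
    ultimately have "e\<^sup>2 \<le> 0" using LIMSEQ_le_const[of _ 0 "e\<^sup>2"] by blast
    then show False using e(1) by simp
  qed
  have inK: "(\<lambda>n. proj (Kn n) y) \<longlonglongrightarrow> y" if "y \<in> K" for y
  proof -
    obtain W where W: "\<And>n. W n \<in> Kn n" "W \<longlonglongrightarrow> y" using M1[OF \<open>y \<in> K\<close>] by blast
    have bd: "norm (proj (Kn n) y - y) \<le> 2 * norm (W n - y)" for n
    proof -
      have "proj (Kn n) y - y = proj (Kn n) (y - W n) + (W n - y)"
        using linear_diff[OF bounded_linear.linear[OF bounded_linear_proj[OF Kn]], of n y "W n"] proj_id[OF Kn W(1), of n] by simp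
      also have "norm \<dots> \<le> norm (proj (Kn n) (y - W n)) + norm (W n - y)" by (rule norm_triangle_ineq)
      also have "\<dots> \<le> 2 * norm (W n - y)" using proj_norm_le[OF Kn, of n "y - W n"] by (simp add: norm_minus_commute)
      finally show ?thesis .
    qed
    have "(\<lambda>n. 2 * norm (W n - y)) \<longlonglongrightarrow> 2 * 0"
      by (intro tendsto_intros tendsto_norm_zero LIM_zero W(2))
    then have "(\<lambda>n. proj (Kn n) y - y) \<longlonglongrightarrow> 0"
      using Lim_null_comparison[of "\<lambda>n. proj (Kn n) y - y" "\<lambda>n. 2 * norm (W n - y)" sequentially] bd by simp
    then show ?thesis by (simp add: LIM_zero_iff)
  qed
  have "(\<lambda>n. proj (Kn n) (proj K x) + proj (Kn n) (x - proj K x)) \<longlonglongrightarrow> proj K x + 0"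
    by (intro tendsto_add inK orth proj_in[OF K]) (simp add: inner_diff_left proj_inner[OF K])
  moreover have "proj (Kn n) (proj K x) + proj (Kn n) (x - proj K x) = proj (Kn n) x" for n
    using linear_add[OF bounded_linear.linear[OF bounded_linear_proj[OF Kn]], of n "proj K x" "x - proj K x"] by simp
  ultimately show ?thesis by simp
qed

section \<open>The space $L^2$ as a type\<close>

text \<open>Preimages of the countably many basic open sets split into a measurable main part and a
  null part. All null parts fit into one null set \<open>N0\<close>, and making the function
  constant on \<open>N0\<close> leaves only the main parts.\<close>

lemma borel_measurable_completion_ex:
  fixes f :: "'a \<Rightarrow> 'b::second_countable_topology"
  assumes f: "f \<in> borel_measurable (completion M)"
  obtains g where "g \<in> borel_measurable M" "AE x in M. f x = g x"
proof -
  obtain B :: "'b set set" where B: "countable B" "topological_basis B" using ex_countable_basis by blast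
  define F where "F b = f -` b \<inter> space M" for b
  have F: "F b \<in> sets (completion M)" if "b \<in> B" for b
    using measurable_sets[OF f, of b] topological_basis_open[OF B(2) that] by (simp add: F_def)
  have "\<exists>N\<in>null_sets M. null_part M (F b) \<subseteq> N" if "b \<in> B" for b
    using null_part[OF F[OF that]] by blast
  then obtain N where N: "\<And>b. b \<in> B \<Longrightarrow> N b \<in> null_sets M" "\<And>b. b \<in> B \<Longrightarrow> null_part M (F b) \<subseteq> N b"
    by metis
  define N0 where "N0 = (\<Union>b\<in>B. N b)"
  have N0: "N0 \<in> null_sets M" unfolding N0_def using B(1) N(1) by (intro null_sets_UN') auto
  define g where "g x = (if x \<in> N0 then undefined else f x)" for x
  have "g \<in> M \<rightarrow>\<^sub>M sigma UNIV B"
  proof (rule measurable_measure_of)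
    fix b assume b: "b \<in> B"
    have "g -` b \<inter> space M = (main_part M (F b) - N0) \<union> (if undefined \<in> b then N0 else {})"
    proof -
      have "F b = main_part M (F b) \<union> null_part M (F b)" "null_part M (F b) \<subseteq> N0"
        using main_part_null_part_Un[OF F[OF b]] N(2)[OF b] b by (auto simp: N0_def)
      moreover have "N0 \<subseteq> space M" using null_setsD2[OF N0] sets.sets_into_space by blast
      moreover have "g -` b \<inter> space M = (F b - N0) \<union> (if undefined \<in> b then N0 \<inter> space M else {})"
        by (auto simp: g_def F_def split: if_splits)
      ultimately show ?thesis by auto
    qed
    also have "\<dots> \<in> sets M"
      using main_part_sets[OF F[OF b]] null_setsD2[OF N0] by auto
    finally show "g -` b \<inter> space M \<in> sets M" .
  qed auto
  then have "g \<in> borel_measurable M" by (simp add: borel_eq_countable_basis[OF B])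
  moreover have "AE x in M. f x = g x" using AE_not_in[OF N0] by eventually_elim (simp add: g_def)
  ultimately show thesis using that by blast
qed

text \<open>Borel functions and \<open>lborel\<close> are used instead of Lebesgue measurability
  because \<open>lborel\<close> on a product space is the product measure, so that Fubini applies;
  the completed measure is not a product of completed measures.\<close>

definition sq_int :: "('a::euclidean_space \<Rightarrow> 'b::euclidean_space) \<Rightarrow> bool" where
  "sq_int f \<longleftrightarrow> f \<in> borel_measurable borel \<and> integrable lborel (\<lambda>x. (norm (f x))\<^sup>2)"

lemma sq_int_measurable: "sq_int f \<Longrightarrow> f \<in> borel_measurable borel"
  by (simp add: sq_int_def)

lemma norm_add_sq_le: "(norm (x + y))\<^sup>2 \<le> 2 * (norm x)\<^sup>2 + 2 * (norm (y::'a::real_inner))\<^sup>2"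
proof -
  have "(norm (x + y))\<^sup>2 + (norm (x - y))\<^sup>2 = 2 * (norm x)\<^sup>2 + 2 * (norm y)\<^sup>2"
    by (simp add: power2_norm_eq_inner inner_simps)
  then show ?thesis using zero_le_power2[of "norm (x - y)"] by linarith
qed

lemma abs_inner_le_sq: "\<bar>x \<bullet> y\<bar> \<le> (norm x)\<^sup>2 + (norm (y::'a::real_inner))\<^sup>2"
proof -
  have "\<bar>x \<bullet> y\<bar> \<le> norm x * norm y" by (rule Cauchy_Schwarz_ineq2)
  moreover have "0 \<le> (norm x - norm y)\<^sup>2" by simp
  moreover have "0 \<le> norm x * norm y" by simp
  ultimately show ?thesis unfolding power2_diff by linarith
qed

lemma sq_int_add: "sq_int f \<Longrightarrow> sq_int g \<Longrightarrow> sq_int (\<lambda>x. f x + g x)"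
  unfolding sq_int_def
proof safe
  assume f[measurable]: "f \<in> borel_measurable borel" and g[measurable]: "g \<in> borel_measurable borel"
    and i: "integrable lborel (\<lambda>x. (norm (f x))\<^sup>2)" "integrable lborel (\<lambda>x. (norm (g x))\<^sup>2)"
  have *: "integrable lborel (\<lambda>x. 2 * (norm (f x))\<^sup>2 + 2 * (norm (g x))\<^sup>2)" using i by simp
  show "integrable lborel (\<lambda>x. (norm (f x + g x))\<^sup>2)"
    by (rule Bochner_Integration.integrable_bound[OF *]) (auto simp: norm_add_sq_le)
qed measurable

lemma sq_int_scale: "sq_int f \<Longrightarrow> sq_int (\<lambda>x. c *\<^sub>R f x)"
  unfolding sq_int_def by (auto simp: power_mult_distrib)

lemma sq_int_diff: "sq_int f \<Longrightarrow> sq_int g \<Longrightarrow> sq_int (\<lambda>x. f x - g x)"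
  using sq_int_add[of f "\<lambda>x. (-1) *\<^sub>R g x"] sq_int_scale[of g "-1"] by simp

lemma sq_int_minus: "sq_int f \<Longrightarrow> sq_int (\<lambda>x. - f x)"
  using sq_int_scale[of f "-1"] by simp

lemma sq_int_zero: "sq_int (\<lambda>x. 0)"
  by (simp add: sq_int_def)

lemma sq_int_inner: "sq_int f \<Longrightarrow> sq_int g \<Longrightarrow> integrable lborel (\<lambda>x. f x \<bullet> g x)"
  unfolding sq_int_def
proof safe
  assume f[measurable]: "f \<in> borel_measurable borel" and g[measurable]: "g \<in> borel_measurable borel"
    and i: "integrable lborel (\<lambda>x. (norm (f x))\<^sup>2)" "integrable lborel (\<lambda>x. (norm (g x))\<^sup>2)"
  have *: "integrable lborel (\<lambda>x. (norm (f x))\<^sup>2 + (norm (g x))\<^sup>2)" using i by simp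
  show "integrable lborel (\<lambda>x. f x \<bullet> g x)"
    by (rule Bochner_Integration.integrable_bound[OF *]) (auto simp: abs_inner_le_sq)
qed

lemma part_equivp_AE_eq:
  "part_equivp (\<lambda>f g :: 'a::euclidean_space \<Rightarrow> 'b::euclidean_space.
    sq_int f \<and> sq_int g \<and> (AE x in lborel. f x = g x))"
proof (rule part_equivpI, goal_cases)
  case 1
  show ?case using sq_int_zero by auto
next
  case 2
  show ?case by (auto simp: symp_def eq_commute)
next
  case 3
  have "AE x in lborel. f x = h x" if "AE x in lborel. f x = g x" "AE x in lborel. g x = h x"
    for f g h :: "'a \<Rightarrow> 'b" using that by eventually_elim simp
  then show ?case unfolding transp_def by blast
qed

\<comment> \<open>As a type, L2 can be an instance of the Hilbert and Banach space classes, so that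
  functions of time with values in it can be integrated. The quotient is partial because the
  relation is reflexive only on square integrable functions.\<close>
quotient_type (overloaded) ('a, 'b) l2 = "'a::euclidean_space \<Rightarrow> 'b::euclidean_space" / partial:
  "\<lambda>f g. sq_int f \<and> sq_int g \<and> (AE x in lborel. f x = g x)"
  by (rule part_equivp_AE_eq)

instantiation l2 :: (euclidean_space, euclidean_space) real_vector
begin

lift_definition zero_l2 :: "('a, 'b) l2" is "\<lambda>x. 0" by (simp add: sq_int_zero)

lift_definition plus_l2 :: "('a, 'b) l2 \<Rightarrow> ('a, 'b) l2 \<Rightarrow> ('a, 'b) l2" is "\<lambda>f g x. f x + g x"
  by (auto simp: sq_int_add)

lift_definition scaleR_l2 :: "real \<Rightarrow> ('a, 'b) l2 \<Rightarrow> ('a, 'b) l2" is "\<lambda>c f x. c *\<^sub>R f x"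
  by (auto simp: sq_int_scale)

lift_definition uminus_l2 :: "('a, 'b) l2 \<Rightarrow> ('a, 'b) l2" is "\<lambda>f x. - f x"
  by (auto simp: sq_int_minus)

lift_definition minus_l2 :: "('a, 'b) l2 \<Rightarrow> ('a, 'b) l2 \<Rightarrow> ('a, 'b) l2" is "\<lambda>f g x. f x - g x"
  by (auto simp: sq_int_diff)

instance
proof
  fix x y z :: "('a, 'b) l2" and a b :: real
  show "x + y + z = x + (y + z)" by transfer (auto simp: sq_int_add add.assoc)
  show "x + y = y + x" by transfer (auto simp: sq_int_add add.commute)
  show "0 + x = x" by transfer auto
  show "- x + x = 0" by transfer (auto simp: sq_int_zero)
  show "x - y = x + - y" by transfer (auto simp: sq_int_diff)
  show "a *\<^sub>R (x + y) = a *\<^sub>R x + a *\<^sub>R y"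
    by transfer (auto simp: sq_int_add sq_int_scale scaleR_add_right)
  show "(a + b) *\<^sub>R x = a *\<^sub>R x + b *\<^sub>R x"
    by transfer (auto simp: sq_int_add sq_int_scale scaleR_add_left)
  show "a *\<^sub>R b *\<^sub>R x = (a * b) *\<^sub>R x" by transfer (auto simp: sq_int_scale)
  show "1 *\<^sub>R x = x" by transfer auto
qed

end

instantiation l2 :: (euclidean_space, euclidean_space) real_inner
begin

lift_definition inner_l2 :: "('a, 'b) l2 \<Rightarrow> ('a, 'b) l2 \<Rightarrow> real" is "\<lambda>f g. LINT x|lborel. f x \<bullet> g x"
  by (rule integral_cong_AE) (auto intro!: borel_measurable_inner dest: sq_int_measurable)

definition norm_l2 :: "('a, 'b) l2 \<Rightarrow> real" where "norm_l2 x = sqrt (x \<bullet> x)"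
definition sgn_l2 :: "('a, 'b) l2 \<Rightarrow> ('a, 'b) l2" where "sgn_l2 x = x /\<^sub>R norm x"
definition dist_l2 :: "('a, 'b) l2 \<Rightarrow> ('a, 'b) l2 \<Rightarrow> real" where "dist_l2 x y = norm (x - y)"
definition uniformity_l2 :: "(('a, 'b) l2 \<times> ('a, 'b) l2) filter" where
  "uniformity_l2 = (INF e\<in>{0 <..}. principal {(x, y). dist x y < e})"
definition open_l2 :: "('a, 'b) l2 set \<Rightarrow> bool" where
  "open_l2 U \<longleftrightarrow> (\<forall>x\<in>U. eventually (\<lambda>(x', y). x' = x \<longrightarrow> y \<in> U) uniformity)"

instance
proof
  fix x y z :: "('a, 'b) l2" and a b :: real
  show "dist x y = norm (x - y)" by (rule dist_l2_def)
  show "sgn x = x /\<^sub>R norm x" by (rule sgn_l2_def)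
  show "uniformity = (INF e\<in>{0 <..}. principal {(x :: ('a, 'b) l2, y). dist x y < e})"
    by (rule uniformity_l2_def)
  show "open U \<longleftrightarrow> (\<forall>x\<in>U. eventually (\<lambda>(x', y). x' = x \<longrightarrow> y \<in> U) uniformity)"
    for U :: "('a, 'b) l2 set" by (rule open_l2_def)
  show "x \<bullet> y = y \<bullet> x" by transfer (simp add: inner_commute)
  show "(x + y) \<bullet> z = x \<bullet> z + y \<bullet> z"
    by transfer (simp add: inner_add_left sq_int_inner Bochner_Integration.integral_add)
  show "a *\<^sub>R x \<bullet> y = a * (x \<bullet> y)" by transfer simp
  show "0 \<le> x \<bullet> x" by transfer simp
  show "x \<bullet> x = 0 \<longleftrightarrow> x = 0"
  proof transfer
    fix f :: "'a \<Rightarrow> 'b" assume "sq_int f \<and> sq_int f \<and> (AE x in lborel. f x = f x)"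
    then have f: "sq_int f" by simp
    have "(LINT x|lborel. f x \<bullet> f x) = 0 \<longleftrightarrow> (AE x in lborel. f x \<bullet> f x = 0)"
      using sq_int_inner[OF f f] by (intro integral_nonneg_eq_0_iff_AE) auto
    then show "((LINT x|lborel. f x \<bullet> f x) = 0) =
      (sq_int f \<and> sq_int (\<lambda>x. 0::'b) \<and> (AE x in lborel. f x = 0))" using f sq_int_zero by (auto simp del: inner_eq_zero_iff simp: inner_eq_zero_iff[abs_def])
  qed
  show "norm x = sqrt (x \<bullet> x)" by (rule norm_l2_def)
qed

end

lemma sq_int_rep: "sq_int (rep_l2 x)"
  using Quotient3_rep_reflp[OF Quotient3_l2, of x] by simp

lemma rep_abs_l2: "sq_int f \<Longrightarrow> AE x in lborel. rep_l2 (abs_l2 f) x = f x"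
  using rep_abs_rsp[OF Quotient3_l2, of f f] by auto

lemma abs_rep_l2: "abs_l2 (rep_l2 x) = x"
  by (rule Quotient3_abs_rep[OF Quotient3_l2])

lemma abs_l2_eq: "sq_int f \<Longrightarrow> sq_int g \<Longrightarrow> AE x in lborel. f x = g x \<Longrightarrow> abs_l2 f = abs_l2 g"
  using Quotient3_rel_abs[OF Quotient3_l2, of f g] by simp

lemma rep_measurable[measurable]: "rep_l2 x \<in> borel_measurable borel"
  by (rule sq_int_measurable[OF sq_int_rep])

lemma inner_abs_l2: "sq_int f \<Longrightarrow> sq_int g \<Longrightarrow> abs_l2 f \<bullet> abs_l2 g = (LINT x|lborel. f x \<bullet> g x)"
  by (simp add: inner_l2.abs_eq)

lemma inner_l2_rep: "x \<bullet> y = (LINT t|lborel. rep_l2 x t \<bullet> rep_l2 y t)"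
  using inner_abs_l2[OF sq_int_rep sq_int_rep, of x y] by (simp add: abs_rep_l2)

lemma norm_abs_l2: "sq_int f \<Longrightarrow> (norm (abs_l2 f))\<^sup>2 = (LINT x|lborel. (norm (f x))\<^sup>2)"
  by (simp add: power2_norm_eq_inner inner_abs_l2)

lemma abs_l2_add: "sq_int f \<Longrightarrow> sq_int g \<Longrightarrow> abs_l2 f + abs_l2 g = abs_l2 (\<lambda>x. f x + g x)"
  by (simp add: plus_l2.abs_eq)

lemma abs_l2_scale: "sq_int f \<Longrightarrow> c *\<^sub>R abs_l2 f = abs_l2 (\<lambda>x. c *\<^sub>R f x)"
  by (simp add: scaleR_l2.abs_eq)

lemma abs_l2_diff: "sq_int f \<Longrightarrow> sq_int g \<Longrightarrow> abs_l2 f - abs_l2 g = abs_l2 (\<lambda>x. f x - g x)"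
  by (simp add: minus_l2.abs_eq)

lemma nn_integral_norm_sq:
  "sq_int f \<Longrightarrow> (\<integral>\<^sup>+x. ennreal ((norm (f x))\<^sup>2) \<partial>lborel) = ennreal ((norm (abs_l2 f))\<^sup>2)"
  by (subst nn_integral_eq_integral) (auto simp: sq_int_def norm_abs_l2)

lemma sq_intI:
  assumes "f \<in> borel_measurable borel" "(\<integral>\<^sup>+x. ennreal ((norm (f x))\<^sup>2) \<partial>lborel) < \<infinity>"
  shows "sq_int f"
  using assms unfolding sq_int_def by (auto intro!: integrableI_bounded)

subsection \<open>Completeness\<close>

text \<open>The weight \<open>4 ^ k\<close> leaves a summable bound \<open>(1/4) ^ k\<close> for the
  integrals of the squared increments. Hence the weighted sum is finite at almost every point, where
  the increments decay like \<open>(1/2) ^ k\<close> and can be summed.\<close>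

lemma AE_Cauchy_of_fast_L2:
  fixes f :: "nat \<Rightarrow> 'a::euclidean_space \<Rightarrow> 'b::euclidean_space"
  assumes f: "\<And>k. sq_int (f k)" and fast: "\<And>k. norm (abs_l2 (f (Suc k)) - abs_l2 (f k)) \<le> (1/4) ^ k"
  shows "AE x in lborel. convergent (\<lambda>k. f k x)"
proof -
  define d where "d k x = f (Suc k) x - f k x" for k x
  have d: "sq_int (d k)" for k unfolding d_def by (intro sq_int_diff f)
  note [measurable] = sq_int_measurable[OF d]
  have nd: "(\<integral>\<^sup>+x. ennreal (4 ^ k * (norm (d k x))\<^sup>2) \<partial>lborel) \<le> ennreal ((1/4) ^ k)" for k
  proof -
    have "(\<integral>\<^sup>+x. ennreal (4 ^ k * (norm (d k x))\<^sup>2) \<partial>lborel) = ennreal (4 ^ k * (norm (abs_l2 (d k)))\<^sup>2)"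
      by (simp add: ennreal_mult nn_integral_cmult nn_integral_norm_sq[OF d])
    also have "\<dots> \<le> ennreal (4 ^ k * ((1/4) ^ k)\<^sup>2)"
      using fast[of k] by (intro ennreal_leI mult_left_mono power_mono) (auto simp: d_def[abs_def] abs_l2_diff f)
    also have "4 ^ k * ((1/4) ^ k)\<^sup>2 = (1/4::real) ^ k" by (simp add: power2_eq_square power_one_over)
    finally show ?thesis .
  qed
  have "(\<integral>\<^sup>+x. (\<Sum>k. ennreal (4 ^ k * (norm (d k x))\<^sup>2)) \<partial>lborel)
      = (\<Sum>k. \<integral>\<^sup>+x. ennreal (4 ^ k * (norm (d k x))\<^sup>2) \<partial>lborel)"
    by (rule nn_integral_suminf) simp
  also have "\<dots> \<le> (\<Sum>k. ennreal ((1/4) ^ k))" by (intro suminf_le nd summableI)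
  also have "\<dots> < \<infinity>" by (subst suminf_ennreal2) (auto intro: summable_geometric)
  finally have "AE x in lborel. (\<Sum>k. ennreal (4 ^ k * (norm (d k x))\<^sup>2)) \<noteq> \<infinity>"
    by (intro nn_integral_PInf_AE) auto
  then show ?thesis
  proof eventually_elim
    case (elim x)
    define S where "S = (\<Sum>k. ennreal (4 ^ k * (norm (d k x))\<^sup>2))"
    define C where "C = enn2real S"
    have C0: "0 \<le> C" by (simp add: C_def)
    have "S < top" using elim by (simp add: S_def top.not_eq_extremum)
    then have S: "S = ennreal C" by (simp add: C_def)
    have C: "4 ^ k * (norm (d k x))\<^sup>2 \<le> C" for k
    proof -
      have "ennreal (4 ^ k * (norm (d k x))\<^sup>2) = (\<Sum>k\<in>{k}. ennreal (4 ^ k * (norm (d k x))\<^sup>2))" by simp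
      also have "\<dots> \<le> S" unfolding S_def by (rule sum_le_suminf) auto
      finally show ?thesis unfolding S using C0 by (simp only: ennreal_le_iff)
    qed
    have "norm (d k x) \<le> sqrt C * (1/2) ^ k" for k
    proof (rule power2_le_imp_le)
      have "(norm (d k x))\<^sup>2 \<le> C * (1/4) ^ k" using C[of k] by (simp add: field_simps power_one_over)
      also have "\<dots> = (sqrt C * (1/2) ^ k)\<^sup>2"
      proof -
        have "(1/4::real) ^ k = ((1/2) ^ k)\<^sup>2" using power_mult_distrib[of "1/2::real" "1/2" k] by (simp add: power2_eq_square)
        then show ?thesis using C0 by (simp add: power_mult_distrib)
      qed
      finally show "(norm (d k x))\<^sup>2 \<le> (sqrt C * (1/2) ^ k)\<^sup>2" .
    qed (simp add: C0)
    moreover have "summable (\<lambda>k. sqrt C * (1/2) ^ k)" by (intro summable_mult summable_geometric) simp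
    ultimately have "summable (\<lambda>k. d k x)" by (blast intro: summable_comparison_test')
    then have "convergent (\<lambda>n. \<Sum>k<n. d k x)" by (simp add: summable_iff_convergent)
    then have "convergent (\<lambda>n. f n x - f 0 x)" using sum_lessThan_telescope[of "\<lambda>k. f k x"] by (simp add: d_def)
    then show ?case by (simp add: convergent_diff_const_right_iff)
  qed
qed

text \<open>The Riesz-Fischer argument: a rapidly convergent subsequence has an almost everywhere
  limit, which Fatou's lemma identifies as its limit in norm.\<close>

instance l2 :: (euclidean_space, euclidean_space) complete_space
proof
  fix X :: "nat \<Rightarrow> ('a, 'b) l2" assume X: "Cauchy X"
  obtain r where r: "strict_mono r" "\<And>n m. n \<le> m \<Longrightarrow> dist (X (r n)) (X (r m)) < (1/4) ^ n"
  proof -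
    have "\<exists>M. \<forall>i\<ge>M. \<forall>j\<ge>M. dist (X i) (X j) < (1/4) ^ n" for n
      using X unfolding Cauchy_def by simp
    then obtain M where M: "\<And>n i j. i \<ge> M n \<Longrightarrow> j \<ge> M n \<Longrightarrow> dist (X i) (X j) < (1/4) ^ n" by metis
    \<comment> \<open>The sum puts \<open>r n\<close> above \<open>M n\<close>, and the summand
      \<open>n\<close> makes \<open>r\<close> strictly increasing whatever \<open>M\<close>
      is.\<close>
    define r where "r n = (\<Sum>i\<le>n. M i) + n" for n
    have "strict_mono r" by (rule strict_mono_Suc_iff[THEN iffD2]) (simp add: r_def)
    moreover have "dist (X (r n)) (X (r m)) < (1/4) ^ n" if "n \<le> m" for n m
    proof (rule M)
      have "M n \<le> (\<Sum>i\<le>n. M i)" by (intro member_le_sum) auto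
      then show "M n \<le> r n" by (simp add: r_def)
      have "r n \<le> r m" using \<open>strict_mono r\<close> that by (simp add: strict_mono_less_eq)
      then show "M n \<le> r m" using \<open>M n \<le> r n\<close> by simp
    qed
    ultimately show thesis by (rule that)
  qed
  define f where "f k = rep_l2 (X (r k))" for k
  have f: "sq_int (f k)" and af: "abs_l2 (f k) = X (r k)" for k
    by (auto simp: f_def sq_int_rep abs_rep_l2)
  note [measurable] = sq_int_measurable[OF f]
  define g where "g x = lim (\<lambda>k. f k x)" for x
  have g[measurable]: "g \<in> borel_measurable borel" unfolding g_def by measurable
  have "AE x in lborel. convergent (\<lambda>k. f k x)"
  proof (rule AE_Cauchy_of_fast_L2)
    show "norm (abs_l2 (f (Suc k)) - abs_l2 (f k)) \<le> (1/4) ^ k" for k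
      using r(2)[of k "Suc k"] by (simp add: af dist_norm norm_minus_commute)
  qed (rule f)
  then have lim: "AE x in lborel. (\<lambda>k. f k x) \<longlonglongrightarrow> g x"
    by eventually_elim (simp add: g_def convergent_LIMSEQ_iff)
  \<comment> \<open>The pointwise limit inherits the Cauchy estimate. This gives at once that
    \<open>g - f n\<close> is square integrable and that it is small.\<close>
  have fatou: "(\<integral>\<^sup>+x. ennreal ((norm (g x - f n x))\<^sup>2) \<partial>lborel) \<le> ennreal (((1/4) ^ n)\<^sup>2)" for n
  proof -
    have "(\<integral>\<^sup>+x. ennreal ((norm (g x - f n x))\<^sup>2) \<partial>lborel)
      = (\<integral>\<^sup>+x. liminf (\<lambda>m. ennreal ((norm (f m x - f n x))\<^sup>2)) \<partial>lborel)"
    proof (rule nn_integral_cong_AE, use lim in eventually_elim)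
      case (elim x)
      have "(\<lambda>m. ennreal ((norm (f m x - f n x))\<^sup>2)) \<longlonglongrightarrow> ennreal ((norm (g x - f n x))\<^sup>2)"
        by (intro tendsto_ennrealI tendsto_intros elim)
      then show ?case by (rule lim_imp_Liminf[OF sequentially_bot, symmetric])
    qed
    also have "\<dots> \<le> liminf (\<lambda>m. \<integral>\<^sup>+x. ennreal ((norm (f m x - f n x))\<^sup>2) \<partial>lborel)"
      by (rule nn_integral_liminf) measurable
    also have "\<dots> \<le> ennreal (((1/4) ^ n)\<^sup>2)"
    proof (rule Liminf_le)
      have "(\<integral>\<^sup>+x. ennreal ((norm (f m x - f n x))\<^sup>2) \<partial>lborel) \<le> ennreal (((1/4) ^ n)\<^sup>2)" if "m \<ge> n" for m
      proof -
        have "norm (X (r m) - X (r n)) \<le> (1/4) ^ n" using r(2)[OF that] by (simp add: dist_norm norm_minus_commute)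
        then show ?thesis
          by (simp add: nn_integral_norm_sq[OF sq_int_diff[OF f f]] abs_l2_diff[OF f f, symmetric] af
            ennreal_leI power_mono del: ennreal_le_iff)
      qed
      then show "eventually (\<lambda>m. (\<integral>\<^sup>+x. ennreal ((norm (f m x - f n x))\<^sup>2) \<partial>lborel) \<le> ennreal (((1/4) ^ n)\<^sup>2)) sequentially"
        using eventually_sequentially by blast
    qed simp
    finally show ?thesis .
  qed
  have gf: "sq_int (\<lambda>x. g x - f n x)" for n
    by (rule sq_intI) (auto intro: le_less_trans[OF fatou] ennreal_less_top)
  then have gs: "sq_int g" using sq_int_add[OF gf[of 0] f[of 0]] by simp
  have "norm (X (r n) - abs_l2 g) \<le> (1/4) ^ n" for n
  proof -
    have "ennreal ((norm (abs_l2 g - X (r n)))\<^sup>2) \<le> ennreal (((1/4) ^ n)\<^sup>2)"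
      using fatou[of n] nn_integral_norm_sq[OF gf, of n] abs_l2_diff[OF gs f, of n] by (simp add: af)
    then have "(norm (abs_l2 g - X (r n)))\<^sup>2 \<le> ((1/4) ^ n)\<^sup>2" by (subst (asm) ennreal_le_iff) auto
    then have "norm (abs_l2 g - X (r n)) \<le> (1/4) ^ n" by (rule power2_le_imp_le) simp
    then show ?thesis by (simp only: norm_minus_commute)
  qed
  moreover have "(\<lambda>n. (1/4::real) ^ n) \<longlonglongrightarrow> 0" by (rule LIMSEQ_power_zero) simp
  ultimately have "(\<lambda>n. X (r n) - abs_l2 g) \<longlonglongrightarrow> 0"
    by (rule Lim_null_comparison[OF always_eventually[OF allI]])
  then have "(X \<circ> r) \<longlonglongrightarrow> abs_l2 g" by (simp add: LIM_zero_iff o_def)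
  then show "convergent X"
    using Cauchy_converges_subseq[OF X r(1)] unfolding convergent_def by blast
qed

instance l2 :: (euclidean_space, euclidean_space) banach ..

subsection \<open>Separability\<close>

text \<open>By Lebesgue differentiation, almost every value is a limit of averages over small cubes.
  Cutting \<open>g\<close> off to one closed box in \<open>\<Omega>\<close> makes the integral over
  every box vanish, since the intersection of two boxes is a box; countably many such boxes exhaust
  \<open>\<Omega>\<close>.\<close>

lemma AE_zero_of_box_integrals:
  fixes g :: "'a::euclidean_space \<Rightarrow> real"
  assumes "open \<Omega>"
    and int: "\<And>a b. cbox a b \<subseteq> \<Omega> \<Longrightarrow> set_integrable lebesgue (cbox a b) g"
    and zero: "\<And>a b. cbox a b \<subseteq> \<Omega> \<Longrightarrow> (LINT x:box a b|lebesgue. g x) = 0"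
  shows "AE x in lebesgue. x \<in> \<Omega> \<longrightarrow> g x = 0"
proof -
  have hk: "(g has_integral 0) (cbox a b)" if "cbox a b \<subseteq> \<Omega>" for a b
  proof -
    have s: "set_integrable lebesgue (box a b) g"
      by (rule set_integrable_subset[OF int[OF that]]) (auto simp: box_subset_cbox)
    show ?thesis
      using has_integral_set_lebesgue[OF s] zero[OF that] by (simp add: has_integral_open_interval)
  qed
  have cb: "AE x in lebesgue. x \<in> cbox c d \<longrightarrow> g x = 0" if cd: "cbox c d \<subseteq> \<Omega>" for c d
  proof -
    define h where "h x = (if x \<in> cbox c d then g x else 0)" for x
    have h0: "(h has_integral 0) (cbox a b)" for a b
    proof -
      obtain p q where pq: "cbox c d \<inter> cbox a b = cbox p q" using Int_interval by blast
      then have "(g has_integral 0) (cbox p q)" using cd by (intro hk) blast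
      then show ?thesis unfolding h_def has_integral_restrict_Int pq .
    qed
    then have "h integrable_on cbox a b" for a b by blast
    then obtain N where N: "negligible N"
      "\<And>x e. \<lbrakk>x \<notin> N; 0 < e\<rbrakk> \<Longrightarrow> \<exists>d>0. \<forall>r. 0 < r \<and> r < d \<longrightarrow>
         norm (integral (cbox x (x + r *\<^sub>R One)) h /\<^sub>R r ^ DIM('a) - h x) < e"
      using integrable_ccontinuous_explicit[of h] by blast
    have h_zero: "h x = 0" if "x \<notin> N" for x
    proof (rule ccontr)
      assume "h x \<noteq> 0"
      then obtain d where "d > 0" "\<forall>r. 0 < r \<and> r < d \<longrightarrow>
         norm (integral (cbox x (x + r *\<^sub>R One)) h /\<^sub>R r ^ DIM('a) - h x) < norm (h x)"
        using N(2)[OF \<open>x \<notin> N\<close>, of "norm (h x)"] by auto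
      moreover have "integral (cbox x (x + r *\<^sub>R One)) h = 0" for r
        using h0 by (rule integral_unique)
      ultimately show False by (auto dest: dense)
    qed
    have "AE x in lebesgue. x \<notin> N"
      using N(1) by (intro AE_not_in) (simp add: negligible_iff_null_sets)
    moreover have "g x = 0" if "x \<notin> N" "x \<in> cbox c d" for x
      using h_zero[OF that(1)] that(2) by (simp add: h_def)
    ultimately show ?thesis by (auto elim: eventually_mono)
  qed
  obtain \<D> where D: "countable \<D>" "\<D> \<subseteq> Pow \<Omega>" "\<And>X. X \<in> \<D> \<Longrightarrow> \<exists>a b. X = cbox a b" "\<Union>\<D> = \<Omega>"
    using open_countable_Union_open_cbox[OF \<open>open \<Omega>\<close>] by metis
  have "AE x in lebesgue. \<forall>X\<in>\<D>. x \<in> X \<longrightarrow> g x = 0"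
    unfolding AE_ball_countable[OF D(1)] using D(2,3) cb by (metis PowD subsetD)
  then show ?thesis by eventually_elim (use D(4) in blast)
qed

text \<open>The total set consists of indicators of finite unions of basic open sets, times basis
  vectors. Orthogonality to them makes the integral of each component vanish over every open box, as
  such a box is an increasing union of finite unions of basic sets.\<close>

lemma l2_total:
  obtains S :: "('a::euclidean_space, 'b::euclidean_space) l2 set"
  where "countable S" "\<And>x. (\<And>s. s \<in> S \<Longrightarrow> x \<bullet> s = 0) \<Longrightarrow> x = 0"
proof -
  obtain B :: "'a set set" where B: "countable B" "topological_basis B" using ex_countable_basis by blast
  have oB: "open b" if "b \<in> B" for b using B(2) that topological_basis_open by blast
  \<comment> \<open>A union of infinite measure is given the value 0, since its indicator is not
    square integrable.\<close>
  define st where "st W e = abs_l2 (\<lambda>x. if emeasure lborel W < \<infinity> then indicator W x *\<^sub>R e else 0)"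
    for W :: "'a set" and e :: 'b
  define S where "S = (\<lambda>(F,e). st (\<Union>F) e) ` ({F. finite F \<and> F \<subseteq> B} \<times> Basis)"
  have "countable S"
    unfolding S_def
    by (rule countable_image, rule countable_SIGMA, rule countable_Collect_finite_subset[OF B(1)])
       (simp add: countable_finite)
  moreover have "y = 0" if orth: "\<And>s. s \<in> S \<Longrightarrow> y \<bullet> s = 0" for y
  proof -
    have ae: "AE x in lebesgue. rep_l2 y x \<bullet> e = 0" if e: "e \<in> Basis" for e
    proof -
      define g where "g x = rep_l2 y x \<bullet> e" for x
      have g[measurable]: "g \<in> borel_measurable borel" unfolding g_def by measurable
      have si: "sq_int (\<lambda>x. indicator W x *\<^sub>R e)" if "W \<in> sets borel" "emeasure lborel W < \<infinity>" for W :: "'a set"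
      proof -
        have "(\<lambda>x. (norm (indicator W x *\<^sub>R e))\<^sup>2) = (indicator W :: 'a \<Rightarrow> real)"
          using e by (auto simp: indicator_def)
        then show ?thesis unfolding sq_int_def using that by (auto intro!: integrable_real_indicator)
      qed
      have ig: "set_integrable lborel W g" if "W \<in> sets borel" "emeasure lborel W < \<infinity>" for W :: "'a set"
        using sq_int_inner[OF sq_int_rep si[OF that], of y] by (simp add: set_integrable_def g_def)
      have zW: "(LINT x:W|lborel. g x) = 0" if W: "W = \<Union>F" "finite F" "F \<subseteq> B" "emeasure lborel W < \<infinity>" for F W
      proof -
        have Wb: "W \<in> sets borel" using W oB by (auto intro!: borel_open)
        have "y \<bullet> st W e = 0" by (rule orth) (use W e in \<open>auto simp: S_def\<close>)
        moreover have "y \<bullet> st W e = (LINT x|lborel. rep_l2 y x \<bullet> (indicator W x *\<^sub>R e))"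
          using inner_abs_l2[OF sq_int_rep si[OF Wb W(4)], of y] W(4) by (simp add: abs_rep_l2 st_def)
        ultimately show ?thesis by (simp add: set_lebesgue_integral_def g_def)
      qed
      have "AE x in lebesgue. x \<in> UNIV \<longrightarrow> g x = 0"
      proof (rule AE_zero_of_box_integrals)
        fix a b :: 'a
        have "set_integrable lborel (cbox a b) g" by (rule ig) (auto simp: emeasure_lborel_cbox_eq)
        then show "set_integrable lebesgue (cbox a b) g"
          by (simp add: set_integrable_def integrable_completion)
        show "(LINT x:box a b|lebesgue. g x) = 0"
        proof (cases "box a b = {}")
          case False
          define C where "C = {c \<in> B. c \<subseteq> box a b}"
          have C: "\<Union>C = box a b"
            using topological_basisE[OF B(2) open_box[of a b]] unfolding C_def by blast
          have cC: "countable C" using B(1) by (auto simp: C_def)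
          have neC: "C \<noteq> {}" using C False by auto
          \<comment> \<open>Initial segments of an enumeration of the basic sets inside the box:
            finite unions, increasing to the box, to which continuity of the integral from below
            applies.\<close>
          define W where "W n = \<Union>(from_nat_into C ` {..n})" for n
          have fin: "from_nat_into C n \<in> C" for n using neC by (rule from_nat_into)
          have UW: "(\<Union>n. W n) = box a b"
          proof -
            have "(\<Union>n. W n) = \<Union>(range (from_nat_into C))" by (auto simp: W_def)
            then show ?thesis using range_from_nat_into[OF neC cC] C by simp
          qed
          have Wsub: "W n \<subseteq> box a b" for n using UW by blast
          have Wm: "W n \<in> sets borel" for n
            unfolding W_def using fin oB by (intro borel_open open_Union) (auto simp: C_def)
          have fW: "emeasure lborel (W n) < \<infinity>" for n
            by (rule le_less_trans[OF emeasure_mono[OF Wsub]]) (auto simp: emeasure_lborel_box_eq)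
          have mW: "incseq W" unfolding W_def by (intro monoI Union_mono image_mono) simp
          have "(\<lambda>n. LINT x:W n|lborel. g x) \<longlonglongrightarrow> (LINT x:(\<Union>n. W n)|lborel. g x)"
          proof (rule set_integral_cont_up)
            show "incseq W" by (rule mW)
            show "set_integrable lborel (\<Union>n. W n) g"
              unfolding UW by (rule ig) (auto simp: emeasure_lborel_box_eq)
          qed (use Wm in simp)
          moreover have "(LINT x:W n|lborel. g x) = 0" for n
            by (rule zW[of _ "from_nat_into C ` {..n}"]) (use fin fW in \<open>auto simp: W_def C_def\<close>)
          ultimately have "(LINT x:box a b|lborel. g x) = 0"
            unfolding UW by (simp add: LIMSEQ_const_iff)
          then show ?thesis by (simp add: set_lebesgue_integral_def integral_completion)
        qed (simp add: set_lebesgue_integral_def)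
      qed simp
      then show ?thesis by (simp add: g_def)
    qed
    have "AE x in lebesgue. \<forall>e\<in>Basis. rep_l2 y x \<bullet> e = 0"
      unfolding AE_ball_countable[OF countable_finite[OF finite_Basis]] using ae by blast
    then have "AE x in lborel. \<forall>e\<in>Basis. rep_l2 y x \<bullet> e = 0" by (simp add: AE_completion_iff)
    then have "AE x in lborel. rep_l2 y x = 0" by eventually_elim (simp add: euclidean_eq_iff[where 'a='b])
    then have "y \<bullet> y = 0" unfolding inner_l2_rep by (intro integral_eq_zero_AE) (auto elim: eventually_mono)
    then show "y = 0" by simp
  qed
  ultimately show thesis by (rule that)
qed

instance l2 :: (euclidean_space, euclidean_space) second_countable_topology
proof
  obtain S :: "('a, 'b) l2 set"
    where "countable S" "\<And>x. (\<And>s. s \<in> S \<Longrightarrow> x \<bullet> s = 0) \<Longrightarrow> x = 0" by (rule l2_total) blast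
  then show "\<exists>B::('a, 'b) l2 set set. countable B \<and> open = generate_topology B"
    by (rule second_countable_of_total)
qed

subsection \<open>Lebesgue measurable functions as elements of $L^2$\<close>

text \<open>The passage from Lebesgue measurable functions, as they occur in the statement of the
  problem, to the quotient type, by way of a Borel representative. It is meaningful on
  \<open>L2 UNIV\<close>.\<close>

definition l2_of :: "('a::euclidean_space \<Rightarrow> 'b::euclidean_space) \<Rightarrow> ('a, 'b) l2" where
  "l2_of f = abs_l2 (SOME g. sq_int g \<and> (AE x in lebesgue. f x = g x))"

lemma L2_UNIV: "f \<in> L2 UNIV \<longleftrightarrow> f \<in> borel_measurable lebesgue \<and> integrable lebesgue (\<lambda>x. (norm (f x))\<^sup>2)"
  by (simp add: L2_def lebesgue_on_UNIV_eq)

lemma sq_int_imp_L2: "sq_int f \<Longrightarrow> f \<in> L2 UNIV"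
  by (auto simp: L2_UNIV sq_int_def integrable_completion intro: measurable_completion)

lemma L2_UNIV_sq_int_ex:
  assumes "f \<in> L2 UNIV"
  shows "\<exists>g. sq_int g \<and> (AE x in lebesgue. f x = g x)"
proof -
  have f: "f \<in> borel_measurable lebesgue" "integrable lebesgue (\<lambda>x. (norm (f x))\<^sup>2)"
    using assms by (auto simp: L2_UNIV)
  obtain g where g: "g \<in> borel_measurable lborel" "AE x in lborel. f x = g x"
    using borel_measurable_completion_ex[OF f(1)] by blast
  have ae: "AE x in lebesgue. f x = g x" using g(2) by (rule AE_completion)
  have [measurable]: "g \<in> borel_measurable borel" using g(1) by simp
  have [measurable]: "g \<in> borel_measurable lebesgue" using measurable_completion[OF g(1)] .
  have "integrable lebesgue (\<lambda>x. (norm (g x))\<^sup>2)"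
    by (rule integrable_cong_AE_imp[OF f(2)]) (use ae in \<open>auto elim: eventually_mono\<close>)
  then have "sq_int g" using g(1) by (simp add: sq_int_def integrable_completion)
  then show ?thesis using ae by blast
qed

lemma l2_of_eqI:
  assumes "sq_int g" "AE x in lebesgue. f x = g x"
  shows "l2_of f = abs_l2 g"
proof -
  define h where "h = (SOME g. sq_int g \<and> (AE x in lebesgue. f x = g x))"
  have h: "sq_int h \<and> (AE x in lebesgue. f x = h x)"
    unfolding h_def by (rule someI[where x=g]) (use assms in simp)
  then have "AE x in lebesgue. h x = g x" using assms(2) by auto
  then have "abs_l2 h = abs_l2 g" using h assms(1) by (intro abs_l2_eq) (auto simp: AE_completion_iff)
  then show ?thesis by (simp add: l2_of_def h_def)
qed

lemma l2_of_sq_int: "sq_int f \<Longrightarrow> l2_of f = abs_l2 f"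
  by (rule l2_of_eqI) auto

lemma l2_of_rep: "l2_of (rep_l2 y) = y"
  by (simp add: l2_of_sq_int sq_int_rep abs_rep_l2)

lemma rep_l2_of:
  assumes "f \<in> L2 UNIV"
  shows "AE x in lebesgue. rep_l2 (l2_of f) x = f x"
proof -
  obtain g where g: "sq_int g" "AE x in lebesgue. f x = g x" using L2_UNIV_sq_int_ex[OF assms] by blast
  have "AE x in lebesgue. rep_l2 (abs_l2 g) x = g x" using rep_abs_l2[OF g(1)] by (rule AE_completion)
  then show ?thesis unfolding l2_of_eqI[OF g] using g(2) by eventually_elim simp
qed

lemma l2_of_cong:
  assumes "f \<in> L2 UNIV" "AE x in lebesgue. f x = g x"
  shows "l2_of f = l2_of g"
proof -
  obtain h where h: "sq_int h" "AE x in lebesgue. f x = h x" using L2_UNIV_sq_int_ex[OF assms(1)] by blast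
  have "AE x in lebesgue. g x = h x" using h(2) assms(2) by eventually_elim simp
  then show ?thesis by (simp add: l2_of_eqI[OF h] l2_of_eqI[OF h(1)])
qed

lemma l2_of_eqD:
  assumes "f \<in> L2 UNIV" "g \<in> L2 UNIV" "l2_of f = l2_of g"
  shows "AE x in lebesgue. f x = g x"
  using rep_l2_of[OF assms(1)] rep_l2_of[OF assms(2)] unfolding assms(3) by eventually_elim simp

lemma inner_l2_of:
  assumes "f \<in> L2 UNIV" "g \<in> L2 UNIV"
  shows "l2_of f \<bullet> l2_of g = (LINT x|lebesgue. f x \<bullet> g x)"
    and "integrable lebesgue (\<lambda>x. f x \<bullet> g x)"
proof -
  have [measurable]: "f \<in> borel_measurable lebesgue" "g \<in> borel_measurable lebesgue"
    using assms by (auto simp: L2_UNIV)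
  have [measurable]: "rep_l2 y \<in> borel_measurable lebesgue" for y :: "('a, 'b) l2"
    using measurable_completion[of "rep_l2 y" lborel borel] by simp
  have ae: "AE x in lebesgue. rep_l2 (l2_of f) x \<bullet> rep_l2 (l2_of g) x = f x \<bullet> g x"
    using rep_l2_of[OF assms(1)] rep_l2_of[OF assms(2)] by eventually_elim simp
  have "l2_of f \<bullet> l2_of g = (LINT x|lebesgue. rep_l2 (l2_of f) x \<bullet> rep_l2 (l2_of g) x)"
    by (simp add: inner_l2_rep integral_completion)
  also have "\<dots> = (LINT x|lebesgue. f x \<bullet> g x)" by (rule integral_cong_AE) (use ae in auto)
  finally show "l2_of f \<bullet> l2_of g = (LINT x|lebesgue. f x \<bullet> g x)" .
  have "integrable lebesgue (\<lambda>x. rep_l2 (l2_of f) x \<bullet> rep_l2 (l2_of g) x)"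
    using sq_int_inner[OF sq_int_rep sq_int_rep] by (simp add: integrable_completion)
  then show "integrable lebesgue (\<lambda>x. f x \<bullet> g x)"
    by (rule integrable_cong_AE_imp) (use ae in \<open>auto elim: eventually_mono\<close>)
qed

lemma l2_of_lincomb:
  assumes "f \<in> L2 UNIV" "g \<in> L2 UNIV"
  shows "(\<lambda>x. c *\<^sub>R f x + d *\<^sub>R g x) \<in> L2 UNIV"
    and "l2_of (\<lambda>x. c *\<^sub>R f x + d *\<^sub>R g x) = c *\<^sub>R l2_of f + d *\<^sub>R l2_of g"
proof -
  obtain f' where f': "sq_int f'" "AE x in lebesgue. f x = f' x" using L2_UNIV_sq_int_ex[OF assms(1)] by blast
  obtain g' where g': "sq_int g'" "AE x in lebesgue. g x = g' x" using L2_UNIV_sq_int_ex[OF assms(2)] by blast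
  have s: "sq_int (\<lambda>x. c *\<^sub>R f' x + d *\<^sub>R g' x)" by (intro sq_int_add sq_int_scale f' g')
  have ae: "AE x in lebesgue. c *\<^sub>R f x + d *\<^sub>R g x = c *\<^sub>R f' x + d *\<^sub>R g' x"
    using f'(2) g'(2) by eventually_elim simp
  show "l2_of (\<lambda>x. c *\<^sub>R f x + d *\<^sub>R g x) = c *\<^sub>R l2_of f + d *\<^sub>R l2_of g"
    unfolding l2_of_eqI[OF s ae] l2_of_eqI[OF f'] l2_of_eqI[OF g']
    by (simp add: abs_l2_add abs_l2_scale sq_int_scale f' g')
  have [measurable]: "f \<in> borel_measurable lebesgue" "g \<in> borel_measurable lebesgue"
    using assms by (auto simp: L2_UNIV)
  have "integrable lebesgue (\<lambda>x. (norm (c *\<^sub>R f' x + d *\<^sub>R g' x))\<^sup>2)"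
    using sq_int_imp_L2[OF s] by (simp add: L2_UNIV)
  then have "integrable lebesgue (\<lambda>x. (norm (c *\<^sub>R f x + d *\<^sub>R g x))\<^sup>2)"
    by (rule integrable_cong_AE_imp) (use ae in \<open>auto elim: eventually_mono\<close>)
  then show "(\<lambda>x. c *\<^sub>R f x + d *\<^sub>R g x) \<in> L2 UNIV" by (simp add: L2_UNIV)
qed

text \<open>Extension by zero puts the functions on all domains into one Hilbert space, where
  functions on different domains can be subtracted.\<close>

definition l2_ext :: "'a::euclidean_space set \<Rightarrow> ('a \<Rightarrow> 'b::euclidean_space) \<Rightarrow> ('a, 'b) l2" where
  "l2_ext S f = l2_of (extend0 S f)"

context
  fixes S :: "'a::euclidean_space set"
  assumes S: "S \<in> sets lebesgue"
begin

lemma L2_extend0_iff: "extend0 S f \<in> L2 UNIV \<longleftrightarrow> f \<in> L2 S"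
proof -
  have "(\<lambda>x. (norm (extend0 S f x))\<^sup>2) = (\<lambda>x. indicator S x *\<^sub>R (norm (f x))\<^sup>2)"
    by (auto simp: extend0_def indicator_def)
  moreover have "integrable (lebesgue_on S) (\<lambda>x. (norm (f x))\<^sup>2) \<longleftrightarrow>
      integrable lebesgue (\<lambda>x. indicator S x *\<^sub>R (norm (f x))\<^sup>2)"
    using S by (simp add: integrable_restrict_space)
  ultimately show ?thesis
    unfolding L2_UNIV L2_def[of S] mem_Collect_eq using borel_measurable_if[OF S, of f]
    by (simp add: extend0_def[abs_def])
qed

lemma AE_lebesgue_on_iff: "(AE x in lebesgue_on S. P x) \<longleftrightarrow> (AE x in lebesgue. x \<in> S \<longrightarrow> P x)"
  using S by (simp add: AE_restrict_space_iff)

lemma inner_l2_ext: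
  assumes "f \<in> L2 S" "g \<in> L2 S"
  shows "l2_ext S f \<bullet> l2_ext S g = (LINT x|lebesgue_on S. f x \<bullet> g x)"
proof -
  have "l2_ext S f \<bullet> l2_ext S g = (LINT x|lebesgue. extend0 S f x \<bullet> extend0 S g x)"
    unfolding l2_ext_def using assms by (intro inner_l2_of) (auto simp: L2_extend0_iff)
  also have "\<dots> = (LINT x|lebesgue. indicator S x *\<^sub>R (f x \<bullet> g x))"
    by (intro Bochner_Integration.integral_cong) (auto simp: extend0_def indicator_def)
  also have "\<dots> = (LINT x|lebesgue_on S. f x \<bullet> g x)" using S by (simp add: integral_restrict_space)
  finally show ?thesis .
qed

lemma integrable_inner_L2:
  assumes "f \<in> L2 S" "g \<in> L2 S"
  shows "integrable (lebesgue_on S) (\<lambda>x. f x \<bullet> g x)"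
proof -
  have "integrable lebesgue (\<lambda>x. extend0 S f x \<bullet> extend0 S g x)"
    using assms by (intro inner_l2_of) (auto simp: L2_extend0_iff)
  also have "(\<lambda>x. extend0 S f x \<bullet> extend0 S g x) = (\<lambda>x. indicator S x *\<^sub>R (f x \<bullet> g x))"
    by (auto simp: extend0_def indicator_def)
  finally show ?thesis using S by (simp add: integrable_restrict_space)
qed

lemma norm_l2_ext: "f \<in> L2 S \<Longrightarrow> norm (l2_ext S f) = L2_norm S f"
  by (simp add: norm_eq_sqrt_inner inner_l2_ext L2_norm_def power2_norm_eq_inner)

lemma l2_ext_lincomb:
  assumes "f \<in> L2 S" "g \<in> L2 S"
  shows "(\<lambda>x. c *\<^sub>R f x + d *\<^sub>R g x) \<in> L2 S"
    and "l2_ext S (\<lambda>x. c *\<^sub>R f x + d *\<^sub>R g x) = c *\<^sub>R l2_ext S f + d *\<^sub>R l2_ext S g"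
proof -
  have e: "extend0 S (\<lambda>x. c *\<^sub>R f x + d *\<^sub>R g x) = (\<lambda>x. c *\<^sub>R extend0 S f x + d *\<^sub>R extend0 S g x)"
    by (auto simp: extend0_def)
  have f: "extend0 S f \<in> L2 UNIV" "extend0 S g \<in> L2 UNIV" using assms by (auto simp: L2_extend0_iff)
  show "(\<lambda>x. c *\<^sub>R f x + d *\<^sub>R g x) \<in> L2 S"
    using l2_of_lincomb(1)[OF f, of c d] unfolding e[symmetric] by (simp only: L2_extend0_iff)
  show "l2_ext S (\<lambda>x. c *\<^sub>R f x + d *\<^sub>R g x) = c *\<^sub>R l2_ext S f + d *\<^sub>R l2_ext S g"
    unfolding l2_ext_def e by (rule l2_of_lincomb(2)[OF f])
qed

lemma L2_diff: "f \<in> L2 S \<Longrightarrow> g \<in> L2 S \<Longrightarrow> (\<lambda>x. f x - g x) \<in> L2 S"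
  using l2_ext_lincomb(1)[of f g 1 "-1"] by simp

lemma l2_ext_diff: "f \<in> L2 S \<Longrightarrow> g \<in> L2 S \<Longrightarrow> l2_ext S (\<lambda>x. f x - g x) = l2_ext S f - l2_ext S g"
  using l2_ext_lincomb(2)[of f g 1 "-1"] by simp

lemma l2_ext_cong:
  assumes "f \<in> L2 S" "AE x in lebesgue_on S. f x = g x"
  shows "l2_ext S f = l2_ext S g"
  unfolding l2_ext_def
proof (rule l2_of_cong)
  show "extend0 S f \<in> L2 UNIV" using assms(1) by (simp add: L2_extend0_iff)
  have "AE x in lebesgue. x \<in> S \<longrightarrow> f x = g x" using assms(2) by (simp add: AE_lebesgue_on_iff)
  then show "AE x in lebesgue. extend0 S f x = extend0 S g x" by eventually_elim (simp add: extend0_def)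
qed

lemma rep_l2_ext:
  assumes "f \<in> L2 S"
  shows "AE x in lebesgue. rep_l2 (l2_ext S f) x = extend0 S f x"
  unfolding l2_ext_def using assms by (intro rep_l2_of) (simp add: L2_extend0_iff)

lemma l2_ext_rep:
  assumes "AE x in lebesgue. x \<notin> S \<longrightarrow> rep_l2 y x = 0"
  shows "rep_l2 y \<in> L2 S" "l2_ext S (rep_l2 y) = y"
proof -
  have ae: "AE x in lebesgue. rep_l2 y x = extend0 S (rep_l2 y) x"
    using assms by eventually_elim (auto simp: extend0_def)
  have L: "rep_l2 y \<in> L2 UNIV" by (intro sq_int_imp_L2 sq_int_rep)
  then have *: "rep_l2 y \<in> borel_measurable lebesgue" "integrable lebesgue (\<lambda>x. (norm (rep_l2 y x))\<^sup>2)"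
    by (auto simp: L2_UNIV)
  show "rep_l2 y \<in> L2 S"
    unfolding L2_def mem_Collect_eq using * S
    using integrable_mult_indicator[OF S *(2)]
    by (auto simp: integrable_restrict_space intro: measurable_restrict_space1)
  show "l2_ext S (rep_l2 y) = y"
    unfolding l2_ext_def using l2_of_cong[OF L ae] by (simp add: l2_of_rep)
qed

end

section \<open>Square integrable functions of time\<close>

text \<open>Functions of time live on the whole line, so that translating them raises no question
  about end points; data on the time interval are set to zero outside it. Functions are kept rather
  than classes, because values at single times are used.\<close>

definition L2t :: "(real \<Rightarrow> 'x::{real_inner,banach,second_countable_topology}) \<Rightarrow> bool" where
  "L2t F \<longleftrightarrow> F \<in> borel_measurable borel \<and> integrable lborel (\<lambda>t. (norm (F t))\<^sup>2)"

definition sqn :: "(real \<Rightarrow> 'x::{real_inner,banach,second_countable_topology}) \<Rightarrow> real" where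
  "sqn F = (LINT t|lborel. (norm (F t))\<^sup>2)"

lemma L2t_measurable: "L2t F \<Longrightarrow> F \<in> borel_measurable borel"
  and L2t_integrable: "L2t F \<Longrightarrow> integrable lborel (\<lambda>t. (norm (F t))\<^sup>2)"
  by (simp_all add: L2t_def)

lemma sqn_nonneg: "0 \<le> sqn F"
  by (simp add: sqn_def)

lemma L2t_bound:
  assumes "L2t F" and [measurable]: "G \<in> borel_measurable borel"
    and le: "AE t in lborel. norm (G t) \<le> c * norm (F t)"
  shows "L2t G" "sqn G \<le> c\<^sup>2 * sqn F"
proof -
  have *: "integrable lborel (\<lambda>t. c\<^sup>2 * (norm (F t))\<^sup>2)" using assms(1) by (simp add: L2t_def)
  have ae: "AE t in lborel. (norm (G t))\<^sup>2 \<le> c\<^sup>2 * (norm (F t))\<^sup>2"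
    using le by eventually_elim (metis norm_ge_zero power_mono power_mult_distrib)
  show L: "L2t G" unfolding L2t_def
    by (rule conjI, measurable, rule Bochner_Integration.integrable_bound[OF *]) (use ae in auto)
  have "sqn G \<le> (LINT t|lborel. c\<^sup>2 * (norm (F t))\<^sup>2)" unfolding sqn_def
    by (rule integral_mono_AE[OF L2t_integrable[OF L] * ae])
  then show "sqn G \<le> c\<^sup>2 * sqn F" by (simp add: sqn_def)
qed

lemma L2t_add:
  assumes "L2t F" "L2t G"
  shows "L2t (\<lambda>t. F t + G t)" "sqn (\<lambda>t. F t + G t) \<le> 2 * sqn F + 2 * sqn G"
proof -
  have [measurable]: "F \<in> borel_measurable borel" "G \<in> borel_measurable borel"
    using assms by (auto simp: L2t_def)
  have i: "integrable lborel (\<lambda>x. (norm (F x))\<^sup>2)" "integrable lborel (\<lambda>x. (norm (G x))\<^sup>2)"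
    using assms by (auto simp: L2t_def)
  have *: "integrable lborel (\<lambda>x. 2 * (norm (F x))\<^sup>2 + 2 * (norm (G x))\<^sup>2)" using i by simp
  show L: "L2t (\<lambda>t. F t + G t)" unfolding L2t_def
    by (rule conjI, measurable, rule Bochner_Integration.integrable_bound[OF *]) (auto simp: norm_add_sq_le)
  have "sqn (\<lambda>t. F t + G t) \<le> (LINT t|lborel. 2 * (norm (F t))\<^sup>2 + 2 * (norm (G t))\<^sup>2)" unfolding sqn_def
    by (rule integral_mono[OF L2t_integrable[OF L] *]) (rule norm_add_sq_le)
  then show "sqn (\<lambda>t. F t + G t) \<le> 2 * sqn F + 2 * sqn G" using i by (simp add: sqn_def)
qed

lemma L2t_scale: "L2t F \<Longrightarrow> L2t (\<lambda>t. c *\<^sub>R F t)"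
  by (rule L2t_bound(1)[of F _ "\<bar>c\<bar>"]) (auto dest: L2t_measurable)

lemma L2t_uminus: "L2t F \<Longrightarrow> L2t (\<lambda>t. - F t)"
  using L2t_scale[of F "-1"] by simp

lemma sqn_uminus: "sqn (\<lambda>t. - F t) = sqn F"
  by (simp add: sqn_def)

lemma L2t_diff:
  assumes "L2t F" "L2t G"
  shows "L2t (\<lambda>t. F t - G t)" "sqn (\<lambda>t. F t - G t) \<le> 2 * sqn F + 2 * sqn G"
  using L2t_add[OF assms(1) L2t_uminus[OF assms(2)]] by (auto simp: sqn_uminus)

lemma L2t_indicator: "L2t F \<Longrightarrow> A \<in> sets borel \<Longrightarrow> L2t (\<lambda>t. indicator A t *\<^sub>R F t)"
  by (rule L2t_bound(1)[of F _ 1])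
     (auto dest: L2t_measurable simp: indicator_def intro!: borel_measurable_scaleR borel_measurable_indicator)

lemma L2t_inner:
  assumes "L2t F" "L2t G"
  shows "integrable lborel (\<lambda>t. F t \<bullet> G t)"
    and "\<bar>LINT t|lborel. F t \<bullet> G t\<bar> \<le> sqrt (sqn F) * sqrt (sqn G)"
    and "integrable lborel (\<lambda>t. norm (F t) * norm (G t))"
    and "(LINT t|lborel. norm (F t) * norm (G t)) \<le> sqrt (sqn F) * sqrt (sqn G)"
proof -
  have [measurable]: "F \<in> borel_measurable borel" "G \<in> borel_measurable borel"
    using assms by (auto simp: L2t_def)
  have i: "integrable lborel (\<lambda>x. (norm (F x))\<^sup>2)" "integrable lborel (\<lambda>x. (norm (G x))\<^sup>2)"
    using assms by (auto simp: L2t_def)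
  have *: "integrable lborel (\<lambda>x. (norm (F x))\<^sup>2 + (norm (G x))\<^sup>2)" using i by simp
  show 1: "integrable lborel (\<lambda>t. F t \<bullet> G t)"
    by (rule Bochner_Integration.integrable_bound[OF *]) (auto simp: abs_inner_le_sq)
  have le: "norm x * norm y \<le> (norm x)\<^sup>2 + (norm y)\<^sup>2" for x y :: 'a
  proof -
    have "0 \<le> (norm x - norm y)\<^sup>2" "0 \<le> norm x * norm y" by simp_all
    then show ?thesis unfolding power2_diff by linarith
  qed
  show 2: "integrable lborel (\<lambda>t. norm (F t) * norm (G t))"
    by (rule Bochner_Integration.integrable_bound[OF *]) (auto simp: le abs_mult)
  define I where "I = (LINT t|lborel. norm (F t) * norm (G t))"
  have I0: "0 \<le> I" unfolding I_def by (intro integral_nonneg_AE) auto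
  have "(\<integral>\<^sup>+t. ennreal (norm (F t)) * ennreal (norm (G t)) \<partial>lborel)\<^sup>2
      \<le> (\<integral>\<^sup>+t. (ennreal (norm (F t)))\<^sup>2 \<partial>lborel) * (\<integral>\<^sup>+t. (ennreal (norm (G t)))\<^sup>2 \<partial>lborel)"
    by (rule Cauchy_Schwarz_nn_integral) auto
  also have "(\<integral>\<^sup>+t. ennreal (norm (F t)) * ennreal (norm (G t)) \<partial>lborel) = ennreal I"
    unfolding I_def by (subst nn_integral_eq_integral[symmetric, OF 2]) (auto simp: ennreal_mult)
  also have "(\<integral>\<^sup>+t. (ennreal (norm (F t)))\<^sup>2 \<partial>lborel) = ennreal (sqn F)"
    unfolding sqn_def by (subst nn_integral_eq_integral[symmetric, OF i(1)]) (auto simp: ennreal_power)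
  also have "(\<integral>\<^sup>+t. (ennreal (norm (G t)))\<^sup>2 \<partial>lborel) = ennreal (sqn G)"
    unfolding sqn_def by (subst nn_integral_eq_integral[symmetric, OF i(2)]) (auto simp: ennreal_power)
  finally have "ennreal (I\<^sup>2) \<le> ennreal (sqn F * sqn G)"
    by (simp add: ennreal_power I0 ennreal_mult sqn_nonneg)
  then have "I\<^sup>2 \<le> sqn F * sqn G" by (simp add: sqn_nonneg)
  then have "sqrt (I\<^sup>2) \<le> sqrt (sqn F * sqn G)" by (rule real_sqrt_le_mono)
  then have IS: "I \<le> sqrt (sqn F) * sqrt (sqn G)" using I0 by (simp add: real_sqrt_mult)
  then show "(LINT t|lborel. norm (F t) * norm (G t)) \<le> sqrt (sqn F) * sqrt (sqn G)" by (simp add: I_def)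
  have "\<bar>LINT t|lborel. F t \<bullet> G t\<bar> \<le> (LINT t|lborel. \<bar>F t \<bullet> G t\<bar>)" by (rule integral_abs_bound)
  also have "\<dots> \<le> I" unfolding I_def by (rule integral_mono[OF _ 2]) (use 1 Cauchy_Schwarz_ineq2 in auto)
  finally show "\<bar>LINT t|lborel. F t \<bullet> G t\<bar> \<le> sqrt (sqn F) * sqrt (sqn G)" using IS by simp
qed

lemma L2t_set_integrable:
  assumes "L2t F"
  shows "set_integrable lborel {a..b} F"
proof -
  have [measurable]: "F \<in> borel_measurable borel" using assms by (simp add: L2t_def)
  have *: "integrable lborel (\<lambda>t. indicator {a..b} t + (norm (F t))\<^sup>2)"
    using assms by (intro Bochner_Integration.integrable_add integrable_real_indicator) (auto simp: L2t_def emeasure_lborel_Icc_eq)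
  have le: "x \<le> 1 + x\<^sup>2" for x :: real
  proof -
    have "0 \<le> (x - 1/2)\<^sup>2" by simp
    then show ?thesis by (simp add: power2_eq_square algebra_simps)
  qed
  show ?thesis unfolding set_integrable_def
    by (rule Bochner_Integration.integrable_bound[OF *]) (auto simp: indicator_def le)
qed

lemma L2t_set_integral_norm_le:
  assumes "L2t F" "a \<le> b"
  shows "(LINT t:{a..b}|lborel. norm (F t)) \<le> sqrt (b - a) * sqrt (sqn F)"
proof -
  have sq: "(\<lambda>t. (norm (indicator {a..b} t :: real))\<^sup>2) = (indicator {a..b} :: real \<Rightarrow> real)"
    by (auto simp: indicator_def)
  have L: "L2t (\<lambda>t. indicator {a..b} t :: real)"
    unfolding L2t_def sq by (auto intro!: integrable_real_indicator simp: emeasure_lborel_Icc_eq)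
  have S: "sqn (\<lambda>t. indicator {a..b} t :: real) = b - a"
    unfolding sqn_def sq using assms(2) by simp
  have n: "L2t (\<lambda>t. norm (F t))" "sqn (\<lambda>t. norm (F t)) = sqn F"
    using assms(1) by (auto simp: L2t_def sqn_def)
  show ?thesis
    using L2t_inner(4)[OF L n(1)] unfolding S n(2) set_lebesgue_integral_def
    by simp
qed

text \<open>The difference of the products is expanded around the limits into three integrals, each
  with a small factor, and each is bounded by Cauchy-Schwarz. It serves to let the step tend to zero
  in the difference quotients of the energy.\<close>

lemma tendsto_L2t_inner:
  assumes F: "L2t F" "\<And>h. L2t (Fh h)" "((\<lambda>h. sqn (\<lambda>t. Fh h t - F t)) \<longlongrightarrow> 0) net"
    and G: "L2t G" "\<And>h. L2t (Gh h)" "((\<lambda>h. sqn (\<lambda>t. Gh h t - G t)) \<longlongrightarrow> 0) net"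
    and A: "A \<in> sets borel"
  shows "((\<lambda>h. LINT t:A|lborel. Fh h t \<bullet> Gh h t) \<longlongrightarrow> (LINT t:A|lborel. F t \<bullet> G t)) net"
proof -
  define ind where "ind H = (\<lambda>t. indicator A t *\<^sub>R H t)" for H :: "real \<Rightarrow> 'a"
  have ind: "L2t (ind H)" "sqn (ind H) \<le> sqn H" if "L2t H" for H
    using L2t_bound[of H "ind H" 1] L2t_indicator[OF that A] that
    by (auto simp: ind_def indicator_def dest: L2t_measurable)
  have D: "L2t (\<lambda>t. Fh h t - F t)" "L2t (\<lambda>t. Gh h t - G t)" for h
    using F G L2t_diff by blast+
  have eq: "(LINT t:A|lborel. Fh h t \<bullet> Gh h t) - (LINT t:A|lborel. F t \<bullet> G t) =
     (LINT t|lborel. ind (\<lambda>t. Fh h t - F t) t \<bullet> (Gh h t - G t))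
     + (LINT t|lborel. ind (\<lambda>t. Fh h t - F t) t \<bullet> G t) + (LINT t|lborel. ind F t \<bullet> (Gh h t - G t))" for h
  proof -
    have i: "integrable lborel (\<lambda>t. ind (Fh h) t \<bullet> Gh h t)" "integrable lborel (\<lambda>t. ind F t \<bullet> G t)"
      using F G ind by (auto intro!: L2t_inner)
    have j: "integrable lborel (\<lambda>t. ind (\<lambda>t. Fh h t - F t) t \<bullet> (Gh h t - G t))"
      "integrable lborel (\<lambda>t. ind (\<lambda>t. Fh h t - F t) t \<bullet> G t)"
      "integrable lborel (\<lambda>t. ind F t \<bullet> (Gh h t - G t))"
      using F G ind D by (auto intro!: L2t_inner)
    have "(LINT t:A|lborel. Fh h t \<bullet> Gh h t) - (LINT t:A|lborel. F t \<bullet> G t) =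
      (LINT t|lborel. ind (Fh h) t \<bullet> Gh h t) - (LINT t|lborel. ind F t \<bullet> G t)"
      by (simp add: set_lebesgue_integral_def ind_def)
    also have "\<dots> = (LINT t|lborel. ind (Fh h) t \<bullet> Gh h t - ind F t \<bullet> G t)"
      using i by simp
    also have "\<dots> = (LINT t|lborel. (ind (\<lambda>t. Fh h t - F t) t \<bullet> (Gh h t - G t)
      + ind (\<lambda>t. Fh h t - F t) t \<bullet> G t) + ind F t \<bullet> (Gh h t - G t))"
      by (rule Bochner_Integration.integral_cong) (auto simp: ind_def inner_simps algebra_simps)
    also have "\<dots> = (LINT t|lborel. ind (\<lambda>t. Fh h t - F t) t \<bullet> (Gh h t - G t)
      + ind (\<lambda>t. Fh h t - F t) t \<bullet> G t) + (LINT t|lborel. ind F t \<bullet> (Gh h t - G t))"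
      by (rule Bochner_Integration.integral_add[OF Bochner_Integration.integrable_add[OF j(1,2)] j(3)])
    finally show ?thesis by (simp only: Bochner_Integration.integral_add[OF j(1,2)])
  qed
  define a where "a h = sqrt (sqn (\<lambda>t. Fh h t - F t))" for h
  define b where "b h = sqrt (sqn (\<lambda>t. Gh h t - G t))" for h
  have ab: "(a \<longlongrightarrow> 0) net" "(b \<longlongrightarrow> 0) net"
    unfolding a_def b_def using tendsto_real_sqrt[OF F(3)] tendsto_real_sqrt[OF G(3)] by auto
  have bd: "norm ((LINT t:A|lborel. Fh h t \<bullet> Gh h t) - (LINT t:A|lborel. F t \<bullet> G t))
      \<le> a h * b h + a h * sqrt (sqn G) + sqrt (sqn F) * b h" for h
  proof -
    have cs: "\<bar>LINT t|lborel. ind X t \<bullet> Y t\<bar> \<le> sqrt (sqn X) * sqrt (sqn Y)" if "L2t X" "L2t Y" for X Y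
    proof -
      have "\<bar>LINT t|lborel. ind X t \<bullet> Y t\<bar> \<le> sqrt (sqn (ind X)) * sqrt (sqn Y)"
        by (rule L2t_inner(2)[OF ind(1)[OF that(1)] that(2)])
      also have "\<dots> \<le> sqrt (sqn X) * sqrt (sqn Y)"
        using ind(2)[OF that(1)] by (intro mult_right_mono real_sqrt_le_mono) (auto simp: sqn_nonneg)
      finally show ?thesis .
    qed
    show ?thesis
      unfolding eq real_norm_def a_def b_def
      using cs[OF D(1)[of h] D(2)[of h]] cs[OF D(1)[of h] G(1)] cs[OF F(1) D(2)[of h]] by linarith
  qed
  have "((\<lambda>h. a h * b h + a h * sqrt (sqn G) + sqrt (sqn F) * b h) \<longlongrightarrow> 0 * 0 + 0 * sqrt (sqn G) + sqrt (sqn F) * 0) net"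
    by (intro tendsto_intros ab)
  then have "((\<lambda>h. (LINT t:A|lborel. Fh h t \<bullet> Gh h t) - (LINT t:A|lborel. F t \<bullet> G t)) \<longlongrightarrow> 0) net"
    using Lim_null_comparison[OF always_eventually[OF allI[OF bd]]] by simp
  then show ?thesis by (simp add: LIM_zero_iff)
qed

subsection \<open>Continuity of translations\<close>

lemma integral_translate:
  fixes f :: "real \<Rightarrow> 'x::{banach,second_countable_topology}"
  shows "(LINT t|lborel. f (t + h)) = (LINT t|lborel. f t)"
  using lborel_integral_real_affine[of 1 f h] by (simp add: add.commute)

lemma integrable_translate:
  fixes f :: "real \<Rightarrow> 'x::{banach,second_countable_topology}"
  shows "integrable lborel (\<lambda>t. f (t + h)) \<longleftrightarrow> integrable lborel f"
  using lborel_integrable_real_affine_iff[of 1 f h] by (simp add: add.commute)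

lemma L2t_translate: "L2t F \<Longrightarrow> L2t (\<lambda>t. F (t + h))" and sqn_translate: "sqn (\<lambda>t. F (t + h)) = sqn F"
  using integrable_translate[of "\<lambda>t. (norm (F t))\<^sup>2" h] integral_translate[of "\<lambda>t. (norm (F t))\<^sup>2" h]
  by (auto simp: L2t_def sqn_def)

text \<open>Between a compact \<open>K\<close> inside \<open>A\<close> and an open \<open>U\<close>
  around \<open>A\<close> there is a positive distance \<open>d\<close>. For a shift shorter than
  \<open>d\<close>, the indicators can differ at \<open>t\<close> only if \<open>t\<close> or
  \<open>t + h\<close> lies in \<open>U - K\<close>, which has small measure.\<close>

lemma indicator_translate_tendsto:
  fixes A :: "real set"
  assumes A: "A \<in> sets borel" "bounded A"
  shows "((\<lambda>h. LINT t|lborel. \<bar>indicator A (t + h) - indicator A t :: real\<bar>) \<longlongrightarrow> 0) (at 0)"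
proof (rule tendstoI)
  fix e :: real assume e: "e > 0"
  have Al: "A \<in> sets lebesgue" using A(1) by simp
  have e4: "e/4 > 0" using e by simp
  obtain U where U: "open U" "A \<subseteq> U" "(U - A) \<in> lmeasurable" "emeasure lebesgue (U - A) < ennreal (e/4)"
    by (rule sets_lebesgue_outer_open[OF Al e4])
  obtain K where K: "closed K" "K \<subseteq> A" "(A - K) \<in> lmeasurable" "emeasure lebesgue (A - K) < ennreal (e/4)"
    by (rule sets_lebesgue_inner_closed[OF Al e4])
  have "compact K" using K(1,2) A(2) bounded_subset compact_eq_bounded_closed by blast
  moreover have "closed (- U)" "K \<inter> - U = {}" using U K by auto
  ultimately obtain d where d: "d > 0" "\<forall>x\<in>K. \<forall>y\<in>- U. d \<le> dist x y"
    using separate_compact_closed by blast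
  define V where "V = U - K"
  have Vb: "V \<in> sets borel" using U(1) K(1) by (simp add: V_def)
  have V_eq: "V = (U - A) \<union> (A - K)" using U(2) K(2) by (auto simp: V_def)
  have "emeasure lborel V \<le> emeasure lebesgue (U - A) + emeasure lebesgue (A - K)"
    using emeasure_subadditive[OF fmeasurableD[OF U(3)] fmeasurableD[OF K(3)]] Vb by (simp add: V_eq)
  also have "\<dots> < ennreal (e/4 + e/4)" by (rule add_mono_ennreal[OF U(4) K(4)])
  also have "e/4 + e/4 = e/2" by simp
  finally have Ve: "emeasure lborel V < ennreal (e/2)" .
  then have Vfin: "emeasure lborel V < \<infinity>" using order.strict_trans ennreal_less_top by (metis infinity_ennreal_def)
  then have VI: "integrable lborel (indicator V :: real \<Rightarrow> real)" using Vb by simp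
  have Vm: "(LINT t|lborel. indicator V t :: real) < e/2"
  proof -
    have "ennreal (measure lborel V) < ennreal (e/2)"
      using Ve emeasure_eq_ennreal_measure[of lborel V] Vfin by (simp add: top.not_eq_extremum)
    then show ?thesis using Vb by (simp add: ennreal_less_iff)
  qed
  have "dist (LINT t|lborel. \<bar>indicator A (t + h) - indicator A t :: real\<bar>) 0 < e" if h: "dist h 0 < d" for h
  proof -
    have pt: "\<bar>indicator A (t + h) - indicator A t :: real\<bar> \<le> indicator V t + indicator V (t + h)" for t
    proof -
      have 1: "t \<in> K \<Longrightarrow> t + h \<in> U" using d(2) h by (force simp: dist_real_def)
      have 2: "t + h \<in> K \<Longrightarrow> t \<in> U" using d(2) h by (force simp: dist_real_def)
      show ?thesis using 1 2 U(2) K(2) by (auto simp: V_def indicator_def)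
    qed
    have VI': "integrable lborel (\<lambda>t. indicator V (t + h) :: real)"
      using VI integrable_translate[of "indicator V :: real \<Rightarrow> real" h] by simp
    have "(LINT t|lborel. \<bar>indicator A (t + h) - indicator A t :: real\<bar>)
        \<le> (LINT t|lborel. indicator V t + indicator V (t + h))"
    proof (rule integral_mono)
      show "integrable lborel (\<lambda>t. \<bar>indicator A (t + h) - indicator A t :: real\<bar>)"
        by (rule Bochner_Integration.integrable_bound[OF Bochner_Integration.integrable_add[OF VI VI']])
           (use pt A(1) in \<open>auto intro!: borel_measurable_abs borel_measurable_diff order_trans[OF pt]\<close>)
      show "integrable lborel (\<lambda>t. indicator V t + indicator V (t + h) :: real)" using VI VI' by simp
    qed (rule pt)
    also have "\<dots> = (LINT t|lborel. indicator V t) + (LINT t|lborel. indicator V t)"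
      using VI VI' integral_translate[of "indicator V :: real \<Rightarrow> real" h] by simp
    also have "\<dots> < e" using Vm by linarith
    finally show ?thesis by (simp add: dist_real_def)
  qed
  then show "\<forall>\<^sub>F h in at 0. dist (LINT t|lborel. \<bar>indicator A (t + h) - indicator A t :: real\<bar>) 0 < e"
    using d(1) unfolding eventually_at by blast
qed

text \<open>The pointwise bound by \<open>2 * norm (F t)\<close> yields the majorant for dominated
  convergence and makes \<open>s\<close> vanish wherever \<open>F\<close> does, so that bounded
  support is inherited.\<close>

lemma L2t_simple_approx:
  assumes "L2t F" "e > 0"
  obtains s where "simple_function lborel s" "L2t s" "sqn (\<lambda>t. s t - F t) < e"
    "\<And>t. norm (s t) \<le> 2 * norm (F t)"
proof -
  have F[measurable]: "F \<in> borel_measurable borel" using assms(1) by (simp add: L2t_def)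
  have "F \<in> borel_measurable lborel" by simp
  from borel_measurable_implies_sequence_metric[OF this, of 0]
  obtain s where s: "\<And>i. simple_function lborel (s i)" "\<And>t. (\<lambda>i. s i t) \<longlonglongrightarrow> F t"
    "\<And>i t. norm (s i t) \<le> 2 * norm (F t)" by (auto simp: dist_norm)
  have [measurable]: "s i \<in> borel_measurable borel" for i
    using borel_measurable_simple_function[OF s(1)] by simp
  have Ls: "L2t (s i)" for i by (rule L2t_bound(1)[OF assms(1), of _ 2]) (auto simp: s)
  have "(\<lambda>i. sqn (\<lambda>t. s i t - F t)) \<longlonglongrightarrow> (LINT t|(lborel :: real measure). 0)"
    unfolding sqn_def
  proof (rule integral_dominated_convergence[of "\<lambda>t. 0" lborel "\<lambda>i t. (norm (s i t - F t))\<^sup>2" "\<lambda>t. 9 * (norm (F t))\<^sup>2"])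
    show "integrable lborel (\<lambda>t. 9 * (norm (F t))\<^sup>2)" using assms(1) by (simp add: L2t_def)
    show "AE t in lborel. (\<lambda>i. (norm (s i t - F t))\<^sup>2) \<longlonglongrightarrow> 0"
      using s(2) by (auto intro!: AE_I2 tendsto_eq_intros LIM_zero tendsto_norm_zero)
    have "(norm (s i t - F t))\<^sup>2 \<le> 9 * (norm (F t))\<^sup>2" for i t
    proof -
      have "norm (s i t - F t) \<le> 3 * norm (F t)"
        using norm_triangle_ineq4[of "s i t" "F t"] s(3)[of i t] by linarith
      then have "(norm (s i t - F t))\<^sup>2 \<le> (3 * norm (F t))\<^sup>2" by (rule power_mono) simp
      then show ?thesis by (simp add: power_mult_distrib)
    qed
    then show "\<And>i. AE t in lborel. norm ((norm (s i t - F t))\<^sup>2) \<le> 9 * (norm (F t))\<^sup>2" by simp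
  qed auto
  then have "eventually (\<lambda>i. sqn (\<lambda>t. s i t - F t) < e) sequentially"
    using assms(2) by (simp add: order_tendsto_iff)
  then obtain i where "sqn (\<lambda>t. s i t - F t) < e" by (auto simp: eventually_sequentially)
  then show thesis using that s Ls by blast
qed

text \<open>A simple function is a finite combination of indicators of bounded sets, so the case of
  indicators suffices. Differences of indicators have values 0, 1 and -1, so their squares are their
  absolute values; the factor \<open>C\<close> is the number of terms in a squared sum.\<close>

lemma simple_translate_tendsto:
  fixes s :: "real \<Rightarrow> 'x::{real_inner,banach,second_countable_topology}"
  assumes s: "simple_function lborel s" "L2t s" and supp: "\<And>t. t \<notin> {-R..R} \<Longrightarrow> s t = 0"
  shows "((\<lambda>h. sqn (\<lambda>t. s (t + h) - s t)) \<longlongrightarrow> 0) (at 0)"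
proof -
  define Y where "Y = range s - {0}"
  have finY: "finite Y" using simple_functionD(1)[OF s(1)] by (simp add: Y_def)
  define A where "A y = s -` {y}" for y
  have A: "A y \<in> sets borel" for y using simple_functionD(2)[OF s(1), of "{y}"] by (simp add: A_def)
  have bA: "bounded (A y)" if "y \<in> Y" for y
  proof (rule bounded_subset[of "{-R..R}"])
    show "A y \<subseteq> {-R..R}" using that supp by (force simp: A_def Y_def)
  qed simp
  have s_eq: "s t = (\<Sum>y\<in>Y. indicator (A y) t *\<^sub>R y)" for t
  proof (cases "s t = 0")
    case True
    then show ?thesis by (auto simp: A_def Y_def intro!: sum.neutral)
  next
    case False
    then have "(\<Sum>y\<in>Y. indicator (A y) t *\<^sub>R y) = (\<Sum>y\<in>{s t}. indicator (A y) t *\<^sub>R y)"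
      by (intro sum.mono_neutral_right finY) (auto simp: Y_def A_def)
    then show ?thesis by (simp add: A_def)
  qed
  define C where "C = real (card Y)"
  have pt: "(norm (s (t + h) - s t))\<^sup>2 \<le> (\<Sum>y\<in>Y. C * (norm y)\<^sup>2 * \<bar>indicator (A y) (t + h) - indicator (A y) t\<bar>)" for t h
  proof -
    define c where "c y = (indicator (A y) (t + h) - indicator (A y) t :: real)" for y
    have "s (t + h) - s t = (\<Sum>y\<in>Y. c y *\<^sub>R y)"
      by (simp add: s_eq c_def sum_subtractf scaleR_diff_left)
    then have "norm (s (t + h) - s t) \<le> (\<Sum>y\<in>Y. norm (c y *\<^sub>R y))" by (simp only: norm_sum)
    then have "(norm (s (t + h) - s t))\<^sup>2 \<le> (\<Sum>y\<in>Y. norm (c y *\<^sub>R y))\<^sup>2" by (rule power_mono) simp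
    also have "\<dots> \<le> C * (\<Sum>y\<in>Y. (norm (c y *\<^sub>R y))\<^sup>2)"
      unfolding C_def using sum_squared_le_sum_of_squares[of "\<lambda>y. norm (c y *\<^sub>R y)" Y] by (simp add: mult.commute)
    also have "\<dots> = (\<Sum>y\<in>Y. C * (norm y)\<^sup>2 * \<bar>c y\<bar>)"
      unfolding sum_distrib_left by (rule sum.cong) (auto simp: c_def indicator_def power_mult_distrib)
    finally show ?thesis by (simp add: c_def)
  qed
  have ii: "integrable lborel (\<lambda>t. \<bar>indicator (A y) (t + h) - indicator (A y) t :: real\<bar>)" if "y \<in> Y" for y h
  proof -
    have "emeasure lborel (A y) < \<infinity>" using bA[OF that] by (rule emeasure_bounded_finite)
    then have "integrable lborel (indicator (A y) :: real \<Rightarrow> real)" using A by simp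
    then show ?thesis using integrable_translate[of "indicator (A y) :: real \<Rightarrow> real" h] by simp
  qed
  have bd: "norm (sqn (\<lambda>t. s (t + h) - s t)) \<le>
     (\<Sum>y\<in>Y. C * (norm y)\<^sup>2 * (LINT t|lborel. \<bar>indicator (A y) (t + h) - indicator (A y) t\<bar>))" for h
  proof -
    have "sqn (\<lambda>t. s (t + h) - s t) \<le> (LINT t|lborel. (\<Sum>y\<in>Y. C * (norm y)\<^sup>2 * \<bar>indicator (A y) (t + h) - indicator (A y) t\<bar>))"
      unfolding sqn_def
    proof (rule integral_mono)
      show "integrable lborel (\<lambda>t. (norm (s (t + h) - s t))\<^sup>2)"
        by (intro L2t_integrable L2t_diff L2t_translate s)
    qed (use ii pt in auto)
    then show ?thesis using ii by (simp add: sqn_nonneg)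
  qed
  have "((\<lambda>h. \<Sum>y\<in>Y. C * (norm y)\<^sup>2 * (LINT t|lborel. \<bar>indicator (A y) (t + h) - indicator (A y) t\<bar>)) \<longlongrightarrow> (\<Sum>y\<in>Y. C * (norm y)\<^sup>2 * 0)) (at 0)"
    by (intro tendsto_intros indicator_translate_tendsto A bA)
  then show ?thesis using Lim_null_comparison[OF always_eventually[OF allI[OF bd]]] by simp
qed

lemma translate_tendsto:
  fixes F :: "real \<Rightarrow> 'x::{real_inner,banach,second_countable_topology}"
  assumes F: "L2t F" and supp: "\<And>t. t \<notin> {-R..R} \<Longrightarrow> F t = 0"
  shows "((\<lambda>h. sqn (\<lambda>t. F (t + h) - F t)) \<longlongrightarrow> 0) (at 0)"
proof (rule tendstoI)
  fix e :: real assume e: "e > 0"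
  \<comment> \<open>The error \<open>D\<close> of the approximation enters as
    \<open>2 * (2 * sqn D + 2 * sqn D)\<close>, so e/16 leaves e/2 for it; the other half comes from
    the translate of \<open>s\<close>.\<close>
  obtain s where s: "simple_function lborel s" "L2t s" "sqn (\<lambda>t. s t - F t) < e/16"
    "\<And>t. norm (s t) \<le> 2 * norm (F t)"
    using L2t_simple_approx[OF F, of "e/16"] e by auto
  have "((\<lambda>h. sqn (\<lambda>t. s (t + h) - s t)) \<longlongrightarrow> 0) (at 0)"
  proof (rule simple_translate_tendsto[OF s(1,2), of R])
    show "s t = 0" if "t \<notin> {-R..R}" for t using supp[OF that] s(4)[of t] by simp
  qed
  then have "\<forall>\<^sub>F h in at 0. sqn (\<lambda>t. s (t + h) - s t) < e/4" using e by (intro order_tendstoD(2)) auto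
  then show "\<forall>\<^sub>F h in at 0. dist (sqn (\<lambda>t. F (t + h) - F t)) 0 < e"
  proof eventually_elim
    case (elim h)
    define D where "D t = s t - F t" for t
    have D: "L2t D" unfolding D_def by (intro L2t_diff s F)
    have "sqn (\<lambda>t. F (t + h) - F t) = sqn (\<lambda>t. (s (t + h) - s t) - (D (t + h) - D t))"
      by (rule arg_cong[of _ _ sqn]) (auto simp: D_def algebra_simps)
    also have "\<dots> \<le> 2 * sqn (\<lambda>t. s (t + h) - s t) + 2 * sqn (\<lambda>t. D (t + h) - D t)"
      by (intro L2t_diff L2t_translate s D)
    also have "sqn (\<lambda>t. D (t + h) - D t) \<le> 2 * sqn D + 2 * sqn D"
      using L2t_diff(2)[OF L2t_translate[OF D, of h] D] by (simp add: sqn_translate)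
    finally have "sqn (\<lambda>t. F (t + h) - F t) < e" using elim s(3) by (simp add: D_def[abs_def])
    then show ?case by (simp add: sqn_nonneg)
  qed
qed

subsection \<open>Interval integrals and Steklov averages\<close>

lemma set_integral_combine_Icc:
  fixes F :: "real \<Rightarrow> 'x::{banach,second_countable_topology}"
  assumes "a \<le> b" "b \<le> c" "set_integrable lborel {a..c} F"
  shows "(LINT s:{a..c}|lborel. F s) = (LINT s:{a..b}|lborel. F s) + (LINT s:{b..c}|lborel. F s)"
proof -
  have "{a..c} = {a..b} \<union> {b..c}" using assms by auto
  moreover have "AE s in lborel. \<not> (s \<in> {a..b} \<and> s \<in> {b..c})"
    using AE_lborel_singleton[of b] by eventually_elim auto
  ultimately show ?thesis
    using set_integral_Un_AE[of "{a..b}" "{b..c}" lborel F]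
      set_integrable_subset[OF assms(3), of "{a..b}"] set_integrable_subset[OF assms(3), of "{b..c}"] assms(1,2)
    by auto
qed

lemma set_integral_translate:
  fixes F :: "real \<Rightarrow> 'x::{banach,second_countable_topology}"
  shows "(LINT s:{a..b}|lborel. F (s + h)) = (LINT s:{a+h..b+h}|lborel. F s)"
proof -
  have "(LINT s:{a+h..b+h}|lborel. F s) = (LINT s|lborel. indicator {a+h..b+h} (s + h) *\<^sub>R F (s + h))"
    unfolding set_lebesgue_integral_def by (rule integral_translate[symmetric])
  also have "\<dots> = (LINT s:{a..b}|lborel. F (s + h))"
    unfolding set_lebesgue_integral_def by (rule Bochner_Integration.integral_cong) (auto simp: indicator_def)
  finally show ?thesis by simp
qed

lemma set_integrable_translate:
  fixes F :: "real \<Rightarrow> 'x::{banach,second_countable_topology}"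
  shows "set_integrable lborel {a..b} (\<lambda>s. F (s + h)) \<longleftrightarrow> set_integrable lborel {a+h..b+h} F"
proof -
  have "(\<lambda>s. indicator {a..b} s *\<^sub>R F (s + h)) = (\<lambda>s. indicator {a+h..b+h} (s + h) *\<^sub>R F (s + h))"
    by (auto simp: indicator_def)
  then show ?thesis
    unfolding set_integrable_def
    using integrable_translate[of "\<lambda>s. indicator {a+h..b+h} s *\<^sub>R F s" h] by simp
qed

text \<open>The integral from \<open>s\<close> to \<open>t + h\<close> is split once at
  \<open>t\<close> and once at \<open>s + h\<close>; the two windows may overlap. This is how an
  average over a moving window acquires a difference quotient as its time derivative.\<close>

lemma set_integral_shift_diff:
  fixes F :: "real \<Rightarrow> 'x::{banach,second_countable_topology}"
  assumes "s \<le> t" "0 \<le> h" "set_integrable lborel {s..t+h} F"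
  shows "(LINT \<tau>:{t..t+h}|lborel. F \<tau>) - (LINT \<tau>:{s..s+h}|lborel. F \<tau>) = (LINT \<tau>:{s..t}|lborel. F (\<tau> + h) - F \<tau>)"
proof -
  have sub: "set_integrable lborel {a..b} F" if "s \<le> a" "b \<le> t + h" for a b
    by (rule set_integrable_subset[OF assms(3)]) (use that in auto)
  let ?A = "LINT \<tau>:{s..t}|lborel. F \<tau>" and ?B = "LINT \<tau>:{t..t+h}|lborel. F \<tau>"
    and ?C = "LINT \<tau>:{s..s+h}|lborel. F \<tau>" and ?D = "LINT \<tau>:{s+h..t+h}|lborel. F \<tau>"
  have "(LINT \<tau>:{s..t+h}|lborel. F \<tau>) = ?A + ?B"
    by (rule set_integral_combine_Icc) (use assms in auto)
  moreover have "(LINT \<tau>:{s..t+h}|lborel. F \<tau>) = ?C + ?D"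
    by (rule set_integral_combine_Icc) (use assms in auto)
  ultimately have eq: "?A + ?B = ?C + ?D" by simp
  have "?B - ?C = (?A + ?B) - ?C - ?A" by simp
  also have "\<dots> = ?D - ?A" unfolding eq by simp
  finally have "?B - ?C = ?D - ?A" .
  moreover have "(LINT \<tau>:{s..t}|lborel. F (\<tau> + h) - F \<tau>) = ?D - ?A"
    using assms sub by (subst set_integral_diff(2)) (auto simp: set_integrable_translate set_integral_translate)
  ultimately show ?thesis by simp
qed

text \<open>The Steklov average. Its window starts at \<open>t\<close>, so near the final time it
  needs values from beyond; the reflected evolution provides them.\<close>

definition stek :: "real \<Rightarrow> (real \<Rightarrow> 'x::{banach,second_countable_topology}) \<Rightarrow> real \<Rightarrow> 'x" where
  "stek h F t = (1/h) *\<^sub>R (LINT s:{t..t+h}|lborel. F s)"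

lemma stek_alt: "stek h F t = (1/h) *\<^sub>R (LINT s:{0..h}|lborel. F (t + s))"
  using set_integral_translate[of 0 h F t] by (simp add: stek_def add.commute)

lemma stek_measurable:
  assumes [measurable]: "F \<in> borel_measurable borel"
  shows "stek h F \<in> borel_measurable borel"
  unfolding stek_alt[abs_def] set_lebesgue_integral_def by measurable

lemma average_norm_sq_le:
  fixes g :: "real \<Rightarrow> 'x::{real_inner,banach,second_countable_topology}"
  assumes g: "L2t g" and h: "h > 0"
  shows "(norm ((1/h) *\<^sub>R (LINT s:{0..h}|lborel. g s)))\<^sup>2 \<le> (1/h) * (LINT s:{0..h}|lborel. (norm (g s))\<^sup>2)"
proof -
  define k where "k = (\<lambda>s. indicator {0..h} s *\<^sub>R g s)"
  have k: "L2t k" unfolding k_def by (rule L2t_indicator[OF g]) simp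
  have sk: "sqn k = (LINT s:{0..h}|lborel. (norm (g s))\<^sup>2)"
    unfolding sqn_def set_lebesgue_integral_def k_def
    by (rule Bochner_Integration.integral_cong) (auto simp: indicator_def)
  have "norm (LINT s:{0..h}|lborel. g s) \<le> (LINT s:{0..h}|lborel. norm (g s))"
    by (rule set_integral_norm_bound[OF L2t_set_integrable[OF g]])
  also have "\<dots> = (LINT s:{0..h}|lborel. norm (k s))"
    unfolding set_lebesgue_integral_def k_def
    by (rule Bochner_Integration.integral_cong) (auto simp: indicator_def)
  also have "\<dots> \<le> sqrt h * sqrt (sqn k)" using L2t_set_integral_norm_le[OF k, of 0 h] h by simp
  finally have "(norm (LINT s:{0..h}|lborel. g s))\<^sup>2 \<le> (sqrt h * sqrt (sqn k))\<^sup>2"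
    by (rule power_mono) simp
  also have "\<dots> = h * sqn k" using h by (simp add: power_mult_distrib sqn_nonneg)
  finally have "(1/h)\<^sup>2 * (norm (LINT s:{0..h}|lborel. g s))\<^sup>2 \<le> (1/h)\<^sup>2 * (h * sqn k)"
    by (rule mult_left_mono) simp
  also have "\<dots> = (1/h) * sqn k" using h by (simp add: power2_eq_square)
  finally show ?thesis using h by (simp add: sk power_mult_distrib power_divide)
qed

text \<open>By Jensen's inequality, the squared error at \<open>t\<close> is at most the mean over
  \<open>s\<close> between 0 and \<open>h\<close> of the squared translation error at
  \<open>t\<close>. Integrating over \<open>t\<close> and exchanging the integrals bounds it by the
  worst translation error.\<close>

lemma stek_bound:
  fixes F :: "real \<Rightarrow> 'x::{real_inner,banach,second_countable_topology}"
  assumes F: "L2t F" and h: "h > 0" and c: "\<And>s. 0 \<le> s \<Longrightarrow> s \<le> h \<Longrightarrow> sqn (\<lambda>t. F (t + s) - F t) \<le> c"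
  shows "L2t (\<lambda>t. stek h F t - F t) \<and> sqn (\<lambda>t. stek h F t - F t) \<le> c"
proof -
  have [measurable]: "F \<in> borel_measurable borel" using F by (simp add: L2t_def)
  note [measurable] = stek_measurable[of F h]
  have c0: "0 \<le> c" using order_trans[OF sqn_nonneg c[of 0]] h by simp
  have pt: "ennreal ((norm (stek h F t - F t))\<^sup>2) \<le> ennreal (1/h) * (\<integral>\<^sup>+s. indicator {0..h} s * ennreal ((norm (F (t + s) - F t))\<^sup>2) \<partial>lborel)" for t
  proof -
    define g where "g s = indicator {0..h} s *\<^sub>R (F (t + s) - F t)" for s
    have Fs: "L2t (\<lambda>s. F (t + s))" using L2t_translate[OF F, of t] by (simp add: add.commute)
    \<comment> \<open>As a function of \<open>s\<close>, the constant value \<open>F t\<close> is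
      square integrable only after being cut off to the window.\<close>
    have const: "L2t (\<lambda>s. indicator {0..h} s *\<^sub>R F t)"
      unfolding L2t_def
    proof
      have "(\<lambda>s. (norm (indicator {0..h} s *\<^sub>R F t))\<^sup>2) = (\<lambda>s. (norm (F t))\<^sup>2 * indicator {0..h} s)"
        by (auto simp: indicator_def)
      then show "integrable lborel (\<lambda>s. (norm (indicator {0..h} s *\<^sub>R F t))\<^sup>2)"
        by (simp add: emeasure_lborel_Icc_eq)
    qed measurable
    have g: "L2t g"
      unfolding g_def scaleR_diff_right by (intro L2t_diff L2t_indicator Fs const) simp
    have "stek h F t - F t = (1/h) *\<^sub>R (LINT s:{0..h}|lborel. g s)"
    proof -
      have "(LINT s:{0..h}|lborel. g s) = (LINT s:{0..h}|lborel. F (t + s) - indicator {0..h} s *\<^sub>R F t)"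
        unfolding set_lebesgue_integral_def g_def
        by (rule Bochner_Integration.integral_cong) (auto simp: indicator_def)
      also have "\<dots> = (LINT s:{0..h}|lborel. F (t + s)) - (LINT s:{0..h}|lborel. indicator {0..h} s *\<^sub>R F t)"
        by (intro set_integral_diff L2t_set_integrable Fs const)
      also have "(LINT s:{0..h}|lborel. indicator {0..h} s *\<^sub>R F t) = h *\<^sub>R F t"
      proof -
        have "(LINT s:{0..h}|lborel. indicator {0..h} s *\<^sub>R F t) = (LINT s|lborel. indicator {0..h} s *\<^sub>R F t)"
          unfolding set_lebesgue_integral_def
          by (rule Bochner_Integration.integral_cong) (auto simp: indicator_def)
        also have "\<dots> = h *\<^sub>R F t"
          using h by (subst integral_scaleR_left) (auto simp: emeasure_lborel_Icc_eq)
        finally show ?thesis .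
      qed
      finally show ?thesis using h by (simp add: stek_alt scaleR_diff_right)
    qed
    then have "(norm (stek h F t - F t))\<^sup>2 \<le> (1/h) * (LINT s:{0..h}|lborel. (norm (g s))\<^sup>2)"
      using average_norm_sq_le[OF g h] by simp
    also have "(LINT s:{0..h}|lborel. (norm (g s))\<^sup>2) = (LINT s|lborel. indicator {0..h} s * (norm (F (t + s) - F t))\<^sup>2)"
      unfolding set_lebesgue_integral_def g_def
      by (rule Bochner_Integration.integral_cong) (auto simp: indicator_def)
    finally have "ennreal ((norm (stek h F t - F t))\<^sup>2) \<le> ennreal ((1/h) * (LINT s|lborel. indicator {0..h} s * (norm (F (t + s) - F t))\<^sup>2))"
      by (rule ennreal_leI)
    also have "\<dots> = ennreal (1/h) * ennreal (LINT s|lborel. indicator {0..h} s * (norm (F (t + s) - F t))\<^sup>2)"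
      using h by (intro ennreal_mult integral_nonneg_AE) auto
    also have "ennreal (LINT s|lborel. indicator {0..h} s * (norm (F (t + s) - F t))\<^sup>2)
        = (\<integral>\<^sup>+s. ennreal (indicator {0..h} s * (norm (F (t + s) - F t))\<^sup>2) \<partial>lborel)"
    proof (rule nn_integral_eq_integral[symmetric])
      have "(\<lambda>s. indicator {0..h} s * (norm (F (t + s) - F t))\<^sup>2) = (\<lambda>s. (norm (g s))\<^sup>2)"
        by (auto simp: g_def indicator_def)
      then show "integrable lborel (\<lambda>s. indicator {0..h} s * (norm (F (t + s) - F t))\<^sup>2)"
        using L2t_integrable[OF g] by simp
    qed auto
    also have "\<dots> = (\<integral>\<^sup>+s. indicator {0..h} s * ennreal ((norm (F (t + s) - F t))\<^sup>2) \<partial>lborel)"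
      by (rule nn_integral_cong) (auto simp: indicator_def)
    finally show ?thesis .
  qed
  have "(\<integral>\<^sup>+t. ennreal ((norm (stek h F t - F t))\<^sup>2) \<partial>lborel)
    \<le> (\<integral>\<^sup>+t. ennreal (1/h) * (\<integral>\<^sup>+s. indicator {0..h} s * ennreal ((norm (F (t + s) - F t))\<^sup>2) \<partial>lborel) \<partial>lborel)"
    by (rule nn_integral_mono) (rule pt)
  also have "\<dots> = ennreal (1/h) * (\<integral>\<^sup>+t. \<integral>\<^sup>+s. indicator {0..h} s * ennreal ((norm (F (t + s) - F t))\<^sup>2) \<partial>lborel \<partial>lborel)"
    by (rule nn_integral_cmult) measurable
  also have "(\<integral>\<^sup>+t. \<integral>\<^sup>+s. indicator {0..h} s * ennreal ((norm (F (t + s) - F t))\<^sup>2) \<partial>lborel \<partial>lborel)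
    = (\<integral>\<^sup>+s. \<integral>\<^sup>+t. indicator {0..h} s * ennreal ((norm (F (t + s) - F t))\<^sup>2) \<partial>lborel \<partial>lborel)"
    by (rule lborel_pair.Fubini'[symmetric]) measurable
  also have "\<dots> \<le> (\<integral>\<^sup>+s. ennreal c * indicator {0..h} s \<partial>lborel)"
  proof (rule nn_integral_mono)
    fix s :: real
    have "(\<integral>\<^sup>+t. ennreal ((norm (F (t + s) - F t))\<^sup>2) \<partial>lborel) = ennreal (sqn (\<lambda>t. F (t + s) - F t))"
      unfolding sqn_def
      by (rule nn_integral_eq_integral[OF L2t_integrable[OF L2t_diff(1)[OF L2t_translate[OF F] F]]]) auto
    then show "(\<integral>\<^sup>+t. indicator {0..h} s * ennreal ((norm (F (t + s) - F t))\<^sup>2) \<partial>lborel) \<le> ennreal c * indicator {0..h} s"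
      using c[of s] by (auto simp: indicator_def ennreal_leI)
  qed
  also have "\<dots> = ennreal (c * h)"
    using h c0 by (simp add: nn_integral_cmult_indicator ennreal_mult)
  finally have "(\<integral>\<^sup>+t. ennreal ((norm (stek h F t - F t))\<^sup>2) \<partial>lborel) \<le> ennreal (1/h) * ennreal (c * h)"
    by (simp add: mult_left_mono)
  also have "\<dots> = ennreal c" using h c0 by (subst ennreal_mult[symmetric]) auto
  finally have le: "(\<integral>\<^sup>+t. ennreal ((norm (stek h F t - F t))\<^sup>2) \<partial>lborel) \<le> ennreal c" .
  then have i: "integrable lborel (\<lambda>t. (norm (stek h F t - F t))\<^sup>2)"
    by (intro integrableI_bounded) (auto intro: le_less_trans ennreal_less_top)
  have "ennreal (sqn (\<lambda>t. stek h F t - F t)) \<le> ennreal c"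
    unfolding sqn_def using le by (subst nn_integral_eq_integral[symmetric, OF i]) auto
  then show ?thesis using i c0 by (auto simp: L2t_def)
qed

lemma L2t_stek:
  assumes F: "L2t F" and h: "h > 0"
  shows "L2t (stek h F)"
proof -
  have "sqn (\<lambda>t. F (t + s) - F t) \<le> 4 * sqn F" for s
    using L2t_diff(2)[OF L2t_translate[OF F, of s] F] by (simp add: sqn_translate)
  from stek_bound[OF F h this] have "L2t (\<lambda>t. (stek h F t - F t) + F t)" by (intro L2t_add F) auto
  then show ?thesis by simp
qed

lemma stek_tendsto:
  fixes F :: "real \<Rightarrow> 'x::{real_inner,banach,second_countable_topology}"
  assumes F: "L2t F" and supp: "\<And>t. t \<notin> {-R..R} \<Longrightarrow> F t = 0"
  shows "((\<lambda>h. sqn (\<lambda>t. stek h F t - F t)) \<longlongrightarrow> 0) (at_right 0)"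
proof (rule tendstoI)
  fix e :: real assume e: "e > 0"
  have "\<forall>\<^sub>F s in at 0. sqn (\<lambda>t. F (t + s) - F t) < e/2"
    using order_tendstoD(2)[OF translate_tendsto[OF F supp], of R "e/2"] e by auto
  then obtain d where d: "d > 0" "\<And>s. s \<noteq> 0 \<Longrightarrow> \<bar>s\<bar> < d \<Longrightarrow> sqn (\<lambda>t. F (t + s) - F t) < e/2"
    unfolding eventually_at by (auto simp: dist_real_def)
  have "sqn (\<lambda>t. stek h F t - F t) \<le> e/2" if "0 < h" "h < d" for h
  proof -
    have "sqn (\<lambda>t. F (t + s) - F t) \<le> e/2" if "0 \<le> s" "s \<le> h" for s
    proof (cases "s = 0")
      case True
      then show ?thesis using e by (simp add: sqn_def)
    next
      case False
      then show ?thesis using d(2)[of s] that \<open>h < d\<close> by simp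
    qed
    then show ?thesis using stek_bound[OF F \<open>0 < h\<close>] by blast
  qed
  then have "dist (sqn (\<lambda>t. stek h F t - F t)) 0 < e" if "0 < h" "h < d" for h
    using that e by (fastforce simp: sqn_nonneg)
  then show "\<forall>\<^sub>F h in at_right 0. dist (sqn (\<lambda>t. stek h F t - F t)) 0 < e"
    unfolding eventually_at_right_field using d(1) by blast
qed

lemma average_tendsto:
  fixes \<phi> :: "real \<Rightarrow> 'x::{banach,second_countable_topology}"
  assumes \<phi>: "continuous_on UNIV \<phi>"
  shows "((\<lambda>h. stek h \<phi> t) \<longlongrightarrow> \<phi> t) (at_right 0)"
proof (rule tendstoI)
  fix e :: real assume e: "e > 0"
  have "isCont \<phi> t" using \<phi> by (simp add: continuous_on_eq_continuous_at)
  then obtain d where d: "d > 0" "\<And>s. \<bar>s - t\<bar> < d \<Longrightarrow> dist (\<phi> s) (\<phi> t) < e/2"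
    using e unfolding continuous_at_eps_delta by (metis dist_real_def half_gt_zero)
  have "dist (stek h \<phi> t) (\<phi> t) < e" if h: "0 < h" "h < d" for h
  proof -
    have i: "set_integrable lborel {t..t+h} \<phi>"
      by (rule borel_integrable_atLeastAtMost') (use \<phi> continuous_on_subset in blast)
    have c: "set_integrable lborel {t..t+h} (\<lambda>s. \<phi> t)"
      by (rule borel_integrable_atLeastAtMost') simp
    have "h *\<^sub>R \<phi> t = (LINT s:{t..t+h}|lborel. \<phi> t)"
      using h by (simp add: set_lebesgue_integral_def emeasure_lborel_Icc_eq)
    then have "stek h \<phi> t - \<phi> t = (1/h) *\<^sub>R (LINT s:{t..t+h}|lborel. \<phi> s - \<phi> t)"
    proof -
      assume *: "h *\<^sub>R \<phi> t = (LINT s:{t..t+h}|lborel. \<phi> t)"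
      have "\<phi> t = (1/h) *\<^sub>R (h *\<^sub>R \<phi> t)" using h by simp
      then show ?thesis
        unfolding * using i c by (simp add: stek_def scaleR_diff_right set_integral_diff(2))
    qed
    also have "norm \<dots> \<le> (1/h) * (LINT s:{t..t+h}|lborel. norm (\<phi> s - \<phi> t))"
      using set_integral_norm_bound[of lborel "{t..t+h}" "\<lambda>s. \<phi> s - \<phi> t"] i c h by (simp add: divide_right_mono)
    also have "\<dots> \<le> (1/h) * (LINT s:{t..t+h}|lborel. e/2)"
    proof (intro mult_left_mono set_integral_mono)
      show "set_integrable lborel {t..t+h} (\<lambda>s. norm (\<phi> s - \<phi> t))"
        using i c by (intro set_integrable_norm set_integral_diff)
      show "set_integrable lborel {t..t+h} (\<lambda>s. e/2)"
        by (rule borel_integrable_atLeastAtMost') simp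
      show "norm (\<phi> s - \<phi> t) \<le> e/2" if "s \<in> {t..t+h}" for s
        using d(2)[of s] that h by (simp add: dist_norm less_imp_le)
    qed (use h in auto)
    also have "\<dots> = e/2" using h by (simp add: set_lebesgue_integral_def emeasure_lborel_Icc_eq)
    finally show ?thesis using e by (simp add: dist_norm)
  qed
  then show "\<forall>\<^sub>F h in at_right 0. dist (stek h \<phi> t) (\<phi> t) < e"
    unfolding eventually_at_right_field using d(1) by blast
qed

text \<open>The projection is bounded and linear, so it commutes with the integral and fixes the
  integrand almost everywhere; the integral is therefore fixed by it.\<close>

lemma set_integral_in_closed_subspace:
  fixes F :: "real \<Rightarrow> 'x::{real_inner,banach,second_countable_topology}"
  assumes K: "subspace K" "closed K" and F: "set_integrable lborel A F"
    and inK: "AE t in lborel. t \<in> A \<longrightarrow> F t \<in> K"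
  shows "(LINT t:A|lborel. F t) \<in> K"
proof -
  have i: "integrable lborel (\<lambda>t. indicator A t *\<^sub>R F t)" using F by (simp add: set_integrable_def)
  note bl = bounded_linear_proj[OF K]
  have "proj K (LINT t:A|lborel. F t) = (LINT t|lborel. proj K (indicator A t *\<^sub>R F t))"
    unfolding set_lebesgue_integral_def by (rule integral_bounded_linear[OF bl i, symmetric])
  also have "\<dots> = (LINT t|lborel. indicator A t *\<^sub>R F t)"
  proof (rule integral_cong_AE)
    show "AE t in lborel. proj K (indicator A t *\<^sub>R F t) = indicator A t *\<^sub>R F t"
      using inK by eventually_elim (auto simp: indicator_def proj_id[OF K] subspace_0[OF K(1)])
  qed (use integrable_bounded_linear[OF bl i] i in auto)
  finally show ?thesis using proj_in[OF K] by (metis set_lebesgue_integral_def)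
qed

lemma AE_lborel_affine:
  fixes P :: "real \<Rightarrow> bool"
  assumes "AE t in lborel. P t" "c \<noteq> 0"
  shows "AE t in lborel. P (a + c * t)"
proof -
  obtain N where N: "{t \<in> space lborel. \<not> P t} \<subseteq> N" "emeasure lborel N = 0" "N \<in> sets lborel"
    using AE_E[OF assms(1)] by blast
  have "AE t in lborel. t \<notin> N" using N by (intro AE_not_in) auto
  then have "AE t in lborel. a + c * t \<notin> N"
    using N(3) by (intro AE_borel_affine[OF assms(2)]) auto
  then show ?thesis by eventually_elim (use N(1) in auto)
qed

section \<open>Abstract evolution equations\<close>

text \<open>\<open>y\<close> is the continuous representative of the \<open>H\<close>-component of \<open>U\<close>, and \<open>G\<close> represents
  its derivative, as a functional on \<open>K\<close>, by an element of the ambient space \<open>X = H \<times> H'\<close>.\<close>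

definition evo :: "('h \<times> 'g) set \<Rightarrow> real \<Rightarrow> (real \<Rightarrow> 'h) \<Rightarrow>
   (real \<Rightarrow> 'h::{real_inner,banach,second_countable_topology} \<times> 'g::{real_inner,banach,second_countable_topology})
   \<Rightarrow> (real \<Rightarrow> 'h \<times> 'g) \<Rightarrow> bool" where
  "evo K T y U G \<longleftrightarrow> continuous_on UNIV y \<and> L2t U \<and> L2t G \<and> (\<forall>t. t \<notin> {0..T} \<longrightarrow> U t = 0 \<and> G t = 0) \<and>
     (AE t in lborel. t \<in> {0..T} \<longrightarrow> U t \<in> K \<and> fst (U t) = y t) \<and>
     (\<forall>v\<in>K. \<forall>s t. 0 \<le> s \<longrightarrow> s \<le> t \<longrightarrow> t \<le> T \<longrightarrow> (y t - y s) \<bullet> fst v = (LINT \<tau>:{s..t}|lborel. G \<tau> \<bullet> v))"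

lemma L2t_reflect: "L2t F \<Longrightarrow> L2t (\<lambda>t. F (c - t))"
  using lborel_integrable_real_affine_iff[of "-1" "\<lambda>t. (norm (F t))\<^sup>2" c]
  by (auto simp: L2t_def intro!: measurable_compose[of "\<lambda>t. c - t" borel borel F])

text \<open>Even reflection at \<open>T\<close> of the solution, odd reflection of its derivative.
  The two summands of each sum overlap only at \<open>T\<close>, a null set, because all functions
  vanish outside the original interval. On the doubled interval, times up to and including
  \<open>T\<close> have room for forward windows.\<close>

lemma evo_reflect:
  assumes e: "evo K T y U G" and T: "0 < T"
  shows "evo K (2 * T) (\<lambda>t. y (min t (2 * T - t))) (\<lambda>t. U t + U (2 * T - t)) (\<lambda>t. G t - G (2 * T - t))"
  unfolding evo_def
proof (intro conjI ballI allI impI)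
  have y: "continuous_on UNIV y" and U: "L2t U" and G: "L2t G"
    and supp: "\<And>t. t \<notin> {0..T} \<Longrightarrow> U t = 0" "\<And>t. t \<notin> {0..T} \<Longrightarrow> G t = 0"
    and ae: "AE t in lborel. t \<in> {0..T} \<longrightarrow> U t \<in> K \<and> fst (U t) = y t"
    and eq: "\<And>v s t. v \<in> K \<Longrightarrow> 0 \<le> s \<Longrightarrow> s \<le> t \<Longrightarrow> t \<le> T \<Longrightarrow>
      (y t - y s) \<bullet> fst v = (LINT \<tau>:{s..t}|lborel. G \<tau> \<bullet> v)"
    using e unfolding evo_def by blast+
  show "continuous_on UNIV (\<lambda>t. y (min t (2 * T - t)))"
    by (rule continuous_on_compose2[OF y]) (auto intro!: continuous_intros)
  show "L2t (\<lambda>t. U t + U (2 * T - t))" by (intro L2t_add L2t_reflect U)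
  show "L2t (\<lambda>t. G t - G (2 * T - t))" by (intro L2t_diff L2t_reflect G)
  show "U t + U (2 * T - t) = 0" "G t - G (2 * T - t) = 0" if "t \<notin> {0..2 * T}" for t
    using that supp[of t] supp[of "2 * T - t"] T by auto
  have "AE t in lborel. 2 * T - t \<in> {0..T} \<longrightarrow> U (2 * T - t) \<in> K \<and> fst (U (2 * T - t)) = y (2 * T - t)"
    using AE_lborel_affine[OF ae, of "-1" "2 * T"] by simp
  then show "AE t in lborel. t \<in> {0..2 * T} \<longrightarrow> U t + U (2 * T - t) \<in> K \<and> fst (U t + U (2 * T - t)) = y (min t (2 * T - t))"
    using ae AE_lborel_singleton[of T]
  proof eventually_elim
    case (elim t)
    then show ?case using supp(1)[of t] supp(1)[of "2 * T - t"] by (cases "t < T") (auto simp: min_def)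
  qed
  fix v s t assume v: "v \<in> K" and st: "0 \<le> s" "s \<le> t" "t \<le> 2 * T"
  have int: "set_integrable lborel {a..b} (\<lambda>\<tau>. G \<tau> \<bullet> v)" for a b
    unfolding set_integrable_def
    using integrable_inner_left[of v lborel "\<lambda>\<tau>. indicator {a..b} \<tau> *\<^sub>R G \<tau>"] L2t_set_integrable[OF G, of a b]
    by (simp add: set_integrable_def)
  \<comment> \<open>\<open>G\<close> vanishes after \<open>T\<close>, so the integrated equation
    persists for all later times if \<open>y\<close> is evaluated at times cut down to
    \<open>T\<close>.\<close>
  have clamp: "(LINT \<tau>:{a..b}|lborel. G \<tau> \<bullet> v) = (y (min b T) - y (min a T)) \<bullet> fst v" if "0 \<le> a" "a \<le> b" for a b
  proof -
    have z: "(LINT \<tau>:{c..d}|lborel. G \<tau> \<bullet> v) = 0" if "T \<le> c" for c d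
    proof -
      have "AE \<tau> in lborel. indicator {c..d} \<tau> *\<^sub>R (G \<tau> \<bullet> v) = 0"
        using AE_lborel_singleton[of T] by eventually_elim (use supp(2) that in \<open>auto simp: indicator_def\<close>)
      then show ?thesis unfolding set_lebesgue_integral_def by (rule integral_eq_zero_AE)
    qed
    consider "b \<le> T" | "a \<le> T" "T \<le> b" | "T \<le> a" by linarith
    then show ?thesis
    proof cases
      case 1
      then show ?thesis using eq[OF v, of a b] that by (simp add: min_absorb1)
    next
      case 2
      then have "(LINT \<tau>:{a..b}|lborel. G \<tau> \<bullet> v) = (LINT \<tau>:{a..T}|lborel. G \<tau> \<bullet> v) + (LINT \<tau>:{T..b}|lborel. G \<tau> \<bullet> v)"
        by (intro set_integral_combine_Icc int)
      then show ?thesis using eq[OF v, of a T] that 2 z[of T b] by (simp add: min_absorb1 min_absorb2)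
    next
      case 3
      then show ?thesis using z[of a b] that by (simp add: min_absorb2)
    qed
  qed
  have refl: "(LINT \<tau>:{s..t}|lborel. G (2 * T - \<tau>) \<bullet> v) = (LINT \<tau>:{2*T-t..2*T-s}|lborel. G \<tau> \<bullet> v)"
  proof -
    have "(LINT \<tau>:{2*T-t..2*T-s}|lborel. G \<tau> \<bullet> v)
       = (LINT \<tau>|lborel. indicator {2*T-t..2*T-s} (2 * T - \<tau>) *\<^sub>R (G (2 * T - \<tau>) \<bullet> v))"
      unfolding set_lebesgue_integral_def
      using lborel_integral_real_affine[of "-1" "\<lambda>\<tau>. indicator {2*T-t..2*T-s} \<tau> *\<^sub>R (G \<tau> \<bullet> v)" "2 * T"] by simp
    also have "\<dots> = (LINT \<tau>:{s..t}|lborel. G (2 * T - \<tau>) \<bullet> v)"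
      unfolding set_lebesgue_integral_def
      by (rule Bochner_Integration.integral_cong) (auto simp: indicator_def)
    finally show ?thesis by simp
  qed
  have int': "set_integrable lborel {s..t} (\<lambda>\<tau>. G (2 * T - \<tau>) \<bullet> v)"
    unfolding set_integrable_def
    using integrable_inner_left[of v lborel "\<lambda>\<tau>. indicator {s..t} \<tau> *\<^sub>R G (2 * T - \<tau>)"]
      L2t_set_integrable[OF L2t_reflect[OF G], of s t "2 * T"]
    by (simp add: set_integrable_def)
  have "(LINT \<tau>:{s..t}|lborel. (G \<tau> - G (2 * T - \<tau>)) \<bullet> v)
     = (LINT \<tau>:{s..t}|lborel. G \<tau> \<bullet> v) - (LINT \<tau>:{s..t}|lborel. G (2 * T - \<tau>) \<bullet> v)"
    unfolding inner_diff_left by (rule set_integral_diff(2)[OF int int'])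
  also have "\<dots> = ((y (min t T) - y (min s T)) - (y (min (2*T-s) T) - y (min (2*T-t) T))) \<bullet> fst v"
    unfolding refl using st by (simp add: clamp inner_diff_left)
  also have "(y (min t T) - y (min s T)) - (y (min (2*T-s) T) - y (min (2*T-t) T))
     = (y (min t T) + y (min (2*T-t) T)) - (y (min s T) + y (min (2*T-s) T))"
    by (simp add: algebra_simps)
  also have "\<dots> = y (min t (2 * T - t)) - y (min s (2 * T - s))"
  proof -
    \<comment> \<open>One of \<open>a\<close> and \<open>2*T - a\<close> is at least
      \<open>T\<close>, so one summand on the left is \<open>y T\<close> and the other is the
      reflected value.\<close>
    have "y (min a T) + y (min (2*T-a) T) = y T + y (min a (2 * T - a))" for a
      by (cases "a \<le> T") (auto simp: min_def)
    then show ?thesis by simp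
  qed
  finally show "(y (min t (2 * T - t)) - y (min s (2 * T - s))) \<bullet> fst v
     = (LINT \<tau>:{s..t}|lborel. (G \<tau> - G (2 * T - \<tau>)) \<bullet> v)" by simp
qed

lemma stek_inner:
  assumes "L2t F"
  shows "stek h F t \<bullet> v = (1/h) * (LINT \<tau>:{t..t+h}|lborel. F \<tau> \<bullet> v)"
proof -
  have i: "integrable lborel (\<lambda>\<tau>. indicator {t..t+h} \<tau> *\<^sub>R F \<tau>)"
    using L2t_set_integrable[OF assms, of t "t+h"] by (simp add: set_integrable_def)
  have "(LINT \<tau>:{t..t+h}|lborel. F \<tau> \<bullet> v) = (LINT \<tau>|lborel. (indicator {t..t+h} \<tau> *\<^sub>R F \<tau>) \<bullet> v)"
    by (simp add: set_lebesgue_integral_def)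
  also have "\<dots> = (LINT \<tau>:{t..t+h}|lborel. F \<tau>) \<bullet> v"
    unfolding set_lebesgue_integral_def by (rule integral_inner_left) (use i in blast)
  finally show ?thesis by (simp add: stek_def)
qed

text \<open>The equation integrated over one window: difference quotients of \<open>y\<close> are
  represented on \<open>K\<close> by averages of \<open>G\<close>, at every admissible time and not
  merely at almost every one.\<close>

lemma evo_stek:
  assumes "evo K T y U G" "v \<in> K" "0 \<le> t" "0 < h" "t + h \<le> T"
  shows "(y (t + h) - y t) \<bullet> fst v = h * (stek h G t \<bullet> v)"
proof -
  have "(y (t + h) - y t) \<bullet> fst v = (LINT \<tau>:{t..t+h}|lborel. G \<tau> \<bullet> v)" and "L2t G"
    using assms unfolding evo_def by auto
  then show ?thesis using assms(4) by (simp add: stek_inner)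
qed

text \<open>Instead of differentiating \<open>|y|\<^sup>2\<close>, its difference quotients are integrated: since
  \<open>|y(\<tau>+h)|\<^sup>2 - |y(\<tau>)|\<^sup>2 = (y(\<tau>+h) - y(\<tau>), y(\<tau>+h) + y(\<tau>))\<close>, the equation can be tested
  with \<open>U(\<tau>+h) + U(\<tau>) \<in> K\<close>.\<close>

lemma energy_equality_less:
  assumes e: "evo K T y U G" and K: "subspace K" and t: "0 \<le> t" "t < T"
  shows "(norm (y t))\<^sup>2 - (norm (y 0))\<^sup>2 = 2 * (LINT \<tau>:{0..t}|lborel. G \<tau> \<bullet> U \<tau>)"
proof -
  have y: "continuous_on UNIV y" and U: "L2t U" and G: "L2t G"
    and supp: "\<And>t. t \<notin> {0..T} \<Longrightarrow> U t = 0" "\<And>t. t \<notin> {0..T} \<Longrightarrow> G t = 0"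
    and ae: "AE t in lborel. t \<in> {0..T} \<longrightarrow> U t \<in> K \<and> fst (U t) = y t"
    using e unfolding evo_def by blast+
  define \<phi> where "\<phi> s = (norm (y s))\<^sup>2" for s
  have \<phi>: "continuous_on UNIV \<phi>" unfolding \<phi>_def by (intro continuous_intros y)
  have [measurable]: "y \<in> borel_measurable borel" "\<phi> \<in> borel_measurable borel"
    using y \<phi> by (auto intro: borel_measurable_continuous_onI)
  have [measurable]: "U \<in> borel_measurable borel" "G \<in> borel_measurable borel"
    using U G by (auto simp: L2t_def)
  note [measurable] = stek_measurable[of G]
  have quot: "stek h \<phi> t - stek h \<phi> 0 = (LINT \<tau>:{0..t}|lborel. stek h G \<tau> \<bullet> (U (\<tau> + h) + U \<tau>))"
    if h: "0 < h" "h < T - t" for h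
  proof -
    have "stek h \<phi> t - stek h \<phi> 0 = (1/h) * (LINT \<tau>:{0..t}|lborel. \<phi> (\<tau> + h) - \<phi> \<tau>)"
    proof -
      have "set_integrable lborel {0..t + h} \<phi>"
        by (rule borel_integrable_atLeastAtMost') (use \<phi> continuous_on_subset in blast)
      from set_integral_shift_diff[OF t(1) _ this] h show ?thesis
        by (simp add: stek_def diff_divide_distrib[symmetric])
    qed
    also have "\<dots> = (LINT \<tau>:{0..t}|lborel. (1/h) * (\<phi> (\<tau> + h) - \<phi> \<tau>))" by simp
    also have "\<dots> = (LINT \<tau>:{0..t}|lborel. stek h G \<tau> \<bullet> (U (\<tau> + h) + U \<tau>))"
    proof (rule set_lebesgue_integral_cong_AE)
      have "AE \<tau> in lborel. \<tau> + h \<in> {0..T} \<longrightarrow> U (\<tau> + h) \<in> K \<and> fst (U (\<tau> + h)) = y (\<tau> + h)"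
        using AE_lborel_affine[OF ae, of 1 h] by (simp add: add.commute)
      then show "AE \<tau>\<in>{0..t} in lborel. (1/h) * (\<phi> (\<tau> + h) - \<phi> \<tau>) = stek h G \<tau> \<bullet> (U (\<tau> + h) + U \<tau>)"
        using ae
      proof eventually_elim
        case (elim \<tau>)
        show ?case
        proof
          assume \<tau>: "\<tau> \<in> {0..t}"
          then have 1: "U (\<tau> + h) \<in> K" "fst (U (\<tau> + h)) = y (\<tau> + h)" "U \<tau> \<in> K" "fst (U \<tau>) = y \<tau>"
            using elim h t by auto
          have "(y (\<tau> + h) - y \<tau>) \<bullet> fst (U (\<tau> + h) + U \<tau>) = h * (stek h G \<tau> \<bullet> (U (\<tau> + h) + U \<tau>))"
            using \<tau> h t by (intro evo_stek[OF e] subspace_add[OF K] 1) auto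
          moreover have "(y (\<tau> + h) - y \<tau>) \<bullet> fst (U (\<tau> + h) + U \<tau>) = \<phi> (\<tau> + h) - \<phi> \<tau>"
            by (simp add: 1 \<phi>_def power2_norm_eq_inner inner_simps inner_commute)
          ultimately show "(1/h) * (\<phi> (\<tau> + h) - \<phi> \<tau>) = stek h G \<tau> \<bullet> (U (\<tau> + h) + U \<tau>)"
            using h by (simp add: divide_eq_eq mult.commute)
        qed
      qed
    qed measurable
    finally show ?thesis .
  qed
  have sU: "U t = 0" "G t = 0" if "t \<notin> {-T..T}" for t using that supp[of t] t by auto
  have lim: "((\<lambda>h. LINT \<tau>:{0..t}|lborel. stek h G \<tau> \<bullet> (U (\<tau> + h) + U \<tau>)) \<longlongrightarrow> (LINT \<tau>:{0..t}|lborel. G \<tau> \<bullet> (U \<tau> + U \<tau>))) (at_right 0)"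
  proof -
    \<comment> \<open>The convergence lemma asks for square integrability at every parameter,
      whereas the average is controlled for positive steps only; other steps get the limit
      \<open>G\<close> itself.\<close>
    define Gh where "Gh h = (if h > 0 then stek h G else G)" for h
    have "((\<lambda>h. LINT \<tau>:{0..t}|lborel. Gh h \<tau> \<bullet> (U (\<tau> + h) + U \<tau>)) \<longlongrightarrow> (LINT \<tau>:{0..t}|lborel. G \<tau> \<bullet> (U \<tau> + U \<tau>))) (at_right 0)"
    proof (rule tendsto_L2t_inner)
      show "L2t G" by (rule G)
      show "L2t (Gh h)" for h by (simp add: Gh_def L2t_stek G)
      show "((\<lambda>h. sqn (\<lambda>\<tau>. Gh h \<tau> - G \<tau>)) \<longlongrightarrow> 0) (at_right 0)"
        using stek_tendsto[OF G sU(2)]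
        by (rule Lim_transform_eventually) (auto simp: Gh_def eventually_at_right_field intro!: exI[of _ 1])
      show "L2t (\<lambda>\<tau>. U \<tau> + U \<tau>)" "L2t (\<lambda>\<tau>. U (\<tau> + h) + U \<tau>)" for h
        by (intro L2t_add L2t_translate U)+
      have "((\<lambda>h. sqn (\<lambda>\<tau>. U (\<tau> + h) - U \<tau>)) \<longlongrightarrow> 0) (at_right 0)"
        by (rule tendsto_within_subset[OF translate_tendsto[OF U sU(1)] subset_UNIV])
      then show "((\<lambda>h. sqn (\<lambda>\<tau>. U (\<tau> + h) + U \<tau> - (U \<tau> + U \<tau>))) \<longlongrightarrow> 0) (at_right 0)" by simp
    qed simp
    then show ?thesis
      by (rule Lim_transform_eventually) (auto simp: Gh_def eventually_at_right_field intro!: exI[of _ 1])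
  qed
  have "((\<lambda>h. stek h \<phi> t - stek h \<phi> 0) \<longlongrightarrow> \<phi> t - \<phi> 0) (at_right 0)"
    by (intro tendsto_diff average_tendsto \<phi>)
  then have "((\<lambda>h. LINT \<tau>:{0..t}|lborel. stek h G \<tau> \<bullet> (U (\<tau> + h) + U \<tau>)) \<longlongrightarrow> \<phi> t - \<phi> 0) (at_right 0)"
    by (rule Lim_transform_eventually)
       (use t quot in \<open>auto simp: eventually_at_right_field intro!: exI[of _ "T - t"]\<close>)
  then have "\<phi> t - \<phi> 0 = (LINT \<tau>:{0..t}|lborel. G \<tau> \<bullet> (U \<tau> + U \<tau>))"
    using lim by (rule tendsto_unique[OF trivial_limit_at_right_real])
  also have "\<dots> = (LINT \<tau>:{0..t}|lborel. 2 * (G \<tau> \<bullet> U \<tau>))" by (simp add: inner_add_right)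
  finally show ?thesis by (simp add: \<phi>_def)
qed

text \<open>The version for \<open>t < T\<close> needs room for a forward step. Applied to the
  evolution reflected to the doubled interval it covers \<open>t = T\<close>, and up to
  \<open>T\<close> the reflected summands vanish almost everywhere.\<close>

lemma energy_equality:
  assumes e: "evo K T y U G" and K: "subspace K" and T: "0 < T" and t: "0 \<le> t" "t \<le> T"
  shows "(norm (y t))\<^sup>2 - (norm (y 0))\<^sup>2 = 2 * (LINT \<tau>:{0..t}|lborel. G \<tau> \<bullet> U \<tau>)"
proof -
  have [measurable]: "U \<in> borel_measurable borel" "G \<in> borel_measurable borel"
    using e by (auto simp: L2t_def evo_def)
  have supp: "\<And>t. t \<notin> {0..T} \<Longrightarrow> U t = 0" "\<And>t. t \<notin> {0..T} \<Longrightarrow> G t = 0"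
    using e unfolding evo_def by blast+
  have "(norm (y (min t (2 * T - t))))\<^sup>2 - (norm (y (min 0 (2 * T - 0))))\<^sup>2
     = 2 * (LINT \<tau>:{0..t}|lborel. (G \<tau> - G (2 * T - \<tau>)) \<bullet> (U \<tau> + U (2 * T - \<tau>)))"
    by (rule energy_equality_less[OF evo_reflect[OF e T] K]) (use t T in auto)
  also have "(LINT \<tau>:{0..t}|lborel. (G \<tau> - G (2 * T - \<tau>)) \<bullet> (U \<tau> + U (2 * T - \<tau>)))
     = (LINT \<tau>:{0..t}|lborel. G \<tau> \<bullet> U \<tau>)"
  proof (rule set_lebesgue_integral_cong_AE)
    show "AE \<tau>\<in>{0..t} in lborel. (G \<tau> - G (2 * T - \<tau>)) \<bullet> (U \<tau> + U (2 * T - \<tau>)) = G \<tau> \<bullet> U \<tau>"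
      using AE_lborel_singleton[of T] by eventually_elim (use t supp in auto)
  qed measurable
  finally show ?thesis using t T by (simp add: min_def)
qed

subsection \<open>Approximation by functions that are smoother in time\<close>

text \<open>Cauchy-Schwarz gives Hoelder continuity with exponent 1/2.\<close>

lemma continuous_of_integral:
  fixes w :: "real \<Rightarrow> 'x::{real_inner,banach,second_countable_topology}"
  assumes w': "L2t w'" and w: "\<And>s t. s \<le> t \<Longrightarrow> w t - w s = (LINT \<tau>:{s..t}|lborel. w' \<tau>)"
  shows "continuous_on UNIV w"
proof -
  define C where "C = sqrt (sqn w')"
  have C0: "0 \<le> C" by (simp add: C_def sqn_nonneg)
  have le: "dist (w t) (w s) \<le> sqrt \<bar>t - s\<bar> * C" for s t
  proof -
    have *: "dist (w t) (w s) \<le> sqrt \<bar>t - s\<bar> * C" if "s \<le> t" for s t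
    proof -
      have "dist (w t) (w s) = norm (LINT \<tau>:{s..t}|lborel. w' \<tau>)" using w[OF that] by (simp add: dist_norm)
      also have "\<dots> \<le> (LINT \<tau>:{s..t}|lborel. norm (w' \<tau>))"
        by (rule set_integral_norm_bound[OF L2t_set_integrable[OF w']])
      also have "\<dots> \<le> sqrt (t - s) * C" unfolding C_def by (rule L2t_set_integral_norm_le[OF w' that])
      finally show ?thesis using that by simp
    qed
    show ?thesis using *[of s t] *[of t s] by (cases "s \<le> t") (auto simp: dist_commute abs_minus_commute)
  qed
  show ?thesis
    unfolding continuous_on_def
  proof
    fix s :: real
    have "((\<lambda>t. sqrt \<bar>t - s\<bar> * C) \<longlongrightarrow> sqrt \<bar>s - s\<bar> * C) (at s)" by (intro tendsto_intros)
    then have lim: "((\<lambda>t. sqrt \<bar>t - s\<bar> * C) \<longlongrightarrow> 0) (at s)" by simp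
    have "((\<lambda>t. dist (w t) (w s)) \<longlongrightarrow> 0) (at s)"
      by (rule Lim_null_comparison[OF always_eventually lim]) (simp only: real_norm_def abs_of_nonneg zero_le_dist le simp_thms)
    then show "(w \<longlongrightarrow> w s) (at s)" by (subst tendsto_dist_iff)
  qed
qed

text \<open>\<open>w\<close> is the Steklov average of the reflected \<open>U\<close>. Its
  derivative is a difference quotient of values in \<open>K\<close>, hence again in
  \<open>K\<close>, and the average \<open>\<Gamma>\<close> of the reflected \<open>G\<close>
  represents the derivative of its first component on \<open>K\<close>. Continuity of averages
  controls all three errors by one small step \<open>h\<close>.\<close>

lemma evo_approx:
  fixes K :: "('h::{real_inner,banach,second_countable_topology} \<times> 'g::{real_inner,banach,second_countable_topology}) set"
  assumes e: "evo K T y U G" and K: "subspace K" "closed K" and T: "0 < T" and eps: "0 < \<epsilon>"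
  obtains w w' \<Gamma> where "L2t w'" "L2t \<Gamma>" "continuous_on UNIV w"
    "\<And>t. t \<in> {0..T} \<Longrightarrow> w t \<in> K" "AE t in lborel. t \<in> {0..T} \<longrightarrow> w' t \<in> K"
    "\<And>s t. s \<le> t \<Longrightarrow> w t - w s = (LINT \<tau>:{s..t}|lborel. w' \<tau>)"
    "norm (fst (w 0) - y 0) < \<epsilon>"
    "sqn (\<lambda>t. indicator {0..T} t *\<^sub>R (U t - w t)) < \<epsilon>"
    "sqn (\<lambda>t. indicator {0..T} t *\<^sub>R (G t - \<Gamma> t)) < \<epsilon>"
    "AE t in lborel. t \<in> {0..T} \<longrightarrow> (\<forall>v\<in>K. fst (w' t) \<bullet> fst v = \<Gamma> t \<bullet> v)"
proof -
  define y2 where "y2 t = y (min t (2 * T - t))" for t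
  define U2 where "U2 t = U t + U (2 * T - t)" for t
  define G2 where "G2 t = G t - G (2 * T - t)" for t
  have e2: "evo K (2 * T) y2 U2 G2"
    using evo_reflect[OF e T] by (simp add: y2_def[abs_def] U2_def[abs_def] G2_def[abs_def])
  have supp0: "U t = 0" "G t = 0" if "t \<notin> {0..T}" for t using e that by (auto simp: evo_def)
  have y2: "continuous_on UNIV y2" and U2: "L2t U2" and G2: "L2t G2"
    and supp: "\<And>t. t \<notin> {0..2*T} \<Longrightarrow> U2 t = 0" "\<And>t. t \<notin> {0..2*T} \<Longrightarrow> G2 t = 0"
    and ae: "AE t in lborel. t \<in> {0..2*T} \<longrightarrow> U2 t \<in> K \<and> fst (U2 t) = y2 t"
    using e2 unfolding evo_def by blast+
  have sU: "U2 t = 0" "G2 t = 0" if "t \<notin> {-(2*T)..2*T}" for t using that supp[of t] T by auto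
  have [measurable]: "U \<in> borel_measurable borel" "G \<in> borel_measurable borel"
    "U2 \<in> borel_measurable borel" "G2 \<in> borel_measurable borel" "y2 \<in> borel_measurable borel"
    using e U2 G2 y2 by (auto simp: L2t_def evo_def intro: borel_measurable_continuous_onI)
  have "\<forall>\<^sub>F h in at_right 0. dist (stek h y2 0) (y2 0) < \<epsilon>"
    by (rule tendstoD[OF average_tendsto[OF y2] eps])
  moreover have "\<forall>\<^sub>F h in at_right 0. sqn (\<lambda>t. stek h U2 t - U2 t) < \<epsilon>"
    by (rule order_tendstoD(2)[OF stek_tendsto[OF U2 sU(1)] eps])
  moreover have "\<forall>\<^sub>F h in at_right 0. sqn (\<lambda>t. stek h G2 t - G2 t) < \<epsilon>"
    by (rule order_tendstoD(2)[OF stek_tendsto[OF G2 sU(2)] eps])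
  \<comment> \<open>With a step below \<open>T\<close>, every window starting at or before
    \<open>T\<close> stays inside the doubled interval.\<close>
  moreover have "\<forall>\<^sub>F h in at_right 0. h < T"
    using T by (auto simp: eventually_at_right_field)
  moreover have "\<forall>\<^sub>F h in at_right 0. h > (0::real)"
    by (simp add: eventually_at_right_less)
  ultimately have "\<forall>\<^sub>F h in at_right 0. dist (stek h y2 0) (y2 0) < \<epsilon> \<and> sqn (\<lambda>t. stek h U2 t - U2 t) < \<epsilon>
      \<and> sqn (\<lambda>t. stek h G2 t - G2 t) < \<epsilon> \<and> h < T \<and> h > 0"
    by eventually_elim simp
  then obtain h where h: "dist (stek h y2 0) (y2 0) < \<epsilon>" "sqn (\<lambda>t. stek h U2 t - U2 t) < \<epsilon>"
      "sqn (\<lambda>t. stek h G2 t - G2 t) < \<epsilon>" "h < T" "h > 0"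
    using eventually_happens'[OF trivial_limit_at_right_real] by (metis (no_types, lifting))
  define w where "w = stek h U2"
  define w' where "w' t = (1/h) *\<^sub>R (U2 (t + h) - U2 t)" for t
  define \<Gamma> where "\<Gamma> = stek h G2"
  note [measurable] = stek_measurable[of U2 h] stek_measurable[of G2 h]
  have w': "L2t w'" unfolding w'_def by (intro L2t_scale L2t_diff L2t_translate U2)
  have wint: "w t - w s = (LINT \<tau>:{s..t}|lborel. w' \<tau>)" if "s \<le> t" for s t
    using set_integral_shift_diff[OF that, of h U2] L2t_set_integrable[OF U2] h(5)
    by (simp add: w_def stek_def w'_def[abs_def] scaleR_diff_right[symmetric])
  have ae_h: "AE \<tau> in lborel. \<tau> + h \<in> {0..2*T} \<longrightarrow> U2 (\<tau> + h) \<in> K \<and> fst (U2 (\<tau> + h)) = y2 (\<tau> + h)"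
    using AE_lborel_affine[OF ae, of 1 h] by (simp add: add.commute)
  have eq_small: "sqn (\<lambda>t. indicator {0..T} t *\<^sub>R (F t - F' t)) \<le> sqn (\<lambda>t. F' t - F2 t)"
    if ae: "AE t in lborel. t \<in> {0..T} \<longrightarrow> F t = F2 t" and L: "L2t F'" "L2t F2" and [measurable]: "F \<in> borel_measurable borel"
    for F F' F2 :: "real \<Rightarrow> 'h \<times> 'g"
  proof -
    have [measurable]: "F' \<in> borel_measurable borel" using L by (simp add: L2t_def)
    have "sqn (\<lambda>t. indicator {0..T} t *\<^sub>R (F t - F' t)) \<le> 1\<^sup>2 * sqn (\<lambda>t. F' t - F2 t)"
    proof (rule L2t_bound(2))
      show "L2t (\<lambda>t. F' t - F2 t)" by (intro L2t_diff L)
      show "AE t in lborel. norm (indicator {0..T} t *\<^sub>R (F t - F' t)) \<le> 1 * norm (F' t - F2 t)"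
        using ae by eventually_elim (auto simp: indicator_def norm_minus_commute)
    qed measurable
    then show ?thesis by simp
  qed
  have agree: "AE t in lborel. t \<in> {0..T} \<longrightarrow> U t = U2 t" "AE t in lborel. t \<in> {0..T} \<longrightarrow> G t = G2 t"
    using AE_lborel_singleton[of T] by (eventually_elim, use supp0 in \<open>auto simp: U2_def G2_def\<close>)+
  show thesis
  proof (rule that[of w' \<Gamma> w])
    show "L2t w'" by (rule w')
    show "L2t \<Gamma>" unfolding \<Gamma>_def by (rule L2t_stek[OF G2 h(5)])
    show "continuous_on UNIV w" by (rule continuous_of_integral[OF w' wint])
    show "w t \<in> K" if "t \<in> {0..T}" for t
    proof -
      have "(LINT s:{t..t+h}|lborel. U2 s) \<in> K"
      proof (rule set_integral_in_closed_subspace[OF K L2t_set_integrable[OF U2]])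
        show "AE s in lborel. s \<in> {t..t+h} \<longrightarrow> U2 s \<in> K"
          using ae by eventually_elim (use that h in auto)
      qed
      then show ?thesis by (simp add: w_def stek_def subspace_scale[OF K(1)])
    qed
    show "AE t in lborel. t \<in> {0..T} \<longrightarrow> w' t \<in> K"
      using ae ae_h
    proof eventually_elim
      case (elim t)
      show ?case
      proof
        assume "t \<in> {0..T}"
        then have "U2 (t + h) \<in> K" "U2 t \<in> K" using elim h T by auto
        then show "w' t \<in> K" unfolding w'_def by (intro subspace_scale[OF K(1)] subspace_diff[OF K(1)])
      qed
    qed
    show "w t - w s = (LINT \<tau>:{s..t}|lborel. w' \<tau>)" if "s \<le> t" for s t by (rule wint[OF that])
    show "norm (fst (w 0) - y 0) < \<epsilon>"
    proof -
      have "(LINT s:{0..0+h}|lborel. fst (U2 s)) = (LINT s:{0..0+h}|lborel. y2 s)"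
      proof (rule set_lebesgue_integral_cong_AE)
        show "AE s\<in>{0..0+h} in lborel. fst (U2 s) = y2 s"
          using ae by eventually_elim (use h T in auto)
      next
        show "(\<lambda>s. fst (U2 s)) \<in> borel_measurable lborel"
          by (rule measurable_compose[OF _ borel_measurable_continuous_onI]) (auto intro!: continuous_intros)
      qed auto
      moreover have "fst (LINT s:{0..0+h}|lborel. U2 s) = (LINT s:{0..0+h}|lborel. fst (U2 s))"
      proof -
        have "integrable lborel (\<lambda>s. indicator {0..0+h} s *\<^sub>R U2 s)"
          using L2t_set_integrable[OF U2, of 0 "0+h"] by (simp add: set_integrable_def)
        from integral_bounded_linear[OF bounded_linear_fst this]
        show ?thesis by (simp add: set_lebesgue_integral_def)
      qed
      ultimately have "fst (w 0) = stek h y2 0" by (simp add: w_def stek_def)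
      moreover have "y2 0 = y 0" using T by (simp add: y2_def min_def)
      ultimately show ?thesis using h(1) by (simp add: dist_norm)
    qed
    show "sqn (\<lambda>t. indicator {0..T} t *\<^sub>R (U t - w t)) < \<epsilon>"
      unfolding w_def by (rule le_less_trans[OF eq_small h(2)]) (use agree L2t_stek[OF U2 h(5)] U2 in auto)
    show "sqn (\<lambda>t. indicator {0..T} t *\<^sub>R (G t - \<Gamma> t)) < \<epsilon>"
      unfolding \<Gamma>_def by (rule le_less_trans[OF eq_small h(3)]) (use agree L2t_stek[OF G2 h(5)] G2 in auto)
    show "AE t in lborel. t \<in> {0..T} \<longrightarrow> (\<forall>v\<in>K. fst (w' t) \<bullet> fst v = \<Gamma> t \<bullet> v)"
      using ae ae_h
    proof eventually_elim
      case (elim t)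
      show ?case
      proof (intro impI ballI)
        fix v assume t: "t \<in> {0..T}" and v: "v \<in> K"
        have "fst (w' t) = (1/h) *\<^sub>R (y2 (t + h) - y2 t)" using elim t h T by (simp add: w'_def)
        then show "fst (w' t) \<bullet> fst v = \<Gamma> t \<bullet> v"
          using evo_stek[OF e2 v, of t h] t h T by (simp add: \<Gamma>_def)
      qed
    qed
  qed
qed

subsection \<open>The energy estimate\<close>

text \<open>The maximum of \<open>\<phi>\<close> weighted by \<open>exp (- (2 * L * s))\<close> is
  estimated. With twice the rate \<open>L\<close> in the weight, the integral term returns at most
  half of the maximum and is absorbed, which is where the factor 2 in the bound comes from.\<close>

lemma gronwall_bound:
  fixes \<phi> :: "real \<Rightarrow> real"
  assumes cont: "continuous_on {0..T} \<phi>" and T: "0 \<le> T" and L: "0 < L" and C: "0 \<le> C"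
    and le: "\<And>t. 0 \<le> t \<Longrightarrow> t \<le> T \<Longrightarrow> \<phi> t \<le> C + L * (LINT \<tau>:{0..t}|lborel. \<phi> \<tau>)"
    and t: "0 \<le> t" "t \<le> T"
  shows "\<phi> t \<le> 2 * C * exp (2 * L * T)"
proof -
  define \<psi> where "\<psi> s = \<phi> s * exp (- (2 * L * s))" for s
  have "continuous_on {0..T} \<psi>" unfolding \<psi>_def by (intro continuous_intros cont)
  then obtain m where m: "m \<in> {0..T}" "\<And>s. s \<in> {0..T} \<Longrightarrow> \<psi> s \<le> \<psi> m"
    using continuous_attains_sup[of "{0..T}" \<psi>] T by auto
  \<comment> \<open>Truncation at 0 makes \<open>M\<close> a nonnegative factor, as the monotonicity
    steps below require.\<close>
  define M where "M = max 0 (\<psi> m)"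
  have \<phi>M: "\<phi> s \<le> M * exp (2 * L * s)" if "s \<in> {0..T}" for s
  proof -
    have "\<phi> s = \<psi> s * exp (2 * L * s)" by (simp add: \<psi>_def mult.assoc exp_add[symmetric])
    also have "\<dots> \<le> M * exp (2 * L * s)" using m(2)[OF that] by (intro mult_right_mono) (auto simp: M_def)
    finally show ?thesis .
  qed
  have "(LINT \<tau>:{0..m}|lborel. \<phi> \<tau>) \<le> (LINT \<tau>:{0..m}|lborel. M * exp (2 * L * \<tau>))"
  proof (rule set_integral_mono)
    show "set_integrable lborel {0..m} \<phi>"
      by (rule borel_integrable_atLeastAtMost', rule continuous_on_subset[OF cont]) (use m in auto)
    show "set_integrable lborel {0..m} (\<lambda>\<tau>. M * exp (2 * L * \<tau>))"
      by (rule borel_integrable_atLeastAtMost') (intro continuous_intros)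
    show "\<phi> s \<le> M * exp (2 * L * s)" if "s \<in> {0..m}" for s using \<phi>M that m by auto
  qed
  also have "\<dots> = M * exp (2 * L * m) / (2 * L) - M * exp (2 * L * 0) / (2 * L)"
    unfolding set_lebesgue_integral_def real_scaleR_def
  proof (rule integral_FTC_Icc_real[of 0 m, unfolded mult.commute[of "_ :: real" "indicator _ _"]])
    show "0 \<le> m" using m by simp
    show "((\<lambda>x. M * exp (2 * L * x) / (2 * L)) has_field_derivative M * exp (2 * L * x)) (at x)" for x
      using L by (auto intro!: derivative_eq_intros)
  qed (auto intro!: continuous_intros)
  also have "\<dots> \<le> M * exp (2 * L * m) / (2 * L)" using L by (simp add: M_def)
  finally have "L * (LINT \<tau>:{0..m}|lborel. \<phi> \<tau>) \<le> L * (M * exp (2 * L * m) / (2 * L))"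
    by (rule mult_left_mono) (use L in simp)
  then have "\<phi> m \<le> C + M * exp (2 * L * m) / 2" using le[of m] m L by simp
  then have "\<psi> m * exp (2 * L * m) \<le> C + M * exp (2 * L * m) / 2"
    by (simp add: \<psi>_def mult.assoc exp_add[symmetric])
  moreover have "1 \<le> exp (2 * L * m)" using L m by simp
  ultimately have M2: "M \<le> 2 * C"
  proof (cases "\<psi> m \<le> 0")
    case False
    then have "M * exp (2 * L * m) \<le> 2 * C"
      using \<open>\<psi> m * exp (2 * L * m) \<le> C + M * exp (2 * L * m) / 2\<close> by (simp add: M_def)
    moreover have "M * 1 \<le> M * exp (2 * L * m)"
      using \<open>1 \<le> exp (2 * L * m)\<close> by (rule mult_left_mono) (simp add: M_def)
    ultimately show ?thesis by simp
  qed (use C in \<open>simp add: M_def\<close>)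
  have "\<phi> t \<le> M * exp (2 * L * t)" by (rule \<phi>M) (use t in auto)
  also have "\<dots> \<le> (2 * C) * exp (2 * L * T)"
    using M2 t L by (intro mult_mono) (auto simp: M_def C)
  finally show ?thesis .
qed

text \<open>\<open>coercive\<close> is a Garding inequality whose negative term involves only the
  first component, the one that Gronwall's inequality can absorb. \<open>meas\<close> speaks of
  compositions with functions of time, since the operators are applied to solutions.\<close>

locale coercive_family =
  fixes B :: "real \<Rightarrow> 'h::{real_inner,banach,second_countable_topology} \<times> 'g::{real_inner,banach,second_countable_topology} \<Rightarrow> 'h \<times> 'g"
    and M \<kappa> \<mu> :: real
  assumes lin: "linear (B t)"
    and bound: "norm (B t x) \<le> M * norm x"
    and coercive: "\<kappa> * (norm x)\<^sup>2 - \<mu> * (norm (fst x))\<^sup>2 \<le> B t x \<bullet> x"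
    and meas: "F \<in> borel_measurable borel \<Longrightarrow> (\<lambda>t. B t (F t)) \<in> borel_measurable borel"
    and pos: "0 < \<kappa>" "0 < \<mu>" "0 \<le> M"
begin

lemma L2t_B: "L2t F \<Longrightarrow> L2t (\<lambda>t. B t (F t))" "L2t F \<Longrightarrow> sqn (\<lambda>t. B t (F t)) \<le> M\<^sup>2 * sqn F"
  using L2t_bound[of F "\<lambda>t. B t (F t)" M] bound meas[of F] by (auto simp: L2t_def)

text \<open>\<open>R\<close> is the residual of an arbitrary comparison function \<open>w\<close> in
  \<open>K\<close>. The error \<open>E\<close> solves the equation with right side
  \<open>R - B E\<close> and is itself an admissible test vector, so only the projection of
  \<open>R\<close> onto \<open>K\<close> matters. Gronwall's inequality with rate
  \<open>2 * \<mu>\<close> produces the factor \<open>2 * exp (4 * \<mu> * T)\<close>.\<close>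

lemma energy_estimate:
  assumes e: "evo K T y U (\<lambda>t. indicator {0..T} t *\<^sub>R ((f t, 0) - B t (U t)))"
    and K: "subspace K" "closed K" and T: "0 < T"
    and w': "L2t w'" and w: "continuous_on UNIV w" "\<And>t. t \<in> {0..T} \<Longrightarrow> w t \<in> K"
    and wint: "\<And>s t. s \<le> t \<Longrightarrow> w t - w s = (LINT \<tau>:{s..t}|lborel. w' \<tau>)"
    and R: "\<And>t. R t = indicator {0..T} t *\<^sub>R ((f t - fst (w' t), 0) - B t (w t))" "L2t R"
    and t: "0 \<le> t" "t \<le> T"
  shows "(norm (y t - fst (w t)))\<^sup>2
    \<le> 2 * ((norm (y 0 - fst (w 0)))\<^sup>2 + sqn (\<lambda>t. proj K (R t)) / (2 * \<kappa>)) * exp (4 * \<mu> * T)"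
proof -
  define G where "G t = indicator {0..T} t *\<^sub>R ((f t, 0) - B t (U t))" for t
  have eG: "evo K T y U G" using e by (simp add: G_def[abs_def])
  then have y: "continuous_on UNIV y" and U: "L2t U" and G: "L2t G"
    and supp: "\<And>t. t \<notin> {0..T} \<Longrightarrow> U t = 0" "\<And>t. t \<notin> {0..T} \<Longrightarrow> G t = 0"
    and ae: "AE t in lborel. t \<in> {0..T} \<longrightarrow> U t \<in> K \<and> fst (U t) = y t"
    and eq: "\<And>v s t. v \<in> K \<Longrightarrow> 0 \<le> s \<Longrightarrow> s \<le> t \<Longrightarrow> t \<le> T \<Longrightarrow>
      (y t - y s) \<bullet> fst v = (LINT \<tau>:{s..t}|lborel. G \<tau> \<bullet> v)"
    unfolding evo_def by blast+
  define z where "z t = y t - fst (w t)" for t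
  define E where "E t = U t - indicator {0..T} t *\<^sub>R w t" for t
  \<comment> \<open>Only the first component of \<open>w'\<close> pairs with test vectors in the
    time derivative, so its representative in \<open>X\<close> has second component 0.\<close>
  define d where "d t = (fst (w' t), 0 :: 'g)" for t
  define Q where "Q t = G t - indicator {0..T} t *\<^sub>R d t" for t
  have wL: "L2t (\<lambda>t. indicator {0..T} t *\<^sub>R w t)"
  proof -
    have [measurable]: "w \<in> borel_measurable borel" using w(1) by (rule borel_measurable_continuous_onI)
    have "set_integrable lborel {0..T} (\<lambda>t. (norm (w t))\<^sup>2)"
      by (rule borel_integrable_atLeastAtMost', rule continuous_on_subset[of UNIV]) (intro continuous_intros w(1), simp)
    moreover have "(\<lambda>t. (norm (indicator {0..T} t *\<^sub>R w t))\<^sup>2) = (\<lambda>t. indicator {0..T} t *\<^sub>R (norm (w t))\<^sup>2)"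
      by (auto simp: indicator_def)
    ultimately show ?thesis by (simp add: L2t_def set_integrable_def)
  qed
  have dL: "L2t d"
  proof (rule L2t_bound(1)[OF w', of _ 1])
    have [measurable]: "w' \<in> borel_measurable borel" using w' by (simp add: L2t_def)
    show "d \<in> borel_measurable borel" unfolding d_def
      by (intro measurable_compose[OF \<open>w' \<in> borel_measurable borel\<close>] borel_measurable_continuous_onI continuous_intros)
    have "norm (d t) \<le> norm (w' t)" for t
      using norm_fst_le[of "fst (w' t)" "snd (w' t)"] by (simp add: d_def)
    then show "AE t in lborel. norm (d t) \<le> 1 * norm (w' t)" by simp
  qed
  have EL: "L2t E" unfolding E_def by (intro L2t_diff U wL)
  have QL: "L2t Q" unfolding Q_def by (intro L2t_diff L2t_indicator G dL) simp
  have z: "continuous_on UNIV z" unfolding z_def by (intro continuous_intros y w(1))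
  have evoE: "evo K T z E Q"
    unfolding evo_def
  proof (intro conjI ballI allI impI)
    show "E t = 0" "Q t = 0" if "t \<notin> {0..T}" for t using that supp by (auto simp: E_def Q_def)
    show "AE t in lborel. t \<in> {0..T} \<longrightarrow> E t \<in> K \<and> fst (E t) = z t"
      using ae by eventually_elim (auto simp: E_def z_def w(2) subspace_diff[OF K(1)])
    fix v s t assume v: "v \<in> K" and st: "0 \<le> s" "s \<le> t" "t \<le> T"
    have i: "integrable lborel (\<lambda>\<tau>. indicator {s..t} \<tau> *\<^sub>R F \<tau>)" if "L2t F" for F :: "real \<Rightarrow> 'h \<times> 'g"
      using L2t_set_integrable[OF that, of s t] by (simp add: set_integrable_def)
    have ii: "set_integrable lborel {s..t} (\<lambda>\<tau>. F \<tau> \<bullet> v)" if "L2t F" for F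
      using integrable_inner_left[OF i[OF that], of v] by (simp add: set_integrable_def)
    have "(fst (w t) - fst (w s)) \<bullet> fst v = (w t - w s) \<bullet> (fst v, 0)" by (simp add: inner_prod_def)
    also have "\<dots> = (LINT \<tau>:{s..t}|lborel. w' \<tau> \<bullet> (fst v, 0))"
      unfolding wint[OF st(2)] set_lebesgue_integral_def
      by (subst integral_inner_left[symmetric]) (use i[OF w'] in auto)
    also have "\<dots> = (LINT \<tau>:{s..t}|lborel. d \<tau> \<bullet> v)" by (simp add: d_def inner_prod_def)
    finally have "(z t - z s) \<bullet> fst v = (LINT \<tau>:{s..t}|lborel. G \<tau> \<bullet> v) - (LINT \<tau>:{s..t}|lborel. d \<tau> \<bullet> v)"
      using eq[OF v st] by (simp add: z_def inner_simps)
    also have "\<dots> = (LINT \<tau>:{s..t}|lborel. G \<tau> \<bullet> v - d \<tau> \<bullet> v)"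
      by (rule set_integral_diff(2)[symmetric]) (intro ii G dL)+
    also have "\<dots> = (LINT \<tau>:{s..t}|lborel. Q \<tau> \<bullet> v)"
      unfolding set_lebesgue_integral_def
      by (rule Bochner_Integration.integral_cong) (use st in \<open>auto simp: Q_def indicator_def inner_diff_left\<close>)
    finally show "(z t - z s) \<bullet> fst v = (LINT \<tau>:{s..t}|lborel. Q \<tau> \<bullet> v)" .
  qed (rule z EL QL)+
  define P where "P t = proj K (R t)" for t
  have [measurable]: "R \<in> borel_measurable borel" using R(2) by (simp add: L2t_def)
  have PL: "L2t P"
  proof (rule L2t_bound(1)[OF R(2), of _ 1])
    show "P \<in> borel_measurable borel" unfolding P_def
      by (intro measurable_compose[OF \<open>R \<in> borel_measurable borel\<close>] borel_measurable_continuous_onI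
        linear_continuous_on bounded_linear_proj K)
    show "AE t in lborel. norm (P t) \<le> 1 * norm (R t)" using proj_norm_le[OF K] by (auto simp: P_def)
  qed
  have pt: "AE \<tau> in lborel. \<tau> \<in> {0..T} \<longrightarrow> 2 * (Q \<tau> \<bullet> E \<tau>) \<le> (norm (P \<tau>))\<^sup>2 / (2 * \<kappa>) + 2 * \<mu> * (norm (z \<tau>))\<^sup>2"
    using ae
  proof eventually_elim
    case (elim \<tau>)
    show ?case
    proof
      assume \<tau>: "\<tau> \<in> {0..T}"
      have EK: "E \<tau> \<in> K" and Ez: "fst (E \<tau>) = z \<tau>"
        using elim \<tau> by (auto simp: E_def z_def w(2) subspace_diff[OF K(1)])
      have "Q \<tau> = R \<tau> - B \<tau> (E \<tau>)"
        using \<tau> by (simp add: Q_def G_def R(1) E_def d_def linear_diff[OF lin])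
      then have "Q \<tau> \<bullet> E \<tau> = P \<tau> \<bullet> E \<tau> - B \<tau> (E \<tau>) \<bullet> E \<tau>"
        using proj_inner[OF K EK, of "R \<tau>"] by (simp add: P_def inner_diff_left)
      also have "\<dots> \<le> norm (P \<tau>) * norm (E \<tau>) - (\<kappa> * (norm (E \<tau>))\<^sup>2 - \<mu> * (norm (z \<tau>))\<^sup>2)"
        using norm_cauchy_schwarz[of "P \<tau>" "E \<tau>"] coercive[of "E \<tau>" \<tau>] by (simp add: Ez)
      also have "norm (P \<tau>) * norm (E \<tau>) - (\<kappa> * (norm (E \<tau>))\<^sup>2 - \<mu> * (norm (z \<tau>))\<^sup>2)
        \<le> (norm (P \<tau>))\<^sup>2 / (4 * \<kappa>) + \<mu> * (norm (z \<tau>))\<^sup>2"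
      proof -
        \<comment> \<open>Young's inequality, weighted so that the coercivity term
          \<open>\<kappa>\<close> times the squared norm of \<open>E\<close> is used up
          exactly.\<close>
        have "0 \<le> (norm (P \<tau>) / (2 * sqrt \<kappa>) - sqrt \<kappa> * norm (E \<tau>))\<^sup>2" by simp
        also have "\<dots> = (norm (P \<tau>))\<^sup>2 / (4 * \<kappa>) + \<kappa> * (norm (E \<tau>))\<^sup>2 - norm (P \<tau>) * norm (E \<tau>)"
          using pos by (simp add: power2_diff power_divide power_mult_distrib field_simps)
        finally show ?thesis by simp
      qed
      finally show "2 * (Q \<tau> \<bullet> E \<tau>) \<le> (norm (P \<tau>))\<^sup>2 / (2 * \<kappa>) + 2 * \<mu> * (norm (z \<tau>))\<^sup>2" by (simp add: field_simps)
    qed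
  qed
  define C where "C = (norm (z 0))\<^sup>2 + sqn P / (2 * \<kappa>)"
  have zi: "set_integrable lborel {a..b} (\<lambda>\<tau>. (norm (z \<tau>))\<^sup>2)" for a b
    by (rule borel_integrable_atLeastAtMost', rule continuous_on_subset[of UNIV]) (intro continuous_intros z, simp)
  have main: "(norm (z s))\<^sup>2 \<le> C + 2 * \<mu> * (LINT \<tau>:{0..s}|lborel. (norm (z \<tau>))\<^sup>2)" if s: "0 \<le> s" "s \<le> T" for s
  proof -
    have Pi: "integrable lborel (\<lambda>\<tau>. (norm (P \<tau>))\<^sup>2 / (2 * \<kappa>))" using L2t_integrable[OF PL] by simp
    have "(norm (z s))\<^sup>2 - (norm (z 0))\<^sup>2 = (LINT \<tau>:{0..s}|lborel. 2 * (Q \<tau> \<bullet> E \<tau>))"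
      using energy_equality[OF evoE K(1) T s] by simp
    also have "\<dots> \<le> (LINT \<tau>|lborel. (norm (P \<tau>))\<^sup>2 / (2 * \<kappa>) + indicator {0..s} \<tau> *\<^sub>R (2 * \<mu> * (norm (z \<tau>))\<^sup>2))"
      unfolding set_lebesgue_integral_def
    proof (rule integral_mono_AE)
      have "integrable lborel (\<lambda>\<tau>. indicator {0..s} \<tau> *\<^sub>R (Q \<tau> \<bullet> E \<tau>))"
        by (intro integrable_mult_indicator L2t_inner QL EL) simp
      then show "integrable lborel (\<lambda>\<tau>. indicator {0..s} \<tau> *\<^sub>R (2 * (Q \<tau> \<bullet> E \<tau>)))"
        by (simp add: mult.left_commute)
      have "integrable lborel (\<lambda>\<tau>. (2 * \<mu>) * (indicator {0..s} \<tau> *\<^sub>R (norm (z \<tau>))\<^sup>2))"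
        using zi[of 0 s] by (intro integrable_mult_right) (simp add: set_integrable_def)
      then show "integrable lborel (\<lambda>\<tau>. (norm (P \<tau>))\<^sup>2 / (2 * \<kappa>) + indicator {0..s} \<tau> *\<^sub>R (2 * \<mu> * (norm (z \<tau>))\<^sup>2))"
        by (intro Bochner_Integration.integrable_add Pi) (simp add: mult.left_commute)
      show "AE \<tau> in lborel. indicator {0..s} \<tau> *\<^sub>R (2 * (Q \<tau> \<bullet> E \<tau>))
          \<le> (norm (P \<tau>))\<^sup>2 / (2 * \<kappa>) + indicator {0..s} \<tau> *\<^sub>R (2 * \<mu> * (norm (z \<tau>))\<^sup>2)"
        using pt by eventually_elim (use s pos in \<open>auto simp: indicator_def\<close>)
    qed
    also have "\<dots> = sqn P / (2 * \<kappa>) + (LINT \<tau>:{0..s}|lborel. 2 * \<mu> * (norm (z \<tau>))\<^sup>2)"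
      unfolding set_lebesgue_integral_def sqn_def
    proof (subst Bochner_Integration.integral_add[OF Pi])
      have "integrable lborel (\<lambda>\<tau>. (2 * \<mu>) * (indicator {0..s} \<tau> *\<^sub>R (norm (z \<tau>))\<^sup>2))"
        using zi[of 0 s] by (intro integrable_mult_right) (simp add: set_integrable_def)
      then show "integrable lborel (\<lambda>\<tau>. indicator {0..s} \<tau> *\<^sub>R (2 * \<mu> * (norm (z \<tau>))\<^sup>2))"
        by (simp add: mult.left_commute)
    qed simp
    finally show ?thesis by (simp add: C_def)
  qed
  have "(norm (z t))\<^sup>2 \<le> 2 * C * exp (2 * (2 * \<mu>) * T)"
  proof (rule gronwall_bound[where \<phi>="\<lambda>t. (norm (z t))\<^sup>2"])
    show "continuous_on {0..T} (\<lambda>t. (norm (z t))\<^sup>2)"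
      by (rule continuous_on_subset[of UNIV]) (intro continuous_intros z, simp)
    show "0 \<le> C" using pos by (simp add: C_def sqn_nonneg)
  qed (use T t pos main in auto)
  then show ?thesis by (simp add: z_def C_def P_def[abs_def])
qed

end

subsection \<open>Convergence of solutions\<close>

lemma L2t_bounded_linear:
  assumes P: "bounded_linear P" and le: "\<And>x. norm (P x) \<le> c * norm x" and F: "L2t F"
  shows "L2t (\<lambda>t. P (F t))" "sqn (\<lambda>t. P (F t)) \<le> c\<^sup>2 * sqn F"
proof -
  have m: "(\<lambda>t. P (F t)) \<in> borel_measurable borel"
    by (rule measurable_compose[OF L2t_measurable[OF F] borel_measurable_continuous_onI])
       (rule linear_continuous_on[OF P])
  show "L2t (\<lambda>t. P (F t))" by (rule L2t_bound(1)[OF F m, of c]) (simp add: le)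
  show "sqn (\<lambda>t. P (F t)) \<le> c\<^sup>2 * sqn F" by (rule L2t_bound(2)[OF F m, of c]) (simp add: le)
qed

lemma L2t_proj:
  assumes "subspace K" "closed K" "L2t F"
  shows "L2t (\<lambda>t. proj K (F t))" "sqn (\<lambda>t. proj K (F t)) \<le> sqn F"
  using L2t_bounded_linear[OF bounded_linear_proj[OF assms(1,2)] _ assms(3), of 1]
    proj_norm_le[OF assms(1,2)] by simp_all

text \<open>Strong convergence at each time is dominated by \<open>2 * norm (F t)\<close>, because
  projections do not increase norms.\<close>

lemma proj_tendsto_L2t:
  fixes K :: "'x::{real_inner,banach,second_countable_topology} set"
  assumes K: "subspace K" "closed K" and Kn: "\<And>n. subspace (Kn n)" "\<And>n. closed (Kn n)"
    and conv: "\<And>x. (\<lambda>n. proj (Kn n) x) \<longlonglongrightarrow> proj K x" and F: "L2t F"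
  shows "(\<lambda>n. sqn (\<lambda>t. proj (Kn n) (F t) - proj K (F t))) \<longlonglongrightarrow> 0"
proof -
  have PL: "L2t (\<lambda>t. proj (Kn n) (F t) - proj K (F t))" for n
    by (intro L2t_diff(1) L2t_proj(1) K Kn F)
  note [measurable] = L2t_measurable[OF PL]
  have "(\<lambda>n. sqn (\<lambda>t. proj (Kn n) (F t) - proj K (F t))) \<longlonglongrightarrow> (LINT t|(lborel :: real measure). 0)"
    unfolding sqn_def
  proof (rule integral_dominated_convergence[of "\<lambda>t. 0" lborel "\<lambda>n t. (norm (proj (Kn n) (F t) - proj K (F t)))\<^sup>2" "\<lambda>t. 4 * (norm (F t))\<^sup>2"])
    show "integrable lborel (\<lambda>t. 4 * (norm (F t))\<^sup>2)" using F by (simp add: L2t_def)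
    show "AE t in lborel. (\<lambda>n. (norm (proj (Kn n) (F t) - proj K (F t)))\<^sup>2) \<longlonglongrightarrow> 0"
    proof (rule AE_I2)
      fix t
      have "(\<lambda>n. (norm (proj (Kn n) (F t) - proj K (F t)))\<^sup>2) \<longlonglongrightarrow> (norm (proj K (F t) - proj K (F t)))\<^sup>2"
        by (intro tendsto_intros conv)
      then show "(\<lambda>n. (norm (proj (Kn n) (F t) - proj K (F t)))\<^sup>2) \<longlonglongrightarrow> 0" by simp
    qed
    have "(norm (proj (Kn n) (F t) - proj K (F t)))\<^sup>2 \<le> 4 * (norm (F t))\<^sup>2" for n t
    proof -
      have "norm (proj (Kn n) (F t) - proj K (F t)) \<le> 2 * norm (F t)"
        using norm_triangle_ineq4[of "proj (Kn n) (F t)" "proj K (F t)"]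
          proj_norm_le[OF K, of "F t"] proj_norm_le[OF Kn, of n "F t"] by linarith
      then have "(norm (proj (Kn n) (F t) - proj K (F t)))\<^sup>2 \<le> (2 * norm (F t))\<^sup>2" by (rule power_mono) simp
      then show ?thesis by (simp add: power_mult_distrib)
    qed
    then show "\<And>n. AE t in lborel. norm ((norm (proj (Kn n) (F t) - proj K (F t)))\<^sup>2) \<le> 4 * (norm (F t))\<^sup>2" by simp
  qed auto
  then show ?thesis by simp
qed

lemma bounded_linear_fst_zero: "bounded_linear (\<lambda>x :: 'a::real_normed_vector \<times> 'b::real_normed_vector. (fst x, 0 :: 'b))"
  by (intro bounded_linear_Pair bounded_linear_fst bounded_linear_zero)

lemma norm_fst_zero_le: "norm (fst x, 0 :: 'b::real_normed_vector) \<le> 1 * norm (x :: 'a::real_normed_vector \<times> 'b)"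
  using norm_fst_le[of "fst x" "snd x"] by simp

text \<open>The distance is split at \<open>w\<close> and at its projection onto
  \<open>Kn n\<close>. The outer terms are energy estimates, with residuals \<open>R\<close> of
  \<open>w\<close> and \<open>Rn\<close> of the projected \<open>w\<close>; the middle term is the
  convergence of projections. \<open>w\<close> is fixed by \<open>\<delta>\<close> before
  \<open>n\<close> is chosen large.\<close>

lemma (in coercive_family) solutions_converge:
  fixes K :: "('h \<times> 'g) set"
  assumes T: "0 < T" and K: "subspace K" "closed K" and Kn: "\<And>n. subspace (Kn n)" "\<And>n. closed (Kn n)"
    and conv: "\<And>x. (\<lambda>n. proj (Kn n) x) \<longlonglongrightarrow> proj K x"
    and f: "L2t f" and fn: "\<And>n. L2t (fn n)"
    and fconv: "(\<lambda>n. sqn (\<lambda>t. indicator {0..T} t *\<^sub>R (fn n t - f t))) \<longlonglongrightarrow> 0"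
    and sol: "evo K T y U (\<lambda>t. indicator {0..T} t *\<^sub>R ((f t, 0) - B t (U t)))"
    and soln: "\<And>n. evo (Kn n) T (yn n) (Us n) (\<lambda>t. indicator {0..T} t *\<^sub>R ((fn n t, 0) - B t (Us n t)))"
    and init: "(\<lambda>n. yn n 0) \<longlonglongrightarrow> y 0" and e: "0 < e"
  shows "\<forall>\<^sub>F n in sequentially. \<forall>t\<in>{0..T}. norm (yn n t - y t) < e"
proof -
  \<comment> \<open>\<open>C * \<delta>\<close> is the energy bound for an initial error of
    \<open>2 * \<delta>\<close> and a residual of \<open>(5 + 4 * M^2) * \<delta>\<close>. The
    latter is twice the limit residual \<open>(2 + 2 * M^2) * \<delta>\<close> plus one more
    \<open>\<delta>\<close> for terms that vanish as \<open>n\<close> grows.\<close>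
  define C where "C = 2 * (2 + (5 + 4 * M\<^sup>2) / (2 * \<kappa>)) * exp (4 * \<mu> * T)"
  have C0: "0 < C" using pos by (simp add: C_def add_pos_nonneg)
  \<comment> \<open>The bound by 1 allows the square of \<open>\<delta>\<close> to be estimated by
    \<open>\<delta>\<close>; the other bound keeps \<open>C * \<delta>\<close> below the square of
    e/3.\<close>
  define \<delta> where "\<delta> = min 1 ((e/3)\<^sup>2 / (2 * C))"
  have \<delta>: "0 < \<delta>" "\<delta> \<le> 1" "C * \<delta> < (e/3)\<^sup>2"
  proof -
    show "0 < \<delta>" "\<delta> \<le> 1" using e C0 by (auto simp: \<delta>_def)
    have "C * \<delta> \<le> C * ((e/3)\<^sup>2 / (2 * C))" using C0 by (intro mult_left_mono) (auto simp: \<delta>_def)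
    also have "\<dots> = (e/3)\<^sup>2 / 2" using C0 by simp
    also have "\<dots> < (e/3)\<^sup>2" using e by simp
    finally show "C * \<delta> < (e/3)\<^sup>2" .
  qed
  define G where "G t = indicator {0..T} t *\<^sub>R ((f t, 0) - B t (U t))" for t
  have solG: "evo K T y U G" using sol by (simp add: G_def[abs_def])
  then have U: "L2t U" and G: "L2t G" by (auto simp: evo_def)
  obtain w w' \<Gamma> where w': "L2t w'" and \<Gamma>: "L2t \<Gamma>" and w: "continuous_on UNIV w"
    and wK: "\<And>t. t \<in> {0..T} \<Longrightarrow> w t \<in> K" and w'K: "AE t in lborel. t \<in> {0..T} \<longrightarrow> w' t \<in> K"
    and wint: "\<And>s t. s \<le> t \<Longrightarrow> w t - w s = (LINT \<tau>:{s..t}|lborel. w' \<tau>)"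
    and w0: "norm (fst (w 0) - y 0) < \<delta>"
    and wU: "sqn (\<lambda>t. indicator {0..T} t *\<^sub>R (U t - w t)) < \<delta>"
    and wG: "sqn (\<lambda>t. indicator {0..T} t *\<^sub>R (G t - \<Gamma> t)) < \<delta>"
    and w\<Gamma>: "AE t in lborel. t \<in> {0..T} \<longrightarrow> (\<forall>v\<in>K. fst (w' t) \<bullet> fst v = \<Gamma> t \<bullet> v)"
    by (rule evo_approx[OF solG K T \<delta>(1)]) (rule that; assumption)
  note linP = bounded_linear.linear[OF bounded_linear_proj[OF K]]
  note linPn = bounded_linear.linear[OF bounded_linear_proj[OF Kn]]
  \<comment> \<open>\<open>w\<close> is only known to be continuous on the line, so square
    integrability is obtained by cutting off to the time interval.\<close>
  define W where "W t = indicator {0..T} t *\<^sub>R w t" for t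
  define W' where "W' t = indicator {0..T} t *\<^sub>R w' t" for t
  define F where "F t = indicator {0..T} t *\<^sub>R (f t, 0 :: 'g)" for t
  define Fn where "Fn n t = indicator {0..T} t *\<^sub>R (fn n t, 0 :: 'g)" for n t
  have W: "L2t W"
  proof -
    have [measurable]: "w \<in> borel_measurable borel" using w by (rule borel_measurable_continuous_onI)
    have "set_integrable lborel {0..T} (\<lambda>t. (norm (w t))\<^sup>2)"
      by (rule borel_integrable_atLeastAtMost', rule continuous_on_subset[of UNIV]) (intro continuous_intros w, simp)
    moreover have "(\<lambda>t. (norm (W t))\<^sup>2) = (\<lambda>t. indicator {0..T} t *\<^sub>R (norm (w t))\<^sup>2)"
      by (auto simp: W_def indicator_def)
    moreover have "W \<in> borel_measurable borel" unfolding W_def[abs_def] by measurable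
    ultimately show ?thesis by (simp add: L2t_def set_integrable_def)
  qed
  have W': "L2t W'" unfolding W'_def by (intro L2t_indicator w') simp
  have emb: "L2t (\<lambda>t. (g t, 0 :: 'g))" if "L2t g" for g :: "real \<Rightarrow> 'h"
  proof -
    have "bounded_linear (\<lambda>x :: 'h. (x, 0 :: 'g))"
      by (intro bounded_linear_Pair bounded_linear_ident bounded_linear_zero)
    from L2t_bounded_linear(1)[OF this _ that, of 1] show ?thesis by (simp add: norm_Pair)
  qed
  have F: "L2t F" unfolding F_def by (intro L2t_indicator emb f) simp
  have Fn: "L2t (Fn n)" for n unfolding Fn_def by (intro L2t_indicator emb fn) simp
  have PnL: "L2t (\<lambda>t. proj (Kn n) (X t))" "sqn (\<lambda>t. proj (Kn n) (X t)) \<le> sqn X" if "L2t X" for X n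
    by (rule L2t_proj[OF Kn that])+
  have PL: "L2t (\<lambda>t. proj K (X t))" if "L2t X" for X
    by (rule L2t_proj(1)[OF K that])
  have DL: "L2t (\<lambda>t. (fst (X t), 0 :: 'g))" "sqn (\<lambda>t. (fst (X t), 0 :: 'g)) \<le> sqn X"
    if "L2t X" for X :: "real \<Rightarrow> 'h \<times> 'g"
    using L2t_bounded_linear[OF bounded_linear_fst_zero norm_fst_zero_le that] by simp_all
  define R where "R t = F t - (fst (W' t), 0) - B t (W t)" for t
  define Rn where "Rn n t = Fn n t - (fst (proj (Kn n) (W' t)), 0) - B t (proj (Kn n) (W t))" for n t
  have R: "L2t R" unfolding R_def by (intro L2t_diff(1) F DL(1) L2t_B(1) W W')
  have Rn: "L2t (Rn n)" for n unfolding Rn_def by (intro L2t_diff(1) Fn DL(1) L2t_B(1) PnL(1) W W')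
  have R_eq: "R t = indicator {0..T} t *\<^sub>R ((f t - fst (w' t), 0) - B t (w t))" for t
    by (cases "t \<in> {0..T}") (simp_all add: R_def F_def W_def W'_def linear_0[OF lin] zero_prod_def[symmetric])
  have Rn_eq: "Rn n t = indicator {0..T} t *\<^sub>R ((fn n t - fst (proj (Kn n) (w' t)), 0) - B t (proj (Kn n) (w t)))" for n t
    by (cases "t \<in> {0..T}")
       (simp_all add: Rn_def Fn_def W_def W'_def linear_0[OF lin] linear_0[OF linPn] zero_prod_def[symmetric])
  have sPR: "sqn (\<lambda>t. proj K (R t)) \<le> (2 + 2 * M\<^sup>2) * \<delta>"
  proof -
    \<comment> \<open>\<open>S\<close> agrees with \<open>R\<close> as a functional on
      \<open>K\<close>: \<open>G\<close> is the right side of the limit equation and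
      \<open>\<Gamma>\<close> represents \<open>w'\<close> there. Unlike \<open>R\<close>, it is
      made of approximation errors only, so the projection of \<open>R\<close> is small.\<close>
    define S where "S t = indicator {0..T} t *\<^sub>R (G t - \<Gamma> t) + B t (indicator {0..T} t *\<^sub>R (U t - w t))" for t
    have Uw: "L2t (\<lambda>t. indicator {0..T} t *\<^sub>R (U t - w t))"
    proof -
      have "(\<lambda>t. indicator {0..T} t *\<^sub>R (U t - w t)) = (\<lambda>t. indicator {0..T} t *\<^sub>R U t - W t)"
        by (auto simp: W_def scaleR_diff_right)
      then show ?thesis using L2t_diff(1)[OF L2t_indicator[OF U] W] by simp
    qed
    have G\<Gamma>: "L2t (\<lambda>t. indicator {0..T} t *\<^sub>R (G t - \<Gamma> t))" by (intro L2t_indicator L2t_diff(1) G \<Gamma>) simp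
    have S: "L2t S" "sqn S \<le> 2 * sqn (\<lambda>t. indicator {0..T} t *\<^sub>R (G t - \<Gamma> t)) + 2 * sqn (\<lambda>t. B t (indicator {0..T} t *\<^sub>R (U t - w t)))"
      unfolding S_def by (rule L2t_add[OF G\<Gamma> L2t_B(1)[OF Uw]])+
    have ae: "AE t in lborel. proj K (R t) = proj K (S t)"
      using w\<Gamma>
    proof eventually_elim
      case (elim t)
      show ?case
      proof (rule proj_unique[OF K proj_in[OF K]])
        fix v assume v: "v \<in> K"
        have "S t \<bullet> v = R t \<bullet> v"
        proof (cases "t \<in> {0..T}")
          case True
          have "S t \<bullet> v = ((f t, 0) - B t (U t)) \<bullet> v - fst (w' t) \<bullet> fst v + (B t (U t) - B t (w t)) \<bullet> v"
            using True elim v by (simp add: S_def G_def inner_add_left inner_diff_left linear_diff[OF lin])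
          also have "\<dots> = R t \<bullet> v"
            using True by (simp add: R_eq inner_diff_left) (simp add: inner_prod_def inner_diff_left)
          finally show ?thesis .
        next
          case False
          then show ?thesis by (simp add: S_def R_eq linear_0[OF lin])
        qed
        then show "proj K (S t) \<bullet> v = R t \<bullet> v" by (simp add: proj_inner[OF K v])
      qed
    qed
    have "sqn (\<lambda>t. proj K (R t)) \<le> 1\<^sup>2 * sqn S"
    proof (rule L2t_bound(2)[OF S(1) L2t_measurable[OF PL[OF R]]])
      show "AE t in lborel. norm (proj K (R t)) \<le> 1 * norm (S t)"
        using ae by eventually_elim (simp add: proj_norm_le[OF K])
    qed
    also have "\<dots> \<le> 2 * \<delta> + 2 * (M\<^sup>2 * \<delta>)"
    proof -
      have "M\<^sup>2 * sqn (\<lambda>t. indicator {0..T} t *\<^sub>R (U t - w t)) \<le> M\<^sup>2 * \<delta>"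
        using wU by (intro mult_left_mono) auto
      then show ?thesis using S(2) wG L2t_B(2)[OF Uw] by simp
    qed
    finally show ?thesis by (simp add: algebra_simps)
  qed
  have W_id: "proj K (W t) = W t" for t
    by (rule proj_id[OF K]) (auto simp: W_def indicator_def wK subspace_0[OF K(1)])
  have W'_id: "AE t in lborel. proj K (W' t) = W' t"
    using w'K by eventually_elim (auto simp: W'_def indicator_def subspace_0[OF K(1)] intro!: proj_id[OF K])
  have tR: "(\<lambda>n. sqn (\<lambda>t. Rn n t - R t)) \<longlonglongrightarrow> 0"
  proof (rule Lim_null_comparison[OF always_eventually[OF allI]])
    fix n
    define D1 where "D1 t = Fn n t - F t" for t
    define D2 where "D2 t = (fst (proj (Kn n) (W' t) - proj K (W' t)), 0 :: 'g)" for t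
    define D3 where "D3 t = B t (proj (Kn n) (W t) - proj K (W t))" for t
    have L: "L2t (\<lambda>t. proj (Kn n) (X t) - proj K (X t))" if "L2t X" for X
      by (intro L2t_diff(1) PnL(1) PL that)
    have D1: "L2t D1" unfolding D1_def by (intro L2t_diff(1) Fn F)
    have D2: "L2t D2" "sqn D2 \<le> sqn (\<lambda>t. proj (Kn n) (W' t) - proj K (W' t))"
      unfolding D2_def using DL[OF L[OF W']] by simp_all
    have D3: "L2t D3" "sqn D3 \<le> M\<^sup>2 * sqn (\<lambda>t. proj (Kn n) (W t) - proj K (W t))"
      unfolding D3_def by (rule L2t_B[OF L[OF W]])+
    have D23: "L2t (\<lambda>t. D2 t + D3 t)" "sqn (\<lambda>t. D2 t + D3 t) \<le> 2 * sqn D2 + 2 * sqn D3"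
      by (rule L2t_add[OF D2(1) D3(1)])+
    have eq: "AE t in lborel. Rn n t - R t = D1 t - (D2 t + D3 t)"
      using W'_id by eventually_elim
        (simp add: Rn_def R_def D1_def D2_def D3_def W_id linear_diff[OF lin] prod_eq_iff)
    have "sqn (\<lambda>t. Rn n t - R t) \<le> 1\<^sup>2 * sqn (\<lambda>t. D1 t - (D2 t + D3 t))"
      by (rule L2t_bound(2)[OF L2t_diff(1)[OF D1 D23(1)] L2t_measurable[OF L2t_diff(1)[OF Rn R]]])
         (use eq in \<open>auto elim: eventually_mono\<close>)
    also have "\<dots> \<le> 2 * sqn D1 + 2 * sqn (\<lambda>t. D2 t + D3 t)" using L2t_diff(2)[OF D1 D23(1)] by simp
    also have "sqn D1 = sqn (\<lambda>t. indicator {0..T} t *\<^sub>R (fn n t - f t))"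
      unfolding sqn_def by (rule Bochner_Integration.integral_cong) (auto simp: D1_def Fn_def F_def indicator_def)
    finally show "norm (sqn (\<lambda>t. Rn n t - R t)) \<le> 2 * sqn (\<lambda>t. indicator {0..T} t *\<^sub>R (fn n t - f t))
      + 2 * (2 * sqn (\<lambda>t. proj (Kn n) (W' t) - proj K (W' t)) + 2 * (M\<^sup>2 * sqn (\<lambda>t. proj (Kn n) (W t) - proj K (W t))))"
      using D2(2) D3(2) D23(2) by (simp add: sqn_nonneg)
  next
    have "(\<lambda>n. 2 * sqn (\<lambda>t. indicator {0..T} t *\<^sub>R (fn n t - f t))
      + 2 * (2 * sqn (\<lambda>t. proj (Kn n) (W' t) - proj K (W' t)) + 2 * (M\<^sup>2 * sqn (\<lambda>t. proj (Kn n) (W t) - proj K (W t)))))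
      \<longlonglongrightarrow> 2 * 0 + 2 * (2 * 0 + 2 * (M\<^sup>2 * 0))"
      by (intro tendsto_intros fconv proj_tendsto_L2t K Kn conv W W')
    then show "(\<lambda>n. 2 * sqn (\<lambda>t. indicator {0..T} t *\<^sub>R (fn n t - f t))
      + 2 * (2 * sqn (\<lambda>t. proj (Kn n) (W' t) - proj K (W' t)) + 2 * (M\<^sup>2 * sqn (\<lambda>t. proj (Kn n) (W t) - proj K (W t)))))
      \<longlonglongrightarrow> 0" by simp
  qed
  define r where "r n = 2 * sqn (\<lambda>t. Rn n t - R t) + 2 * sqn (\<lambda>t. proj (Kn n) (R t) - proj K (R t))" for n
  have r0: "r \<longlonglongrightarrow> 0"
  proof -
    have "r \<longlonglongrightarrow> 2 * 0 + 2 * 0" unfolding r_def by (intro tendsto_intros tR proj_tendsto_L2t K Kn conv R)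
    then show ?thesis by simp
  qed
  have sPn: "sqn (\<lambda>t. proj (Kn n) (Rn n t)) \<le> 2 * ((2 + 2 * M\<^sup>2) * \<delta>) + 2 * r n" for n
  proof -
    \<comment> \<open>The projected residual on \<open>Kn n\<close> is the one on \<open>K\<close>
      plus two errors, from replacing \<open>Rn\<close> by \<open>R\<close> (\<open>A1\<close>) and
      from replacing the projection (\<open>A2\<close>); twice the sum of their bounds is
      \<open>r\<close>, up to the factor 2.\<close>
    define A1 where "A1 t = proj (Kn n) (Rn n t - R t)" for t
    define A2 where "A2 t = proj (Kn n) (R t) - proj K (R t)" for t
    have A1: "L2t A1" "sqn A1 \<le> sqn (\<lambda>t. Rn n t - R t)"
      unfolding A1_def by (rule PnL[OF L2t_diff(1)[OF Rn R]])+
    have A2: "L2t A2" unfolding A2_def by (intro L2t_diff(1) PnL(1) PL R)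
    have "sqn (\<lambda>t. proj (Kn n) (Rn n t)) = sqn (\<lambda>t. proj K (R t) + (A1 t + A2 t))"
      by (rule arg_cong[of _ _ sqn]) (auto simp: A1_def A2_def linear_diff[OF linPn])
    also have "\<dots> \<le> 2 * sqn (\<lambda>t. proj K (R t)) + 2 * sqn (\<lambda>t. A1 t + A2 t)"
      by (rule L2t_add(2)[OF PL[OF R] L2t_add(1)[OF A1(1) A2]])
    also have "sqn (\<lambda>t. A1 t + A2 t) \<le> 2 * sqn A1 + 2 * sqn A2" by (rule L2t_add(2)[OF A1(1) A2])
    finally show ?thesis using sPR A1(2) by (simp add: r_def A2_def[abs_def])
  qed
  define q where "q n = (norm (yn n 0 - fst (proj (Kn n) (w 0))))\<^sup>2" for n
  have q: "q \<longlonglongrightarrow> (norm (y 0 - fst (w 0)))\<^sup>2"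
  proof -
    have "q \<longlonglongrightarrow> (norm (y 0 - fst (proj K (w 0))))\<^sup>2"
      unfolding q_def by (intro tendsto_intros init conv)
    then show ?thesis using proj_id[OF K wK[of 0]] T by simp
  qed
  have sq\<delta>: "(norm (y 0 - fst (w 0)))\<^sup>2 < \<delta>"
  proof -
    have "(norm (y 0 - fst (w 0)))\<^sup>2 < \<delta>\<^sup>2"
      using w0 by (intro power_strict_mono) (auto simp: norm_minus_commute)
    also have "\<delta>\<^sup>2 \<le> \<delta>" using \<delta> by (simp add: power2_eq_square mult_le_one)
    finally show ?thesis .
  qed
  have bd_exp: "2 * (a + s / (2 * \<kappa>)) * exp (4 * \<mu> * T) \<le> C * \<delta>"
    if "a \<le> 2 * \<delta>" "s \<le> (5 + 4 * M\<^sup>2) * \<delta>" for a s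
  proof -
    have "s / (2 * \<kappa>) \<le> (5 + 4 * M\<^sup>2) * \<delta> / (2 * \<kappa>)" using that pos by (intro divide_right_mono) auto
    then have "2 * (a + s / (2 * \<kappa>)) * exp (4 * \<mu> * T) \<le> 2 * (2 * \<delta> + (5 + 4 * M\<^sup>2) * \<delta> / (2 * \<kappa>)) * exp (4 * \<mu> * T)"
      using that by (intro mult_right_mono mult_left_mono add_mono) auto
    also have "\<dots> = C * \<delta>" by (simp add: C_def algebra_simps)
    finally show ?thesis .
  qed
  have small: "norm x < e/3" if "(norm x)\<^sup>2 \<le> C * \<delta>" for x :: 'h
    using that \<delta>(3) e by (intro power2_less_imp_less[of "norm x" "e/3"]) auto
  have yw: "norm (y t - fst (w t)) < e/3" if "t \<in> {0..T}" for t
  proof (rule small)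
    have "(norm (y t - fst (w t)))\<^sup>2 \<le> 2 * ((norm (y 0 - fst (w 0)))\<^sup>2 + sqn (\<lambda>t. proj K (R t)) / (2 * \<kappa>)) * exp (4 * \<mu> * T)"
      by (rule energy_estimate[OF sol K T w' w wK wint R_eq R]) (use that in auto)
    also have "\<dots> \<le> C * \<delta>"
    proof (rule bd_exp)
      have "(2 + 2 * M\<^sup>2) * \<delta> \<le> (5 + 4 * M\<^sup>2) * \<delta>" using \<delta>(1) by (intro mult_right_mono) auto
      then show "sqn (\<lambda>t. proj K (R t)) \<le> (5 + 4 * M\<^sup>2) * \<delta>" using sPR by simp
    qed (use sq\<delta> \<delta> in auto)
    finally show "(norm (y t - fst (w t)))\<^sup>2 \<le> C * \<delta>" .
  qed
  have ynw: "(norm (yn n t - fst (proj (Kn n) (w t))))\<^sup>2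
      \<le> 2 * (q n + sqn (\<lambda>t. proj (Kn n) (Rn n t)) / (2 * \<kappa>)) * exp (4 * \<mu> * T)" if "t \<in> {0..T}" for n t
    unfolding q_def
  proof (rule energy_estimate[OF soln Kn T PnL(1)[OF w'] _ _ _ Rn_eq Rn])
    show "continuous_on UNIV (\<lambda>t. proj (Kn n) (w t))"
      by (rule bounded_linear.continuous_on[OF bounded_linear_proj[OF Kn] w])
    show "proj (Kn n) (w t) \<in> Kn n" for t by (rule proj_in[OF Kn])
    fix s t :: real assume "s \<le> t"
    have "integrable lborel (\<lambda>\<tau>. indicator {s..t} \<tau> *\<^sub>R w' \<tau>)"
      using L2t_set_integrable[OF w', of s t] by (simp add: set_integrable_def)
    then have "proj (Kn n) (LINT \<tau>:{s..t}|lborel. w' \<tau>) = (LINT \<tau>:{s..t}|lborel. proj (Kn n) (w' \<tau>))"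
      unfolding set_lebesgue_integral_def
      by (subst integral_bounded_linear[OF bounded_linear_proj[OF Kn], symmetric]) (auto simp: linear_scale[OF linPn])
    then show "proj (Kn n) (w t) - proj (Kn n) (w s) = (LINT \<tau>:{s..t}|lborel. proj (Kn n) (w' \<tau>))"
      using wint[OF \<open>s \<le> t\<close>] by (simp add: linear_diff[OF linPn, symmetric])
  qed (use that in auto)
  \<comment> \<open>A bound uniform in \<open>t\<close>: the projection error of \<open>w t\<close>
    is that of \<open>w 0\<close> plus the integral of that of \<open>w'\<close>, which
    Cauchy-Schwarz bounds over the whole interval.\<close>
  define m where "m n = norm (proj (Kn n) (w 0) - proj K (w 0)) + sqrt T * sqrt (sqn (\<lambda>t. proj (Kn n) (w' t) - proj K (w' t)))" for n
  have m0: "m \<longlonglongrightarrow> 0"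
  proof -
    have "m \<longlonglongrightarrow> norm (proj K (w 0) - proj K (w 0)) + sqrt T * sqrt 0"
      unfolding m_def by (intro tendsto_intros proj_tendsto_L2t K Kn conv w')
    then show ?thesis by simp
  qed
  have mw: "norm (proj (Kn n) (w t) - w t) \<le> m n" if t: "t \<in> {0..T}" for n t
  proof -
    define Q where "Q x = proj (Kn n) x - proj K x" for x
    have Q: "bounded_linear Q" unfolding Q_def by (intro bounded_linear_sub bounded_linear_proj K Kn)
    have QL: "L2t (\<lambda>\<tau>. Q (w' \<tau>))" unfolding Q_def by (intro L2t_diff(1) PnL(1) PL w')
    have i: "integrable lborel (\<lambda>\<tau>. indicator {0..t} \<tau> *\<^sub>R w' \<tau>)"
      using L2t_set_integrable[OF w', of 0 t] by (simp add: set_integrable_def)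
    have wt: "w t = w 0 + (LINT \<tau>:{0..t}|lborel. w' \<tau>)"
      using wint[of 0 t] t by (simp add: diff_eq_eq add.commute)
    have "proj (Kn n) (w t) - w t = Q (w t)" using proj_id[OF K wK[OF t]] by (simp add: Q_def)
    also have "\<dots> = Q (w 0) + (LINT \<tau>:{0..t}|lborel. Q (w' \<tau>))"
      unfolding wt set_lebesgue_integral_def linear_add[OF bounded_linear.linear[OF Q]]
      by (subst integral_bounded_linear[OF Q i, symmetric]) (simp add: linear_scale[OF bounded_linear.linear[OF Q]])
    also have "norm \<dots> \<le> norm (Q (w 0)) + norm (LINT \<tau>:{0..t}|lborel. Q (w' \<tau>))" by (rule norm_triangle_ineq)
    also have "norm (LINT \<tau>:{0..t}|lborel. Q (w' \<tau>)) \<le> (LINT \<tau>:{0..t}|lborel. norm (Q (w' \<tau>)))"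
      by (rule set_integral_norm_bound[OF L2t_set_integrable[OF QL]])
    also have "\<dots> \<le> sqrt (t - 0) * sqrt (sqn (\<lambda>\<tau>. Q (w' \<tau>)))"
      by (rule L2t_set_integral_norm_le[OF QL]) (use t in simp)
    also have "\<dots> \<le> sqrt T * sqrt (sqn (\<lambda>\<tau>. Q (w' \<tau>)))"
      using t by (intro mult_right_mono) (auto simp: sqn_nonneg)
    finally show ?thesis by (simp add: m_def Q_def)
  qed
  have "\<forall>\<^sub>F n in sequentially. q n < 2 * \<delta>" by (rule order_tendstoD(2)[OF q]) (use sq\<delta> \<delta> in simp)
  moreover have "\<forall>\<^sub>F n in sequentially. r n < \<delta> / 2" by (rule order_tendstoD(2)[OF r0]) (use \<delta> in simp)
  moreover have "\<forall>\<^sub>F n in sequentially. m n < e / 3" by (rule order_tendstoD(2)[OF m0]) (use e in simp)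
  ultimately show ?thesis
  proof eventually_elim
    case (elim n)
    show ?case
    proof
      fix t assume t: "t \<in> {0..T}"
      have "norm (yn n t - fst (proj (Kn n) (w t))) < e/3"
      proof (rule small, rule order_trans[OF ynw[OF t]], rule bd_exp)
        show "q n \<le> 2 * \<delta>" using elim by simp
        show "sqn (\<lambda>t. proj (Kn n) (Rn n t)) \<le> (5 + 4 * M\<^sup>2) * \<delta>"
          using sPn[of n] elim(2) by (simp add: algebra_simps)
      qed
      moreover have "norm (fst (proj (Kn n) (w t)) - fst (w t)) < e/3"
      proof -
        have "norm (fst (proj (Kn n) (w t) - w t)) \<le> norm (proj (Kn n) (w t) - w t)"
          by (metis norm_fst_le prod.collapse)
        then show ?thesis using mw[OF t, of n] elim(3) by simp
      qed
      moreover have "norm (fst (w t) - y t) < e/3" using yw[OF t] by (simp add: norm_minus_commute)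
      moreover have "norm (yn n t - y t) \<le> norm (yn n t - fst (proj (Kn n) (w t)))
          + norm (fst (proj (Kn n) (w t)) - fst (w t)) + norm (fst (w t) - y t)"
      proof -
        have "yn n t - y t = (yn n t - fst (proj (Kn n) (w t))) + (fst (proj (Kn n) (w t)) - fst (w t)) + (fst (w t) - y t)"
          by simp
        then show ?thesis by (metis norm_triangle_mono norm_triangle_ineq order_refl)
      qed
      ultimately show "norm (yn n t - y t) < e" by linarith
    qed
  qed
qed

section \<open>Test functions\<close>

text \<open>The standard smooth function that vanishes on the negative half-line, divided by powers.
  The powers make the family closed under differentiation up to linear combinations.\<close>

definition flat :: "nat \<Rightarrow> real \<Rightarrow> real" where
  "flat k s = (if s > 0 then exp (- (1/s)) / s ^ k else 0)"

lemma flat_tendsto_0: "(flat k \<longlongrightarrow> 0) (at 0)"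
proof -
  have "((\<lambda>s::real. inverse s ^ k / exp (inverse s)) \<longlongrightarrow> 0) (at_right 0)"
    by (rule filterlim_compose[OF tendsto_power_div_exp_0 filterlim_inverse_at_top_right])
  then have "(flat k \<longlongrightarrow> 0) (at_right 0)"
    by (rule Lim_transform_eventually)
       (auto simp: flat_def eventually_at_right_field exp_minus field_simps power_inverse intro!: exI[of _ 1])
  moreover have "(flat k \<longlongrightarrow> 0) (at_left 0)"
    by (rule tendsto_eventually) (auto simp: flat_def eventually_at_left_field intro!: exI[of _ "-1"])
  ultimately show ?thesis by (simp add: filterlim_at_split)
qed

lemma flat_deriv: "(flat k has_real_derivative (flat (k + 2) s - real k * flat (k + 1) s)) (at s)"
proof -
  consider "s > 0" | "s < 0" | "s = 0" by linarith
  then show ?thesis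
  proof cases
    case 1
    have "((\<lambda>s. exp (- (1/s)) / s ^ k) has_real_derivative (flat (k + 2) s - real k * flat (k + 1) s)) (at s)"
    proof -
      have pw: "((\<lambda>s. s ^ k) has_real_derivative (real k * s ^ k / s)) (at s)"
        using DERIV_pow[of k s UNIV] 1 by (cases k) auto
      have ex: "((\<lambda>s. exp (- (1/s))) has_real_derivative (exp (- (1/s)) / s\<^sup>2)) (at s)"
        using 1 by (auto intro!: derivative_eq_intros simp: power2_eq_square)
      have "(exp (- (1/s)) / s\<^sup>2 * s ^ k - exp (- (1/s)) * (real k * s ^ k / s)) / (s ^ k * s ^ k)
          = flat (k + 2) s - real k * flat (k + 1) s"
        using 1 by (simp add: flat_def field_simps power2_eq_square)
      then show ?thesis using DERIV_divide[OF ex pw] 1 by simp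
    qed
    then show ?thesis
      by (rule has_field_derivative_transform_within_open[of _ _ _ "{0<..}"]) (use 1 in \<open>auto simp: flat_def\<close>)
  next
    case 2
    have "((\<lambda>s. 0) has_real_derivative (flat (k + 2) s - real k * flat (k + 1) s)) (at s)"
      using 2 by (simp add: flat_def)
    then show ?thesis
      by (rule has_field_derivative_transform_within_open[of _ _ _ "{..<0}"]) (use 2 in \<open>auto simp: flat_def\<close>)
  next
    case 3
    \<comment> \<open>At 0 the difference quotient of \<open>flat k\<close> is
      \<open>flat (Suc k)\<close>, so differentiability there reduces to the limit of the next
      member of the family.\<close>
    have "((\<lambda>h. (flat k (0 + h) - flat k 0) / h) \<longlongrightarrow> 0) (at 0)"
      using flat_tendsto_0[of "Suc k"]
      by (rule Lim_transform_eventually) (auto simp: flat_def field_simps)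
    then show ?thesis using 3 by (simp add: DERIV_def flat_def)
  qed
qed

lemma flat_0_bounds: "0 \<le> flat 0 s" "flat 0 s \<le> 1"
  by (auto simp: flat_def)

text \<open>This class is closed under directional derivatives, which yields the smoothness of the bump
  functions below.\<close>

inductive flat_alg :: "('a::euclidean_space \<Rightarrow> real) \<Rightarrow> bool" where
  const: "flat_alg (\<lambda>x. c)"
| comp: "flat_alg (\<lambda>x. flat k (a \<bullet> x + d))"
| add: "flat_alg f \<Longrightarrow> flat_alg g \<Longrightarrow> flat_alg (\<lambda>x. f x + g x)"
| mult: "flat_alg f \<Longrightarrow> flat_alg g \<Longrightarrow> flat_alg (\<lambda>x. f x * g x)"

lemma flat_alg_prod: "finite I \<Longrightarrow> (\<And>i. i \<in> I \<Longrightarrow> flat_alg (f i)) \<Longrightarrow> flat_alg (\<lambda>x. \<Prod>i\<in>I. f i x)"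
  by (induction I rule: finite_induct) (auto intro: flat_alg.intros)

lemma flat_alg_derivative:
  "flat_alg f \<Longrightarrow> \<exists>f'. (\<forall>x. (f has_derivative f' x) (at x)) \<and> (\<forall>v. flat_alg (\<lambda>x. f' x v))"
proof (induction rule: flat_alg.induct)
  case (const c)
  show ?case by (rule exI[of _ "\<lambda>x v. 0"]) (auto intro: flat_alg.const)
next
  case (comp k a d)
  let ?f' = "\<lambda>x v. (a \<bullet> v) * (flat (k + 2) (a \<bullet> x + d) + (- real k) * flat (k + 1) (a \<bullet> x + d))"
  have "((\<lambda>x. flat k (a \<bullet> x + d)) has_derivative ?f' x) (at x)" for x
  proof -
    have "((\<lambda>x. a \<bullet> x + d) has_derivative (\<lambda>v. a \<bullet> v)) (at x)" by (auto intro!: derivative_eq_intros)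
    from has_derivative_compose[OF this, OF flat_deriv[of k "a \<bullet> x + d", unfolded has_field_derivative_def]]
    show ?thesis by (simp add: mult.commute)
  qed
  moreover have "flat_alg (\<lambda>x. ?f' x v)" for v by (intro flat_alg.intros)
  ultimately show ?case by (intro exI[of _ ?f']) simp
next
  case (add f g)
  then obtain f' g' where *: "\<forall>x. (f has_derivative f' x) (at x)" "\<forall>v. flat_alg (\<lambda>x. f' x v)"
    "\<forall>x. (g has_derivative g' x) (at x)" "\<forall>v. flat_alg (\<lambda>x. g' x v)" by blast
  show ?case
    by (rule exI[of _ "\<lambda>x v. f' x v + g' x v"]) (use * in \<open>auto intro: has_derivative_add flat_alg.add\<close>)
next
  case (mult f g)
  then obtain f' g' where *: "\<forall>x. (f has_derivative f' x) (at x)" "\<forall>v. flat_alg (\<lambda>x. f' x v)"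
    "\<forall>x. (g has_derivative g' x) (at x)" "\<forall>v. flat_alg (\<lambda>x. g' x v)" by blast
  show ?case
    by (rule exI[of _ "\<lambda>x v. f x * g' x v + f' x v * g x"])
       (use * mult in \<open>auto intro!: has_derivative_mult flat_alg.add flat_alg.mult\<close>)
qed

lemma flat_alg_dir_deriv:
  assumes "flat_alg f"
  shows "f differentiable_on UNIV" "flat_alg (dir_deriv v f)"
proof -
  obtain f' where f': "\<And>x. (f has_derivative f' x) (at x)" "\<And>v. flat_alg (\<lambda>x. f' x v)"
    using flat_alg_derivative[OF assms] by blast
  show "f differentiable_on UNIV" using f'(1) by (auto simp: differentiable_on_def differentiable_def)
  have "dir_deriv v f = (\<lambda>x. f' x v)"
    unfolding dir_deriv_def using frechet_derivative_at[OF f'(1)] by (simp add: fun_eq_iff)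
  then show "flat_alg (dir_deriv v f)" using f'(2) by simp
qed

text \<open>Only the first derivatives have to belong to the class. This admits primitives of bumps,
  which are not visibly members of it themselves.\<close>

lemma smoothI:
  assumes "f differentiable_on UNIV" "\<And>v. flat_alg (dir_deriv v f)"
  shows "smooth f"
  unfolding smooth_def
proof
  fix vs
  have "flat_alg (foldr dir_deriv us g) \<and> foldr dir_deriv us g differentiable_on UNIV" if "flat_alg g" for us and g :: "'a \<Rightarrow> real"
    by (induction us) (use that flat_alg_dir_deriv in auto)
  then show "foldr dir_deriv vs f differentiable_on UNIV"
    \<comment> \<open>\<open>foldr\<close> applies the last vector of the list first, so the first
      differentiation is split off at the end of the list.\<close>
    using assms by (cases vs rule: rev_cases) auto
qed

lemma flat_alg_smooth: "flat_alg f \<Longrightarrow> smooth f"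
  by (intro smoothI flat_alg_dir_deriv)

lemma smooth_dir_deriv: "smooth f \<Longrightarrow> smooth (dir_deriv v f)"
  unfolding smooth_def
proof
  fix vs assume "\<forall>vs. foldr dir_deriv vs f differentiable_on UNIV"
  from this[rule_format, of "vs @ [v]"]
  show "foldr dir_deriv vs (dir_deriv v f) differentiable_on UNIV" by simp
qed

lemma smooth_differentiable: "smooth f \<Longrightarrow> f differentiable (at x)"
  unfolding smooth_def by (metis UNIV_I at_within_open differentiable_on_def foldr_Nil id_apply open_UNIV)

lemma smooth_continuous: "smooth f \<Longrightarrow> continuous_on UNIV f"
  by (simp add: continuous_at_imp_continuous_on differentiable_imp_continuous_within smooth_differentiable)

lemma dir_deriv_zero_off_support:
  assumes "x \<notin> closure {x. f x \<noteq> 0}"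
  shows "dir_deriv v f x = 0"
proof -
  have "((\<lambda>x. 0) has_derivative (\<lambda>v. 0)) (at x)" by simp
  then have "(f has_derivative (\<lambda>v. 0)) (at x)"
    by (rule has_derivative_transform_within_open[of _ _ _ _ "- closure {x. f x \<noteq> 0}"])
       (use assms closure_subset[of "{x. f x \<noteq> 0}"] in auto)
  then show ?thesis unfolding dir_deriv_def using frechet_derivative_at by metis
qed

lemma compact_closure_subset: "compact C \<Longrightarrow> closure A \<subseteq> C \<Longrightarrow> compact (closure A)"
  by (metis closed_closure compact_Int_closed inf.absorb_iff2)

lemma dir_deriv_test_function:
  assumes "\<phi> \<in> test_functions S"
  shows "dir_deriv v \<phi> \<in> test_functions S"
proof -
  have "closure {x. dir_deriv v \<phi> x \<noteq> 0} \<subseteq> closure {x. \<phi> x \<noteq> 0}"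
    using dir_deriv_zero_off_support[of _ \<phi> v] by (intro closure_minimal) auto
  then show ?thesis
    using assms smooth_dir_deriv[of \<phi> v] compact_closure_subset[of "closure {x. \<phi> x \<noteq> 0}"]
    by (auto simp: test_functions_def)
qed

lemma test_function_sq_int:
  assumes "\<phi> \<in> test_functions S"
  shows "sq_int \<phi>"
proof -
  define C where "C = closure {x. \<phi> x \<noteq> 0}"
  have C: "compact C" and c: "continuous_on UNIV \<phi>"
    using assms smooth_continuous by (auto simp: test_functions_def C_def)
  have [measurable]: "\<phi> \<in> borel_measurable borel" using c by (rule borel_measurable_continuous_onI)
  have "integrable lborel (\<lambda>x. indicator C x *\<^sub>R (norm (\<phi> x))\<^sup>2)"
    by (rule borel_integrable_compact[OF C]) (intro continuous_intros continuous_on_subset[OF c], simp)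
  also have "(\<lambda>x. indicator C x *\<^sub>R (norm (\<phi> x))\<^sup>2) = (\<lambda>x. (norm (\<phi> x))\<^sup>2)"
  proof
    fix x
    have "\<phi> x = 0" if "x \<notin> C" using that closure_subset[of "{x. \<phi> x \<noteq> 0}"] by (auto simp: C_def)
    then show "indicator C x *\<^sub>R (norm (\<phi> x))\<^sup>2 = (norm (\<phi> x))\<^sup>2" by (auto simp: indicator_def)
  qed
  finally show ?thesis by (simp add: sq_int_def)
qed

lemma test_function_zero_off: "\<phi> \<in> test_functions S \<Longrightarrow> x \<notin> S \<Longrightarrow> \<phi> x = 0"
  using closure_subset[of "{x. \<phi> x \<noteq> 0}"] by (auto simp: test_functions_def)

section \<open>Box bumps and the fundamental lemma of the calculus of variations\<close>

text \<open>\<open>m\<close> is a steepness parameter: the support stays in the closed box while the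
  values tend to the indicator of the open box as \<open>m\<close> grows.\<close>

definition bump :: "real \<Rightarrow> 'a::euclidean_space \<Rightarrow> 'a \<Rightarrow> 'a \<Rightarrow> real" where
  "bump m a b x = (\<Prod>i\<in>Basis. flat 0 (m * (x \<bullet> i - a \<bullet> i)) * flat 0 (m * (b \<bullet> i - x \<bullet> i)))"

lemma bump_flat_alg: "flat_alg (bump m a b)"
proof -
  have eq: "bump m a b = (\<lambda>x. \<Prod>i\<in>Basis. flat 0 ((m *\<^sub>R i) \<bullet> x + - (m * (a \<bullet> i))) * flat 0 (((- m) *\<^sub>R i) \<bullet> x + m * (b \<bullet> i)))"
    by (auto simp: bump_def fun_eq_iff algebra_simps inner_commute)
  show ?thesis unfolding eq by (intro flat_alg_prod flat_alg.intros) auto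
qed

lemma bump_bounds: "0 \<le> bump m a b x" "bump m a b x \<le> 1"
  unfolding bump_def
  by (auto intro!: prod_nonneg prod_le_1 mult_nonneg_nonneg mult_le_one flat_0_bounds)

lemma bump_nonzero: "m > 0 \<Longrightarrow> bump m a b x \<noteq> 0 \<Longrightarrow> x \<in> box a b"
  by (auto simp: bump_def flat_def box_def zero_less_mult_iff split: if_splits)

lemma bump_pos: "m > 0 \<Longrightarrow> x \<in> box a b \<Longrightarrow> bump m a b x > 0"
  unfolding bump_def by (intro prod_pos) (auto simp: flat_def box_def)

lemma bump_test_function:
  assumes "m > 0" "cbox a b \<subseteq> S"
  shows "bump m a b \<in> test_functions S"
proof -
  have "closure {x. bump m a b x \<noteq> 0} \<subseteq> cbox a b"
    using bump_nonzero[OF assms(1)] box_subset_cbox by (intro closure_minimal) blast+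
  then show ?thesis
    using assms(2) flat_alg_smooth[OF bump_flat_alg, of m a b]
      compact_closure_subset[OF compact_cbox[of a b], of "{x. bump m a b x \<noteq> 0}"]
    by (auto simp: test_functions_def)
qed

lemma bump_tendsto: "(\<lambda>m. bump (real (Suc m)) a b x) \<longlonglongrightarrow> indicator (box a b) x"
proof (cases "x \<in> box a b")
  case True
  have fl: "(\<lambda>m. flat 0 (real (Suc m) * s)) \<longlonglongrightarrow> 1" if "s > 0" for s
  proof -
    have "(\<lambda>m. exp (- (inverse (real (Suc m)) * (1 / s)))) \<longlonglongrightarrow> exp (- (0 * (1/s)))"
      by (intro tendsto_intros LIMSEQ_inverse_real_of_nat)
    moreover have "flat 0 (real (Suc m) * s) = exp (- (inverse (real (Suc m)) * (1 / s)))" for m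
    proof -
      have "0 < real (Suc m) * s" using that by simp
      then show ?thesis by (simp add: flat_def field_simps)
    qed
    ultimately show ?thesis by simp
  qed
  have "(\<lambda>m. bump (real (Suc m)) a b x) \<longlonglongrightarrow> (\<Prod>i\<in>(Basis::'a set). 1 * 1)"
    unfolding bump_def using True by (intro tendsto_prod tendsto_mult fl) (auto simp: box_def)
  then show ?thesis using True by simp
next
  case False
  then have "bump (real (Suc m)) a b x = 0" for m using bump_nonzero[of "real (Suc m)" a b x] by auto
  then show ?thesis using False by simp
qed

text \<open>Bumps in a box inside \<open>\<Omega>\<close> converge boundedly to its indicator, so
  vanishing test integrals imply vanishing box integrals, and differentiation of integrals finishes
  the argument.\<close>

lemma AE_zero_of_test_integrals:
  fixes g :: "'a::euclidean_space \<Rightarrow> real"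
  assumes "open \<Omega>" and g: "g \<in> L2 \<Omega>"
    and zero: "\<And>\<phi>. \<phi> \<in> test_functions \<Omega> \<Longrightarrow> (LINT x|lebesgue_on \<Omega>. g x * \<phi> x) = 0"
  shows "AE x in lebesgue_on \<Omega>. g x = 0"
proof -
  have \<Omega>: "\<Omega> \<in> sets lebesgue" using \<open>open \<Omega>\<close> by simp
  define g0 where "g0 = extend0 \<Omega> g"
  have g0: "g0 \<in> L2 UNIV" using g by (simp add: g0_def L2_extend0_iff[OF \<Omega>])
  then have [measurable]: "g0 \<in> borel_measurable lebesgue" by (simp add: L2_UNIV)
  have int: "set_integrable lebesgue (cbox a b) g0" for a b
  proof -
    have "sq_int (indicator (cbox a b) :: 'a \<Rightarrow> real)"
    proof -
      have "(\<lambda>x. (norm (indicator (cbox a b) x :: real))\<^sup>2) = (indicator (cbox a b) :: 'a \<Rightarrow> real)"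
        by (auto simp: indicator_def)
      then show ?thesis by (auto simp: sq_int_def emeasure_lborel_cbox_eq intro!: integrable_real_indicator)
    qed
    from inner_l2_of(2)[OF sq_int_imp_L2[OF this] g0] show ?thesis by (simp add: set_integrable_def)
  qed
  have "AE x in lebesgue. x \<in> \<Omega> \<longrightarrow> g0 x = 0"
  proof (rule AE_zero_of_box_integrals[OF \<open>open \<Omega>\<close> int])
    fix a b assume ab: "cbox a b \<subseteq> \<Omega>"
    have bm[measurable]: "bump m a b \<in> borel_measurable lebesgue" for m
    proof -
      have "bump m a b \<in> borel_measurable borel"
        by (rule borel_measurable_continuous_onI[OF smooth_continuous[OF flat_alg_smooth[OF bump_flat_alg]]])
      then show ?thesis by (intro measurable_completion) simp
    qed
    have z: "(LINT x|lebesgue. g0 x * bump (real (Suc m)) a b x) = 0" for m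
    proof -
      have "(LINT x|lebesgue. g0 x * bump (real (Suc m)) a b x) = (LINT x|lebesgue_on \<Omega>. g x * bump (real (Suc m)) a b x)"
      proof -
        have "(\<lambda>x. g0 x * bump (real (Suc m)) a b x) = (\<lambda>x. indicator \<Omega> x *\<^sub>R (g x * bump (real (Suc m)) a b x))"
          by (auto simp: g0_def extend0_def indicator_def)
        then show ?thesis
          using \<Omega> by (subst Bochner_Integration.integral_restrict_space) (auto simp del: of_nat_Suc)
      qed
      also have "\<dots> = 0" by (rule zero, rule bump_test_function[OF _ ab]) simp
      finally show ?thesis .
    qed
    have "(\<lambda>m. LINT x|lebesgue. g0 x * bump (real (Suc m)) a b x) \<longlonglongrightarrow> (LINT x|lebesgue. g0 x * indicator (box a b) x)"
    proof (rule integral_dominated_convergence[where w="\<lambda>x. norm (indicator (cbox a b) x *\<^sub>R g0 x)"])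
      show "integrable lebesgue (\<lambda>x. norm (indicator (cbox a b) x *\<^sub>R g0 x))"
        using int[of a b] unfolding set_integrable_def by (rule integrable_norm)
      show "AE x in lebesgue. (\<lambda>m. g0 x * bump (real (Suc m)) a b x) \<longlonglongrightarrow> g0 x * indicator (box a b) x"
        by (intro AE_I2 tendsto_mult_left bump_tendsto)
      fix m
      show "AE x in lebesgue. norm (g0 x * bump (real (Suc m)) a b x) \<le> norm (indicator (cbox a b) x *\<^sub>R g0 x)"
      proof (rule AE_I2)
        fix x
        show "norm (g0 x * bump (real (Suc m)) a b x) \<le> norm (indicator (cbox a b) x *\<^sub>R g0 x)"
        proof (cases "bump (real (Suc m)) a b x = 0")
          case False
          then have "x \<in> cbox a b" using bump_nonzero[of "real (Suc m)" a b x] box_subset_cbox by auto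
          then show ?thesis using bump_bounds[of "real (Suc m)" a b x] by (simp add: abs_mult mult_left_le)
        qed simp
      qed
    qed (auto intro!: borel_measurable_times borel_measurable_indicator bm \<open>g0 \<in> borel_measurable lebesgue\<close>)
    then have "(LINT x|lebesgue. g0 x * indicator (box a b) x) = 0" unfolding z by (simp add: LIMSEQ_const_iff)
    then show "(LINT x:box a b|lebesgue. g0 x) = 0" by (simp add: set_lebesgue_integral_def mult.commute)
  qed
  then show ?thesis unfolding AE_lebesgue_on_iff[OF \<Omega>] by eventually_elim (simp add: g0_def extend0_def)
qed

section \<open>The space $H^1$ as a closed subspace\<close>

lemma L2_nth:
  fixes g :: "'a::euclidean_space \<Rightarrow> real^'n"
  assumes "S \<in> sets lebesgue" "g \<in> L2 S"
  shows "(\<lambda>x. g x $ i) \<in> L2 S"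
proof -
  have g: "g \<in> borel_measurable (lebesgue_on S)" "integrable (lebesgue_on S) (\<lambda>x. (norm (g x))\<^sup>2)"
    using assms by (auto simp: L2_def)
  have [measurable]: "(\<lambda>x. g x $ i) \<in> borel_measurable (lebesgue_on S)"
    using g(1) by (rule measurable_compose) (simp add: borel_measurable_continuous_onI continuous_on_component)
  have "integrable (lebesgue_on S) (\<lambda>x. (norm (g x $ i))\<^sup>2)"
  proof (rule Bochner_Integration.integrable_bound[OF g(2)])
    have "(g x $ i)\<^sup>2 \<le> (norm (g x))\<^sup>2" for x
      by (metis abs_ge_zero component_le_norm_cart power2_abs power_mono)
    then show "AE x in lebesgue_on S. norm ((norm (g x $ i))\<^sup>2) \<le> norm ((norm (g x))\<^sup>2)" by simp
  qed measurable
  then show ?thesis by (simp add: L2_def)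
qed

text \<open>The difference of corresponding components annihilates all test functions. This removes
  the dependence on the representative chosen in \<open>weak_grad\<close>.\<close>

lemma weak_gradient_unique:
  fixes g h :: "real^'n \<Rightarrow> real^'n"
  assumes "open \<Omega>" "g \<in> L2 \<Omega>" "h \<in> L2 \<Omega>" "has_weak_gradient \<Omega> v g" "has_weak_gradient \<Omega> v h"
  shows "AE x in lebesgue_on \<Omega>. g x = h x"
proof -
  have \<Omega>: "\<Omega> \<in> sets lebesgue" using \<open>open \<Omega>\<close> by simp
  have "AE x in lebesgue_on \<Omega>. g x $ i - h x $ i = 0" for i
  proof (rule AE_zero_of_test_integrals[OF \<open>open \<Omega>\<close>])
    have L: "(\<lambda>x. g x $ i) \<in> L2 \<Omega>" "(\<lambda>x. h x $ i) \<in> L2 \<Omega>" using assms L2_nth[OF \<Omega>] by auto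
    then show "(\<lambda>x. g x $ i - h x $ i) \<in> L2 \<Omega>" by (rule L2_diff[OF \<Omega>])
    fix \<phi> assume \<phi>: "\<phi> \<in> test_functions \<Omega>"
    have \<phi>L: "\<phi> \<in> L2 \<Omega>"
    proof -
      have "extend0 \<Omega> \<phi> = \<phi>" using test_function_zero_off[OF \<phi>] by (auto simp: extend0_def)
      then show ?thesis using sq_int_imp_L2[OF test_function_sq_int[OF \<phi>]] L2_extend0_iff[OF \<Omega>, of \<phi>] by simp
    qed
    have i: "integrable (lebesgue_on \<Omega>) (\<lambda>x. g x $ i * \<phi> x)" "integrable (lebesgue_on \<Omega>) (\<lambda>x. h x $ i * \<phi> x)"
      using integrable_inner_L2[OF \<Omega> L(1) \<phi>L] integrable_inner_L2[OF \<Omega> L(2) \<phi>L] by auto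
    have "(LINT x|lebesgue_on \<Omega>. v x * dir_deriv (axis i 1) \<phi> x) = - (LINT x|lebesgue_on \<Omega>. g x $ i * \<phi> x)"
      "(LINT x|lebesgue_on \<Omega>. v x * dir_deriv (axis i 1) \<phi> x) = - (LINT x|lebesgue_on \<Omega>. h x $ i * \<phi> x)"
      using assms(4,5) \<phi> unfolding has_weak_gradient_def by blast+
    then have "(LINT x|lebesgue_on \<Omega>. g x $ i * \<phi> x) = (LINT x|lebesgue_on \<Omega>. h x $ i * \<phi> x)" by linarith
    then show "(LINT x|lebesgue_on \<Omega>. (g x $ i - h x $ i) * \<phi> x) = 0"
      using i by (simp add: left_diff_distrib)
  qed
  then have "AE x in lebesgue_on \<Omega>. \<forall>i\<in>UNIV. g x $ i - h x $ i = 0"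
    unfolding AE_ball_countable[OF countable_finite[OF finite[of "UNIV :: 'n set"]]] by blast
  then show ?thesis by eventually_elim (simp add: vec_eq_iff)
qed

definition H1_emb :: "(real^'n) set \<Rightarrow> (real^'n \<Rightarrow> real) \<Rightarrow> (real^'n, real) l2 \<times> (real^'n, real^'n) l2" where
  "H1_emb \<Omega> v = (l2_ext \<Omega> v, l2_ext \<Omega> (weak_grad \<Omega> v))"

text \<open>Membership in \<open>K\<close> is described by orthogonality relations: the first two
  families force function and gradient to vanish outside \<open>\<Omega>\<close>, the third is the
  weak gradient identity for \<open>\<phi>\<close> and the direction \<open>i\<close>. Described in
  this way, \<open>K\<close> is visibly a closed subspace.\<close>

definition H1_constraints :: "(real^'n) set \<Rightarrow> ((real^'n, real) l2 \<times> (real^'n, real^'n) l2) set" where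
  "H1_constraints \<Omega> =
     {(l2_of f, 0) | f. f \<in> L2 UNIV \<and> (\<forall>x\<in>\<Omega>. f x = 0)} \<union> {(0, l2_of f) | f. f \<in> L2 UNIV \<and> (\<forall>x\<in>\<Omega>. f x = 0)} \<union>
     {(l2_of (dir_deriv (axis i 1) \<phi>), l2_of (\<lambda>x. \<phi> x *\<^sub>R axis i 1)) | \<phi> i. \<phi> \<in> test_functions \<Omega>}"

definition H1_space :: "(real^'n) set \<Rightarrow> ((real^'n, real) l2 \<times> (real^'n, real^'n) l2) set" where
  "H1_space \<Omega> = {x. \<forall>z\<in>H1_constraints \<Omega>. x \<bullet> z = 0}"

lemma vanishing_constraint:
  assumes "f \<in> L2 UNIV" "\<And>x. x \<in> \<Omega> \<Longrightarrow> f x = 0"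
  shows "(l2_of f, 0) \<in> H1_constraints \<Omega>"
  using assms unfolding H1_constraints_def by blast

lemma vanishing_constraint_grad:
  assumes "f \<in> L2 UNIV" "\<And>x. x \<in> \<Omega> \<Longrightarrow> f x = 0"
  shows "(0, l2_of f) \<in> H1_constraints \<Omega>"
  using assms unfolding H1_constraints_def by blast

lemma subspace_H1_space: "subspace (H1_space \<Omega>)"
  by (rule subspaceI) (auto simp: H1_space_def inner_add_left)

lemma closed_H1_space: "closed (H1_space \<Omega>)"
proof -
  have "H1_space \<Omega> = (\<Inter>z\<in>H1_constraints \<Omega>. {x. x \<bullet> z = 0})" by (auto simp: H1_space_def)
  then show ?thesis by (auto intro!: closed_INT closed_Collect_eq continuous_intros)
qed

text \<open>The admissible test function is the restriction of \<open>y\<close> itself to the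
  complement of \<open>S\<close>, which yields that its squared norm is 0.\<close>

lemma zero_outside:
  fixes y :: "('a::euclidean_space, 'b::euclidean_space) l2"
  assumes S: "S \<in> sets lebesgue" and orth: "\<And>f. f \<in> L2 UNIV \<Longrightarrow> (\<forall>x\<in>S. f x = 0) \<Longrightarrow> y \<bullet> l2_of f = 0"
  shows "AE x in lebesgue. x \<notin> S \<longrightarrow> rep_l2 y x = 0"
proof -
  define f where "f = extend0 (- S) (rep_l2 y)"
  have S': "- S \<in> sets lebesgue" using S by (simp add: Compl_in_sets_lebesgue)
  have y: "rep_l2 y \<in> L2 UNIV" by (rule sq_int_imp_L2[OF sq_int_rep])
  have "rep_l2 y \<in> L2 (- S)"
    using y S' integrable_mult_indicator[OF S', of "\<lambda>x. (norm (rep_l2 y x))\<^sup>2"]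
    by (auto simp: L2_UNIV L2_def integrable_restrict_space intro: measurable_restrict_space1)
  then have f: "f \<in> L2 UNIV" by (simp add: f_def L2_extend0_iff[OF S'])
  have "l2_of f \<bullet> l2_of f = (LINT x|lebesgue. f x \<bullet> f x)" by (rule inner_l2_of(1)[OF f f])
  also have "\<dots> = (LINT x|lebesgue. rep_l2 y x \<bullet> f x)"
    by (rule Bochner_Integration.integral_cong) (auto simp: f_def extend0_def)
  also have "\<dots> = y \<bullet> l2_of f" using inner_l2_of(1)[OF y f] by (simp add: l2_of_rep)
  also have "\<dots> = 0" by (rule orth[OF f]) (simp add: f_def extend0_def)
  finally have "l2_of f = 0" by simp
  moreover have "l2_of (\<lambda>x. 0) = (0 :: ('a, 'b) l2)"
    by (simp add: l2_of_sq_int sq_int_zero zero_l2.abs_eq)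
  ultimately have "AE x in lebesgue. f x = 0"
    using l2_of_eqD[OF f sq_int_imp_L2[OF sq_int_zero]] by simp
  then show ?thesis by eventually_elim (auto simp: f_def extend0_def split: if_splits)
qed

lemma inner_ext_vanishing:
  assumes S: "S \<in> sets lebesgue" and v: "v \<in> L2 S" and f: "f \<in> L2 UNIV" "\<forall>x\<in>S. f x = 0"
  shows "l2_ext S v \<bullet> l2_of f = 0"
proof -
  have "l2_ext S v \<bullet> l2_of f = (LINT x|lebesgue. extend0 S v x \<bullet> f x)"
    unfolding l2_ext_def by (rule inner_l2_of(1)[OF _ f(1)]) (simp add: L2_extend0_iff[OF S] v)
  also have "\<dots> = (LINT x|(lebesgue :: 'a measure). 0)"
    by (rule Bochner_Integration.integral_cong) (use f(2) in \<open>auto simp: extend0_def\<close>)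
  finally show ?thesis by simp
qed

lemma test_function_L2:
  assumes "S \<in> sets lebesgue" "\<phi> \<in> test_functions S"
  shows "\<phi> \<in> L2 S" "l2_ext S \<phi> = l2_of \<phi>"
proof -
  have e: "extend0 S \<phi> = \<phi>" using test_function_zero_off[OF assms(2)] by (auto simp: extend0_def)
  show "\<phi> \<in> L2 S"
    using sq_int_imp_L2[OF test_function_sq_int[OF assms(2)]] L2_extend0_iff[OF assms(1), of \<phi>] e by simp
  show "l2_ext S \<phi> = l2_of \<phi>" by (simp add: l2_ext_def e)
qed

lemma L2_scaleR_axis:
  fixes \<phi> :: "'a::euclidean_space \<Rightarrow> real" and e :: "'b::euclidean_space"
  assumes "\<phi> \<in> L2 S"
  shows "(\<lambda>x. \<phi> x *\<^sub>R e) \<in> L2 S"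
proof -
  have [measurable]: "\<phi> \<in> borel_measurable (lebesgue_on S)" using assms by (simp add: L2_def)
  have "integrable (lebesgue_on S) (\<lambda>x. (norm (\<phi> x))\<^sup>2 * (norm e)\<^sup>2)"
    using assms by (simp add: L2_def)
  then show ?thesis by (simp add: L2_def power_mult_distrib)
qed

text \<open>Test functions and their derivatives vanish off \<open>\<Omega>\<close>, so the two
  integrals over \<open>\<Omega>\<close> are the two components of one inner product in
  \<open>X\<close>.\<close>

lemma has_weak_gradient_iff:
  fixes g :: "real^'n \<Rightarrow> real^'n"
  assumes \<Omega>: "\<Omega> \<in> sets lebesgue" and v: "v \<in> L2 \<Omega>" and g: "g \<in> L2 \<Omega>"
  shows "has_weak_gradient \<Omega> v g \<longleftrightarrow> (\<forall>\<phi>\<in>test_functions \<Omega>. \<forall>i.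
    (l2_ext \<Omega> v, l2_ext \<Omega> g) \<bullet> (l2_of (dir_deriv (axis i 1) \<phi>), l2_of (\<lambda>x. \<phi> x *\<^sub>R axis i 1)) = 0)"
proof -
  have "((LINT x|lebesgue_on \<Omega>. v x * dir_deriv (axis i 1) \<phi> x) = - (LINT x|lebesgue_on \<Omega>. g x $ i * \<phi> x)) \<longleftrightarrow>
    (l2_ext \<Omega> v, l2_ext \<Omega> g) \<bullet> (l2_of (dir_deriv (axis i 1) \<phi>), l2_of (\<lambda>x. \<phi> x *\<^sub>R axis i 1)) = 0"
    if \<phi>: "\<phi> \<in> test_functions \<Omega>" for \<phi> i
  proof -
    note d = test_function_L2[OF \<Omega> dir_deriv_test_function[OF \<phi>, of "axis i 1"]]
    note p = test_function_L2[OF \<Omega> \<phi>]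
    have pe: "l2_ext \<Omega> (\<lambda>x. \<phi> x *\<^sub>R axis i 1) = l2_of (\<lambda>x. \<phi> x *\<^sub>R (axis i 1 :: real^'n))"
    proof -
      have "extend0 \<Omega> (\<lambda>x. \<phi> x *\<^sub>R (axis i 1 :: real^'n)) = (\<lambda>x. \<phi> x *\<^sub>R axis i 1)"
        using test_function_zero_off[OF \<phi>] by (auto simp: extend0_def)
      then show ?thesis by (simp add: l2_ext_def)
    qed
    have "l2_ext \<Omega> v \<bullet> l2_of (dir_deriv (axis i 1) \<phi>) = (LINT x|lebesgue_on \<Omega>. v x * dir_deriv (axis i 1) \<phi> x)"
      using inner_l2_ext[OF \<Omega> v d(1)] by (simp add: d(2))
    moreover have "l2_ext \<Omega> g \<bullet> l2_of (\<lambda>x. \<phi> x *\<^sub>R axis i 1) = (LINT x|lebesgue_on \<Omega>. g x $ i * \<phi> x)"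
      using inner_l2_ext[OF \<Omega> g L2_scaleR_axis[OF p(1), of "axis i 1"]]
      by (simp add: pe inner_axis mult.commute)
    ultimately show ?thesis by (simp add: eq_neg_iff_add_eq_0)
  qed
  then show ?thesis by (simp add: has_weak_gradient_def)
qed

lemma H1_weak_grad:
  assumes "v \<in> H1 \<Omega>"
  shows "v \<in> L2 \<Omega>" "weak_grad \<Omega> v \<in> L2 \<Omega>" "has_weak_gradient \<Omega> v (weak_grad \<Omega> v)"
proof -
  show "v \<in> L2 \<Omega>" using assms by (simp add: H1_def)
  have "\<exists>g. g \<in> L2 \<Omega> \<and> has_weak_gradient \<Omega> v g" using assms by (auto simp: H1_def)
  from someI_ex[OF this] show "weak_grad \<Omega> v \<in> L2 \<Omega>" "has_weak_gradient \<Omega> v (weak_grad \<Omega> v)"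
    by (simp_all add: weak_grad_def)
qed

context
  fixes \<Omega> :: "(real^'n) set"
  assumes open_\<Omega>: "open \<Omega>"
begin

lemma lebesgue_\<Omega>: "\<Omega> \<in> sets lebesgue"
  using open_\<Omega> by simp

lemma H1I:
  assumes "v \<in> L2 \<Omega>" "g \<in> L2 \<Omega>" "has_weak_gradient \<Omega> v g"
  shows "v \<in> H1 \<Omega>" "H1_emb \<Omega> v = (l2_ext \<Omega> v, l2_ext \<Omega> g)"
proof -
  show v: "v \<in> H1 \<Omega>" using assms by (auto simp: H1_def)
  note wg = H1_weak_grad[OF v]
  show "H1_emb \<Omega> v = (l2_ext \<Omega> v, l2_ext \<Omega> g)"
    unfolding H1_emb_def
    using l2_ext_cong[OF lebesgue_\<Omega> wg(2) weak_gradient_unique[OF open_\<Omega> wg(2) assms(2) wg(3) assms(3)]]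
    by simp
qed

lemma H1_lincomb:
  assumes "v \<in> H1 \<Omega>" "w \<in> H1 \<Omega>"
  shows "(\<lambda>x. c * v x + d * w x) \<in> H1 \<Omega>"
    and "H1_emb \<Omega> (\<lambda>x. c * v x + d * w x) = c *\<^sub>R H1_emb \<Omega> v + d *\<^sub>R H1_emb \<Omega> w"
proof -
  note v = H1_weak_grad[OF assms(1)] and w = H1_weak_grad[OF assms(2)]
  note lc = l2_ext_lincomb[OF lebesgue_\<Omega> v(1) w(1), of c d, unfolded real_scaleR_def]
  note lg = l2_ext_lincomb[OF lebesgue_\<Omega> v(2) w(2), of c d]
  have "has_weak_gradient \<Omega> (\<lambda>x. c * v x + d * w x) (\<lambda>x. c *\<^sub>R weak_grad \<Omega> v x + d *\<^sub>R weak_grad \<Omega> w x)"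
    unfolding has_weak_gradient_iff[OF lebesgue_\<Omega> lc(1) lg(1)] lc(2) lg(2)
  proof (intro ballI allI)
    fix \<phi> i assume \<phi>: "\<phi> \<in> test_functions \<Omega>"
    let ?z = "(l2_of (dir_deriv (axis i 1) \<phi>), l2_of (\<lambda>x. \<phi> x *\<^sub>R (axis i 1 :: real^'n)))"
    have "(l2_ext \<Omega> v, l2_ext \<Omega> (weak_grad \<Omega> v)) \<bullet> ?z = 0" "(l2_ext \<Omega> w, l2_ext \<Omega> (weak_grad \<Omega> w)) \<bullet> ?z = 0"
      using v(3) w(3) \<phi> unfolding has_weak_gradient_iff[OF lebesgue_\<Omega> v(1,2)] has_weak_gradient_iff[OF lebesgue_\<Omega> w(1,2)]
      by blast+
    moreover have "(c *\<^sub>R l2_ext \<Omega> v + d *\<^sub>R l2_ext \<Omega> w, c *\<^sub>R l2_ext \<Omega> (weak_grad \<Omega> v) + d *\<^sub>R l2_ext \<Omega> (weak_grad \<Omega> w)) \<bullet> ?z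
        = c * ((l2_ext \<Omega> v, l2_ext \<Omega> (weak_grad \<Omega> v)) \<bullet> ?z) + d * ((l2_ext \<Omega> w, l2_ext \<Omega> (weak_grad \<Omega> w)) \<bullet> ?z)"
      by (simp add: inner_add_left distrib_left)
    ultimately show "(c *\<^sub>R l2_ext \<Omega> v + d *\<^sub>R l2_ext \<Omega> w, c *\<^sub>R l2_ext \<Omega> (weak_grad \<Omega> v) + d *\<^sub>R l2_ext \<Omega> (weak_grad \<Omega> w)) \<bullet> ?z = 0"
      by simp
  qed
  from H1I[OF lc(1) lg(1) this]
  show "(\<lambda>x. c * v x + d * w x) \<in> H1 \<Omega>"
    and "H1_emb \<Omega> (\<lambda>x. c * v x + d * w x) = c *\<^sub>R H1_emb \<Omega> v + d *\<^sub>R H1_emb \<Omega> w"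
    by (simp_all add: lc(2) lg(2) H1_emb_def)
qed

lemma norm_H1_emb: "v \<in> H1 \<Omega> \<Longrightarrow> norm (H1_emb \<Omega> v) = H1_norm \<Omega> v"
  using H1_weak_grad[of v \<Omega>] by (simp add: H1_emb_def H1_norm_def norm_prod_def norm_l2_ext[OF lebesgue_\<Omega>])

lemma H1_emb_in_H1_space:
  assumes "v \<in> H1 \<Omega>"
  shows "H1_emb \<Omega> v \<in> H1_space \<Omega>"
proof -
  note v = H1_weak_grad[OF assms]
  have "H1_emb \<Omega> v \<bullet> z = 0" if "z \<in> H1_constraints \<Omega>" for z
    using that inner_ext_vanishing[OF lebesgue_\<Omega> v(1)] inner_ext_vanishing[OF lebesgue_\<Omega> v(2)]
      v(3)[unfolded has_weak_gradient_iff[OF lebesgue_\<Omega> v(1,2)]]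
    unfolding H1_constraints_def H1_emb_def by auto
  then show ?thesis by (simp add: H1_space_def)
qed

lemma H1_space_zero_outside:
  assumes "x \<in> H1_space \<Omega>"
  shows "AE t in lebesgue. t \<notin> \<Omega> \<longrightarrow> rep_l2 (fst x) t = 0" "AE t in lebesgue. t \<notin> \<Omega> \<longrightarrow> rep_l2 (snd x) t = 0"
proof -
  have *: "x \<bullet> z = 0" if "z \<in> H1_constraints \<Omega>" for z using assms that by (simp add: H1_space_def)
  show "AE t in lebesgue. t \<notin> \<Omega> \<longrightarrow> rep_l2 (fst x) t = 0"
  proof (rule zero_outside[OF lebesgue_\<Omega>])
    fix f :: "real^'n \<Rightarrow> real" assume "f \<in> L2 UNIV" "\<forall>x\<in>\<Omega>. f x = 0"
    then have "x \<bullet> (l2_of f, 0) = 0" by (intro * vanishing_constraint) auto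
    then show "fst x \<bullet> l2_of f = 0" by (simp add: inner_prod_def)
  qed
  show "AE t in lebesgue. t \<notin> \<Omega> \<longrightarrow> rep_l2 (snd x) t = 0"
  proof (rule zero_outside[OF lebesgue_\<Omega>])
    fix f :: "real^'n \<Rightarrow> real^'n" assume "f \<in> L2 UNIV" "\<forall>x\<in>\<Omega>. f x = 0"
    then have "x \<bullet> (0, l2_of f) = 0" by (intro * vanishing_constraint_grad) auto
    then show "snd x \<bullet> l2_of f = 0" by (simp add: inner_prod_def)
  qed
qed

text \<open>Surjectivity of \<open>H1_emb\<close> onto \<open>H1_space\<close>: the constraints
  satisfied by \<open>x\<close> say that the representative of its second component is a weak
  gradient of that of the first.\<close>

lemma H1_space_rep:
  assumes "x \<in> H1_space \<Omega>"
  shows "rep_l2 (fst x) \<in> H1 \<Omega>" "H1_emb \<Omega> (rep_l2 (fst x)) = x"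
proof -
  note r1 = l2_ext_rep[OF lebesgue_\<Omega> H1_space_zero_outside(1)[OF assms]]
    and r2 = l2_ext_rep[OF lebesgue_\<Omega> H1_space_zero_outside(2)[OF assms]]
  have "has_weak_gradient \<Omega> (rep_l2 (fst x)) (rep_l2 (snd x))"
    unfolding has_weak_gradient_iff[OF lebesgue_\<Omega> r1(1) r2(1)] r1(2) r2(2)
    using assms by (auto simp: H1_space_def H1_constraints_def)
  from H1I[OF r1(1) r2(1) this]
  show "rep_l2 (fst x) \<in> H1 \<Omega>" "H1_emb \<Omega> (rep_l2 (fst x)) = x" by (simp_all add: r1(2) r2(2))
qed

end

section \<open>Mosco convergence in terms of closed subspaces\<close>

lemma l2_ext_superset: "\<Omega> \<subseteq> D \<Longrightarrow> l2_ext D (extend0 \<Omega> v) = l2_ext \<Omega> v"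
  unfolding l2_ext_def by (rule arg_cong[of _ _ l2_of]) (auto simp: extend0_def fun_eq_iff)

lemma K_space_emb:
  assumes D: "D \<in> sets lebesgue" and \<Omega>: "open \<Omega>" "\<Omega> \<subseteq> D" and w: "w \<in> K_space D \<Omega>"
  shows "(l2_ext D (fst w), l2_ext D (snd w)) \<in> H1_space \<Omega>"
proof -
  have w': "fst w \<in> L2 D" "snd w \<in> L2 D" using w by (auto simp: K_space_def X_space_def)
  obtain v where v: "v \<in> H1 \<Omega>" "AE x in lebesgue_on D. fst w x = extend0 \<Omega> v x"
     "AE x in lebesgue_on D. snd w x = extend0 \<Omega> (weak_grad \<Omega> v) x" using w unfolding K_space_def by blast
  have "(l2_ext D (fst w), l2_ext D (snd w)) = H1_emb \<Omega> v"
    using l2_ext_cong[OF D w'(1) v(2)] l2_ext_cong[OF D w'(2) v(3)]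
    by (simp add: H1_emb_def l2_ext_superset[OF \<Omega>(2)])
  then show ?thesis using H1_emb_in_H1_space[OF \<Omega>(1) v(1)] by simp
qed

lemma H1_space_K_space:
  assumes D: "D \<in> sets lebesgue" and \<Omega>: "open \<Omega>" "\<Omega> \<subseteq> D" and x: "x \<in> H1_space \<Omega>"
  shows "(rep_l2 (fst x), rep_l2 (snd x)) \<in> K_space D \<Omega>"
    "(l2_ext D (rep_l2 (fst x)), l2_ext D (rep_l2 (snd x))) = x"
proof -
  note z = H1_space_zero_outside[OF \<Omega>(1) x]
  have zD: "AE t in lebesgue. t \<notin> D \<longrightarrow> rep_l2 (fst x) t = 0" "AE t in lebesgue. t \<notin> D \<longrightarrow> rep_l2 (snd x) t = 0"
    using z(1) by (eventually_elim, use \<Omega> in auto) (use z(2) in eventually_elim, use \<Omega> in auto)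
  note r1 = l2_ext_rep[OF D zD(1)] and r2 = l2_ext_rep[OF D zD(2)]
  show "(l2_ext D (rep_l2 (fst x)), l2_ext D (rep_l2 (snd x))) = x" by (simp add: r1(2) r2(2))
  note v = H1_space_rep[OF \<Omega>(1) x]
  have eq: "l2_ext \<Omega> (rep_l2 (fst x)) = fst x" "l2_ext \<Omega> (weak_grad \<Omega> (rep_l2 (fst x))) = snd x"
    using v(2) by (auto simp: H1_emb_def prod_eq_iff)
  note wg = H1_weak_grad[OF v(1)]
  have "AE t in lebesgue. rep_l2 (fst x) t = extend0 \<Omega> (rep_l2 (fst x)) t"
    using rep_l2_ext[OF lebesgue_\<Omega>[OF \<Omega>(1)] wg(1)] by (simp add: eq)
  moreover have "AE t in lebesgue. rep_l2 (snd x) t = extend0 \<Omega> (weak_grad \<Omega> (rep_l2 (fst x))) t"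
    using rep_l2_ext[OF lebesgue_\<Omega>[OF \<Omega>(1)] wg(2)] by (simp add: eq)
  ultimately show "(rep_l2 (fst x), rep_l2 (snd x)) \<in> K_space D \<Omega>"
    using r1(1) r2(1) v(1) unfolding K_space_def X_space_def
    by (auto simp: AE_lebesgue_on_iff[OF D] intro!: bexI[of _ "rep_l2 (fst x)"] elim: eventually_mono)
qed

text \<open>Mosco convergence speaks of representatives on \<open>D\<close>, the projections of
  classes on the whole space; \<open>E\<close> translates between them isometrically. A weak limit
  in the whole space must be shown to vanish outside \<open>D\<close> before it comes from a pair of
  functions on \<open>D\<close>.\<close>

lemma mosco_H1_space:
  fixes D \<Omega> :: "(real^'n) set"
  assumes D: "D \<in> sets lebesgue" and \<Omega>: "open \<Omega>" "\<Omega> \<subseteq> D" and \<Omega>n: "\<And>n. open (\<Omega>n n)" "\<And>n. \<Omega>n n \<subseteq> D"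
    and mosco: "H1_Mosco_convergence D \<Omega>n \<Omega>"
  shows "(\<lambda>n. proj (H1_space (\<Omega>n n)) x) \<longlonglongrightarrow> proj (H1_space \<Omega>) x"
proof (rule mosco_imp_proj_tendsto)
  define E where "E w = (l2_ext D (fst w), l2_ext D (snd w))" for w :: "(real^'n \<Rightarrow> real) \<times> (real^'n \<Rightarrow> real^'n)"
  have strong: "norm (E w - E z) = sqrt ((L2_norm D (\<lambda>x. fst w x - fst z x))\<^sup>2 + (L2_norm D (\<lambda>x. snd w x - snd z x))\<^sup>2)"
    if "w \<in> X_space D" "z \<in> X_space D" for w z
    using that
    by (auto simp: E_def X_space_def norm_prod_def l2_ext_diff[OF D, symmetric] norm_l2_ext[OF D] L2_diff[OF D])
  have inner: "X_inner D w z = E w \<bullet> E z" if "w \<in> X_space D" "z \<in> X_space D" for w z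
    using that by (auto simp: X_inner_def E_def X_space_def inner_l2_ext[OF D])
  show "\<exists>Y. (\<forall>n. Y n \<in> H1_space (\<Omega>n n)) \<and> Y \<longlonglongrightarrow> y" if y: "y \<in> H1_space \<Omega>" for y
  proof -
    define w where "w = (rep_l2 (fst y), rep_l2 (snd y))"
    have w: "w \<in> K_space D \<Omega>" "E w = y" using H1_space_K_space[OF D \<Omega> y] by (auto simp: w_def E_def)
    obtain W where W: "\<And>n. W n \<in> K_space D (\<Omega>n n)" "X_strong_conv D W w"
      using mosco w(1) unfolding H1_Mosco_convergence_def by blast
    have "(\<lambda>n. norm (E (W n) - E w)) \<longlonglongrightarrow> 0"
      using W w(1) strong unfolding X_strong_conv_def K_space_def by simp
    then have "(\<lambda>n. E (W n)) \<longlonglongrightarrow> y"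
      unfolding w(2) by (simp add: tendsto_norm_zero_iff LIM_zero_iff)
    moreover have "E (W n) \<in> H1_space (\<Omega>n n)" for n
      unfolding E_def by (rule K_space_emb[OF D \<Omega>n W(1)])
    ultimately show ?thesis by (intro exI[of _ "\<lambda>n. E (W n)"]) simp
  qed
  fix m :: "nat \<Rightarrow> nat" and Y y
  assume m: "filterlim m at_top sequentially" and Y: "\<And>k. Y k \<in> H1_space (\<Omega>n (m k))"
    and weak: "\<And>z. (\<lambda>k. Y k \<bullet> z) \<longlonglongrightarrow> y \<bullet> z"
  define W where "W k = (rep_l2 (fst (Y k)), rep_l2 (snd (Y k)))" for k
  have W: "W k \<in> K_space D (\<Omega>n (m k))" "E (W k) = Y k" for k
    using H1_space_K_space[OF D \<Omega>n Y, of k] by (auto simp: W_def E_def)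
  \<comment> \<open>An orthogonality relation shared by all \<open>Y k\<close> passes to the weak
    limit; applied to functions vanishing on \<open>D\<close>, it confines the limit to
    \<open>D\<close>.\<close>
  have vanish: "y \<bullet> z = 0" if "\<And>k. Y k \<bullet> z = 0" for z
    using weak[of z] that by (simp add: LIMSEQ_const_iff)
  have Yc: "Y k \<bullet> z = 0" if "z \<in> H1_constraints (\<Omega>n (m k))" for z k using Y[of k] that by (simp add: H1_space_def)
  have z1: "AE t in lebesgue. t \<notin> D \<longrightarrow> rep_l2 (fst y) t = 0"
  proof (rule zero_outside[OF D])
    fix f :: "real^'n \<Rightarrow> real" assume "f \<in> L2 UNIV" "\<forall>x\<in>D. f x = 0"
    then have "Y k \<bullet> (l2_of f, 0) = 0" for k
      using \<Omega>n(2) by (intro Yc vanishing_constraint) blast+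
    from vanish[OF this] show "fst y \<bullet> l2_of f = 0" by (simp add: inner_prod_def)
  qed
  have z2: "AE t in lebesgue. t \<notin> D \<longrightarrow> rep_l2 (snd y) t = 0"
  proof (rule zero_outside[OF D])
    fix f :: "real^'n \<Rightarrow> real^'n" assume "f \<in> L2 UNIV" "\<forall>x\<in>D. f x = 0"
    then have "Y k \<bullet> (0, l2_of f) = 0" for k
      using \<Omega>n(2) by (intro Yc vanishing_constraint_grad) blast+
    from vanish[OF this] show "snd y \<bullet> l2_of f = 0" by (simp add: inner_prod_def)
  qed
  define w where "w = (rep_l2 (fst y), rep_l2 (snd y))"
  have w: "w \<in> X_space D" "E w = y"
    using l2_ext_rep[OF D z1] l2_ext_rep[OF D z2] by (auto simp: w_def E_def X_space_def)
  have "X_weak_conv D W w"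
    unfolding X_weak_conv_def
  proof
    fix z assume z: "z \<in> X_space D"
    have "W k \<in> X_space D" for k using W(1) by (simp add: K_space_def)
    then show "(\<lambda>k. X_inner D (W k) z) \<longlonglongrightarrow> X_inner D w z"
      using weak[of "E z"] inner[OF _ z] w W(2) by simp
  qed
  then have "w \<in> K_space D \<Omega>"
    using mosco m W(1) w(1) unfolding H1_Mosco_convergence_def by blast
  from K_space_emb[OF D \<Omega> this] show "y \<in> H1_space \<Omega>" using w(2) by (simp add: E_def)
qed (rule subspace_H1_space closed_H1_space)+

section \<open>The variational formulation in time\<close>

lemma H1_diff:
  assumes "open \<Omega>" "v \<in> H1 \<Omega>" "w \<in> H1 \<Omega>"
  shows "H1_norm \<Omega> (\<lambda>x. v x - w x) = norm (H1_emb \<Omega> v - H1_emb \<Omega> w)"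
  using H1_lincomb[OF assms, of 1 "-1"] norm_H1_emb[OF assms(1), of "\<lambda>x. v x - w x"] by simp

text \<open>Strong measurability in \<open>H1 \<Omega>\<close> becomes ordinary measurability after
  embedding into \<open>X\<close>: embedded simple functions have Borel representatives, and
  \<open>U\<close> is their pointwise limit, equal to the embedding of \<open>u t\<close> for almost
  every \<open>t\<close>.\<close>

lemma bochner_L2_H1_emb:
  fixes \<Omega> :: "(real^'n) set"
  assumes \<Omega>: "open \<Omega>" and u: "u \<in> bochner_L2 {0<..<T} (H1 \<Omega>) (H1_norm \<Omega>)"
  obtains U where "L2t U" "\<And>t. t \<notin> {0..T} \<Longrightarrow> U t = 0"
    "AE t in lborel. t \<in> {0..T} \<longrightarrow> u t \<in> H1 \<Omega> \<and> U t = H1_emb \<Omega> (u t)"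
proof -
  define I where "I = {0<..<T}"
  have I: "I \<in> sets lebesgue" "I \<in> sets borel" by (auto simp: I_def)
  have ae_I: "AE t in lborel. t \<in> {0..T} \<longrightarrow> t \<in> I"
    using AE_lborel_singleton[of 0] AE_lborel_singleton[of T] by eventually_elim (auto simp: I_def)
  obtain s where inH1: "AE t in lebesgue_on I. u t \<in> H1 \<Omega>"
    and s: "\<And>k::nat. simple_fun_on I (H1 \<Omega>) (s k)"
    and lim: "AE t in lebesgue_on I. (\<lambda>k. H1_norm \<Omega> (\<lambda>x. s k t x - u t x)) \<longlonglongrightarrow> 0"
    using u unfolding bochner_L2_def strongly_measurable_on_def I_def by blast
  have int: "integrable (lebesgue_on I) (\<lambda>t. (H1_norm \<Omega> (u t))\<^sup>2)"
    using u by (simp add: bochner_L2_def I_def)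
  define e where "e k t = (if t \<in> I then H1_emb \<Omega> (s k t) else 0)" for k t
  have e: "e k \<in> borel_measurable lebesgue" for k
  proof (rule borel_measurable_simple_function, unfold simple_function_def, intro conjI ballI)
    have fin: "finite (s k ` I)" using s by (simp add: simple_fun_on_def)
    have "e k ` space lebesgue \<subseteq> insert 0 (H1_emb \<Omega> ` s k ` I)" by (auto simp: e_def)
    then show "finite (e k ` space lebesgue)" using fin finite_subset by blast
    fix z
    \<comment> \<open>Different values of the simple function may represent the same class, so the
      preimage of a class is a finite union of level sets; outside \<open>I\<close> the value is 0
      by definition.\<close>
    have "e k -` {z} \<inter> space lebesgue = (\<Union>y\<in>{y \<in> s k ` I. H1_emb \<Omega> y = z}. {t \<in> I. s k t = y}) \<union> (if z = 0 then - I else {})"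
    proof -
      have "e k -` {z} \<inter> space lebesgue = {t \<in> I. H1_emb \<Omega> (s k t) = z} \<union> (if z = 0 then - I else {})"
        by (rule set_eqI) (simp add: e_def)
      moreover have "{t \<in> I. H1_emb \<Omega> (s k t) = z} = (\<Union>y\<in>{y \<in> s k ` I. H1_emb \<Omega> y = z}. {t \<in> I. s k t = y})"
      proof (intro equalityI subsetI)
        fix t assume "t \<in> {t \<in> I. H1_emb \<Omega> (s k t) = z}"
        then have "t \<in> I" "H1_emb \<Omega> (s k t) = z" by simp_all
        then show "t \<in> (\<Union>y\<in>{y \<in> s k ` I. H1_emb \<Omega> y = z}. {t \<in> I. s k t = y})"
          by (intro UN_I[of "s k t"]) simp_all
      next
        fix t assume "t \<in> (\<Union>y\<in>{y \<in> s k ` I. H1_emb \<Omega> y = z}. {t \<in> I. s k t = y})"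
        then show "t \<in> {t \<in> I. H1_emb \<Omega> (s k t) = z}" by (elim UN_E) simp
      qed
      ultimately show ?thesis by (simp only:)
    qed
    moreover have "(\<Union>y\<in>{y \<in> s k ` I. H1_emb \<Omega> y = z}. {t \<in> I. s k t = y}) \<in> sets lebesgue"
      using s[of k] fin by (intro sets.finite_UN) (auto simp: simple_fun_on_def)
    moreover have "(if z = 0 then - I else {}) \<in> sets lebesgue"
      using I(1) Compl_in_sets_lebesgue[of I] by (cases "z = 0") simp_all
    ultimately show "e k -` {z} \<inter> space lebesgue \<in> sets lebesgue"
      by (simp only: sets.Un)
  qed
  have "\<exists>e'. e' \<in> borel_measurable lborel \<and> (AE t in lborel. e k t = e' t)" for k
    using borel_measurable_completion_ex[OF e[of k]] by blast
  then have "\<exists>e'. \<forall>k. e' k \<in> borel_measurable lborel \<and> (AE t in lborel. e k t = e' k t)" by (intro choice) blast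
  then obtain e' where e': "\<And>k. e' k \<in> borel_measurable lborel" "\<And>k. AE t in lborel. e k t = e' k t" by blast
  have [measurable]: "e' k \<in> borel_measurable borel" for k using e'(1)[of k] by simp
  define U where "U t = indicator I t *\<^sub>R lim (\<lambda>k. e' k t)" for t
  have Um[measurable]: "U \<in> borel_measurable borel" unfolding U_def using I(2) by measurable
  have "AE t in lborel. \<forall>k. e k t = e' k t" using e'(2) by (simp add: AE_all_countable)
  moreover have "AE t in lborel. t \<in> I \<longrightarrow> u t \<in> H1 \<Omega>"
    using inH1 by (simp add: AE_lebesgue_on_iff[OF I(1)] AE_completion_iff)
  moreover have "AE t in lborel. t \<in> I \<longrightarrow> (\<lambda>k. H1_norm \<Omega> (\<lambda>x. s k t x - u t x)) \<longlonglongrightarrow> 0"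
    using lim by (simp add: AE_lebesgue_on_iff[OF I(1)] AE_completion_iff)
  ultimately have U_eq: "AE t in lborel. t \<in> I \<longrightarrow> u t \<in> H1 \<Omega> \<and> U t = H1_emb \<Omega> (u t)"
  proof eventually_elim
    case (elim t)
    show ?case
    proof
      assume t: "t \<in> I"
      have ut: "u t \<in> H1 \<Omega>" using elim t by simp
      have st: "s k t \<in> H1 \<Omega>" for k using s[of k] t by (auto simp: simple_fun_on_def)
      have "(\<lambda>k. norm (H1_emb \<Omega> (s k t) - H1_emb \<Omega> (u t))) \<longlonglongrightarrow> 0"
        using elim t by (simp add: H1_diff[OF \<Omega> st ut])
      then have "(\<lambda>k. H1_emb \<Omega> (s k t)) \<longlonglongrightarrow> H1_emb \<Omega> (u t)"
        by (simp add: tendsto_norm_zero_iff LIM_zero_iff)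
      moreover have "e' k t = H1_emb \<Omega> (s k t)" for k using elim t by (simp add: e_def)
      ultimately have "(\<lambda>k. e' k t) \<longlonglongrightarrow> H1_emb \<Omega> (u t)" by simp
      then show "u t \<in> H1 \<Omega> \<and> U t = H1_emb \<Omega> (u t)" using t ut by (simp add: U_def limI)
    qed
  qed
  show thesis
  proof (rule that[of U])
    show "U t = 0" if "t \<notin> {0..T}" for t using that by (auto simp: U_def I_def)
    show "AE t in lborel. t \<in> {0..T} \<longrightarrow> u t \<in> H1 \<Omega> \<and> U t = H1_emb \<Omega> (u t)"
      using U_eq ae_I by eventually_elim auto
    have i: "integrable lebesgue (\<lambda>t. indicator I t *\<^sub>R (H1_norm \<Omega> (u t))\<^sup>2)"
      using int I(1) by (simp add: integrable_restrict_space)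
    have ae: "AE t in lebesgue. indicator I t *\<^sub>R (H1_norm \<Omega> (u t))\<^sup>2 = (norm (U t))\<^sup>2"
      using AE_completion[OF U_eq]
      by eventually_elim (auto simp: indicator_def U_def norm_H1_emb[OF \<Omega>])
    have m: "(\<lambda>t. (norm (U t))\<^sup>2) \<in> borel_measurable lborel" by measurable
    have "integrable lebesgue (\<lambda>t. (norm (U t))\<^sup>2)"
      by (rule integrable_cong_AE_imp[OF i measurable_completion[OF m]]) (use ae in \<open>auto elim: eventually_mono\<close>)
    then show "L2t U" using Um m by (simp add: L2t_def integrable_completion)
  qed
qed

section \<open>Functionals on H1 and evaluation of Bochner integrals\<close>

lemma H1_dual_abs_le:
  assumes "l \<in> H1_dual \<Omega>" "v \<in> H1 \<Omega>" "H1_norm \<Omega> v \<le> 1"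
  shows "\<bar>l v\<bar> \<le> H1_dual_norm \<Omega> l"
proof -
  obtain C where C: "\<And>v. v \<in> H1 \<Omega> \<Longrightarrow> \<bar>l v\<bar> \<le> C * H1_norm \<Omega> v" using assms(1) unfolding H1_dual_def by blast
  have "\<bar>l w\<bar> \<le> \<bar>C\<bar>" if "w \<in> H1 \<Omega>" "H1_norm \<Omega> w \<le> 1" for w
  proof -
    have "0 \<le> H1_norm \<Omega> w" by (simp add: H1_norm_def)
    have "\<bar>l w\<bar> \<le> C * H1_norm \<Omega> w" by (rule C[OF that(1)])
    also have "\<dots> \<le> \<bar>C\<bar> * 1" using that(2) \<open>0 \<le> H1_norm \<Omega> w\<close> by (intro mult_mono) auto
    finally show ?thesis by simp
  qed
  then have "bdd_above ((\<lambda>v. \<bar>l v\<bar>) ` {v \<in> H1 \<Omega>. H1_norm \<Omega> v \<le> 1})" by (intro bdd_aboveI2) auto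
  then show ?thesis unfolding H1_dual_norm_def by (rule cSUP_upper[rotated]) (use assms in simp)
qed

lemma H1_dual_diff:
  assumes "k \<in> H1_dual \<Omega>" "l \<in> H1_dual \<Omega>"
  shows "(\<lambda>v. k v - l v) \<in> H1_dual \<Omega>"
proof -
  obtain C where C: "\<And>v. v \<in> H1 \<Omega> \<Longrightarrow> \<bar>k v\<bar> \<le> C * H1_norm \<Omega> v" using assms(1) unfolding H1_dual_def by blast
  obtain D where D: "\<And>v. v \<in> H1 \<Omega> \<Longrightarrow> \<bar>l v\<bar> \<le> D * H1_norm \<Omega> v" using assms(2) unfolding H1_dual_def by blast
  have "\<bar>k v - l v\<bar> \<le> (C + D) * H1_norm \<Omega> v" if "v \<in> H1 \<Omega>" for v
    using C[OF that] D[OF that] by (simp add: distrib_right)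
  then have "\<exists>C. \<forall>v\<in>H1 \<Omega>. \<bar>k v - l v\<bar> \<le> C * H1_norm \<Omega> v" by blast
  moreover have "k (\<lambda>x. c * v x + d * w x) - l (\<lambda>x. c * v x + d * w x) = c * (k v - l v) + d * (k w - l w)"
    if "v \<in> H1 \<Omega>" "w \<in> H1 \<Omega>" for v w c d
    using assms that by (simp add: H1_dual_def algebra_simps)
  ultimately show ?thesis by (simp add: H1_dual_def)
qed

text \<open>Integrals of simple functions have this form; they must lie in the dual for their
  difference from the Bochner integral to be controlled by \<open>H1_dual_norm\<close>.\<close>

lemma H1_dual_sum:
  assumes "finite Y" "\<And>y. y \<in> Y \<Longrightarrow> y \<in> H1_dual \<Omega>"
  shows "(\<lambda>v. \<Sum>y\<in>Y. c y * y v) \<in> H1_dual \<Omega>"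
  using assms
proof (induction Y rule: finite_induct)
  case empty
  show ?case by (auto simp: H1_dual_def intro: exI[of _ 0])
next
  case (insert l Y)
  then have 1: "(\<lambda>v. \<Sum>y\<in>Y. c y * y v) \<in> H1_dual \<Omega>" and l: "l \<in> H1_dual \<Omega>" by auto
  obtain C where C: "\<And>v. v \<in> H1 \<Omega> \<Longrightarrow> \<bar>l v\<bar> \<le> C * H1_norm \<Omega> v" using l unfolding H1_dual_def by blast
  have "\<bar>- (c l) * l v\<bar> \<le> (\<bar>c l\<bar> * C) * H1_norm \<Omega> v" if "v \<in> H1 \<Omega>" for v
    using mult_left_mono[OF C[OF that], of "\<bar>c l\<bar>"] by (simp add: abs_mult mult.assoc)
  then have "\<exists>C. \<forall>v\<in>H1 \<Omega>. \<bar>- (c l) * l v\<bar> \<le> C * H1_norm \<Omega> v" by blast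
  moreover have "- (c l) * l (\<lambda>x. a * v x + d * w x) = a * (- (c l) * l v) + d * (- (c l) * l w)"
    if "v \<in> H1 \<Omega>" "w \<in> H1 \<Omega>" for v w a d
    using l that by (simp add: H1_dual_def algebra_simps)
  ultimately have "(\<lambda>v. - (c l) * l v) \<in> H1_dual \<Omega>" by (simp only: H1_dual_def mem_Collect_eq) blast
  from H1_dual_diff[OF 1 this] show ?case using insert by (simp add: add.commute)
qed

text \<open>Evaluation at a vector of the unit ball is bounded by the dual norm, so it carries the
  approximation by simple functions to scalar integrals. The scalar function \<open>k\<close> is
  obtained as a limit of measurable functions and equals \<open>g t v\<close> only almost
  everywhere.\<close>

lemma bochner_integral_eval:
  assumes g: "has_bochner_integral_on {0<..<T} (H1_dual \<Omega>) (H1_dual_norm \<Omega>) g J"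
    and v: "v \<in> H1 \<Omega>" "H1_norm \<Omega> v \<le> 1"
  obtains k where "integrable (lebesgue_on {0<..<T}) k" "AE t in lebesgue_on {0<..<T}. k t = g t v"
    "(LINT t|lebesgue_on {0<..<T}. k t) = J v"
proof -
  define I where "I = {0<..<T}"
  have I: "I \<in> sets lebesgue" and fI: "emeasure lebesgue I < \<infinity>"
    by (auto simp: I_def emeasure_lborel_box_eq[of 0 T, simplified] emeasure_bounded_finite less_top[symmetric])
  define M where "M = lebesgue_on I"
  interpret M: finite_measure M
    unfolding M_def by (rule finite_measureI) (use I fI in \<open>auto simp: emeasure_restrict_space top.not_eq_extremum\<close>)
  obtain s where gE: "AE t in M. g t \<in> H1_dual \<Omega>" and J: "J \<in> H1_dual \<Omega>"
    and s: "\<And>k::nat. simple_fun_on I (H1_dual \<Omega>) (s k)"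
    and lim: "AE t in M. (\<lambda>k. H1_dual_norm \<Omega> (\<lambda>z. s k t z - g t z)) \<longlonglongrightarrow> 0"
    and L1: "(\<lambda>k. \<integral>\<^sup>+t. ennreal (H1_dual_norm \<Omega> (\<lambda>z. s k t z - g t z)) \<partial>M) \<longlonglongrightarrow> 0"
    and SJ: "(\<lambda>k. H1_dual_norm \<Omega> (\<lambda>z. simple_integral_on I (s k) z - J z)) \<longlonglongrightarrow> 0"
    using g unfolding has_bochner_integral_on_def I_def[symmetric] M_def[symmetric] by blast
  have fin: "finite (s k ` I)" and dual: "\<And>t. t \<in> I \<Longrightarrow> s k t \<in> H1_dual \<Omega>"
    and setm: "{t \<in> I. s k t = y} \<in> sets lebesgue" for k y
    using s[of k] by (auto simp: simple_fun_on_def)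
  have s_sum: "s k t v = (\<Sum>y\<in>s k ` I. indicator {t \<in> I. s k t = y} t * y v)" if "t \<in> I" for k t
  proof -
    have "(\<Sum>y\<in>s k ` I. indicator {t \<in> I. s k t = y} t * y v) = (\<Sum>y\<in>{s k t}. indicator {t \<in> I. s k t = y} t * y v)"
      by (rule sum.mono_neutral_right) (use fin that in \<open>auto simp: indicator_def\<close>)
    then show ?thesis using that by simp
  qed
  have seti: "integrable M (indicator {t \<in> I. s k t = y} :: real \<Rightarrow> real)"
    and setI: "(LINT t|M. indicator {t \<in> I. s k t = y} t) = measure lebesgue {t \<in> I. s k t = y}" for k y
  proof -
    have m: "{t \<in> I. s k t = y} \<in> sets M" using setm I by (auto simp: M_def sets_restrict_space_iff)
    then show "integrable M (indicator {t \<in> I. s k t = y} :: real \<Rightarrow> real)"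
      by (intro integrable_real_indicator) (simp_all add: M.emeasure_finite less_top[symmetric])
    have "measure M {t \<in> I. s k t = y} = measure lebesgue {t \<in> I. s k t = y}"
      unfolding M_def using I by (intro measure_restrict_space) auto
    then show "(LINT t|M. indicator {t \<in> I. s k t = y} t) = measure lebesgue {t \<in> I. s k t = y}"
      using m by (simp add: sets.Int_space_eq2)
  qed
  have sp: "space M = I" by (simp add: M_def)
  have si: "integrable M (\<lambda>t. s k t v)" for k
  proof -
    have "integrable M (\<lambda>t. \<Sum>y\<in>s k ` I. indicator {t \<in> I. s k t = y} t * y v)"
      by (intro Bochner_Integration.integrable_sum integrable_mult_left seti)
    then show ?thesis by (subst Bochner_Integration.integrable_cong[OF refl s_sum]) (auto simp: sp)
  qed
  have sI: "(LINT t|M. s k t v) = simple_integral_on I (s k) v" for k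
  proof -
    have "(LINT t|M. s k t v) = (LINT t|M. (\<Sum>y\<in>s k ` I. indicator {t \<in> I. s k t = y} t * y v))"
      by (rule Bochner_Integration.integral_cong[OF refl s_sum]) (simp add: sp)
    also have "\<dots> = (\<Sum>y\<in>s k ` I. measure lebesgue {t \<in> I. s k t = y} * y v)"
    proof -
      have "(LINT t|M. (\<Sum>y\<in>s k ` I. indicator {t \<in> I. s k t = y} t * y v))
          = (\<Sum>y\<in>s k ` I. LINT t|M. indicator {t \<in> I. s k t = y} t * y v)"
        by (intro Bochner_Integration.integral_sum integrable_mult_left seti)
      then show ?thesis by (simp only: integral_mult_left_zero setI)
    qed
    finally show ?thesis by (simp add: simple_integral_on_def)
  qed
  have sd: "simple_integral_on I (s k) \<in> H1_dual \<Omega>" for k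
    unfolding simple_integral_on_def using fin dual by (intro H1_dual_sum) auto
  have "(\<lambda>k. simple_integral_on I (s k) v - J v) \<longlonglongrightarrow> 0"
    by (rule Lim_null_comparison[OF always_eventually SJ])
       (use H1_dual_abs_le[OF H1_dual_diff[OF sd J] v] in simp)
  then have limJ: "(\<lambda>k. LINT t|M. s k t v) \<longlonglongrightarrow> J v" by (simp add: LIM_zero_iff sI)
  have pt: "AE t in M. \<forall>k. \<bar>s k t v - g t v\<bar> \<le> H1_dual_norm \<Omega> (\<lambda>z. s k t z - g t z)"
    using gE AE_space
  proof eventually_elim
    case (elim t)
    show ?case
    proof
      fix k
      from H1_dual_abs_le[OF H1_dual_diff[OF dual elim(1)] v, of t k] elim(2)
      show "\<bar>s k t v - g t v\<bar> \<le> H1_dual_norm \<Omega> (\<lambda>z. s k t z - g t z)" by (simp add: sp)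
    qed
  qed
  define h where "h t = lim (\<lambda>k. s k t v)" for t
  have [measurable]: "(\<lambda>t. s k t v) \<in> borel_measurable M" for k using si by blast
  have hm[measurable]: "h \<in> borel_measurable M" unfolding h_def by measurable
  have hg: "AE t in M. h t = g t v"
    using pt lim
  proof eventually_elim
    case (elim t)
    have "(\<lambda>k. s k t v - g t v) \<longlonglongrightarrow> 0"
      by (rule Lim_null_comparison[OF always_eventually elim(2)]) (use elim(1) in simp)
    then have "(\<lambda>k. s k t v) \<longlonglongrightarrow> g t v" by (simp add: LIM_zero_iff)
    then show ?case by (simp add: h_def limI)
  qed
  have le: "(\<integral>\<^sup>+t. ennreal (norm (s k t v - h t)) \<partial>M) \<le> (\<integral>\<^sup>+t. ennreal (H1_dual_norm \<Omega> (\<lambda>z. s k t z - g t z)) \<partial>M)" for k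
    by (rule nn_integral_mono_AE) (use pt hg in \<open>eventually_elim, auto intro: ennreal_leI\<close>)
  have conv: "(\<lambda>k. \<integral>\<^sup>+t. ennreal (norm (s k t v - h t)) \<partial>M) \<longlonglongrightarrow> 0"
    by (rule tendsto_sandwich[OF _ _ tendsto_const L1]) (use le in auto)
  have hi: "integrable M h"
  \<comment> \<open>A single approximant within finite distance of \<open>h\<close> in the integral
    norm suffices: \<open>h\<close> is then an integrable function minus an integrable one.\<close>
  proof -
    have "\<forall>\<^sub>F k in sequentially. (\<integral>\<^sup>+t. ennreal (norm (s k t v - h t)) \<partial>M) < 1"
      by (rule order_tendstoD(2)[OF conv]) simp
    then obtain k where k: "(\<integral>\<^sup>+t. ennreal (norm (s k t v - h t)) \<partial>M) < 1"
      by (auto simp: eventually_sequentially)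
    then have "integrable M (\<lambda>t. s k t v - h t)"
      by (intro integrableI_bounded) (auto intro: order.strict_trans)
    from Bochner_Integration.integrable_diff[OF si[of k] this] show ?thesis by simp
  qed
  have "(\<lambda>k. LINT t|M. s k t v) \<longlonglongrightarrow> (LINT t|M. h t)" by (rule tendsto_L1_int[OF si hi conv])
  then have "(LINT t|M. h t) = J v" using limJ LIMSEQ_unique by blast
  then show thesis
    using hi hg unfolding M_def I_def by (rule that[rotated 2])
qed

subsection \<open>The lemma of du Bois-Reymond\<close>

text \<open>A smooth approximation of the point mass at \<open>s\<close>, concentrated immediately
  to the right of \<open>s\<close>.\<close>

definition step_bump :: "real \<Rightarrow> real \<Rightarrow> real \<Rightarrow> real" where
  "step_bump \<delta> s \<tau> = bump 1 s (s + \<delta>) \<tau> / (LINT x|lborel. bump 1 s (s + \<delta>) x)"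

lemma bump_continuous: "continuous_on UNIV (bump m a b)"
  by (rule smooth_continuous[OF flat_alg_smooth[OF bump_flat_alg]])

lemma bump_integrable:
  assumes "m > 0"
  shows "integrable lborel (bump m a (b :: real))"
proof -
  have "integrable lborel (\<lambda>x. indicator {a..b} x *\<^sub>R bump m a b x)"
    using borel_integrable_atLeastAtMost'[OF continuous_on_subset[OF bump_continuous], of a b m a b]
    by (simp add: set_integrable_def)
  moreover have "(\<lambda>x. indicator {a..b} x *\<^sub>R bump m a b x) = bump m a b"
    using bump_nonzero[OF assms, of a b] by (force simp: indicator_def fun_eq_iff)
  ultimately show ?thesis by simp
qed

context
  fixes \<delta> s :: real
  assumes \<delta>: "\<delta> > 0"
begin

lemma bump_integral_pos: "(LINT x|lborel. bump 1 s (s + \<delta>) x) > 0"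
proof -
  have "(LINT x|lborel. bump 1 s (s + \<delta>) x) \<noteq> 0"
  proof
    assume "(LINT x|lborel. bump 1 s (s + \<delta>) x) = 0"
    then have "AE x in lborel. bump 1 s (s + \<delta>) x = 0"
      using integral_nonneg_eq_0_iff_AE[OF bump_integrable[of 1 s "s + \<delta>"] AE_I2[OF bump_bounds(1)]] by simp
    then have "AE x in lborel. x \<notin> {s<..<s+\<delta>}"
      by eventually_elim (use bump_pos[of 1 _ s "s + \<delta>"] in force)
    then have "{s<..<s+\<delta>} \<in> null_sets lborel" by (subst AE_iff_null_sets) auto
    then show False using \<delta> by (simp add: null_sets_def)
  qed
  moreover have "(LINT x|lborel. bump 1 s (s + \<delta>) x) \<ge> 0"
    by (intro integral_nonneg_AE) (simp add: bump_bounds)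
  ultimately show ?thesis by linarith
qed

lemma step_bump_nonneg: "0 \<le> step_bump \<delta> s \<tau>"
  unfolding step_bump_def by (rule divide_nonneg_pos[OF bump_bounds(1) bump_integral_pos])

lemma step_bump_support: "step_bump \<delta> s \<tau> \<noteq> 0 \<Longrightarrow> s < \<tau> \<and> \<tau> < s + \<delta>"
  using bump_nonzero[of 1 s "s + \<delta>" \<tau>] by (auto simp: step_bump_def)

lemma step_bump_integrable: "integrable lborel (step_bump \<delta> s)"
  unfolding step_bump_def[abs_def] using bump_integrable[of 1 s "s + \<delta>"] by simp

lemma step_bump_integral: "(LINT \<tau>|lborel. step_bump \<delta> s \<tau>) = 1"
  unfolding step_bump_def[abs_def] using bump_integral_pos by simp

lemma step_bump_continuous: "continuous_on UNIV (step_bump \<delta> s)"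
  unfolding step_bump_def[abs_def] using bump_integral_pos by (intro continuous_intros bump_continuous) auto

lemma step_bump_flat_alg: "flat_alg (step_bump \<delta> s)"
proof -
  have "step_bump \<delta> s = (\<lambda>\<tau>. (1 / (LINT x|lborel. bump 1 s (s + \<delta>) x)) * bump 1 s (s + \<delta>) \<tau>)"
    by (auto simp: step_bump_def)
  then show ?thesis by (simp only: flat_alg.mult[OF flat_alg.const bump_flat_alg])
qed

text \<open>A smooth approximation of the jump at \<open>s\<close>, rising from 0 to 1 between
  \<open>s\<close> and \<open>s + \<delta>\<close>.\<close>

definition smooth_step :: "real \<Rightarrow> real" where
  "smooth_step \<tau> = (LINT x:{..\<tau>}|lborel. step_bump \<delta> s x)"

lemma step_bump_set_integrable: "A \<in> sets borel \<Longrightarrow> set_integrable lborel A (step_bump \<delta> s)"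
  unfolding set_integrable_def by (rule integrable_mult_indicator[OF _ step_bump_integrable]) simp

lemma smooth_step_bounds: "0 \<le> smooth_step \<tau>" "smooth_step \<tau> \<le> 1"
proof -
  show "0 \<le> smooth_step \<tau>"
    unfolding smooth_step_def set_lebesgue_integral_def
    by (intro integral_nonneg_AE) (simp add: step_bump_nonneg)
  have "smooth_step \<tau> \<le> (LINT x|lborel. step_bump \<delta> s x)"
    unfolding smooth_step_def set_lebesgue_integral_def
    using step_bump_set_integrable[of "{..\<tau>}"] step_bump_nonneg
    by (intro integral_mono step_bump_integrable) (auto simp: set_integrable_def indicator_def)
  then show "smooth_step \<tau> \<le> 1" by (simp add: step_bump_integral)
qed

lemma smooth_step_0: "\<tau> \<le> s \<Longrightarrow> smooth_step \<tau> = 0"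
  unfolding smooth_step_def set_lebesgue_integral_def
  by (rule integral_eq_zero_AE) (use step_bump_support in \<open>auto simp: indicator_def intro!: AE_I2\<close>, fastforce)

lemma smooth_step_1: "s + \<delta> \<le> \<tau> \<Longrightarrow> smooth_step \<tau> = 1"
proof -
  assume "s + \<delta> \<le> \<tau>"
  then have "smooth_step \<tau> = (LINT \<tau>|lborel. step_bump \<delta> s \<tau>)"
    unfolding smooth_step_def set_lebesgue_integral_def
    by (intro Bochner_Integration.integral_cong) (use step_bump_support in \<open>fastforce simp: indicator_def\<close>)+
  then show ?thesis by (simp add: step_bump_integral)
qed

lemma smooth_step_deriv: "(smooth_step has_real_derivative step_bump \<delta> s \<tau>) (at \<tau>)"
proof -
  \<comment> \<open>A point to the left of both the bump and \<open>\<tau>\<close>, so that near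
    \<open>\<tau>\<close> the integral over a half-line is one from \<open>a\<close>, to which the
    fundamental theorem of calculus applies.\<close>
  define a where "a = min s \<tau> - 1"
  have eq: "smooth_step x = integral {a..x} (step_bump \<delta> s)" if "a \<le> x" for x
  proof -
    have "smooth_step x = (LINT x:{a..x}|lborel. step_bump \<delta> s x)"
      unfolding smooth_step_def set_lebesgue_integral_def
    proof (rule Bochner_Integration.integral_cong)
      fix y
      show "indicator {..x} y *\<^sub>R step_bump \<delta> s y = indicator {a..x} y *\<^sub>R step_bump \<delta> s y"
        using step_bump_support[of y] by (cases "step_bump \<delta> s y = 0") (auto simp: indicator_def a_def)
    qed simp
    also have "\<dots> = integral {a..x} (step_bump \<delta> s)"
      by (rule set_borel_integral_eq_integral(2)) (rule step_bump_set_integrable, simp)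
    finally show ?thesis .
  qed
  have "((\<lambda>x. integral {a..x} (step_bump \<delta> s)) has_real_derivative step_bump \<delta> s \<tau>) (at \<tau> within {a..\<tau>+1})"
    by (rule integral_has_real_derivative[OF continuous_on_subset[OF step_bump_continuous]]) (auto simp: a_def)
  then have "((\<lambda>x. integral {a..x} (step_bump \<delta> s)) has_real_derivative step_bump \<delta> s \<tau>) (at \<tau>)"
    by (simp add: at_within_Icc_at a_def min_def split: if_splits)
  then show ?thesis
    by (rule has_field_derivative_transform_within_open[of _ _ _ "{a<..}"]) (auto simp: a_def eq)
qed

text \<open>The bump is a probability density, so averaging moves \<open>q s\<close> by no more than
  the oscillation of \<open>q\<close> over the support. The bound \<open>\<epsilon>\<close> may be
  crude, for integrability, or small, for the limit.\<close>

lemma step_bump_average: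
  assumes q: "continuous_on UNIV q" and le: "\<And>\<tau>. s < \<tau> \<Longrightarrow> \<tau> < s + \<delta> \<Longrightarrow> \<bar>q \<tau> - q s\<bar> \<le> \<epsilon>"
  shows "integrable lborel (\<lambda>\<tau>. step_bump \<delta> s \<tau> * q \<tau>)"
    and "\<bar>(LINT \<tau>|lborel. step_bump \<delta> s \<tau> * q \<tau>) - q s\<bar> \<le> \<epsilon>"
proof -
  have [measurable]: "q \<in> borel_measurable borel" "step_bump \<delta> s \<in> borel_measurable borel"
    using q step_bump_continuous by (auto intro: borel_measurable_continuous_onI)
  have pt: "\<bar>step_bump \<delta> s \<tau> * (q \<tau> - q s)\<bar> \<le> step_bump \<delta> s \<tau> * \<epsilon>" for \<tau>
    using step_bump_support[of \<tau>] le[of \<tau>] step_bump_nonneg[of \<tau>]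
    by (cases "step_bump \<delta> s \<tau> = 0") (auto simp: abs_mult intro: mult_left_mono)
  have ie: "integrable lborel (\<lambda>\<tau>. step_bump \<delta> s \<tau> * \<epsilon>)" using step_bump_integrable by simp
  have id: "integrable lborel (\<lambda>\<tau>. step_bump \<delta> s \<tau> * (q \<tau> - q s))"
    by (rule Bochner_Integration.integrable_bound[OF ie]) (use pt in \<open>auto intro!: AE_I2 order_trans[OF pt]\<close>)
  have "integrable lborel (\<lambda>\<tau>. step_bump \<delta> s \<tau> * (q \<tau> - q s) + step_bump \<delta> s \<tau> * q s)"
    using id step_bump_integrable by simp
  then show i: "integrable lborel (\<lambda>\<tau>. step_bump \<delta> s \<tau> * q \<tau>)" by (simp add: right_diff_distrib)
  have "(LINT \<tau>|lborel. step_bump \<delta> s \<tau> * (q \<tau> - q s)) = (LINT \<tau>|lborel. step_bump \<delta> s \<tau> * q \<tau>) - q s"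
    using i step_bump_integrable by (simp add: right_diff_distrib step_bump_integral)
  moreover have "\<bar>LINT \<tau>|lborel. step_bump \<delta> s \<tau> * (q \<tau> - q s)\<bar> \<le> (LINT \<tau>|lborel. step_bump \<delta> s \<tau> * \<epsilon>)"
    by (rule order_trans[OF integral_abs_bound integral_mono]) (use id ie pt in auto)
  ultimately show "\<bar>(LINT \<tau>|lborel. step_bump \<delta> s \<tau> * q \<tau>) - q s\<bar> \<le> \<epsilon>"
    by (simp add: step_bump_integral)
qed

end

lemma step_bump_tendsto:
  assumes q: "continuous_on UNIV q"
  shows "((\<lambda>\<delta>. LINT \<tau>|lborel. step_bump \<delta> s \<tau> * q \<tau>) \<longlongrightarrow> q s) (at_right 0)"
proof (rule tendstoI)
  fix e :: real assume e: "e > 0"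
  have "isCont q s" using q by (simp add: continuous_on_eq_continuous_at)
  then obtain d where d: "d > 0" "\<And>\<tau>. dist \<tau> s < d \<Longrightarrow> dist (q \<tau>) (q s) < e/2"
    using e unfolding continuous_at_eps_delta by (metis half_gt_zero)
  have "dist (LINT \<tau>|lborel. step_bump \<delta> s \<tau> * q \<tau>) (q s) < e" if "0 < \<delta>" "\<delta> < d" for \<delta>
  proof -
    have "\<bar>q \<tau> - q s\<bar> \<le> e/2" if "s < \<tau>" "\<tau> < s + \<delta>" for \<tau>
      using d(2)[of \<tau>] that \<open>\<delta> < d\<close> by (simp add: dist_real_def)
    from step_bump_average(2)[OF \<open>0 < \<delta>\<close> q this] show ?thesis using e by (simp add: dist_real_def)
  qed
  then show "\<forall>\<^sub>F \<delta> in at_right 0. dist (LINT \<tau>|lborel. step_bump \<delta> s \<tau> * q \<tau>) (q s) < e"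
    unfolding eventually_at_right_field using d(1) by blast
qed

text \<open>A smooth plateau between \<open>s\<close> and \<open>t\<close> with both ramps to the
  right of these points; \<open>0 < s\<close> and \<open>t + \<delta> < T\<close> keep its support
  inside the open interval. It is smooth because its derivative is a difference of bumps.\<close>

lemma smooth_indicator_test_function:
  assumes st: "0 < s" "s < t" and \<delta>: "0 < \<delta>" "t + \<delta> < T"
  defines "\<phi> \<equiv> \<lambda>\<tau>. smooth_step \<delta> s \<tau> - smooth_step \<delta> t \<tau>"
  shows "\<phi> \<in> test_functions {0<..<T}" "dir_deriv 1 \<phi> = (\<lambda>\<tau>. step_bump \<delta> s \<tau> - step_bump \<delta> t \<tau>)"
proof -
  have d: "(\<phi> has_derivative (\<lambda>h. (step_bump \<delta> s \<tau> - step_bump \<delta> t \<tau>) * h)) (at \<tau>)" for \<tau>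
    using DERIV_diff[OF smooth_step_deriv[OF \<delta>(1), of s \<tau>] smooth_step_deriv[OF \<delta>(1), of t \<tau>]]
    by (simp add: \<phi>_def has_field_derivative_def)
  have dd: "dir_deriv v \<phi> = (\<lambda>\<tau>. (step_bump \<delta> s \<tau> + (-1) * step_bump \<delta> t \<tau>) * v)" for v
    unfolding dir_deriv_def using frechet_derivative_at[OF d] by (simp add: fun_eq_iff)
  show "dir_deriv 1 \<phi> = (\<lambda>\<tau>. step_bump \<delta> s \<tau> - step_bump \<delta> t \<tau>)" by (simp add: dd)
  have "smooth \<phi>"
  proof (rule smoothI)
    show "\<phi> differentiable_on UNIV" using d by (auto simp: differentiable_on_def differentiable_def)
    show "flat_alg (dir_deriv v \<phi>)" for v
      unfolding dd by (intro flat_alg.intros step_bump_flat_alg \<delta>)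
  qed
  moreover have "closure {\<tau>. \<phi> \<tau> \<noteq> 0} \<subseteq> {s..t + \<delta>}"
  proof (rule closure_minimal)
    show "{\<tau>. \<phi> \<tau> \<noteq> 0} \<subseteq> {s..t + \<delta>}"
    proof
      fix \<tau> assume "\<tau> \<in> {\<tau>. \<phi> \<tau> \<noteq> 0}"
      then have "\<phi> \<tau> \<noteq> 0" by simp
      moreover have "\<phi> \<tau> = 0" if "\<tau> < s" using that st by (simp add: \<phi>_def smooth_step_0[OF \<delta>(1)])
      moreover have "\<phi> \<tau> = 0" if "\<tau> > t + \<delta>" using that st by (simp add: \<phi>_def smooth_step_1[OF \<delta>(1)])
      ultimately show "\<tau> \<in> {s..t + \<delta>}" by force
    qed
  qed simp
  moreover have "{s..t + \<delta>} \<subseteq> {0<..<T}" using st \<delta> by auto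
  ultimately show "\<phi> \<in> test_functions {0<..<T}"
    using compact_closure_subset[of "{s..t + \<delta>}" "{\<tau>. \<phi> \<tau> \<noteq> 0}"] by (auto simp: test_functions_def)
qed

text \<open>The plateau functions are the test functions: their derivatives concentrate at
  \<open>s\<close> and \<open>t\<close>, which produces \<open>q s - q t\<close>, while they
  themselves tend boundedly to the indicator of the interval.\<close>

lemma du_bois_reymond_interior:
  assumes q: "continuous_on UNIV q" and g: "L2t g"
    and weak: "\<And>\<phi>. \<phi> \<in> test_functions {0<..<T} \<Longrightarrow>
      (LINT t|lborel. dir_deriv 1 \<phi> t * q t) = - (LINT t|lborel. \<phi> t * g t)"
    and st: "0 < s" "s < t" "t < T"
  shows "q t - q s = (LINT \<tau>:{s..t}|lborel. g \<tau>)"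
proof -
  \<comment> \<open>The denominator starts at 2, not 1, so that \<open>t + \<delta> k < T\<close> is
    strict already for \<open>k = 0\<close>.\<close>
  define \<delta> where "\<delta> k = (T - t) * inverse (real (Suc (Suc k)))" for k
  have \<delta>: "0 < \<delta> k" "t + \<delta> k < T" for k
  proof -
    show "0 < \<delta> k" using st by (simp add: \<delta>_def)
    have "\<delta> k < (T - t) * 1" unfolding \<delta>_def using st by (intro mult_strict_left_mono) (auto simp: field_simps)
    then show "t + \<delta> k < T" by simp
  qed
  have "\<delta> \<longlonglongrightarrow> (T - t) * 0"
    unfolding \<delta>_def by (intro tendsto_intros LIMSEQ_Suc[OF LIMSEQ_inverse_real_of_nat])
  then have \<delta>0: "\<delta> \<longlonglongrightarrow> 0" by simp
  then have fl: "filterlim \<delta> (at_right 0) sequentially"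
    by (rule tendsto_imp_filterlim_at_right) (simp add: \<delta>)
  define \<phi> where "\<phi> k = (\<lambda>\<tau>. smooth_step (\<delta> k) s \<tau> - smooth_step (\<delta> k) t \<tau>)" for k
  note test = smooth_indicator_test_function[OF st(1,2) \<delta>, folded \<phi>_def]
  have iq: "integrable lborel (\<lambda>\<tau>. step_bump (\<delta> k) a \<tau> * q \<tau>)" for a k
  proof -
    have "\<exists>C. \<forall>\<tau>\<in>{a..a+\<delta> k}. \<bar>q \<tau> - q a\<bar> \<le> C"
    proof -
      have "compact ((\<lambda>\<tau>. q \<tau> - q a) ` {a..a+\<delta> k})"
        by (rule compact_continuous_image) (auto intro!: continuous_intros continuous_on_subset[OF q])
      then show ?thesis by (meson bounded_real compact_imp_bounded image_eqI)
    qed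
    then obtain C where "\<And>\<tau>. a < \<tau> \<Longrightarrow> \<tau> < a + \<delta> k \<Longrightarrow> \<bar>q \<tau> - q a\<bar> \<le> C" by force
    from step_bump_average(1)[OF \<delta>(1) q this] show ?thesis .
  qed
  have "(LINT \<tau>|lborel. dir_deriv 1 (\<phi> k) \<tau> * q \<tau>)
      = (LINT \<tau>|lborel. step_bump (\<delta> k) s \<tau> * q \<tau>) - (LINT \<tau>|lborel. step_bump (\<delta> k) t \<tau> * q \<tau>)" for k
    unfolding test(2) left_diff_distrib by (rule Bochner_Integration.integral_diff[OF iq iq])
  moreover have "(\<lambda>k. (LINT \<tau>|lborel. step_bump (\<delta> k) s \<tau> * q \<tau>) - (LINT \<tau>|lborel. step_bump (\<delta> k) t \<tau> * q \<tau>)) \<longlonglongrightarrow> q s - q t"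
    by (intro tendsto_diff filterlim_compose[OF step_bump_tendsto[OF q] fl])
  ultimately have lhs: "(\<lambda>k. - (LINT \<tau>|lborel. \<phi> k \<tau> * g \<tau>)) \<longlonglongrightarrow> q s - q t"
    using weak[OF test(1)] by simp
  have gm[measurable]: "g \<in> borel_measurable borel" using g by (simp add: L2t_def)
  have \<phi>m[measurable]: "\<phi> k \<in> borel_measurable borel" for k
    by (rule sq_int_measurable[OF test_function_sq_int[OF test(1)]])
  have \<phi>z: "\<phi> k \<tau> = 0" if "\<tau> \<notin> {0..T}" for k \<tau>
    using test_function_zero_off[OF test(1)[of k], of \<tau>] that by auto
  have \<phi>b: "\<bar>\<phi> k \<tau>\<bar> \<le> 1" for k \<tau>
    using smooth_step_bounds[OF \<delta>(1)[of k], of s \<tau>] smooth_step_bounds[OF \<delta>(1)[of k], of t \<tau>]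
    by (simp add: \<phi>_def abs_le_iff)
  have "(\<lambda>k. LINT \<tau>|lborel. \<phi> k \<tau> * g \<tau>) \<longlonglongrightarrow> (LINT \<tau>|lborel. indicator {s<..t} \<tau> * g \<tau>)"
  proof (rule integral_dominated_convergence[where w="\<lambda>\<tau>. norm (indicator {0..T} \<tau> *\<^sub>R g \<tau>)"])
    show "integrable lborel (\<lambda>\<tau>. norm (indicator {0..T} \<tau> *\<^sub>R g \<tau>))"
      using L2t_set_integrable[OF g, of 0 T] unfolding set_integrable_def by (rule integrable_norm)
    have "(\<lambda>k. \<phi> k \<tau>) \<longlonglongrightarrow> indicator {s<..t} \<tau>" for \<tau>
    proof (rule tendsto_eventually)
      \<comment> \<open>The ramps lie to the right of their starting points, so the limit at
        \<open>\<tau> = a\<close> is 0. The limiting indicator is therefore open at \<open>s\<close>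
        and closed at \<open>t\<close>.\<close>
      have ev: "\<forall>\<^sub>F k in sequentially. smooth_step (\<delta> k) a \<tau> = (if a < \<tau> then 1 else 0)" for a
      proof (cases "a < \<tau>")
        case True
        then have "\<forall>\<^sub>F k in sequentially. \<delta> k < \<tau> - a" by (intro order_tendstoD(2)[OF \<delta>0]) simp
        then show ?thesis by eventually_elim (use True in \<open>simp add: smooth_step_1[OF \<delta>(1)]\<close>)
      next
        case False
        then show ?thesis by (simp add: smooth_step_0[OF \<delta>(1)])
      qed
      show "\<forall>\<^sub>F k in sequentially. \<phi> k \<tau> = indicator {s<..t} \<tau>"
        using ev[of s] ev[of t] by eventually_elim (use st in \<open>auto simp: \<phi>_def indicator_def\<close>)
    qed
    then show "AE \<tau> in lborel. (\<lambda>k. \<phi> k \<tau> * g \<tau>) \<longlonglongrightarrow> indicator {s<..t} \<tau> * g \<tau>"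
      by (intro AE_I2 tendsto_mult_right)
    show "AE \<tau> in lborel. norm (\<phi> k \<tau> * g \<tau>) \<le> norm (indicator {0..T} \<tau> *\<^sub>R g \<tau>)" for k
    proof (rule AE_I2)
      fix \<tau>
      show "norm (\<phi> k \<tau> * g \<tau>) \<le> norm (indicator {0..T} \<tau> *\<^sub>R g \<tau>)"
        using \<phi>b[of k \<tau>] by (cases "\<tau> \<in> {0..T}") (simp_all add: abs_mult mult_left_le_one_le \<phi>z del: atLeastAtMost_iff)
    qed
  qed measurable
  also have "(LINT \<tau>|lborel. indicator {s<..t} \<tau> * g \<tau>) = (LINT \<tau>:{s..t}|lborel. g \<tau>)"
    unfolding set_lebesgue_integral_def
  proof (rule integral_cong_AE)
    show "AE \<tau> in lborel. indicator {s<..t} \<tau> * g \<tau> = indicator {s..t} \<tau> *\<^sub>R g \<tau>"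
      using AE_lborel_singleton[of s] by eventually_elim (auto simp: indicator_def)
  qed measurable
  finally have "(\<lambda>k. - (LINT \<tau>|lborel. \<phi> k \<tau> * g \<tau>)) \<longlonglongrightarrow> - (LINT \<tau>:{s..t}|lborel. g \<tau>)" by (rule tendsto_minus)
  from LIMSEQ_unique[OF lhs this] show ?thesis by simp
qed

text \<open>\<open>q\<close> minus a primitive of \<open>g\<close> is constant in the open interval
  by the interior case, and continuous, hence constant up to the end points.\<close>

lemma du_bois_reymond:
  assumes q: "continuous_on UNIV q" and g: "L2t g"
    and weak: "\<And>\<phi>. \<phi> \<in> test_functions {0<..<T} \<Longrightarrow>
      (LINT t|lborel. dir_deriv 1 \<phi> t * q t) = - (LINT t|lborel. \<phi> t * g t)"
    and T: "0 < T" and st: "0 \<le> s" "s \<le> t" "t \<le> T"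
  shows "q t - q s = (LINT \<tau>:{s..t}|lborel. g \<tau>)"
proof -
  define g0 where "g0 \<tau> = indicator {0..T} \<tau> *\<^sub>R g \<tau>" for \<tau>
  have g0: "L2t g0" unfolding g0_def by (rule L2t_indicator[OF g]) simp
  have g0i: "integrable lborel g0"
    using L2t_set_integrable[OF g, of 0 T] by (simp add: set_integrable_def g0_def[abs_def])
  have g0s: "set_integrable lborel A g0" if "A \<in> sets borel" for A
    unfolding set_integrable_def using that by (intro integrable_mult_indicator g0i) simp
  define w where "w t = (LINT \<tau>:{..t}|lborel. g0 \<tau>)" for t
  have wd: "w t - w s = (LINT \<tau>:{s..t}|lborel. g0 \<tau>)" if "s \<le> t" for s t
  proof -
    have "{..t} = {..s} \<union> {s<..t}" using that by auto
    then have "w t = w s + (LINT \<tau>:{s<..t}|lborel. g0 \<tau>)"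
    proof -
      have "{..s} \<inter> {s<..t} = {}" by auto
      from set_integral_Un[OF this g0s g0s] \<open>{..t} = {..s} \<union> {s<..t}\<close> show ?thesis unfolding w_def by simp
    qed
    also have "(LINT \<tau>:{s<..t}|lborel. g0 \<tau>) = (LINT \<tau>:{s..t}|lborel. g0 \<tau>)"
    proof (rule set_integral_cong_set)
      show "AE x in lborel. x \<in> {s..t} \<longleftrightarrow> x \<in> {s<..t}"
        using AE_lborel_singleton[of s] by eventually_elim auto
    qed (use g0s in \<open>auto simp: set_borel_measurable_def set_integrable_def\<close>)
    finally show ?thesis by simp
  qed
  have cont: "continuous_on UNIV (\<lambda>t. q t - w t)"
    by (intro continuous_intros q continuous_of_integral[OF g0 wd])
  have eq: "(LINT \<tau>:{s..t}|lborel. g0 \<tau>) = (LINT \<tau>:{s..t}|lborel. g \<tau>)" if "0 \<le> s" "t \<le> T" for s t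
    unfolding set_lebesgue_integral_def
    by (rule Bochner_Integration.integral_cong) (use that in \<open>auto simp: g0_def indicator_def\<close>)
  have inner: "q t - w t = q s - w s" if "0 < s" "s < t" "t < T" for s t
    using du_bois_reymond_interior[OF q g weak that] wd[of s t] eq[of s t] that by simp
  have const: "q x - w x = q (T/2) - w (T/2)" if "x \<in> {0<..<T}" for x
  proof -
    have x: "0 < x" "x < T" using that by simp_all
    consider "x < T/2" | "x = T/2" | "T/2 < x" by linarith
    then show ?thesis
    proof cases
      case 1
      then show ?thesis using inner[OF x(1) 1] T by linarith
    next
      case 2
      then show ?thesis by (simp only:)
    next
      case 3
      then show ?thesis using inner[OF _ 3 x(2)] T by linarith
    qed
  qed
  have "q x - w x = q (T/2) - w (T/2)" if "x \<in> {0..T}" for x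
  proof (rule continuous_constant_on_closure[of "{0<..<T}" "\<lambda>x. q x - w x"])
    show "continuous_on (closure {0<..<T}) (\<lambda>x. q x - w x)" using cont continuous_on_subset by blast
    show "x \<in> closure {0<..<T}" using that T by simp
  qed (rule const)
  from this[of s] this[of t] have "q t - q s = w t - w s" using st by simp
  then show ?thesis using wd[OF st(2)] eq[OF st(1,3)] by simp
qed

section \<open>Slices of functions on the space-time cylinder\<close>

lemma lebesgue_measurable_cong_AE:
  fixes f g :: "'a::euclidean_space \<Rightarrow> 'b::topological_space"
  assumes g: "g \<in> borel_measurable lebesgue" and ae: "AE x in lebesgue. f x = g x"
  shows "f \<in> borel_measurable lebesgue"
proof (rule borel_measurableI)
  fix S :: "'b set" assume "open S"
  then have 1: "g -` S \<inter> space lebesgue \<in> sets lebesgue" using measurable_sets[OF g, of S] by simp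
  have 2: "AE x in lebesgue. x \<in> g -` S \<inter> space lebesgue \<longleftrightarrow> x \<in> f -` S \<inter> space lebesgue"
    using ae by eventually_elim simp
  show "f -` S \<inter> space lebesgue \<in> sets lebesgue" by (rule completion.in_sets_AE[OF 2 1]) simp
qed

lemma sq_int_AE_L2:
  assumes g: "sq_int g" and ae: "AE x in lebesgue. f x = g x"
  shows "f \<in> L2 UNIV" "l2_of f = abs_l2 g"
proof -
  have L: "g \<in> borel_measurable lebesgue" "integrable lebesgue (\<lambda>x. (norm (g x))\<^sup>2)"
    using sq_int_imp_L2[OF g] by (auto simp: L2_UNIV)
  have [measurable]: "f \<in> borel_measurable lebesgue" by (rule lebesgue_measurable_cong_AE[OF L(1) ae])
  have "integrable lebesgue (\<lambda>x. (norm (f x))\<^sup>2)"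
    by (rule integrable_cong_AE_imp[OF L(2)]) (use ae in \<open>auto elim: eventually_mono\<close>)
  then show "f \<in> L2 UNIV" by (simp add: L2_UNIV)
  show "l2_of f = abs_l2 g" by (rule l2_of_eqI[OF g ae])
qed

text \<open>A Lebesgue null set is contained in a Borel null set, and Fubini holds for the Borel
  product measure.\<close>

lemma AE_lebesgue_slices:
  fixes P :: "'a::euclidean_space \<times> real \<Rightarrow> bool"
  assumes "AE z in lebesgue. P z"
  shows "AE t in lborel. AE x in lborel. P (x, t)"
proof -
  have "AE z in lborel. P z" using assms by (simp add: AE_completion_iff)
  then obtain N :: "('a \<times> real) set" where N: "{z \<in> space lborel. \<not> P z} \<subseteq> N" "emeasure lborel N = 0" "N \<in> sets (lborel :: ('a \<times> real) measure)"
    using AE_E by blast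
  have "AE z in lborel. z \<notin> N" using N by (intro AE_not_in) auto
  then have "AE z in (lborel :: 'a measure) \<Otimes>\<^sub>M (lborel :: real measure). z \<notin> N" unfolding lborel_prod .
  then have 1: "AE x in lborel. AE t in lborel. (x, t) \<notin> N" by (rule lborel_pair.AE_pair)
  have "{z \<in> space (lborel \<Otimes>\<^sub>M lborel). (fst z, snd z) \<notin> N} = space (lborel \<Otimes>\<^sub>M lborel) - N" by auto
  also have "\<dots> \<in> sets (lborel \<Otimes>\<^sub>M lborel)" using N(3) by (intro sets.Diff sets.top) (simp only: lborel_prod)
  finally have "AE t in lborel. AE x in lborel. (x, t) \<notin> N"
    using lborel_pair.AE_commute[of "\<lambda>x t. (x, t) \<notin> N"] 1 by blast
  then show ?thesis
  proof eventually_elim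
    case (elim t)
    then show ?case by eventually_elim (use N(1) in auto)
  qed
qed

text \<open>An open set is a countable union of balls with centres in a dense set and rational
  radii. For values in L2 the distances to fixed elements are parameter integrals, so they are
  easier to handle than preimages.\<close>

lemma borel_measurable_of_dist:
  fixes h :: "'m \<Rightarrow> 'x::{metric_space,second_countable_topology}"
  assumes h: "\<And>c. (\<lambda>t. dist (h t) c) \<in> borel_measurable M"
  shows "h \<in> borel_measurable M"
proof (rule borel_measurableI)
  fix S :: "'x set" assume S: "open S"
  obtain D :: "'x set" where D: "countable D" "\<And>X. open X \<Longrightarrow> X \<noteq> {} \<Longrightarrow> \<exists>d\<in>D. d \<in> X"
    by (erule countable_dense_setE)
  define R where "R = {(d, q). d \<in> D \<and> q \<in> \<rat> \<and> ball d q \<subseteq> S}"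
  have cR: "countable R"
    by (rule countable_subset[of _ "D \<times> \<rat>"]) (auto simp: R_def D(1) countable_rat)
  have "h -` S \<inter> space M = (\<Union>(d, q)\<in>R. {t \<in> space M. dist (h t) d < q})"
  proof (intro equalityI subsetI)
    fix t assume t: "t \<in> h -` S \<inter> space M"
    then obtain e where e: "e > 0" "ball (h t) e \<subseteq> S" using S openE by blast
    obtain d where d: "d \<in> D" "d \<in> ball (h t) (e/4)" using D(2)[of "ball (h t) (e/4)"] e by auto
    obtain q where q: "q \<in> \<rat>" "e/4 < q" "q < e/2" using Rats_dense_in_real[of "e/4" "e/2"] e by auto
    have "ball d q \<subseteq> ball (h t) e"
    proof
      fix y assume "y \<in> ball d q"
      then show "y \<in> ball (h t) e" using dist_triangle[of "h t" y d] d q e by simp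
    qed
    then have "(d, q) \<in> R" using e d q by (auto simp: R_def)
    moreover have "dist (h t) d < q" using d q by simp
    ultimately show "t \<in> (\<Union>(d, q)\<in>R. {t \<in> space M. dist (h t) d < q})" using t by auto
  next
    fix t assume "t \<in> (\<Union>(d, q)\<in>R. {t \<in> space M. dist (h t) d < q})"
    then show "t \<in> h -` S \<inter> space M" by (auto simp: R_def subset_eq dist_commute)
  qed
  also have "\<dots> \<in> sets M"
    using h by (intro sets.countable_UN'[OF cR]) (auto split: prod.splits)
  finally show "h -` S \<inter> space M \<in> sets M" .
qed

lemma slice_measurable:
  fixes H :: "'a::euclidean_space \<times> real \<Rightarrow> 'b::topological_space"
  assumes "H \<in> borel_measurable borel"
  shows "(\<lambda>(t, x). H (x, t)) \<in> borel_measurable (borel \<Otimes>\<^sub>M borel)" "(\<lambda>x. H (x, t)) \<in> borel_measurable borel"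
proof -
  have H: "H \<in> borel_measurable (borel \<Otimes>\<^sub>M borel)" using assms by (simp add: borel_prod)
  have "(\<lambda>p. (snd p, fst p)) \<in> borel \<Otimes>\<^sub>M borel \<rightarrow>\<^sub>M borel \<Otimes>\<^sub>M borel" by measurable
  from measurable_compose[OF this H] show "(\<lambda>(t, x). H (x, t)) \<in> borel_measurable (borel \<Otimes>\<^sub>M borel)"
    by (simp add: case_prod_beta')
  have "(\<lambda>x. (x, t)) \<in> borel \<rightarrow>\<^sub>M borel \<Otimes>\<^sub>M borel" by measurable
  from measurable_compose[OF this H] show "(\<lambda>x. H (x, t)) \<in> borel_measurable borel" .
qed

lemma abs_l2_slice_measurable:
  fixes H :: "'a::euclidean_space \<times> real \<Rightarrow> 'b::euclidean_space"
  assumes H: "H \<in> borel_measurable borel" and sq: "\<And>t. sq_int (\<lambda>x. H (x, t))"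
  shows "(\<lambda>t. abs_l2 (\<lambda>x. H (x, t))) \<in> borel_measurable borel"
proof (rule borel_measurable_of_dist)
  fix c :: "('a, 'b) l2"
  have d: "dist (abs_l2 (\<lambda>x. H (x, t))) c = sqrt (LINT x|lborel. (norm (H (x, t) - rep_l2 c x))\<^sup>2)" for t
  proof -
    have "(dist (abs_l2 (\<lambda>x. H (x, t))) c)\<^sup>2 = (norm (abs_l2 (\<lambda>x. H (x, t)) - abs_l2 (rep_l2 c)))\<^sup>2"
      by (simp add: dist_norm abs_rep_l2)
    also have "\<dots> = (LINT x|lborel. (norm (H (x, t) - rep_l2 c x))\<^sup>2)"
      by (simp add: abs_l2_diff[OF sq sq_int_rep] norm_abs_l2[OF sq_int_diff[OF sq sq_int_rep]])
    finally show ?thesis by (metis real_sqrt_unique zero_le_dist)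
  qed
  note [measurable] = slice_measurable(1)[OF H]
  have "(\<lambda>(t, x). (norm (H (x, t) - rep_l2 c x))\<^sup>2) \<in> borel_measurable (borel \<Otimes>\<^sub>M lborel)" by measurable
  then have "(\<lambda>t. LINT x|lborel. (norm (H (x, t) - rep_l2 c x))\<^sup>2) \<in> borel_measurable borel"
    by (rule lborel.borel_measurable_lebesgue_integral)
  then show "(\<lambda>t. dist (abs_l2 (\<lambda>x. H (x, t))) c) \<in> borel_measurable borel" unfolding d by measurable
qed

text \<open>The space-time datum is turned into a function of time with values in L2. By Tonelli,
  almost every slice of a Borel representative is square integrable, and the squared norms of the
  slices are integrable in time.\<close>

lemma L2_slices:
  fixes D \<Omega> :: "'a::euclidean_space set" and f :: "'a \<times> real \<Rightarrow> 'b::euclidean_space"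
  assumes D: "open D" and \<Omega>: "open \<Omega>" "\<Omega> \<subseteq> D" and f: "f \<in> L2 (D \<times> {0<..<T})"
  obtains F where "L2t F"
    "AE t in lborel. t \<in> {0<..<T} \<longrightarrow> (\<lambda>x. f (x, t)) \<in> L2 \<Omega> \<and> F t = l2_ext \<Omega> (\<lambda>x. f (x, t))"
proof -
  define Q where "Q = D \<times> {0<..<T}"
  have "open Q" unfolding Q_def using D by (intro open_Times) auto
  then have Q: "Q \<in> sets lebesgue" by simp
  have \<Omega>l: "\<Omega> \<in> sets lebesgue" "\<Omega> \<in> sets borel" using \<Omega> by auto
  have "extend0 Q f \<in> L2 UNIV" using L2_extend0_iff[OF Q, of f] f[folded Q_def] by simp
  then obtain g where g: "sq_int g" "AE z in lebesgue. extend0 Q f z = g z" using L2_UNIV_sq_int_ex by blast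
  have gm: "g \<in> borel_measurable borel" by (rule sq_int_measurable[OF g(1)])
  note gs[measurable] = slice_measurable[OF gm]
  define n where "n t = (\<integral>\<^sup>+x. ennreal ((norm (g (x, t)))\<^sup>2) \<partial>lborel)" for t
  have n[measurable]: "n \<in> borel_measurable borel"
  proof -
    have "(\<lambda>(t, x). ennreal ((norm (g (x, t)))\<^sup>2)) \<in> borel_measurable (borel \<Otimes>\<^sub>M lborel)" by measurable
    then show ?thesis unfolding n_def by (rule lborel.borel_measurable_nn_integral)
  qed
  have n_int: "(\<integral>\<^sup>+t. n t \<partial>lborel) < \<infinity>"
  proof -
    have "(\<integral>\<^sup>+t. n t \<partial>lborel) = (\<integral>\<^sup>+z. ennreal ((norm (g z))\<^sup>2) \<partial>(lborel \<Otimes>\<^sub>M lborel))"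
      unfolding n_def
      using lborel_pair.nn_integral_snd[of "\<lambda>z. ennreal ((norm (g z))\<^sup>2)"] gm by (simp add: lborel_prod)
    also have "\<dots> = (\<integral>\<^sup>+z. ennreal ((norm (g z))\<^sup>2) \<partial>lborel)" by (simp add: lborel_prod)
    also have "\<dots> < \<infinity>" by (simp add: nn_integral_norm_sq[OF g(1)])
    finally show ?thesis .
  qed
  \<comment> \<open>Slices of infinite norm are replaced by 0, so that every slice, and not just
    almost every one, defines an element of L2.\<close>
  define H where "H z = (if snd z \<in> {0<..<T} \<and> n (snd z) < \<infinity> \<and> fst z \<in> \<Omega> then g z else 0)" for z
  have Hm: "H \<in> borel_measurable borel"
  proof -
    have [measurable]: "g \<in> borel_measurable (borel \<Otimes>\<^sub>M borel)" using gm by (simp add: borel_prod)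
    have "H \<in> borel_measurable (borel \<Otimes>\<^sub>M borel)" unfolding H_def using \<Omega>l(2) by measurable
    then show ?thesis by (simp add: borel_prod)
  qed
  have Hn: "(\<integral>\<^sup>+x. ennreal ((norm (H (x, t)))\<^sup>2) \<partial>lborel) \<le> n t" for t
    unfolding n_def by (rule nn_integral_mono) (auto simp: H_def)
  have Hs: "sq_int (\<lambda>x. H (x, t))" for t
  proof (rule sq_intI)
    show "(\<lambda>x. H (x, t)) \<in> borel_measurable borel" by (rule slice_measurable(2)[OF Hm])
    show "(\<integral>\<^sup>+x. ennreal ((norm (H (x, t)))\<^sup>2) \<partial>lborel) < \<infinity>"
    proof (cases "n t < \<infinity>")
      case True
      then show ?thesis using Hn[of t] by (rule le_less_trans[rotated])
    qed (simp add: H_def)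
  qed
  define F where "F t = abs_l2 (\<lambda>x. H (x, t))" for t
  have Fm[measurable]: "F \<in> borel_measurable borel" unfolding F_def by (rule abs_l2_slice_measurable[OF Hm Hs])
  have "(\<integral>\<^sup>+t. ennreal ((norm (F t))\<^sup>2) \<partial>lborel) \<le> (\<integral>\<^sup>+t. n t \<partial>lborel)"
    by (rule nn_integral_mono) (use Hn nn_integral_norm_sq[OF Hs] in \<open>simp add: F_def\<close>)
  then have "integrable lborel (\<lambda>t. (norm (F t))\<^sup>2)"
    using n_int by (intro integrableI_bounded) (auto intro: le_less_trans)
  then have F: "L2t F" using Fm by (simp add: L2t_def)
  have "AE t in lborel. n t \<noteq> \<infinity>" by (rule nn_integral_PInf_AE) (use n_int in auto)
  then have "AE t in lborel. t \<in> {0<..<T} \<longrightarrow> (\<lambda>x. f (x, t)) \<in> L2 \<Omega> \<and> F t = l2_ext \<Omega> (\<lambda>x. f (x, t))"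
    using AE_lebesgue_slices[OF g(2)]
  proof eventually_elim
    case (elim t)
    show ?case
    proof
      assume t: "t \<in> {0<..<T}"
      have "AE x in lebesgue. extend0 Q f (x, t) = g (x, t)" using elim(2) by (rule AE_completion)
      then have "AE x in lebesgue. extend0 \<Omega> (\<lambda>x. f (x, t)) x = H (x, t)"
        by eventually_elim (use t elim(1) \<Omega>(2) in \<open>auto simp: extend0_def H_def Q_def top.not_eq_extremum\<close>)
      from sq_int_AE_L2[OF Hs this]
      show "(\<lambda>x. f (x, t)) \<in> L2 \<Omega> \<and> F t = l2_ext \<Omega> (\<lambda>x. f (x, t))"
        by (simp add: L2_extend0_iff[OF \<Omega>l(1)] F_def l2_ext_def)
    qed
  qed
  then show thesis using that F by blast
qed

lemma L_infty_borel_rep: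
  fixes D :: "'a::euclidean_space set" and T :: real
  assumes D: "open D" and c: "c \<in> L_infty (D \<times> {0<..<T})"
  obtains c' C where "c' \<in> borel_measurable borel" "\<And>z. \<bar>c' z\<bar> \<le> C" "AE z in lebesgue. z \<in> D \<times> {0<..<T} \<longrightarrow> c z = c' z"
proof -
  define Q where "Q = D \<times> {0<..<T}"
  have oQ: "open Q" unfolding Q_def using D by (intro open_Times) auto
  then have Q: "Q \<in> sets lebesgue" by simp
  obtain C where cm: "c \<in> borel_measurable (lebesgue_on Q)" and C: "AE z in lebesgue_on Q. \<bar>c z\<bar> \<le> C"
    using c unfolding L_infty_def Q_def by blast
  have "(\<lambda>z. if z \<in> Q then c z else 0) \<in> borel_measurable lebesgue" by (rule borel_measurable_if_I[OF cm Q])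
  from borel_measurable_completion_ex[OF this] obtain g where
    g: "g \<in> borel_measurable lborel" "AE z in lborel. (if z \<in> Q then c z else 0) = g z" by blast
  have [measurable]: "g \<in> borel_measurable borel" using g(1) by simp
  show thesis
  \<comment> \<open>Truncation at \<open>\<bar>C\<bar>\<close> makes the bound hold everywhere and
    changes nothing almost everywhere on the cylinder.\<close>
  proof (rule that[of "\<lambda>z. max (- \<bar>C\<bar>) (min \<bar>C\<bar> (g z))" "\<bar>C\<bar>"])
    show "AE z in lebesgue. z \<in> D \<times> {0<..<T} \<longrightarrow> c z = max (- \<bar>C\<bar>) (min \<bar>C\<bar> (g z))"
      using C[unfolded AE_lebesgue_on_iff[OF Q]] AE_completion[OF g(2)]
      by eventually_elim (auto simp: Q_def)
  qed (auto simp: abs_le_iff)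
qed

section \<open>The bilinear form as a family of operators\<close>

lemma sq_int_mult_bounded:
  fixes f :: "'a::euclidean_space \<Rightarrow> real"
  assumes [measurable]: "h \<in> borel_measurable borel" and C: "\<And>x. \<bar>h x\<bar> \<le> C" and f: "sq_int f"
  shows "sq_int (\<lambda>x. h x * f x)"
proof -
  have [measurable]: "f \<in> borel_measurable borel" and i: "integrable lborel (\<lambda>x. (norm (f x))\<^sup>2)"
    using f by (auto simp: sq_int_def)
  have "integrable lborel (\<lambda>x. (norm (h x * f x))\<^sup>2)"
  proof (rule Bochner_Integration.integrable_bound)
    show "integrable lborel (\<lambda>x. C\<^sup>2 * (norm (f x))\<^sup>2)" using i by simp
    have "(norm (h x * f x))\<^sup>2 \<le> C\<^sup>2 * (norm (f x))\<^sup>2" for x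
      using power_mono[OF C[of x], of 2] by (simp add: power_mult_distrib mult_right_mono)
    then show "AE x in lborel. norm ((norm (h x * f x))\<^sup>2) \<le> norm (C\<^sup>2 * (norm (f x))\<^sup>2)" by simp
  qed measurable
  then show ?thesis by (simp add: sq_int_def)
qed

lemma sq_int_sum: "(\<And>i. i \<in> I \<Longrightarrow> sq_int (f i)) \<Longrightarrow> sq_int (\<lambda>x. \<Sum>i\<in>I. f i x)"
  by (induction I rule: infinite_finite_induct) (auto simp: sq_int_add sq_int_zero)

lemma sq_int_nth:
  fixes f :: "'a::euclidean_space \<Rightarrow> real^'n"
  assumes "sq_int f"
  shows "sq_int (\<lambda>x. f x $ i)"
proof -
  have [measurable]: "f \<in> borel_measurable borel" and int: "integrable lborel (\<lambda>x. (norm (f x))\<^sup>2)"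
    using assms by (auto simp: sq_int_def)
  have m: "(\<lambda>x. f x $ i) \<in> borel_measurable borel"
    by (rule measurable_compose[of f borel borel]) (auto intro: borel_measurable_continuous_onI continuous_on_component)
  have "integrable lborel (\<lambda>x. (norm (f x $ i))\<^sup>2)"
  proof (rule Bochner_Integration.integrable_bound[OF int])
    have "(f x $ i)\<^sup>2 \<le> (norm (f x))\<^sup>2" for x
      by (metis abs_ge_zero component_le_norm_cart power2_abs power_mono)
    then show "AE x in lborel. norm ((norm (f x $ i))\<^sup>2) \<le> norm ((norm (f x))\<^sup>2)" by simp
  qed (use m in measurable)
  then show ?thesis using m by (simp add: sq_int_def)
qed

lemma sq_int_vec:
  fixes f :: "'n::finite \<Rightarrow> 'a::euclidean_space \<Rightarrow> real"
  assumes "\<And>i. sq_int (f i)"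
  shows "sq_int (\<lambda>x. (\<chi> i. f i x) :: real^'n)"
proof -
  have "sq_int (\<lambda>x. f i x *\<^sub>R (axis i 1 :: real^'n))" for i
    using assms[of i] by (auto simp: sq_int_def power_mult_distrib)
  then have "sq_int (\<lambda>x. \<Sum>i\<in>UNIV. f i x *\<^sub>R (axis i 1 :: real^'n))" by (rule sq_int_sum)
  moreover have "(\<Sum>i\<in>UNIV. f i x *\<^sub>R (axis i 1 :: real^'n)) = (\<chi> i. f i x)" for x
    using basis_expansion[of "\<chi> i. f i x"] by (simp add: scalar_mult_eq_scaleR)
  ultimately show ?thesis by simp
qed

lemma rep_l2_add: "AE t in lborel. rep_l2 (x + y) t = rep_l2 x t + rep_l2 y t"
proof -
  have "x + y = abs_l2 (\<lambda>t. rep_l2 x t + rep_l2 y t)"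
    using abs_l2_add[OF sq_int_rep sq_int_rep, of x y] by (simp add: abs_rep_l2)
  then show ?thesis using rep_abs_l2[OF sq_int_add[OF sq_int_rep sq_int_rep], of x y] by simp
qed

lemma rep_l2_scale: "AE t in lborel. rep_l2 (r *\<^sub>R x) t = r *\<^sub>R rep_l2 x t"
proof -
  have "r *\<^sub>R x = abs_l2 (\<lambda>t. r *\<^sub>R rep_l2 x t)"
    using abs_l2_scale[OF sq_int_rep, of r x] by (simp add: abs_rep_l2)
  then show ?thesis using rep_abs_l2[OF sq_int_scale[OF sq_int_rep], of r x] by simp
qed

text \<open>Measurability, bounds and ellipticity hold at every point of space-time, because the
  abstract theory asks for a bounded coercive operator at every time. Coefficients given almost
  everywhere on the cylinder are first modified to this form.\<close>

locale borel_coefficients =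
  fixes A :: "'n::finite \<Rightarrow> 'n \<Rightarrow> (real^'n) \<times> real \<Rightarrow> real" and a b :: "'n \<Rightarrow> (real^'n) \<times> real \<Rightarrow> real"
    and c :: "(real^'n) \<times> real \<Rightarrow> real" and \<alpha> C :: real
  assumes measurable_coeffs: "A i j \<in> borel_measurable borel" "a i \<in> borel_measurable borel"
      "b i \<in> borel_measurable borel" "c \<in> borel_measurable borel"
    and bounded_coeffs: "\<bar>A i j z\<bar> \<le> C" "\<bar>a i z\<bar> \<le> C" "\<bar>b i z\<bar> \<le> C" "\<bar>c z\<bar> \<le> C"
    and elliptic: "\<alpha> * (norm \<xi>)\<^sup>2 \<le> (\<Sum>i\<in>UNIV. \<Sum>j\<in>UNIV. A i j z * \<xi> $ i * \<xi> $ j)"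
    and alpha: "0 < \<alpha>"
begin

text \<open>\<open>zeroth\<close> and \<open>flux\<close> sort the integrand of the form by what it
  multiplies: the test function or its gradient. Here \<open>r\<close> stands for the value and
  \<open>p\<close> for the gradient of the function.\<close>

definition zeroth :: "(real^'n) \<times> real \<Rightarrow> real \<Rightarrow> real^'n \<Rightarrow> real" where
  "zeroth z r p = (\<Sum>i\<in>UNIV. b i z * p $ i) + c z * r"

definition flux :: "(real^'n) \<times> real \<Rightarrow> real \<Rightarrow> real^'n \<Rightarrow> real^'n" where
  "flux z r p = (\<chi> i. (\<Sum>j\<in>UNIV. A i j z * p $ j) + a i z * r)"

text \<open>The Riesz representative in \<open>X\<close> of the form with its first argument fixed,
  written down explicitly; it makes sense for all pairs in \<open>X\<close>, whether or not the
  second is a gradient.\<close>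

definition form_op :: "real \<Rightarrow> (real^'n, real) l2 \<times> (real^'n, real^'n) l2 \<Rightarrow> (real^'n, real) l2 \<times> (real^'n, real^'n) l2" where
  "form_op t w = (abs_l2 (\<lambda>x. zeroth (x, t) (rep_l2 (fst w) x) (rep_l2 (snd w) x)),
                  abs_l2 (\<lambda>x. flux (x, t) (rep_l2 (fst w) x) (rep_l2 (snd w) x)))"

lemma C_nonneg: "0 \<le> C"
  using bounded_coeffs(4)[of undefined] by linarith

lemma sq_int_zeroth: "sq_int f \<Longrightarrow> sq_int g \<Longrightarrow> sq_int (\<lambda>x. zeroth (x, t) (f x) (g x))"
  unfolding zeroth_def
  by (intro sq_int_add sq_int_sum sq_int_mult_bounded[of _ C] slice_measurable(2) measurable_coeffs bounded_coeffs sq_int_nth)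

lemma sq_int_flux: "sq_int f \<Longrightarrow> sq_int g \<Longrightarrow> sq_int (\<lambda>x. flux (x, t) (f x) (g x))"
  unfolding flux_def
  by (intro sq_int_vec sq_int_add sq_int_sum sq_int_mult_bounded[of _ C] slice_measurable(2) measurable_coeffs bounded_coeffs sq_int_nth)

lemma form_op_inner:
  "form_op t w \<bullet> z = (LINT x|lborel. zeroth (x, t) (rep_l2 (fst w) x) (rep_l2 (snd w) x) * rep_l2 (fst z) x
     + flux (x, t) (rep_l2 (fst w) x) (rep_l2 (snd w) x) \<bullet> rep_l2 (snd z) x)"
  and form_op_inner_integrable:
  "integrable lborel (\<lambda>x. zeroth (x, t) (rep_l2 (fst w) x) (rep_l2 (snd w) x) * rep_l2 (fst z) x
     + flux (x, t) (rep_l2 (fst w) x) (rep_l2 (snd w) x) \<bullet> rep_l2 (snd z) x)"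
proof -
  note s = sq_int_zeroth[OF sq_int_rep sq_int_rep, of t "fst w" "snd w"] sq_int_flux[OF sq_int_rep sq_int_rep, of t "fst w" "snd w"]
  have i: "integrable lborel (\<lambda>x. zeroth (x, t) (rep_l2 (fst w) x) (rep_l2 (snd w) x) * rep_l2 (fst z) x)"
    using sq_int_inner[OF s(1) sq_int_rep, of "fst z"] by simp
  have j: "integrable lborel (\<lambda>x. flux (x, t) (rep_l2 (fst w) x) (rep_l2 (snd w) x) \<bullet> rep_l2 (snd z) x)"
    by (rule sq_int_inner[OF s(2) sq_int_rep])
  show "integrable lborel (\<lambda>x. zeroth (x, t) (rep_l2 (fst w) x) (rep_l2 (snd w) x) * rep_l2 (fst z) x
     + flux (x, t) (rep_l2 (fst w) x) (rep_l2 (snd w) x) \<bullet> rep_l2 (snd z) x)"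
    by (rule Bochner_Integration.integrable_add[OF i j])
  show "form_op t w \<bullet> z = (LINT x|lborel. zeroth (x, t) (rep_l2 (fst w) x) (rep_l2 (snd w) x) * rep_l2 (fst z) x
     + flux (x, t) (rep_l2 (fst w) x) (rep_l2 (snd w) x) \<bullet> rep_l2 (snd z) x)"
    unfolding form_op_def inner_prod_def Bochner_Integration.integral_add[OF i j]
    using inner_abs_l2[OF s(1) sq_int_rep, of "fst z"] inner_abs_l2[OF s(2) sq_int_rep, of "snd z"]
    by (simp add: abs_rep_l2)
qed

lemma zeroth_lin: "zeroth z (r + r') (p + p') = zeroth z r p + zeroth z r' p'" "zeroth z (k * r) (k *\<^sub>R p) = k * zeroth z r p"
  by (simp_all add: zeroth_def algebra_simps sum.distrib sum_distrib_left)

lemma flux_lin: "flux z (r + r') (p + p') = flux z r p + flux z r' p'" "flux z (k * r) (k *\<^sub>R p) = k *\<^sub>R flux z r p"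
  by (simp_all add: flux_def vec_eq_iff algebra_simps sum.distrib sum_distrib_left)

lemma linear_form_op: "linear (form_op t)"
proof (rule linearI)
  note s = sq_int_zeroth[OF sq_int_rep sq_int_rep, of t] sq_int_flux[OF sq_int_rep sq_int_rep, of t]
  fix w w' :: "(real^'n, real) l2 \<times> (real^'n, real^'n) l2"
  have r: "AE x in lborel. rep_l2 (fst (w + w')) x = rep_l2 (fst w) x + rep_l2 (fst w') x \<and>
      rep_l2 (snd (w + w')) x = rep_l2 (snd w) x + rep_l2 (snd w') x"
    using rep_l2_add[of "fst w" "fst w'"] rep_l2_add[of "snd w" "snd w'"] by simp
  have "abs_l2 (\<lambda>x. zeroth (x, t) (rep_l2 (fst (w + w')) x) (rep_l2 (snd (w + w')) x))
    = abs_l2 (\<lambda>x. zeroth (x, t) (rep_l2 (fst w) x) (rep_l2 (snd w) x) + zeroth (x, t) (rep_l2 (fst w') x) (rep_l2 (snd w') x))"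
    by (rule abs_l2_eq[OF s(1) sq_int_add[OF s(1) s(1)]]) (use r in \<open>eventually_elim, simp add: zeroth_lin\<close>)
  moreover have "abs_l2 (\<lambda>x. flux (x, t) (rep_l2 (fst (w + w')) x) (rep_l2 (snd (w + w')) x))
    = abs_l2 (\<lambda>x. flux (x, t) (rep_l2 (fst w) x) (rep_l2 (snd w) x) + flux (x, t) (rep_l2 (fst w') x) (rep_l2 (snd w') x))"
    by (rule abs_l2_eq[OF s(2) sq_int_add[OF s(2) s(2)]]) (use r in \<open>eventually_elim, simp add: flux_lin\<close>)
  ultimately show "form_op t (w + w') = form_op t w + form_op t w'"
    unfolding form_op_def by (simp only: abs_l2_add[OF s(1) s(1)] abs_l2_add[OF s(2) s(2)] add_Pair)
next
  note s = sq_int_zeroth[OF sq_int_rep sq_int_rep, of t] sq_int_flux[OF sq_int_rep sq_int_rep, of t]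
  fix k :: real and w :: "(real^'n, real) l2 \<times> (real^'n, real^'n) l2"
  have r: "AE x in lborel. rep_l2 (fst (k *\<^sub>R w)) x = k * rep_l2 (fst w) x \<and>
      rep_l2 (snd (k *\<^sub>R w)) x = k *\<^sub>R rep_l2 (snd w) x"
    using rep_l2_scale[of k "fst w"] rep_l2_scale[of k "snd w"] by simp
  have "abs_l2 (\<lambda>x. zeroth (x, t) (rep_l2 (fst (k *\<^sub>R w)) x) (rep_l2 (snd (k *\<^sub>R w)) x))
    = abs_l2 (\<lambda>x. k *\<^sub>R zeroth (x, t) (rep_l2 (fst w) x) (rep_l2 (snd w) x))"
    by (rule abs_l2_eq[OF s(1) sq_int_scale[OF s(1)]]) (use r in \<open>eventually_elim, simp add: zeroth_lin\<close>)
  moreover have "abs_l2 (\<lambda>x. flux (x, t) (rep_l2 (fst (k *\<^sub>R w)) x) (rep_l2 (snd (k *\<^sub>R w)) x))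
    = abs_l2 (\<lambda>x. k *\<^sub>R flux (x, t) (rep_l2 (fst w) x) (rep_l2 (snd w) x))"
    by (rule abs_l2_eq[OF s(2) sq_int_scale[OF s(2)]]) (use r in \<open>eventually_elim, simp add: flux_lin\<close>)
  ultimately show "form_op t (k *\<^sub>R w) = k *\<^sub>R form_op t w"
    unfolding form_op_def by (simp only: abs_l2_scale[OF s(1)] abs_l2_scale[OF s(2)] scaleR_Pair)
qed

definition lip :: real where "lip = C * (real CARD('n) + 1)"

lemma abs_sum_coeff_le:
  fixes d :: "'n \<Rightarrow> real" and p :: "real^'n"
  assumes "\<And>i. \<bar>d i\<bar> \<le> C"
  shows "\<bar>\<Sum>i\<in>UNIV. d i * p $ i\<bar> \<le> real CARD('n) * C * norm p"
proof -
  have "\<bar>\<Sum>i\<in>UNIV. d i * p $ i\<bar> \<le> (\<Sum>i\<in>(UNIV :: 'n set). \<bar>d i * p $ i\<bar>)" by (rule sum_abs)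
  also have "\<dots> \<le> (\<Sum>i\<in>(UNIV :: 'n set). C * norm p)"
    using assms component_le_norm_cart[of p] C_nonneg by (intro sum_mono) (auto simp: abs_mult intro!: mult_mono)
  finally show ?thesis by simp
qed

lemma affine_coeff_le:
  fixes d :: "'n \<Rightarrow> real" and p :: "real^'n"
  assumes "\<And>i. \<bar>d i\<bar> \<le> C" "\<bar>e\<bar> \<le> C"
  shows "\<bar>(\<Sum>i\<in>UNIV. d i * p $ i) + e * r\<bar> \<le> lip * (\<bar>r\<bar> + norm p)"
proof -
  have "\<bar>(\<Sum>i\<in>UNIV. d i * p $ i) + e * r\<bar> \<le> real CARD('n) * C * norm p + C * \<bar>r\<bar>"
    using abs_sum_coeff_le[of d p] assms(1) mult_right_mono[OF assms(2), of "\<bar>r\<bar>"]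
    by (intro order_trans[OF abs_triangle_ineq] add_mono) (auto simp: abs_mult)
  also have "\<dots> \<le> lip * norm p + lip * \<bar>r\<bar>"
  proof (intro add_mono mult_right_mono)
    show "real CARD('n) * C \<le> lip" using C_nonneg by (simp add: lip_def algebra_simps)
    show "C \<le> lip" using C_nonneg by (simp add: lip_def algebra_simps)
  qed auto
  finally show ?thesis by (simp add: algebra_simps)
qed

lemma zeroth_le: "\<bar>zeroth z r p\<bar> \<le> lip * (\<bar>r\<bar> + norm p)"
  unfolding zeroth_def by (rule affine_coeff_le) (rule bounded_coeffs)+

lemma flux_le: "norm (flux z r p) \<le> real CARD('n) * (lip * (\<bar>r\<bar> + norm p))"
proof -
  have "norm (flux z r p) \<le> (\<Sum>i\<in>UNIV. \<bar>flux z r p $ i\<bar>)" by (rule norm_le_l1_cart)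
  also have "\<dots> \<le> (\<Sum>i\<in>(UNIV :: 'n set). lip * (\<bar>r\<bar> + norm p))"
    unfolding flux_def by (intro sum_mono) (auto intro!: affine_coeff_le bounded_coeffs)
  finally show ?thesis by simp
qed

text \<open>With \<open>m\<close> the sum of the absolute value of \<open>r\<close> and the norm of
  \<open>p\<close>, the two components of the operator are at most \<open>lip * m\<close> and
  \<open>CARD('n) * lip * m\<close>. Their squares are added, and the outer factor 2 comes from
  squaring \<open>m\<close>.\<close>

definition bnd :: real where "bnd = sqrt (2 * (1 + (real CARD('n))\<^sup>2) * lip\<^sup>2)"

lemma form_op_bound: "norm (form_op t w) \<le> bnd * norm w"
proof (rule power2_le_imp_le)
  note s = sq_int_zeroth[OF sq_int_rep sq_int_rep, of t "fst w" "snd w"] sq_int_flux[OF sq_int_rep sq_int_rep, of t "fst w" "snd w"]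
  define r where "r = rep_l2 (fst w)"
  define p where "p = rep_l2 (snd w)"
  have rp: "sq_int r" "sq_int p" by (auto simp: r_def p_def sq_int_rep)
  have i: "integrable lborel (\<lambda>x. (norm (zeroth (x, t) (r x) (p x)))\<^sup>2)" "integrable lborel (\<lambda>x. (norm (flux (x, t) (r x) (p x)))\<^sup>2)"
    "integrable lborel (\<lambda>x. (norm (r x))\<^sup>2)" "integrable lborel (\<lambda>x. (norm (p x))\<^sup>2)"
    using s rp by (auto simp: sq_int_def r_def p_def)
  have b0: "bnd\<^sup>2 = 2 * (1 + (real CARD('n))\<^sup>2) * lip\<^sup>2" by (simp add: bnd_def)
  have pt: "(norm (zeroth (x, t) (r x) (p x)))\<^sup>2 + (norm (flux (x, t) (r x) (p x)))\<^sup>2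
     \<le> bnd\<^sup>2 * ((norm (r x))\<^sup>2 + (norm (p x))\<^sup>2)" for x
  proof -
    define m where "m = \<bar>r x\<bar> + norm (p x)"
    have "(norm (zeroth (x, t) (r x) (p x)))\<^sup>2 \<le> (lip * m)\<^sup>2"
      using zeroth_le[of "(x, t)" "r x" "p x"] by (intro power_mono) (auto simp: m_def)
    moreover have "(norm (flux (x, t) (r x) (p x)))\<^sup>2 \<le> (real CARD('n) * (lip * m))\<^sup>2"
      using flux_le[of "(x, t)" "r x" "p x"] by (intro power_mono) (auto simp: m_def)
    moreover have "m\<^sup>2 \<le> 2 * (norm (r x))\<^sup>2 + 2 * (norm (p x))\<^sup>2"
      using norm_add_sq_le[of "\<bar>r x\<bar>" "norm (p x)"] by (simp add: m_def)
    then have "(1 + (real CARD('n))\<^sup>2) * lip\<^sup>2 * m\<^sup>2 \<le> (1 + (real CARD('n))\<^sup>2) * lip\<^sup>2 * (2 * (norm (r x))\<^sup>2 + 2 * (norm (p x))\<^sup>2)"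
      by (intro mult_left_mono) auto
    ultimately show ?thesis unfolding b0 by (simp add: power_mult_distrib algebra_simps)
  qed
  have "(norm (form_op t w))\<^sup>2 = (norm (abs_l2 (\<lambda>x. zeroth (x, t) (r x) (p x))))\<^sup>2 + (norm (abs_l2 (\<lambda>x. flux (x, t) (r x) (p x))))\<^sup>2"
    by (simp add: form_op_def norm_prod_def r_def p_def)
  also have "\<dots> = (LINT x|lborel. (norm (zeroth (x, t) (r x) (p x)))\<^sup>2 + (norm (flux (x, t) (r x) (p x)))\<^sup>2)"
    using i s by (simp add: norm_abs_l2 r_def p_def)
  also have "\<dots> \<le> (LINT x|lborel. bnd\<^sup>2 * ((norm (r x))\<^sup>2 + (norm (p x))\<^sup>2))"
    by (rule integral_mono) (use i pt in auto)
  also have "\<dots> = bnd\<^sup>2 * ((norm (abs_l2 r))\<^sup>2 + (norm (abs_l2 p))\<^sup>2)"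
    using i rp by (simp add: norm_abs_l2)
  also have "\<dots> = (bnd * norm w)\<^sup>2"
    by (simp add: r_def p_def abs_rep_l2 norm_prod_def power_mult_distrib)
  finally show "(norm (form_op t w))\<^sup>2 \<le> (bnd * norm w)\<^sup>2" .
qed (simp add: bnd_def)

text \<open>Put \<open>k = CARD('n) * C\<close>. The terms with \<open>a\<close> and
  \<open>b\<close> are each at most \<open>k\<close> times the norm of \<open>p\<close> times the
  absolute value of \<open>r\<close>; Young's inequality trades both for \<open>\<alpha> / 2\<close>
  on the gradient and \<open>2 * k^2 / \<alpha>\<close> on the value. The term with \<open>c\<close>
  costs \<open>C\<close>. The last summand makes the form coercive in the full norm of
  \<open>X\<close>.\<close>

definition shift :: real where "shift = 2 * (real CARD('n) * C)\<^sup>2 / \<alpha> + C + \<alpha> / 2"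

lemma form_pointwise_coercive:
  "\<alpha> / 2 * (norm p)\<^sup>2 + (\<alpha> / 2 - shift) * r\<^sup>2 \<le> zeroth z r p * r + flux z r p \<bullet> p"
proof -
  define k where "k = real CARD('n) * C"
  have k0: "0 \<le> k" using C_nonneg by (simp add: k_def)
  have "flux z r p \<bullet> p = (\<Sum>i\<in>UNIV. \<Sum>j\<in>UNIV. A i j z * p $ i * p $ j) + (\<Sum>i\<in>UNIV. a i z * p $ i) * r"
  proof -
    have "flux z r p \<bullet> p = (\<Sum>i\<in>UNIV. (\<Sum>j\<in>UNIV. A i j z * p $ j) * p $ i + a i z * p $ i * r)"
      by (simp add: flux_def inner_vec_def algebra_simps)
    also have "\<dots> = (\<Sum>i\<in>UNIV. (\<Sum>j\<in>UNIV. A i j z * p $ j) * p $ i) + (\<Sum>i\<in>UNIV. a i z * p $ i) * r"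
      by (simp add: sum.distrib sum_distrib_right)
    also have "(\<Sum>i\<in>UNIV. (\<Sum>j\<in>UNIV. A i j z * p $ j) * p $ i) = (\<Sum>i\<in>UNIV. \<Sum>j\<in>UNIV. A i j z * p $ i * p $ j)"
      by (intro sum.cong refl) (simp add: sum_distrib_right sum_distrib_left mult_ac)
    finally show ?thesis .
  qed
  then have eq: "zeroth z r p * r + flux z r p \<bullet> p = (\<Sum>i\<in>UNIV. \<Sum>j\<in>UNIV. A i j z * p $ i * p $ j)
      + (\<Sum>i\<in>UNIV. a i z * p $ i) * r + (\<Sum>i\<in>UNIV. b i z * p $ i) * r + c z * r\<^sup>2"
    by (simp add: zeroth_def algebra_simps power2_eq_square)
  have low: "- (k * norm p * \<bar>r\<bar>) \<le> (\<Sum>i\<in>UNIV. d i z * p $ i) * r" if "\<And>i. \<bar>d i z\<bar> \<le> C" for d :: "'n \<Rightarrow> (real^'n) \<times> real \<Rightarrow> real"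
  proof -
    have "\<bar>(\<Sum>i\<in>UNIV. d i z * p $ i) * r\<bar> \<le> k * norm p * \<bar>r\<bar>"
      unfolding abs_mult k_def using abs_sum_coeff_le[of "\<lambda>i. d i z" p] that by (intro mult_right_mono) auto
    then show ?thesis by linarith
  qed
  have "- (C * r\<^sup>2) \<le> c z * r\<^sup>2"
    using mult_right_mono[of "- C" "c z" "r\<^sup>2"] bounded_coeffs(4)[of z] by simp
  moreover have "0 \<le> (sqrt (\<alpha> / 2) * norm p - sqrt (2 / \<alpha>) * k * \<bar>r\<bar>)\<^sup>2" by simp
  then have "2 * (k * norm p * \<bar>r\<bar>) \<le> \<alpha> / 2 * (norm p)\<^sup>2 + 2 * k\<^sup>2 / \<alpha> * r\<^sup>2"
  proof -
    have "sqrt (\<alpha> / 2) * sqrt (2 / \<alpha>) = 1" using alpha by (simp add: real_sqrt_mult[symmetric])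
    then have "(sqrt (\<alpha> / 2) * norm p) * (sqrt (2 / \<alpha>) * k * \<bar>r\<bar>) = k * norm p * \<bar>r\<bar>"
      by (metis (no_types, opaque_lifting) mult.assoc mult.commute mult.left_neutral)
    moreover have "(sqrt (\<alpha> / 2) * norm p - sqrt (2 / \<alpha>) * k * \<bar>r\<bar>)\<^sup>2
      = (sqrt (\<alpha> / 2))\<^sup>2 * (norm p)\<^sup>2 - 2 * ((sqrt (\<alpha> / 2) * norm p) * (sqrt (2 / \<alpha>) * k * \<bar>r\<bar>)) + (sqrt (2 / \<alpha>))\<^sup>2 * k\<^sup>2 * r\<^sup>2"
      by (simp add: power2_diff power_mult_distrib)
    moreover have "(sqrt (\<alpha> / 2))\<^sup>2 = \<alpha> / 2" "(sqrt (2 / \<alpha>))\<^sup>2 = 2 / \<alpha>" using alpha by auto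
    ultimately have "0 \<le> \<alpha> / 2 * (norm p)\<^sup>2 - 2 * (k * norm p * \<bar>r\<bar>) + 2 / \<alpha> * k\<^sup>2 * r\<^sup>2"
      using \<open>0 \<le> (sqrt (\<alpha> / 2) * norm p - sqrt (2 / \<alpha>) * k * \<bar>r\<bar>)\<^sup>2\<close> by (simp only:)
    then show ?thesis by simp
  qed
  ultimately show ?thesis
    unfolding eq using low[of a] low[of b] bounded_coeffs(2,3) elliptic[of p z]
    by (simp add: shift_def k_def[symmetric] left_diff_distrib distrib_right)
qed

lemma form_op_coercive: "\<alpha> / 2 * (norm w)\<^sup>2 - shift * (norm (fst w))\<^sup>2 \<le> form_op t w \<bullet> w"
proof -
  define r where "r = rep_l2 (fst w)"
  define p where "p = rep_l2 (snd w)"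
  have rp: "sq_int r" "sq_int p" "abs_l2 r = fst w" "abs_l2 p = snd w" by (auto simp: r_def p_def sq_int_rep abs_rep_l2)
  have i: "integrable lborel (\<lambda>x. (norm (r x))\<^sup>2)" "integrable lborel (\<lambda>x. (norm (p x))\<^sup>2)"
    using rp by (auto simp: sq_int_def)
  have "\<alpha> / 2 * (norm w)\<^sup>2 - shift * (norm (fst w))\<^sup>2 = \<alpha> / 2 * (norm (abs_l2 p))\<^sup>2 + (\<alpha> / 2 - shift) * (norm (abs_l2 r))\<^sup>2"
    by (simp add: rp norm_prod_def algebra_simps)
  also have "\<dots> = (LINT x|lborel. \<alpha> / 2 * (norm (p x))\<^sup>2 + (\<alpha> / 2 - shift) * (norm (r x))\<^sup>2)"
    using i rp(1,2) by (simp add: norm_abs_l2)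
  also have "\<dots> \<le> form_op t w \<bullet> w"
    unfolding form_op_inner r_def[symmetric] p_def[symmetric]
  proof (rule integral_mono)
    show "integrable lborel (\<lambda>x. \<alpha> / 2 * (norm (p x))\<^sup>2 + (\<alpha> / 2 - shift) * (norm (r x))\<^sup>2)" using i by simp
    show "integrable lborel (\<lambda>x. zeroth (x, t) (r x) (p x) * r x + flux (x, t) (r x) (p x) \<bullet> p x)"
      using form_op_inner_integrable[of t w w] by (simp add: r_def p_def)
    show "\<alpha> / 2 * (norm (p x))\<^sup>2 + (\<alpha> / 2 - shift) * (norm (r x))\<^sup>2
        \<le> zeroth (x, t) (r x) (p x) * r x + flux (x, t) (r x) (p x) \<bullet> p x" for x
      using form_pointwise_coercive[of "p x" "r x" "(x, t)"] by simp
  qed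
  finally show ?thesis .
qed

lemma form_op_measurable_const: "(\<lambda>t. form_op t w) \<in> borel_measurable borel"
proof -
  have m[measurable]: "A i j \<in> borel_measurable (borel \<Otimes>\<^sub>M borel)" "a i \<in> borel_measurable (borel \<Otimes>\<^sub>M borel)"
    "b i \<in> borel_measurable (borel \<Otimes>\<^sub>M borel)" "c \<in> borel_measurable (borel \<Otimes>\<^sub>M borel)" for i j
    using measurable_coeffs by (simp_all add: borel_prod)
  have nth[measurable]: "(\<lambda>z :: (real^'n) \<times> real. rep_l2 (snd w) (fst z) $ i) \<in> borel_measurable (borel \<Otimes>\<^sub>M borel)" for i
    by (rule measurable_compose[OF measurable_fst sq_int_measurable[OF sq_int_nth[OF sq_int_rep]]])
  have z: "(\<lambda>z. zeroth z (rep_l2 (fst w) (fst z)) (rep_l2 (snd w) (fst z))) \<in> borel_measurable borel"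
  proof -
    have "(\<lambda>z. zeroth z (rep_l2 (fst w) (fst z)) (rep_l2 (snd w) (fst z))) \<in> borel_measurable (borel \<Otimes>\<^sub>M borel)"
      unfolding zeroth_def by measurable
    then show ?thesis by (simp add: borel_prod)
  qed
  have f: "(\<lambda>z. flux z (rep_l2 (fst w) (fst z)) (rep_l2 (snd w) (fst z))) \<in> borel_measurable borel"
  proof -
    \<comment> \<open>The flux is written along the coordinate axes, so that its measurability
      follows from that of scalar components.\<close>
    have "(\<lambda>z. \<Sum>i\<in>UNIV. ((\<Sum>j\<in>UNIV. A i j z * rep_l2 (snd w) (fst z) $ j) + a i z * rep_l2 (fst w) (fst z)) *\<^sub>R (axis i 1 :: real^'n))
        \<in> borel_measurable (borel \<Otimes>\<^sub>M borel)" by measurable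
    moreover have "flux z r p = (\<Sum>i\<in>UNIV. ((\<Sum>j\<in>UNIV. A i j z * p $ j) + a i z * r) *\<^sub>R axis i 1)" for z r p
      using basis_expansion[of "flux z r p"] by (simp add: flux_def scalar_mult_eq_scaleR)
    ultimately show ?thesis by (simp add: borel_prod)
  qed
  have "(\<lambda>t. abs_l2 (\<lambda>x. zeroth (x, t) (rep_l2 (fst w) x) (rep_l2 (snd w) x))) \<in> borel_measurable borel"
    using abs_l2_slice_measurable[OF z] sq_int_zeroth[OF sq_int_rep sq_int_rep] by simp
  moreover have "(\<lambda>t. abs_l2 (\<lambda>x. flux (x, t) (rep_l2 (fst w) x) (rep_l2 (snd w) x))) \<in> borel_measurable borel"
    using abs_l2_slice_measurable[OF f] sq_int_flux[OF sq_int_rep sq_int_rep] by simp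
  ultimately show ?thesis unfolding form_op_def by (rule borel_measurable_Pair)
qed

text \<open>For a simple \<open>F\<close> the composition is measurable piece by piece from the case
  of constant arguments; continuity of each operator passes this to the limit.\<close>

lemma form_op_measurable:
  assumes F: "F \<in> borel_measurable borel"
  shows "(\<lambda>t. form_op t (F t)) \<in> borel_measurable borel"
proof -
  have "F \<in> borel_measurable lborel" using F by simp
  from borel_measurable_implies_sequence_metric[OF this, of 0]
  obtain s where s: "\<And>i. simple_function lborel (s i)" "\<And>t. (\<lambda>i. s i t) \<longlonglongrightarrow> F t" by auto
  have m: "(\<lambda>t. form_op t (s i t)) \<in> borel_measurable borel" for i
  proof -
    have fin: "finite (range (s i))" using simple_functionD(1)[OF s(1)[of i]] by simp
    have "s i \<in> borel \<rightarrow>\<^sub>M count_space (range (s i))"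
      unfolding measurable_count_space_eq2[OF fin] using simple_functionD(2)[OF s(1)[of i]] by auto
    from measurable_compose_countable'[OF form_op_measurable_const this countable_finite[OF fin]]
    show ?thesis .
  qed
  show ?thesis
  proof (rule borel_measurable_LIMSEQ_metric[OF m])
    fix t
    have "bounded_linear (form_op t)"
      by (rule bounded_linear_intro[of _ bnd]) (use linear_form_op[of t] form_op_bound[of t] in
        \<open>auto simp: linear_add linear_scale mult.commute\<close>)
    from bounded_linear.tendsto[OF this s(2)] show "(\<lambda>i. form_op t (s i t)) \<longlonglongrightarrow> form_op t (F t)" .
  qed
qed

lemma shift_pos: "0 < shift"
  unfolding shift_def using alpha C_nonneg by (simp add: add_nonneg_pos)

lemma bnd_nonneg: "0 \<le> bnd"
  by (simp add: bnd_def)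

sublocale coercive_family form_op bnd "\<alpha> / 2" shift
  by (intro coercive_family.intro linear_form_op form_op_bound form_op_coercive form_op_measurable
      shift_pos bnd_nonneg half_gt_zero alpha)

end

section \<open>Variational solutions as abstract evolutions\<close>

lemma integral_lebesgue_on_lborel:
  fixes k h :: "real \<Rightarrow> real"
  assumes I: "I \<in> sets lebesgue" and k: "AE t in lebesgue_on I. k t = h t"
    and h: "h \<in> borel_measurable borel" "\<And>t. t \<notin> I \<Longrightarrow> h t = 0"
  shows "(LINT t|lebesgue_on I. k t) = (LINT t|lborel. h t)"
proof -
  have hm: "h \<in> borel_measurable lebesgue" using h(1) by (simp add: measurable_completion)
  have ae: "AE t in lebesgue. indicator I t *\<^sub>R k t = h t"
    using k unfolding AE_lebesgue_on_iff[OF I] by eventually_elim (use h(2) in \<open>auto simp: indicator_def\<close>)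
  have "(LINT t|lebesgue_on I. k t) = (LINT t|lebesgue. indicator I t *\<^sub>R k t)" using I by (simp add: integral_restrict_space)
  also have "\<dots> = (LINT t|lebesgue. h t)" by (rule integral_cong_AE[OF lebesgue_measurable_cong_AE[OF hm ae] hm ae])
  also have "\<dots> = (LINT t|lborel. h t)" by (rule integral_completion) (use h(1) in simp)
  finally show ?thesis .
qed

lemma sum_diagonal: "(\<Sum>i\<in>UNIV. \<Sum>j\<in>UNIV. (if i = j then \<alpha> else 0) * \<xi> $ i * \<xi> $ j) = \<alpha> * (norm (\<xi> :: real^'n))\<^sup>2"
proof -
  have "(\<Sum>j\<in>UNIV. (if i = j then \<alpha> else 0) * \<xi> $ i * \<xi> $ j) = \<alpha> * (\<xi> $ i * \<xi> $ i)" for i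
  proof -
    have "(\<Sum>j\<in>UNIV. (if i = j then \<alpha> else 0) * \<xi> $ i * \<xi> $ j) = (\<Sum>j\<in>UNIV. if i = j then \<alpha> * (\<xi> $ i * \<xi> $ i) else 0)"
      by (rule sum.cong) auto
    then show ?thesis by simp
  qed
  then show ?thesis by (simp add: power2_norm_eq_inner inner_vec_def sum_distrib_left)
qed

text \<open>The finitely many coefficients get bounded Borel versions with a common bound.
  Ellipticity of the versions can fail on a Borel null set \<open>N\<close>; there, and outside the
  cylinder, the matrix is replaced by \<open>\<alpha>\<close> times the identity.\<close>

lemma borel_coefficients_ex:
  fixes A :: "'n \<Rightarrow> 'n \<Rightarrow> (real^'n) \<times> real \<Rightarrow> real" and a b :: "'n \<Rightarrow> (real^'n) \<times> real \<Rightarrow> real"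
    and c :: "(real^'n) \<times> real \<Rightarrow> real"
  assumes D: "open D"
    and coeffs: "\<And>i j. A i j \<in> L_infty (D \<times> {0<..<T})" "\<And>i. a i \<in> L_infty (D \<times> {0<..<T})"
      "\<And>i. b i \<in> L_infty (D \<times> {0<..<T})" "c \<in> L_infty (D \<times> {0<..<T})"
    and alpha: "0 < \<alpha>"
    and elliptic: "AE z in lebesgue_on (D \<times> {0<..<T}).
      \<forall>\<xi> :: real^'n. (\<Sum>i\<in>UNIV. \<Sum>j\<in>UNIV. A i j z * \<xi> $ i * \<xi> $ j) \<ge> \<alpha> * (norm \<xi>)\<^sup>2"
  obtains A' a' b' c' C where "borel_coefficients A' a' b' c' \<alpha> C"
    "AE z in lebesgue. z \<in> D \<times> {0<..<T} \<longrightarrow>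
       (\<forall>i j. A i j z = A' i j z) \<and> (\<forall>i. a i z = a' i z) \<and> (\<forall>i. b i z = b' i z) \<and> c z = c' z"
proof -
  define Q where "Q = D \<times> {0<..<T}"
  have oQ: "open Q" unfolding Q_def using D by (intro open_Times) auto
  then have Q: "Q \<in> sets lebesgue" by simp
  define ok where "ok k q \<longleftrightarrow> fst q \<in> borel_measurable borel \<and> (\<forall>z. \<bar>fst q z\<bar> \<le> snd q) \<and>
      (AE z in lebesgue. z \<in> Q \<longrightarrow> k z = fst q z)" for k and q :: "((real^'n) \<times> real \<Rightarrow> real) \<times> real"
  define R where "R k = (SOME q. ok k q)" for k
  have R: "ok k (R k)" if kQ: "k \<in> L_infty Q" for k
    unfolding R_def
  proof (rule someI_ex)
    obtain c' C where "c' \<in> borel_measurable borel" "\<And>z. \<bar>c' z\<bar> \<le> C" "AE z in lebesgue. z \<in> D \<times> {0<..<T} \<longrightarrow> k z = c' z"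
      by (rule L_infty_borel_rep[OF D kQ[unfolded Q_def]]) (rule that; assumption)
    then have "ok k (c', C)" by (simp add: ok_def Q_def)
    then show "\<exists>q. ok k q" ..
  qed
  define br where "br k = fst (R k)" for k
  define S where "S = (\<lambda>(i, j). A i j) ` UNIV \<union> range a \<union> range b \<union> {c}"
  have S: "finite S" "\<And>i j. A i j \<in> S" "\<And>i. a i \<in> S" "\<And>i. b i \<in> S" "c \<in> S" by (force simp: S_def)+
  have mem: "k \<in> L_infty Q" if "k \<in> S" for k using that coeffs by (auto simp: S_def Q_def)
  have br: "br k \<in> borel_measurable borel" "\<bar>br k z\<bar> \<le> snd (R k)" "AE z in lebesgue. z \<in> Q \<longrightarrow> k z = br k z"
    if "k \<in> S" for k z using R[OF mem[OF that]] unfolding ok_def br_def by blast+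
  \<comment> \<open>The summand \<open>\<alpha>\<close> lets the same bound cover the replacement
    matrix.\<close>
  define C where "C = \<alpha> + (\<Sum>k\<in>S. snd (R k))"
  have R0: "0 \<le> snd (R k)" if "k \<in> S" for k using br(2)[OF that, of undefined] by linarith
  have C: "snd (R k) \<le> C" if "k \<in> S" for k
    using member_le_sum[of k S "\<lambda>k. snd (R k)"] that S(1) R0 alpha by (simp add: C_def)
  have aC: "\<alpha> \<le> C" using sum_nonneg[of S "\<lambda>k. snd (R k)"] R0 by (simp add: C_def)
  have brC: "\<bar>br k z\<bar> \<le> C" if "k \<in> S" for k z using br(2)[OF that, of z] C[OF that] by linarith
  have agree: "AE z in lebesgue. \<forall>k\<in>S. z \<in> Q \<longrightarrow> k z = br k z"
    by (rule AE_ball_countable'[OF br(3) countable_finite[OF S(1)]])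
  have "AE z in lebesgue. z \<in> Q \<longrightarrow> (\<forall>\<xi> :: real^'n. (\<Sum>i\<in>UNIV. \<Sum>j\<in>UNIV. br (A i j) z * \<xi> $ i * \<xi> $ j) \<ge> \<alpha> * (norm \<xi>)\<^sup>2)"
    using agree elliptic[folded Q_def, unfolded AE_lebesgue_on_iff[OF Q]]
    by eventually_elim (simp add: S(2))
  then have "AE z in lborel. z \<in> Q \<longrightarrow> (\<forall>\<xi> :: real^'n. (\<Sum>i\<in>UNIV. \<Sum>j\<in>UNIV. br (A i j) z * \<xi> $ i * \<xi> $ j) \<ge> \<alpha> * (norm \<xi>)\<^sup>2)"
    by (simp add: AE_completion_iff)
  then obtain N :: "((real^'n) \<times> real) set" where N: "{z \<in> space lborel. \<not> (z \<in> Q \<longrightarrow>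
      (\<forall>\<xi> :: real^'n. (\<Sum>i\<in>UNIV. \<Sum>j\<in>UNIV. br (A i j) z * \<xi> $ i * \<xi> $ j) \<ge> \<alpha> * (norm \<xi>)\<^sup>2))} \<subseteq> N"
    "emeasure lborel N = 0" "N \<in> sets lborel" by (rule AE_E)
  define A' where "A' i j z = (if z \<in> Q - N then br (A i j) z else if i = j then \<alpha> else 0)" for i j z
  have "borel_coefficients A' (\<lambda>i. br (a i)) (\<lambda>i. br (b i)) (br c) \<alpha> C"
  proof (rule borel_coefficients.intro)
    have QN: "Q - N \<in> sets borel" using oQ N(3) by auto
    show "A' i j \<in> borel_measurable borel" for i j
      unfolding A'_def using br(1)[OF S(2)[of i j]] QN by (intro measurable_If_set) auto
    show "\<bar>A' i j z\<bar> \<le> C" for i j z using brC[OF S(2), of i j z] alpha aC by (auto simp: A'_def)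
    show "\<alpha> * (norm \<xi>)\<^sup>2 \<le> (\<Sum>i\<in>UNIV. \<Sum>j\<in>UNIV. A' i j z * \<xi> $ i * \<xi> $ j)" for \<xi> z
    proof (cases "z \<in> Q - N")
      case True
      then show ?thesis using N(1) by (auto simp: A'_def)
    next
      case False
      then have "A' i j z = (if i = j then \<alpha> else 0)" for i j by (auto simp: A'_def)
      then show ?thesis using sum_diagonal[of \<alpha> \<xi>] by simp
    qed
  qed (use br(1) brC S alpha in auto)
  moreover have "AE z in lebesgue. z \<notin> N" by (rule AE_completion) (use N in \<open>intro AE_not_in, auto\<close>)
  then have "AE z in lebesgue. z \<in> D \<times> {0<..<T} \<longrightarrow>
       (\<forall>i j. A i j z = A' i j z) \<and> (\<forall>i. a i z = br (a i) z) \<and> (\<forall>i. b i z = br (b i) z) \<and> c z = br c z"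
    using agree
  proof eventually_elim
    case (elim z)
    then show ?case using S(2-5) by (auto simp: A'_def Q_def)
  qed
  ultimately show thesis using that by blast
qed

context borel_coefficients
begin

text \<open>The exceptional times come from slicing the null set where the coefficients disagree.
  They do not depend on the functions, so one null set of times serves all \<open>v\<close> and
  \<open>w\<close>.\<close>

lemma neumann_form_eq_form_op:
  fixes A0 :: "'n \<Rightarrow> 'n \<Rightarrow> (real^'n) \<times> real \<Rightarrow> real" and a0 b0 :: "'n \<Rightarrow> (real^'n) \<times> real \<Rightarrow> real"
    and c0 :: "(real^'n) \<times> real \<Rightarrow> real"
  assumes \<Omega>: "open \<Omega>" "\<Omega> \<subseteq> D"
    and eq: "AE z in lebesgue. z \<in> D \<times> {0<..<T} \<longrightarrow>
       (\<forall>i j. A0 i j z = A i j z) \<and> (\<forall>i. a0 i z = a i z) \<and> (\<forall>i. b0 i z = b i z) \<and> c0 z = c z"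
  shows "AE t in lborel. t \<in> {0<..<T} \<longrightarrow> (\<forall>v\<in>H1 \<Omega>. \<forall>w\<in>H1 \<Omega>.
     neumann_form A0 a0 b0 c0 \<Omega> t v w = form_op t (H1_emb \<Omega> v) \<bullet> H1_emb \<Omega> w)"
  using AE_lebesgue_slices[OF eq]
proof eventually_elim
  case (elim t)
  show ?case
  proof (intro impI ballI)
    fix v w assume t: "t \<in> {0<..<T}" and v: "v \<in> H1 \<Omega>" and w: "w \<in> H1 \<Omega>"
    note \<Omega>l = lebesgue_\<Omega>[OF \<Omega>(1)]
    note gv = H1_weak_grad[OF v] and gw = H1_weak_grad[OF w]
    define \<psi> where "\<psi> x = (\<Sum>i\<in>UNIV. ((\<Sum>j\<in>UNIV. A0 i j (x, t) * weak_grad \<Omega> v x $ j) + a0 i (x, t) * v x) * weak_grad \<Omega> w x $ i)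
        + (\<Sum>i\<in>UNIV. b0 i (x, t) * weak_grad \<Omega> v x $ i) * w x + c0 (x, t) * v x * w x" for x
    define \<Psi> where "\<Psi> x = zeroth (x, t) (rep_l2 (fst (H1_emb \<Omega> v)) x) (rep_l2 (snd (H1_emb \<Omega> v)) x) * rep_l2 (fst (H1_emb \<Omega> w)) x
     + flux (x, t) (rep_l2 (fst (H1_emb \<Omega> v)) x) (rep_l2 (snd (H1_emb \<Omega> v)) x) \<bullet> rep_l2 (snd (H1_emb \<Omega> w)) x" for x
    have \<Psi>m: "\<Psi> \<in> borel_measurable lborel"
      using borel_measurable_integrable[OF form_op_inner_integrable[of t "H1_emb \<Omega> v" "H1_emb \<Omega> w"]] by (simp add: \<Psi>_def[abs_def])
    have \<Psi>m': "\<Psi> \<in> borel_measurable lebesgue" using \<Psi>m by (rule measurable_completion)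
    have ae: "AE x in lebesgue. indicator \<Omega> x *\<^sub>R \<psi> x = \<Psi> x"
      using AE_completion[OF elim] rep_l2_ext[OF \<Omega>l gv(1)] rep_l2_ext[OF \<Omega>l gv(2)] rep_l2_ext[OF \<Omega>l gw(1)] rep_l2_ext[OF \<Omega>l gw(2)]
    proof eventually_elim
      case (elim x)
      show ?case
      proof (cases "x \<in> \<Omega>")
        case True
        then show ?thesis using elim t \<Omega>(2)
          by (auto simp: \<psi>_def \<Psi>_def H1_emb_def extend0_def zeroth_def flux_def inner_vec_def distrib_right)
      next
        case False
        then show ?thesis using elim by (simp add: \<Psi>_def H1_emb_def extend0_def)
      qed
    qed
    have "neumann_form A0 a0 b0 c0 \<Omega> t v w = (LINT x|lebesgue_on \<Omega>. \<psi> x)"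
      by (simp add: neumann_form_def \<psi>_def)
    also have "\<dots> = (LINT x|lebesgue. indicator \<Omega> x *\<^sub>R \<psi> x)" using \<Omega>l by (simp add: integral_restrict_space)
    also have "\<dots> = (LINT x|lebesgue. \<Psi> x)"
      by (rule integral_cong_AE[OF lebesgue_measurable_cong_AE[OF \<Psi>m' ae] \<Psi>m' ae])
    also have "\<dots> = (LINT x|lborel. \<Psi> x)" by (rule integral_completion[OF \<Psi>m])
    finally show "neumann_form A0 a0 b0 c0 \<Omega> t v w = form_op t (H1_emb \<Omega> v) \<bullet> H1_emb \<Omega> w"
      by (simp add: form_op_inner \<Psi>_def)
  qed
qed

end

lemma C_L2_continuous:
  assumes S: "S \<in> sets lebesgue" and u: "u \<in> C_L2 T S"
  shows "continuous_on {0..T} (\<lambda>t. l2_ext S (u t))"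
  unfolding continuous_on_def
proof
  fix t assume t: "t \<in> {0..T}"
  have u': "\<And>t. t \<in> {0..T} \<Longrightarrow> u t \<in> L2 S"
    "((\<lambda>s. L2_norm S (\<lambda>x. u s x - u t x)) \<longlongrightarrow> 0) (at t within {0..T})" using u t by (auto simp: C_L2_def)
  have "L2_norm S (\<lambda>x. u s x - u t x) = norm (l2_ext S (u s) - l2_ext S (u t))" if "s \<in> {0..T}" for s
    using norm_l2_ext[OF S L2_diff[OF S u'(1)[OF that] u'(1)[OF t]]] l2_ext_diff[OF S u'(1)[OF that] u'(1)[OF t]] by simp
  then have "\<forall>\<^sub>F s in at t within {0..T}. L2_norm S (\<lambda>x. u s x - u t x) = norm (l2_ext S (u s) - l2_ext S (u t))"
    by (auto simp: eventually_at_filter)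
  from Lim_transform_eventually[OF u'(2) this]
  show "((\<lambda>t. l2_ext S (u t)) \<longlongrightarrow> l2_ext S (u t)) (at t within {0..T})"
    using tendsto_norm_zero_iff LIM_zero_iff by blast
qed

text \<open>The equation identifies \<open>u' t\<close> on \<open>H1 \<Omega>\<close> with the
  element \<open>(F t, 0) - form_op t (U t)\<close> of \<open>X\<close>. Evaluating the
  distributional derivative at a fixed \<open>v\<close> leaves a scalar statement, which the lemma
  of du Bois-Reymond integrates between any two times.\<close>

lemma (in borel_coefficients) variational_solution_imp_evo:
  fixes A0 :: "'n \<Rightarrow> 'n \<Rightarrow> (real^'n) \<times> real \<Rightarrow> real" and a0 b0 :: "'n \<Rightarrow> (real^'n) \<times> real \<Rightarrow> real"
    and c0 :: "(real^'n) \<times> real \<Rightarrow> real"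
  assumes T: "0 < T" and \<Omega>: "open \<Omega>" "\<Omega> \<subseteq> D"
    and eq: "AE z in lebesgue. z \<in> D \<times> {0<..<T} \<longrightarrow>
       (\<forall>i j. A0 i j z = A i j z) \<and> (\<forall>i. a0 i z = a i z) \<and> (\<forall>i. b0 i z = b i z) \<and> c0 z = c z"
    and sol: "variational_solution A0 a0 b0 c0 T \<Omega> f u0 u"
    and F: "L2t F" "AE t in lborel. t \<in> {0<..<T} \<longrightarrow> (\<lambda>x. f (x, t)) \<in> L2 \<Omega> \<and> F t = l2_ext \<Omega> (\<lambda>x. f (x, t))"
  obtains y U where "\<And>t. t \<in> {0..T} \<Longrightarrow> y t = l2_ext \<Omega> (u t)"
    "evo (H1_space \<Omega>) T y U (\<lambda>t. indicator {0..T} t *\<^sub>R ((F t, 0) - form_op t (U t)))"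
proof -
  note \<Omega>l = lebesgue_\<Omega>[OF \<Omega>(1)]
  obtain u' where W: "W_space T \<Omega> u u'" and equ: "AE t in lebesgue_on {0<..<T}. \<forall>v\<in>H1 \<Omega>.
      u' t v + neumann_form A0 a0 b0 c0 \<Omega> t (u t) v = H_to_dual \<Omega> (\<lambda>x. f (x, t)) v"
    and uC: "u \<in> C_L2 T \<Omega>" using sol unfolding variational_solution_def by blast
  have uL: "u t \<in> L2 \<Omega>" if "t \<in> {0..T}" for t using uC that by (simp add: C_L2_def)
  have ub: "u \<in> bochner_L2 {0<..<T} (H1 \<Omega>) (H1_norm \<Omega>)" and dd: "has_distr_deriv T \<Omega> u u'"
    using W by (auto simp: W_space_def)
  obtain U where U: "L2t U" "\<And>t. t \<notin> {0..T} \<Longrightarrow> U t = 0"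
    "AE t in lborel. t \<in> {0..T} \<longrightarrow> u t \<in> H1 \<Omega> \<and> U t = H1_emb \<Omega> (u t)"
    by (rule bochner_L2_H1_emb[OF \<Omega>(1) ub]) (rule that; assumption)
  \<comment> \<open>Clamping the time makes \<open>y\<close> continuous on the whole line, as
    \<open>evo\<close> demands, without changing it on the time interval.\<close>
  define y where "y t = l2_ext \<Omega> (u (max 0 (min T t)))" for t
  have y: "y t = l2_ext \<Omega> (u t)" if "t \<in> {0..T}" for t using that by (simp add: y_def)
  have yc: "continuous_on UNIV y"
    unfolding y_def
    by (rule continuous_on_compose2[OF C_L2_continuous[OF \<Omega>l uC]]) (use T in \<open>auto intro!: continuous_intros\<close>)
  define G where "G t = indicator {0..T} t *\<^sub>R ((F t, 0) - form_op t (U t))" for t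
  have G: "L2t G"
  proof -
    have "bounded_linear (\<lambda>x :: (real^'n, real) l2. (x, 0 :: (real^'n, real^'n) l2))"
      by (intro bounded_linear_Pair bounded_linear_ident bounded_linear_zero)
    from L2t_bounded_linear(1)[OF this _ F(1), of 1]
    have "L2t (\<lambda>t. (F t, 0 :: (real^'n, real^'n) l2))" by (simp add: norm_Pair)
    from L2t_diff(1)[OF this L2t_B(1)[OF U(1)]] show ?thesis
      unfolding G_def by (rule L2t_indicator) simp
  qed
  have in_I: "AE t in lborel. t \<in> {0<..<T} \<longrightarrow> (\<forall>v\<in>H1 \<Omega>. u' t v = G t \<bullet> H1_emb \<Omega> v)"
  proof -
    have "AE t in lborel. t \<in> {0<..<T} \<longrightarrow> (\<forall>v\<in>H1 \<Omega>.
      u' t v + neumann_form A0 a0 b0 c0 \<Omega> t (u t) v = H_to_dual \<Omega> (\<lambda>x. f (x, t)) v)"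
      using equ by (simp add: AE_lebesgue_on_iff AE_completion_iff)
    then show ?thesis using F(2) U(3) neumann_form_eq_form_op[OF \<Omega> eq]
    proof eventually_elim
      case (elim t)
      show ?case
      proof (intro impI ballI)
        fix v assume t: "t \<in> {0<..<T}" and v: "v \<in> H1 \<Omega>"
        then have t': "t \<in> {0..T}" by auto
        have "H_to_dual \<Omega> (\<lambda>x. f (x, t)) v = F t \<bullet> l2_ext \<Omega> v"
          using elim(2) t inner_l2_ext[OF \<Omega>l _ H1_weak_grad(1)[OF v], of "\<lambda>x. f (x, t)"] by (simp add: H_to_dual_def)
        moreover have "neumann_form A0 a0 b0 c0 \<Omega> t (u t) v = form_op t (U t) \<bullet> H1_emb \<Omega> v"
          using elim(3,4) t t' v by simp
        ultimately have "u' t v = F t \<bullet> l2_ext \<Omega> v - form_op t (U t) \<bullet> H1_emb \<Omega> v"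
          using elim(1) t v by (metis add_diff_cancel_right')
        then show "u' t v = G t \<bullet> H1_emb \<Omega> v"
          using t' by (simp add: G_def inner_diff_left H1_emb_def)
      qed
    qed
  qed
  \<comment> \<open>Both Bochner integrals in the definition of the derivative are evaluated at
    \<open>v\<close>; they give \<open>J v\<close> and \<open>- J v\<close>, hence the weak
    derivative of the scalar function. The unit ball is where evaluation is controlled by the dual
    norm.\<close>
  have small: "(y t - y s) \<bullet> l2_ext \<Omega> v = (LINT \<tau>:{s..t}|lborel. G \<tau> \<bullet> H1_emb \<Omega> v)"
    if v: "v \<in> H1 \<Omega>" "H1_norm \<Omega> v \<le> 1" and st: "0 \<le> s" "s \<le> t" "t \<le> T" for v s t
  proof -
    have "y t \<bullet> l2_ext \<Omega> v - y s \<bullet> l2_ext \<Omega> v = (LINT \<tau>:{s..t}|lborel. G \<tau> \<bullet> H1_emb \<Omega> v)"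
    proof (rule du_bois_reymond[OF _ _ _ T st])
      have qc: "continuous_on UNIV (\<lambda>t. y t \<bullet> l2_ext \<Omega> v)" by (intro continuous_intros yc)
      then show "continuous_on UNIV (\<lambda>t. y t \<bullet> l2_ext \<Omega> v)" .
      have "norm (x \<bullet> H1_emb \<Omega> v) \<le> norm (H1_emb \<Omega> v) * norm x" for x
        using Cauchy_Schwarz_ineq2[of x "H1_emb \<Omega> v"] by (simp add: mult.commute)
      from L2t_bounded_linear(1)[OF bounded_linear_inner_left this G]
      show gL: "L2t (\<lambda>\<tau>. G \<tau> \<bullet> H1_emb \<Omega> v)" .
      fix \<phi> assume \<phi>: "\<phi> \<in> test_functions {0<..<T}"
      obtain J where J: "has_bochner_integral_on {0<..<T} (H1_dual \<Omega>) (H1_dual_norm \<Omega>)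
          (\<lambda>t v. dir_deriv 1 \<phi> t * H_to_dual \<Omega> (u t) v) J"
        "has_bochner_integral_on {0<..<T} (H1_dual \<Omega>) (H1_dual_norm \<Omega>) (\<lambda>t v. \<phi> t * u' t v) (\<lambda>v. - J v)"
        using dd \<phi> unfolding has_distr_deriv_def by blast
      obtain k where k: "integrable (lebesgue_on {0<..<T}) k"
          "AE t in lebesgue_on {0<..<T}. k t = dir_deriv 1 \<phi> t * H_to_dual \<Omega> (u t) v"
          "(LINT t|lebesgue_on {0<..<T}. k t) = J v"
        by (rule bochner_integral_eval[OF J(1) v]) (rule that; assumption)
      obtain l where l: "integrable (lebesgue_on {0<..<T}) l"
          "AE t in lebesgue_on {0<..<T}. l t = \<phi> t * u' t v"
          "(LINT t|lebesgue_on {0<..<T}. l t) = - J v"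
        by (rule bochner_integral_eval[OF J(2) v]) (rule that; assumption)
      note d\<phi> = dir_deriv_test_function[OF \<phi>, of 1]
      note m = sq_int_measurable[OF test_function_sq_int[OF \<phi>]] sq_int_measurable[OF test_function_sq_int[OF d\<phi>]]
      have I: "{0<..<T} \<in> sets lebesgue" by simp
      have "(LINT t|lborel. dir_deriv 1 \<phi> t * (y t \<bullet> l2_ext \<Omega> v)) = J v"
        unfolding k(3)[symmetric]
      proof (rule integral_lebesgue_on_lborel[OF I, symmetric])
        show "AE t in lebesgue_on {0<..<T}. k t = dir_deriv 1 \<phi> t * (y t \<bullet> l2_ext \<Omega> v)"
          using k(2) unfolding AE_lebesgue_on_iff[OF I]
        proof eventually_elim
          case (elim t)
          show ?case
          proof
            assume t: "t \<in> {0<..<T}"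
            then have t': "t \<in> {0..T}" by auto
            show "k t = dir_deriv 1 \<phi> t * (y t \<bullet> l2_ext \<Omega> v)"
              using elim t inner_l2_ext[OF \<Omega>l uL[OF t'] H1_weak_grad(1)[OF v(1)]] y[OF t'] by (simp add: H_to_dual_def)
          qed
        qed
        show "(\<lambda>t. dir_deriv 1 \<phi> t * (y t \<bullet> l2_ext \<Omega> v)) \<in> borel_measurable borel"
          using m(2) borel_measurable_continuous_onI[OF qc] by (rule borel_measurable_times)
        show "dir_deriv 1 \<phi> t * (y t \<bullet> l2_ext \<Omega> v) = 0" if "t \<notin> {0<..<T}" for t
          using test_function_zero_off[OF d\<phi> that] by simp
      qed
      moreover have "(LINT t|lborel. \<phi> t * (G t \<bullet> H1_emb \<Omega> v)) = - J v"
        unfolding l(3)[symmetric]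
      proof (rule integral_lebesgue_on_lborel[OF I, symmetric])
        show "AE t in lebesgue_on {0<..<T}. l t = \<phi> t * (G t \<bullet> H1_emb \<Omega> v)"
          using l(2) AE_completion[OF in_I] unfolding AE_lebesgue_on_iff[OF I]
          by eventually_elim (use v(1) in auto)
        show "(\<lambda>t. \<phi> t * (G t \<bullet> H1_emb \<Omega> v)) \<in> borel_measurable borel"
          using m(1) L2t_measurable[OF gL] by (rule borel_measurable_times)
        show "\<phi> t * (G t \<bullet> H1_emb \<Omega> v) = 0" if "t \<notin> {0<..<T}" for t
          using test_function_zero_off[OF \<phi> that] by simp
      qed
      ultimately show "(LINT t|lborel. dir_deriv 1 \<phi> t * (y t \<bullet> l2_ext \<Omega> v)) = - (LINT t|lborel. \<phi> t * (G t \<bullet> H1_emb \<Omega> v))"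
        by simp
    qed
    then show ?thesis by (simp add: inner_diff_left)
  qed
  have all: "(y t - y s) \<bullet> fst w = (LINT \<tau>:{s..t}|lborel. G \<tau> \<bullet> w)"
    if w: "w \<in> H1_space \<Omega>" and st: "0 \<le> s" "s \<le> t" "t \<le> T" for w s t
  proof -
    \<comment> \<open>A positive factor that scales \<open>w\<close> into the unit ball; the
      identity is linear in \<open>w\<close>, so the factor cancels afterwards.\<close>
    define k where "k = 1 / (1 + norm w)"
    have k: "0 < k" "k * norm w \<le> 1" by (auto simp: k_def add_pos_nonneg field_simps)
    note v = H1_space_rep[OF \<Omega>(1) w]
    define v1 where "v1 = (\<lambda>x. k * rep_l2 (fst w) x + 0 * rep_l2 (fst w) x)"
    have v1: "v1 \<in> H1 \<Omega>" "H1_emb \<Omega> v1 = k *\<^sub>R w"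
      using H1_lincomb[OF \<Omega>(1) v(1) v(1), of k 0] v(2) by (simp_all add: v1_def)
    have "H1_norm \<Omega> v1 \<le> 1" using norm_H1_emb[OF \<Omega>(1) v1(1)] v1(2) k by simp
    moreover have "l2_ext \<Omega> v1 = k *\<^sub>R fst w" using v1(2) by (simp add: H1_emb_def prod_eq_iff)
    ultimately have "(y t - y s) \<bullet> (k *\<^sub>R fst w) = (LINT \<tau>:{s..t}|lborel. k * (G \<tau> \<bullet> w))"
      using small[OF v1(1) _ st] by (simp only: v1(2) inner_scaleR_right)
    then have "k * ((y t - y s) \<bullet> fst w) = k * (LINT \<tau>:{s..t}|lborel. G \<tau> \<bullet> w)"
      by (simp add: set_integral_mult_right)
    then show ?thesis using k(1) by simp
  qed
  have "evo (H1_space \<Omega>) T y U G"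
    unfolding evo_def
  proof (intro conjI ballI allI impI)
    show "AE t in lborel. t \<in> {0..T} \<longrightarrow> U t \<in> H1_space \<Omega> \<and> fst (U t) = y t"
      using U(3) by eventually_elim (use H1_emb_in_H1_space[OF \<Omega>(1)] y in \<open>auto simp: H1_emb_def\<close>)
  qed (use yc U G all in \<open>auto simp: G_def\<close>)
  from this[unfolded G_def[abs_def]] show thesis by (intro that[of y U] y)
qed

section \<open>Return to norms on D\<close>

text \<open>The convergences of sources, of initial values and of solutions are all measured by zero
  extensions from two different domains; this identifies such a distance with one in the common
  Hilbert space.\<close>

lemma L2_norm_extend0_diff:
  assumes D: "D \<in> sets lebesgue" and S: "S \<in> sets lebesgue" "S \<subseteq> D" "v \<in> L2 S" and R: "R \<in> sets lebesgue" "R \<subseteq> D" "w \<in> L2 R"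
  shows "L2_norm D (\<lambda>x. extend0 S v x - extend0 R w x) = norm (l2_ext S v - l2_ext R w)"
    and "extend0 S v \<in> L2 D"
proof -
  have e: "extend0 D (extend0 S v) = extend0 S v" "extend0 D (extend0 R w) = extend0 R w"
    using S(2) R(2) by (auto simp: extend0_def fun_eq_iff)
  have L: "extend0 S v \<in> L2 D" "extend0 R w \<in> L2 D"
    using L2_extend0_iff[OF D, of "extend0 S v"] L2_extend0_iff[OF D, of "extend0 R w"] S R
    by (simp_all add: e L2_extend0_iff)
  then show "extend0 S v \<in> L2 D" by simp
  show "L2_norm D (\<lambda>x. extend0 S v x - extend0 R w x) = norm (l2_ext S v - l2_ext R w)"
    using norm_l2_ext[OF D L2_diff[OF D L]] l2_ext_diff[OF D L] S R by (simp add: l2_ext_superset)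
qed

lemma L2_subset:
  assumes D: "D \<in> sets lebesgue" and S: "S \<in> sets lebesgue" "S \<subseteq> D" and v: "v \<in> L2 D"
  shows "v \<in> L2 S"
proof -
  have *: "extend0 D v \<in> borel_measurable lebesgue" "integrable lebesgue (\<lambda>x. (norm (extend0 D v x))\<^sup>2)"
    using v L2_extend0_iff[OF D, of v] by (auto simp: L2_UNIV)
  have e: "extend0 S v = (\<lambda>x. indicator S x *\<^sub>R extend0 D v x)"
    using S(2) by (auto simp: extend0_def indicator_def fun_eq_iff)
  have "extend0 S v \<in> borel_measurable lebesgue" unfolding e using *(1) S(1) by measurable
  moreover have "integrable lebesgue (\<lambda>x. indicator S x *\<^sub>R (norm (extend0 D v x))\<^sup>2)"
    by (rule integrable_mult_indicator[OF S(1) *(2)])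
  moreover have "(norm (extend0 S v x))\<^sup>2 = indicator S x *\<^sub>R (norm (extend0 D v x))\<^sup>2" for x
    by (simp add: e indicator_def)
  ultimately show ?thesis using L2_extend0_iff[OF S(1), of v] by (simp add: L2_UNIV)
qed

lemma C_L2_extend0:
  assumes D: "D \<in> sets lebesgue" and S: "S \<in> sets lebesgue" "S \<subseteq> D" and u: "u \<in> C_L2 T S"
  shows "(\<lambda>t. extend0 S (u t)) \<in> C_L2 T D"
proof -
  have uL: "u t \<in> L2 S" if "t \<in> {0..T}" for t using u that by (simp add: C_L2_def)
  note e = L2_norm_extend0_diff[OF D S uL S uL]
  show ?thesis
    unfolding C_L2_def
  proof (intro CollectI conjI ballI)
    fix t assume t: "t \<in> {0..T}"
    show "extend0 S (u t) \<in> L2 D" by (rule e(2)[OF t t])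
    have "((\<lambda>s. norm (l2_ext S (u s) - l2_ext S (u t))) \<longlongrightarrow> 0) (at t within {0..T})"
      by (intro tendsto_norm_zero LIM_zero C_L2_continuous[OF S(1) u, unfolded continuous_on_def, rule_format] t)
    moreover have "\<forall>\<^sub>F s in at t within {0..T}. norm (l2_ext S (u s) - l2_ext S (u t)) = L2_norm D (\<lambda>x. extend0 S (u s) x - extend0 S (u t) x)"
      using e(1) t by (auto simp: eventually_at_filter)
    ultimately show "((\<lambda>s. L2_norm D (\<lambda>x. extend0 S (u s) x - extend0 S (u t) x)) \<longlongrightarrow> 0) (at t within {0..T})"
      by (rule Lim_transform_eventually)
  qed
qed

lemma sqn_eq_L2_norm:
  assumes F: "L2t F" "AE t in lborel. t \<in> {0<..<T} \<longrightarrow> norm (F t) = g t"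
  shows "sqn (\<lambda>t. indicator {0..T} t *\<^sub>R F t) = (L2_norm {0<..<T} g)\<^sup>2"
proof -
  have I: "{0<..<T} \<in> sets lebesgue" by simp
  define h where "h t = (norm (indicator {0<..<T} t *\<^sub>R F t))\<^sup>2" for t
  have [measurable]: "F \<in> borel_measurable borel" using F(1) by (rule L2t_measurable)
  have "(L2_norm {0<..<T} g)\<^sup>2 = (LINT t|lebesgue_on {0<..<T}. (norm (g t))\<^sup>2)"
    unfolding L2_norm_def by (simp add: Bochner_Integration.integral_nonneg)
  also have "\<dots> = (LINT t|lborel. h t)"
  proof (rule integral_lebesgue_on_lborel[OF I])
    show "AE t in lebesgue_on {0<..<T}. (norm (g t))\<^sup>2 = h t"
      using AE_completion[OF F(2)] unfolding AE_lebesgue_on_iff[OF I]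
    proof eventually_elim
      case (elim t)
      then show ?case by (auto simp: h_def simp flip: elim)
    qed
    show "h \<in> borel_measurable borel" unfolding h_def[abs_def] by measurable
  qed (simp add: h_def)
  also have "\<dots> = sqn (\<lambda>t. indicator {0..T} t *\<^sub>R F t)"
    unfolding sqn_def
  proof (rule integral_cong_AE)
    show "AE t in lborel. h t = (norm (indicator {0..T} t *\<^sub>R F t))\<^sup>2"
      using AE_lborel_singleton[of 0] AE_lborel_singleton[of T]
      by eventually_elim (auto simp: h_def indicator_def)
  qed (auto simp: h_def[abs_def])
  finally show ?thesis by simp
qed

theorem theorem4p13:
  fixes x0 :: "real^'n" and r T \<alpha> :: real
    and D \<Omega> :: "(real^'n) set" and \<Omega>n :: "nat \<Rightarrow> (real^'n) set"
    and A :: "'n \<Rightarrow> 'n \<Rightarrow> (real^'n) \<times> real \<Rightarrow> real"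
    and a b :: "'n \<Rightarrow> (real^'n) \<times> real \<Rightarrow> real"
    and c :: "(real^'n) \<times> real \<Rightarrow> real"
    and fn :: "nat \<Rightarrow> (real^'n) \<times> real \<Rightarrow> real" and f :: "(real^'n) \<times> real \<Rightarrow> real"
    and u0n :: "nat \<Rightarrow> real^'n \<Rightarrow> real" and u0 :: "real^'n \<Rightarrow> real"
    and un :: "nat \<Rightarrow> real \<Rightarrow> real^'n \<Rightarrow> real" and u :: "real \<Rightarrow> real^'n \<Rightarrow> real"
  assumes T: "0 < T"
    and D: "0 < r" "D = ball x0 r"
    and Omega_n: "\<And>n. open (\<Omega>n n)" "\<And>n. \<Omega>n n \<subseteq> D"
    and Omega: "open \<Omega>" "\<Omega> \<subseteq> D"
    and coeffs: "\<And>i j. A i j \<in> L_infty (D \<times> {0<..<T})"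
      "\<And>i. a i \<in> L_infty (D \<times> {0<..<T})"
      "\<And>i. b i \<in> L_infty (D \<times> {0<..<T})"
      "c \<in> L_infty (D \<times> {0<..<T})"
    and alpha: "0 < \<alpha>"
    and elliptic: "AE z in lebesgue_on (D \<times> {0<..<T}).
      \<forall>\<xi> :: real^'n. (\<Sum>i\<in>UNIV. \<Sum>j\<in>UNIV. A i j z * \<xi> $ i * \<xi> $ j) \<ge> \<alpha> * (norm \<xi>)\<^sup>2"
    and data_n: "\<And>n. fn n \<in> L2 (D \<times> {0<..<T})" "\<And>n. u0n n \<in> L2 D"
    and data: "f \<in> L2 (D \<times> {0<..<T})" "u0 \<in> L2 D"
    and sol_n: "\<And>n. variational_solution A a b c T (\<Omega>n n) (fn n) (u0n n) (un n)"
    and sol: "variational_solution A a b c T \<Omega> f u0 u"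
    and f_conv: "(\<lambda>n. L2_norm {0<..<T} (\<lambda>t. L2_norm D (\<lambda>x.
        extend0 (\<Omega>n n) (\<lambda>y. fn n (y, t)) x - extend0 \<Omega> (\<lambda>y. f (y, t)) x))) \<longlonglongrightarrow> 0"
    and u0_conv: "(\<lambda>n. L2_norm D (\<lambda>x. extend0 (\<Omega>n n) (u0n n) x - extend0 \<Omega> u0 x)) \<longlonglongrightarrow> 0"
    and mosco: "H1_Mosco_convergence D \<Omega>n \<Omega>"
  shows "converges_in_C_L2 T D (\<lambda>n t. extend0 (\<Omega>n n) (un n t)) (\<lambda>t. extend0 \<Omega> (u t))"
proof -
  have oD: "open D" using D by simp
  then have Dl: "D \<in> sets lebesgue" by simp
  note \<Omega>l = lebesgue_\<Omega>[OF Omega(1)] and \<Omega>nl = lebesgue_\<Omega>[OF Omega_n(1)]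
  \<comment> \<open>From here on the coefficients are Borel, bounded and elliptic everywhere. They
    agree with the given ones almost everywhere on the cylinder, so for almost every time the
    equation is the same.\<close>
  obtain A' a' b' c' C where bc: "borel_coefficients A' a' b' c' \<alpha> C"
    and eq: "AE z in lebesgue. z \<in> D \<times> {0<..<T} \<longrightarrow>
       (\<forall>i j. A i j z = A' i j z) \<and> (\<forall>i. a i z = a' i z) \<and> (\<forall>i. b i z = b' i z) \<and> c z = c' z"
    by (rule borel_coefficients_ex[OF oD coeffs alpha elliptic]) (rule that; assumption)
  interpret borel_coefficients A' a' b' c' \<alpha> C by (rule bc)
  obtain F where F: "L2t F" "AE t in lborel. t \<in> {0<..<T} \<longrightarrow> (\<lambda>x. f (x, t)) \<in> L2 \<Omega> \<and> F t = l2_ext \<Omega> (\<lambda>x. f (x, t))"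
    by (rule L2_slices[OF oD Omega data(1)]) (rule that; assumption)
  have "\<exists>G. L2t G \<and> (AE t in lborel. t \<in> {0<..<T} \<longrightarrow>
      (\<lambda>x. fn n (x, t)) \<in> L2 (\<Omega>n n) \<and> G t = l2_ext (\<Omega>n n) (\<lambda>x. fn n (x, t)))" for n
    by (rule L2_slices[OF oD Omega_n data_n(1)[of n]]) blast
  then obtain Fn where Fn: "\<And>n. L2t (Fn n)" "\<And>n. AE t in lborel. t \<in> {0<..<T} \<longrightarrow>
      (\<lambda>x. fn n (x, t)) \<in> L2 (\<Omega>n n) \<and> Fn n t = l2_ext (\<Omega>n n) (\<lambda>x. fn n (x, t))"
    using choice[of "\<lambda>n G. L2t G \<and> (AE t in lborel. t \<in> {0<..<T} \<longrightarrow>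
      (\<lambda>x. fn n (x, t)) \<in> L2 (\<Omega>n n) \<and> G t = l2_ext (\<Omega>n n) (\<lambda>x. fn n (x, t)))"] by blast
  obtain y U where y: "\<And>t. t \<in> {0..T} \<Longrightarrow> y t = l2_ext \<Omega> (u t)"
    and evo: "evo (H1_space \<Omega>) T y U (\<lambda>t. indicator {0..T} t *\<^sub>R ((F t, 0) - form_op t (U t)))"
    by (rule variational_solution_imp_evo[OF T Omega eq sol F]) (rule that; assumption)
  \<comment> \<open>\<open>y\<close> and \<open>U\<close> of each problem are bundled into a pair,
    so that one application of choice selects both for all \<open>n\<close>.\<close>
  have "\<forall>n. \<exists>p. (\<forall>t\<in>{0..T}. fst p t = l2_ext (\<Omega>n n) (un n t)) \<and>
      evo (H1_space (\<Omega>n n)) T (fst p) (snd p) (\<lambda>t. indicator {0..T} t *\<^sub>R ((Fn n t, 0) - form_op t (snd p t)))"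
  proof
    fix n
    obtain z V where "\<And>t. t \<in> {0..T} \<Longrightarrow> z t = l2_ext (\<Omega>n n) (un n t)"
      "evo (H1_space (\<Omega>n n)) T z V (\<lambda>t. indicator {0..T} t *\<^sub>R ((Fn n t, 0) - form_op t (V t)))"
      by (rule variational_solution_imp_evo[OF T Omega_n eq sol_n Fn]) (rule that; assumption)
    then show "\<exists>p. (\<forall>t\<in>{0..T}. fst p t = l2_ext (\<Omega>n n) (un n t)) \<and>
      evo (H1_space (\<Omega>n n)) T (fst p) (snd p) (\<lambda>t. indicator {0..T} t *\<^sub>R ((Fn n t, 0) - form_op t (snd p t)))"
      by (intro exI[of _ "(z, V)"]) simp
  qed
  from choice[OF this] obtain p where
    p: "\<And>n t. t \<in> {0..T} \<Longrightarrow> fst (p n) t = l2_ext (\<Omega>n n) (un n t)"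
      "\<And>n. evo (H1_space (\<Omega>n n)) T (fst (p n)) (snd (p n)) (\<lambda>t. indicator {0..T} t *\<^sub>R ((Fn n t, 0) - form_op t (snd (p n) t)))"
    by blast
  have C: "u \<in> C_L2 T \<Omega>" "\<And>n. un n \<in> C_L2 T (\<Omega>n n)"
    and init: "AE x in lebesgue_on \<Omega>. u 0 x = u0 x" "\<And>n. AE x in lebesgue_on (\<Omega>n n). un n 0 x = u0n n x"
    using sol sol_n by (auto simp: variational_solution_def)
  have uL: "u t \<in> L2 \<Omega>" "un n t \<in> L2 (\<Omega>n n)" if "t \<in> {0..T}" for n t using C that by (auto simp: C_L2_def)
  note dist_eq = L2_norm_extend0_diff(1)[OF Dl \<Omega>nl Omega_n(2) _ \<Omega>l Omega(2)]
  \<comment> \<open>At time 0 the solutions coincide with the initial data almost everywhere, so the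
    assumed convergence of the data is convergence of the initial values of the evolutions.\<close>
  have "(\<lambda>n. norm (fst (p n) 0 - y 0)) \<longlonglongrightarrow> 0"
  proof -
    have 0: "0 \<in> {0..T}" using T by simp
    have "L2_norm D (\<lambda>x. extend0 (\<Omega>n n) (u0n n) x - extend0 \<Omega> u0 x) = norm (fst (p n) 0 - y 0)" for n
      using dist_eq[OF L2_subset[OF Dl \<Omega>nl Omega_n(2) data_n(2)] L2_subset[OF Dl \<Omega>l Omega(2) data(2)], of n]
        l2_ext_cong[OF \<Omega>l uL(1)[OF 0] init(1)] l2_ext_cong[OF \<Omega>nl uL(2)[OF 0] init(2)] y[OF 0] p(1)[OF 0] by simp
    then show ?thesis using u0_conv by simp
  qed
  then have init_conv: "(\<lambda>n. fst (p n) 0) \<longlonglongrightarrow> y 0" using LIM_zero_iff tendsto_norm_zero_iff by blast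
  have "sqn (\<lambda>t. indicator {0..T} t *\<^sub>R (Fn n t - F t)) = (L2_norm {0<..<T} (\<lambda>t. L2_norm D (\<lambda>x.
        extend0 (\<Omega>n n) (\<lambda>y. fn n (y, t)) x - extend0 \<Omega> (\<lambda>y. f (y, t)) x)))\<^sup>2" for n
  proof (rule sqn_eq_L2_norm[OF L2t_diff(1)[OF Fn(1) F(1)]])
    show "AE t in lborel. t \<in> {0<..<T} \<longrightarrow> norm (Fn n t - F t) =
       L2_norm D (\<lambda>x. extend0 (\<Omega>n n) (\<lambda>y. fn n (y, t)) x - extend0 \<Omega> (\<lambda>y. f (y, t)) x)"
      using Fn(2)[of n] F(2) by eventually_elim (auto simp: dist_eq)
  qed
  then have f_conv': "(\<lambda>n. sqn (\<lambda>t. indicator {0..T} t *\<^sub>R (Fn n t - F t))) \<longlonglongrightarrow> 0"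
    using tendsto_power[OF f_conv, of 2] by simp
  show ?thesis
    unfolding converges_in_C_L2_def
  proof (intro conjI allI uniform_limitI)
    show "(\<lambda>t. extend0 (\<Omega>n n) (un n t)) \<in> C_L2 T D" for n by (rule C_L2_extend0[OF Dl \<Omega>nl Omega_n(2) C(2)])
    show "(\<lambda>t. extend0 \<Omega> (u t)) \<in> C_L2 T D" by (rule C_L2_extend0[OF Dl \<Omega>l Omega(2) C(1)])
    fix e :: real assume "0 < e"
    from solutions_converge[OF T subspace_H1_space closed_H1_space subspace_H1_space closed_H1_space
        mosco_H1_space[OF Dl Omega Omega_n mosco] F(1) Fn(1) f_conv' evo p(2) init_conv this]
    show "\<forall>\<^sub>F n in sequentially. \<forall>t\<in>{0..T}. dist (L2_norm D (\<lambda>x. extend0 (\<Omega>n n) (un n t) x - extend0 \<Omega> (u t) x)) 0 < e"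
      by eventually_elim (use uL y p(1) in \<open>auto simp: dist_eq\<close>)
  qed
qed

end
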